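(* Assume that $h$ is non-decreasing and $\Phi$ is non-increasing. Let $C_2:=\left(\int_0^T\Psi_1(t)dt\right)^2$, with $\Psi_1$ the solution of $$\Psi_1(t)=1+\int_0^t\Phi(t-s)\Psi_1(s)\,ds,\quad t\in[0,T],$$ and $C_1:=\int_0^T\Psi_2(t)dt$, with $\Psi_2$ the solution of $$\Psi_2(t)=(\Psi_1(t))^2+\int_0^t\Phi(s)\Psi_2(t-s)\,ds,\quad t\in[0,T].$$ For $n\ge1$ let $c_n:=(\mu+n\Phi(0))C_1+(\mu+n\Phi(0))^2C_2$, and for $0<v_n<\cdots<v_1<T$ set $$\begin{aligned} \beta_n(v_n,\ldots,v_1):=\;&e^{-T(\mu+n\Phi(0))}\,\mathbb E\left[g(\bar\eta_1,\bar\vartheta_1)\,\mathbb E\left[h\left(\sum_{k=1}^ne^{-\kappa(T-v_k)}f(\bar\eta_k)\right)\Big|\,\bar\eta_1\right]\right]\\ &+\sum_{p=1}^{+\infty}\left(\frac{c_n}{p^2}\wedge1\right)\mathbb E\left[g(\bar\eta_1,\bar\vartheta_1)\,\mathbb E\left[h\left(\sum_{k=1}^ne^{-\kappa(T-v_k)}f(\bar\eta_k)+\sum_{i=1}^pf(\eta_i)\right)\Big|\,\bar\eta_1\right]\right]. \end{aligned}$$ Then $$\mathbb E[K_Th(L_T)]\le\mu\int_0^Te^{-\kappa(T-v_1)}\beta_1(v_1)\,dv_1+\mu\sum_{n=2}^{+\infty}\int_0^T\int_0^{v_1}\cdots\int_0^{v_{n-1}}\prod_{i=2}^n\Phi(v_{i-1}-v_i)\,e^{-\kappa(T-v_1)}\beta_n(v_n,\ldots,v_1)\,dv_n\cdots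 dv_1 .$$
   Context: Fix $T>0$, $\mu>0$, $\kappa\ge0$ and a bounded (measurable) function $\Phi:[0,T]\to\mathbb R_+$ with $\|\Phi\|_1=\int_0^T\Phi(s)ds<1$. Let $N$ be a Poisson random measure on $[0,T]\times\mathbb R_+$ with intensity $dt\otimes d\theta$, with natural filtration $\mathbb F^N$. $(H,\Lambda)$ is the unique $\mathbb F^N$-adapted solution of $$H_t=\int_{(0,t]}\int_{\mathbb R_+}\mathbf 1_{\{\theta\le\Lambda_s\}}N(ds,d\theta),\qquad\Lambda_t=\mu+\int_{(0,t)}\Phi(t-u)\,dH_u,\quad t\in[0,T],$$ a standard Hawkes process; $(\tau_i^H)_{i\ge1}$ are its jump times. Claims: $(\eta_1,\vartheta_1)$ is an $\mathbb R_+^2$-valued random variable, and $(\eta_i,\vartheta_i)_{i\ge2}$ and $(\bar\eta_i,\bar\vartheta_i)_{i\ge1}$ are independent copies of it (all these pairs are mutually independent), all independent of $N$ (hence of $H$). $f:\mathbb R_+\to\mathbb R_+$, $g:\mathbb R_+^2\to\mathbb R_+$, $h:\mathbb R_+\to\mathbb R_+$ are bounded (measurable) deterministic functions and $$L_t=\sum_{i=1}^{H_t}e^{-\kappa(t-\tau_i^H)}f(\eta_i),\qquad K_t=\sum_{i=1}^{H_t}e^{-\kappa(t-\tau_i^H)}g(\eta_i,\vartheta_i),\qquad t\in[0,T].$$ Here $a\wedge b=\min(a,b)$. *)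

theory Defs
  imports "HOL-Probability.Probability"
begin

section \<open>Poisson random measures and their filtration\<close>

text \<open>Only sets of finite intensity get a prescribed law; for a $\sigma$-finite \<open>\<nu>\<close> this forces
  $N(A) = \infty$ almost surely when $\nu(A) = \infty$.\<close>

definition (in prob_space) poisson_random_measure ::
    "'b measure \<Rightarrow> ('a \<Rightarrow> 'b measure) \<Rightarrow> bool" where
  "poisson_random_measure \<nu> N \<longleftrightarrow>
     (\<forall>\<omega>\<in>space M. sets (N \<omega>) = sets \<nu> \<and>
        (\<forall>A\<in>sets \<nu>. emeasure (N \<omega>) A = \<infinity> \<or> (\<exists>k::nat. emeasure (N \<omega>) A = of_nat k))) \<and>
     (\<forall>A\<in>sets \<nu>. (\<lambda>\<omega>. emeasure (N \<omega>) A) \<in> borel_measurable M) \<and>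
     (\<forall>A\<in>sets \<nu>. emeasure \<nu> A < \<infinity> \<longrightarrow>
        (\<forall>k::nat. prob {\<omega> \<in> space M. emeasure (N \<omega>) A = of_nat k}
                  = measure \<nu> A ^ k / fact k * exp (- measure \<nu> A))) \<and>
     (\<forall>(A :: nat \<Rightarrow> 'b set) I. finite I \<and> (\<forall>i\<in>I. A i \<in> sets \<nu>) \<and> disjoint_family_on A I \<longrightarrow>
        indep_vars (\<lambda>_. borel) (\<lambda>i \<omega>. emeasure (N \<omega>) (A i)) I)"

definition strip_measure :: "real \<Rightarrow> (real \<times> real) measure" where
  "strip_measure T = restrict_space lborel {0..T} \<Otimes>\<^sub>M restrict_space lborel {0..}"

definition natural_filtration ::
    "'a measure \<Rightarrow> real \<Rightarrow> ('a \<Rightarrow> (real \<times> real) measure) \<Rightarrow> real \<Rightarrow> 'a measure" where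
  "natural_filtration M T N t = sigma (space M)
     {(\<lambda>\<omega>. emeasure (N \<omega>) A) -` B \<inter> space M | A B.
        A \<in> sets (strip_measure T) \<and> A \<subseteq> {0..t} \<times> {0..} \<and> B \<in> sets borel}"

section \<open>Hawkes process\<close>

text \<open>The Stieltjes measure $dH_u$ of a path. The path is extended constantly outside $[0,T]$, so
  that the measure is carried by $(0,T]$.\<close>

definition path_measure :: "real \<Rightarrow> (real \<Rightarrow> 'a \<Rightarrow> nat) \<Rightarrow> 'a \<Rightarrow> real measure" where
  "path_measure T H \<omega> = interval_measure (\<lambda>u. real (H (max 0 (min T u)) \<omega>))"

text \<open>The equations are required almost surely, simultaneously for all times. The values of
  \<open>H\<close> and \<open>\<Lambda>\<close> outside $[0,T]$ play no role.\<close>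

definition hawkes_solution ::
    "'a measure \<Rightarrow> real \<Rightarrow> real \<Rightarrow> (real \<Rightarrow> real) \<Rightarrow> ('a \<Rightarrow> (real \<times> real) measure)
      \<Rightarrow> (real \<Rightarrow> 'a \<Rightarrow> nat) \<Rightarrow> (real \<Rightarrow> 'a \<Rightarrow> real) \<Rightarrow> bool" where
  "hawkes_solution M T \<mu> \<Phi> N H \<Lambda> \<longleftrightarrow>
     (\<forall>t\<in>{0..T}. H t \<in> measurable (natural_filtration M T N t) (count_space UNIV)) \<and>
     (\<forall>t\<in>{0..T}. \<Lambda> t \<in> borel_measurable (natural_filtration M T N t)) \<and>
     (AE \<omega> in M. \<forall>t\<in>{0..T}.
        of_nat (H t \<omega>) =
          (\<integral>\<^sup>+ (s, \<theta>). indicator {0<..t} s * indicator {..\<Lambda> s \<omega>} \<theta> \<partial>N \<omega>) \<and>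
        \<Lambda> t \<omega> = \<mu> + (LINT u:{0<..<t}|path_measure T H \<omega>. \<Phi> (t - u)))"

definition jump_time :: "real \<Rightarrow> (real \<Rightarrow> 'a \<Rightarrow> nat) \<Rightarrow> nat \<Rightarrow> 'a \<Rightarrow> real" where
  "jump_time T H i \<omega> = Inf {t \<in> {0..T}. i \<le> H t \<omega>}"

section \<open>Claims\<close>

text \<open>Mutual independence of the $\sigma$-algebra of \<open>N\<close> (index \<open>None\<close>) and of all the pairs
  \<open>(\<eta> i, \<theta> i)\<close> (indices \<open>Some (False, i)\<close>) and \<open>(\<eta>b i, \<theta>b i)\<close> (indices \<open>Some (True, i)\<close>),
  \<open>i \<ge> 1\<close>.\<close>

definition (in prob_space) claims_model ::
    "real \<Rightarrow> ('a \<Rightarrow> (real \<times> real) measure) \<Rightarrow> (nat \<Rightarrow> 'a \<Rightarrow> real) \<Rightarrow> (nat \<Rightarrow> 'a \<Rightarrow> real)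
      \<Rightarrow> (nat \<Rightarrow> 'a \<Rightarrow> real) \<Rightarrow> (nat \<Rightarrow> 'a \<Rightarrow> real) \<Rightarrow> bool" where
  "claims_model T N \<eta> \<theta> \<eta>b \<theta>b \<longleftrightarrow>
     (\<forall>i\<ge>1. random_variable borel (\<lambda>\<omega>. (\<eta> i \<omega>, \<theta> i \<omega>)) \<and>
             random_variable borel (\<lambda>\<omega>. (\<eta>b i \<omega>, \<theta>b i \<omega>))) \<and>
     (\<forall>i\<ge>1. \<forall>\<omega>\<in>space M. 0 \<le> \<eta> i \<omega> \<and> 0 \<le> \<theta> i \<omega> \<and> 0 \<le> \<eta>b i \<omega> \<and> 0 \<le> \<theta>b i \<omega>) \<and>
     (\<forall>i\<ge>1. distr M borel (\<lambda>\<omega>. (\<eta> i \<omega>, \<theta> i \<omega>)) = distr M borel (\<lambda>\<omega>. (\<eta> 1 \<omega>, \<theta> 1 \<omega>)) \<and>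
             distr M borel (\<lambda>\<omega>. (\<eta>b i \<omega>, \<theta>b i \<omega>)) = distr M borel (\<lambda>\<omega>. (\<eta> 1 \<omega>, \<theta> 1 \<omega>))) \<and>
     indep_sets
       (\<lambda>j. case j of
              None \<Rightarrow> sets (natural_filtration M T N T)
            | Some (b, i) \<Rightarrow> sets (vimage_algebra (space M)
                (if b then (\<lambda>\<omega>. (\<eta>b i \<omega>, \<theta>b i \<omega>)) else (\<lambda>\<omega>. (\<eta> i \<omega>, \<theta> i \<omega>)))
                (borel :: (real \<times> real) measure)))
       (insert None (Some ` (UNIV \<times> {1..})))"

text \<open>$\sum_{i=1}^{H_t} e^{-\kappa (t - \tau_i)} Z_i$; the processes $L$ and $K$ arise from
  $Z_i = f(\eta_i)$ and $Z_i = g(\eta_i, \vartheta_i)$.\<close>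

definition discounted_claims ::
    "real \<Rightarrow> real \<Rightarrow> (real \<Rightarrow> 'a \<Rightarrow> nat) \<Rightarrow> (nat \<Rightarrow> 'a \<Rightarrow> real) \<Rightarrow> real \<Rightarrow> 'a \<Rightarrow> real" where
  "discounted_claims T \<kappa> H Z t \<omega> =
     (\<Sum>i=1..H t \<omega>. exp (- \<kappa> * (t - jump_time T H i \<omega>)) * Z i \<omega>)"

section \<open>The bound\<close>

definition c_coeff :: "real \<Rightarrow> (real \<Rightarrow> real) \<Rightarrow> real \<Rightarrow> real \<Rightarrow> nat \<Rightarrow> real" where
  "c_coeff \<mu> \<Phi> C1 C2 n = (\<mu> + real n * \<Phi> 0) * C1 + (\<mu> + real n * \<Phi> 0)\<^sup>2 * C2"

text \<open>$\mathbb E[g(\bar\eta_1,\bar\vartheta_1)\,\mathbb E[h(\sum_{k=1}^n e^{-\kappa(T-v_k)} f(\bar\eta_k)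
  + \sum_{i=1}^p f(\eta_i)) \mid \bar\eta_1]]$. All integrands being nonnegative, expectations and
  conditional expectations are taken in $[0,\infty]$. The empty sum covers \<open>p = 0\<close>.\<close>

definition claim_expectation ::
    "'a measure \<Rightarrow> real \<Rightarrow> real \<Rightarrow> (real \<Rightarrow> real) \<Rightarrow> (real \<times> real \<Rightarrow> real) \<Rightarrow> (real \<Rightarrow> real)
      \<Rightarrow> (nat \<Rightarrow> 'a \<Rightarrow> real) \<Rightarrow> (nat \<Rightarrow> 'a \<Rightarrow> real) \<Rightarrow> (nat \<Rightarrow> 'a \<Rightarrow> real)
      \<Rightarrow> nat \<Rightarrow> nat \<Rightarrow> (nat \<Rightarrow> real) \<Rightarrow> ennreal" where
  "claim_expectation M T \<kappa> f g h \<eta> \<eta>b \<theta>b n p v =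
     (\<integral>\<^sup>+ \<omega>. ennreal (g (\<eta>b 1 \<omega>, \<theta>b 1 \<omega>)) *
        nn_cond_exp M (vimage_algebra (space M) (\<eta>b 1) borel)
          (\<lambda>\<omega>'. ennreal (h ((\<Sum>k=1..n. exp (- \<kappa> * (T - v k)) * f (\<eta>b k \<omega>')) +
                             (\<Sum>i=1..p. f (\<eta> i \<omega>'))))) \<omega> \<partial>M)"

definition beta ::
    "'a measure \<Rightarrow> real \<Rightarrow> real \<Rightarrow> real \<Rightarrow> (real \<Rightarrow> real) \<Rightarrow> real \<Rightarrow> real
      \<Rightarrow> (real \<Rightarrow> real) \<Rightarrow> (real \<times> real \<Rightarrow> real) \<Rightarrow> (real \<Rightarrow> real)
      \<Rightarrow> (nat \<Rightarrow> 'a \<Rightarrow> real) \<Rightarrow> (nat \<Rightarrow> 'a \<Rightarrow> real) \<Rightarrow> (nat \<Rightarrow> 'a \<Rightarrow> real)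
      \<Rightarrow> nat \<Rightarrow> (nat \<Rightarrow> real) \<Rightarrow> ennreal" where
  "beta M T \<mu> \<kappa> \<Phi> C1 C2 f g h \<eta> \<eta>b \<theta>b n v =
     ennreal (exp (- T * (\<mu> + real n * \<Phi> 0))) * claim_expectation M T \<kappa> f g h \<eta> \<eta>b \<theta>b n 0 v +
     (\<Sum>p. ennreal (min (c_coeff \<mu> \<Phi> C1 C2 n / (real (Suc p))\<^sup>2) 1) *
            claim_expectation M T \<kappa> f g h \<eta> \<eta>b \<theta>b n (Suc p) v)"

text \<open>\<open>iter_integral F m i b v\<close> integrates \<open>F\<close> over the \<open>m\<close> coordinates
  $v_i, \dots, v_{i+m-1}$, with $v_i$ ranging over $[0,b]$ and each further coordinate over the
  interval from 0 to its predecessor; the other coordinates are those of \<open>v\<close>.\<close>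

primrec iter_integral ::
    "((nat \<Rightarrow> real) \<Rightarrow> ennreal) \<Rightarrow> nat \<Rightarrow> nat \<Rightarrow> real \<Rightarrow> (nat \<Rightarrow> real) \<Rightarrow> ennreal" where
  "iter_integral F 0 i b v = F v"
| "iter_integral F (Suc m) i b v =
     (\<integral>\<^sup>+ x\<in>{0..b}. iter_integral F m (Suc i) x (v(i := x)) \<partial>lborel)"

text \<open>$\int_0^T \int_0^{v_1} \cdots \int_0^{v_{n-1}} F(v)\,dv_n \cdots dv_1$\<close>

definition simplex_integral :: "nat \<Rightarrow> real \<Rightarrow> ((nat \<Rightarrow> real) \<Rightarrow> ennreal) \<Rightarrow> ennreal" where
  "simplex_integral n T F = iter_integral F n 1 T (\<lambda>_. 0)"

end

theory Submission
  imports Defs "HOL-Library.More_List"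
begin

text \<open>
  The claims are independent of the jump times, so they are integrated out first. This leaves a sum
  over one distinguished jump of a function of the list of all jump times, and only an upper bound
  for the law of that list is needed.

  On $\{H_T = m\}$ this law is dominated by the density
  $\prod_i \lambda(t_i) \exp(-\int_0^T \lambda)$ on increasing tuples: if the jumps fall into given
  dyadic cells, then in each of these cells \<open>N\<close> has a point below an upper bound of the intensity,
  and in the other cells it has no point below a lower bound. Monotonicity of \<open>\<Phi>\<close> makes both bounds
  functions of the cells, and independence on disjoint rectangles yields the density in the limit.

  The factor $\lambda(v_1) = \mu + \sum \Phi(v_1 - v)$ of the distinguished jump is expanded along the
  earlier jumps $v = v_2$, then the factor of $v_2$, and so on. This produces the chains
  $v_n < \dots < v_1$ with weight $\mu \prod \Phi(v_{i-1} - v_i)$; given a chain, the remaining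
  jumps follow the density of a Hawkes process with $v_1, \dots, v_n$ added to its history. Their
  number \<open>p\<close> has second moment at most $c_n$, so it equals \<open>p\<close> with probability at most
  $(c_n / p^2) \wedge 1$. As \<open>h\<close> is non-decreasing, discount factors of the remaining jumps may be
  replaced by 1, and replacing the weight of $p = 0$ by the smaller one moves mass only to larger
  values.
\<close>

section \<open>Lists of points\<close>

text \<open>An upper bound for the law suffices because every integrand is nonnegative; that the
  densities have total mass one is never shown. The cell bounds converge to left limits of
  \<open>\<Phi>\<close>, so the density is built from the left-continuous version
  \<open>ker\<close>. The two kernels differ at countably many points, which Lebesgue integrals do
  not see, and \<open>\<Phi>\<close> returns in the final bound. The number \<mu> + n \<Phi>(0)
  bounds the intensity generated by n chain points alone. Given the chain, the remaining jumps split
  into clusters whose size has first and second moments solving renewal equations. Their number has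
  mean at most \<mu> + n \<Phi>(0) times the integral of \<open>\<Psi>1\<close>, whose square is the
  C2 term; the C1 term bounds its variance. Since \<Psi>2 \<ge> \<Psi>1^2 \<ge> 1, C1 is at least T,
  so the weights of p = 0 and p = 1 already add up to at least one, which leaves room for the mass
  that is moved. A further obstacle is that no regularity of the paths of \<open>H\<close> is
  assumed: right-continuity has to be extracted from the equations before jump times can be
  used.\<close>

definition list_borel :: "real list measure" where
  "list_borel = vimage_algebra UNIV (\<lambda>l. (length l, nth_default 0 l))
     (count_space UNIV \<Otimes>\<^sub>M (\<Pi>\<^sub>M i\<in>UNIV. borel))"

lemma space_list_borel [simp]: "space list_borel = UNIV"
  by (simp add: list_borel_def)

text \<open>The length and the zero-padded entries generate the sigma-algebra by construction, so
  lists of all lengths form one space and measurability reduces to countably many coordinates. The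
  recorded length makes the padding value harmless.\<close>

lemma measurable_list_borelI:
  assumes "(\<lambda>x. length (f x)) \<in> measurable M (count_space UNIV)"
    and "\<And>i. (\<lambda>x. nth_default 0 (f x) i) \<in> borel_measurable M"
  shows "f \<in> measurable M list_borel"
  unfolding list_borel_def
proof (rule measurable_vimage_algebra2)
  show "f \<in> space M \<rightarrow> UNIV" by simp
  have "(\<lambda>x. nth_default 0 (f x)) \<in> measurable M (\<Pi>\<^sub>M i\<in>UNIV. borel)"
    by (rule measurable_PiM_single') (use assms(2) in auto)
  then show "(\<lambda>x. (length (f x), nth_default 0 (f x)))
      \<in> measurable M (count_space UNIV \<Otimes>\<^sub>M (\<Pi>\<^sub>M i\<in>UNIV. borel))"
    using assms(1) by measurable
qed

lemma measurable_list_borel_pair: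
  "(\<lambda>l. (length l, nth_default 0 l)) \<in> measurable list_borel (count_space UNIV \<Otimes>\<^sub>M (\<Pi>\<^sub>M i\<in>UNIV. borel))"
  unfolding list_borel_def by (rule measurable_vimage_algebra1) (auto simp: space_pair_measure space_PiM)

lemma measurable_length_list_borel [measurable]: "length \<in> measurable list_borel (count_space UNIV)"
  using measurable_compose[OF measurable_list_borel_pair measurable_fst] by simp

lemma measurable_nth_default_list_borel [measurable]:
  "(\<lambda>l. nth_default 0 l i) \<in> borel_measurable list_borel"
proof -
  have "(\<lambda>l. nth_default 0 l) \<in> measurable list_borel (\<Pi>\<^sub>M i\<in>UNIV. borel)"
    using measurable_compose[OF measurable_list_borel_pair measurable_snd] by simp
  from measurable_compose[OF this measurable_component_singleton[of i UNIV]] show ?thesis by simp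
qed

lemma measurable_nth_default [measurable (raw)]:
  assumes [measurable]: "f \<in> measurable M list_borel" "i \<in> measurable M (count_space UNIV)"
  shows "(\<lambda>x. nth_default 0 (f x) (i x)) \<in> borel_measurable M"
  by (rule measurable_compose_countable[where g=i]) measurable

lemma measurable_Cons_list_borel [measurable (raw)]:
  assumes [measurable]: "f \<in> borel_measurable M" "g \<in> measurable M list_borel"
  shows "(\<lambda>x. f x # g x) \<in> measurable M list_borel"
proof (rule measurable_list_borelI)
  fix i show "(\<lambda>x. nth_default 0 (f x # g x) i) \<in> borel_measurable M"
    by (cases i) auto
qed simp

lemma measurable_append_list_borel [measurable (raw)]:
  assumes [measurable]: "f \<in> measurable M list_borel" "g \<in> measurable M list_borel"
  shows "(\<lambda>x. f x @ g x) \<in> measurable M list_borel"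
proof (rule measurable_list_borelI)
  fix i
  have "(\<lambda>x. nth_default 0 (f x @ g x) i) = (\<lambda>x. if i < length (f x) then nth_default 0 (f x) i
      else nth_default 0 (g x) (i - length (f x)))"
    by (auto simp: nth_default_append nth_default_nth)
  also have "\<dots> \<in> borel_measurable M" by measurable
  finally show "(\<lambda>x. nth_default 0 (f x @ g x) i) \<in> borel_measurable M" .
qed simp

lemma measurable_map_list_borel [measurable (raw)]:
  assumes [measurable]: "h \<in> borel_measurable borel" "f \<in> measurable M list_borel"
  shows "(\<lambda>x. map h (f x)) \<in> measurable M list_borel"
proof (rule measurable_list_borelI)
  fix i
  have "(\<lambda>x. nth_default 0 (map h (f x)) i) = (\<lambda>x. if i < length (f x) then h (nth_default 0 (f x) i) else 0)"
    by (auto simp: nth_default_def)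
  also have "\<dots> \<in> borel_measurable M" by measurable
  finally show "(\<lambda>x. nth_default 0 (map h (f x)) i) \<in> borel_measurable M" .
qed simp

lemma measurable_take_list_borel [measurable (raw)]:
  assumes [measurable]: "f \<in> measurable M list_borel" "i \<in> measurable M (count_space UNIV)"
  shows "(\<lambda>x. take (i x) (f x)) \<in> measurable M list_borel"
proof (rule measurable_list_borelI)
  fix j show "(\<lambda>x. nth_default 0 (take (i x) (f x)) j) \<in> borel_measurable M"
    by (simp add: nth_default_take_eq)
qed simp

lemma measurable_drop_list_borel [measurable (raw)]:
  assumes [measurable]: "f \<in> measurable M list_borel" "i \<in> measurable M (count_space UNIV)"
  shows "(\<lambda>x. drop (i x) (f x)) \<in> measurable M list_borel"
proof (rule measurable_list_borelI)
  fix j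
  have "(\<lambda>x. nth_default 0 (drop (i x) (f x)) j) = (\<lambda>x. nth_default 0 (f x) (i x + j))"
    by (auto simp: nth_default_def fun_eq_iff add.commute)
  then show "(\<lambda>x. nth_default 0 (drop (i x) (f x)) j) \<in> borel_measurable M"
    by simp
qed simp

lemma measurable_butlast_list_borel [measurable (raw)]:
  assumes [measurable]: "f \<in> measurable M list_borel"
  shows "(\<lambda>x. butlast (f x)) \<in> measurable M list_borel"
  unfolding butlast_conv_take by measurable

lemma sum_list_nth_default: "(\<Sum>y\<leftarrow>l. F y) = (\<Sum>i<length l. F (nth_default d l i))"
  by (simp add: sum_list_sum_nth atLeast0LessThan nth_default_def)

lemma prod_list_nth_default: "(\<Prod>y\<leftarrow>l. F y) = (\<Prod>i<length l. F (nth_default d l i))"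
  by (simp add: prod.list_conv_set_nth atLeast0LessThan nth_default_def)

lemma borel_measurable_sum_list_borel [measurable (raw)]:
  fixes F :: "'a \<Rightarrow> real \<Rightarrow> 'b::{second_countable_topology, topological_comm_monoid_add}"
  assumes [measurable]: "(\<lambda>(x, y). F x y) \<in> borel_measurable (M \<Otimes>\<^sub>M borel)" "l \<in> measurable M list_borel"
  shows "(\<lambda>x. \<Sum>y\<leftarrow>l x. F x y) \<in> borel_measurable M"
proof -
  have "(\<lambda>x. \<Sum>i<n. F x (nth_default 0 (l x) i)) \<in> borel_measurable M" for n
    by measurable
  from measurable_compose_countable[where g="\<lambda>x. length (l x)", OF this]
  show ?thesis by (simp add: sum_list_nth_default[where d=0])
qed

lemma borel_measurable_prod_list_borel [measurable (raw)]:
  fixes F :: "'a \<Rightarrow> real \<Rightarrow> real"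
  assumes [measurable]: "(\<lambda>(x, y). F x y) \<in> borel_measurable (M \<Otimes>\<^sub>M borel)" "l \<in> measurable M list_borel"
  shows "(\<lambda>x. \<Prod>y\<leftarrow>l x. F x y) \<in> borel_measurable M"
proof -
  have "(\<lambda>x. \<Prod>i<n. F x (nth_default 0 (l x) i)) \<in> borel_measurable M" for n
    by measurable
  from measurable_compose_countable[where g="\<lambda>x. length (l x)", OF this]
  show ?thesis by (simp add: prod_list_nth_default[where d=0])
qed

lemma pred_sorted_list_borel [measurable (raw)]:
  assumes [measurable]: "f \<in> measurable M list_borel"
  shows "Measurable.pred M (\<lambda>x. sorted_wrt (<) (f x))"
proof -
  have "sorted_wrt (<) (f x) \<longleftrightarrow> (\<forall>i j. i < j \<longrightarrow> j < length (f x) \<longrightarrow> nth_default 0 (f x) i < nth_default 0 (f x) j)" for x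
    by (auto simp: sorted_wrt_iff_nth_less nth_default_def)
  then show ?thesis by simp
qed

lemma pred_ball_list_borel [measurable (raw)]:
  assumes [measurable]: "(\<lambda>(x, y). P x y) \<in> measurable (M \<Otimes>\<^sub>M borel) (count_space UNIV)" "f \<in> measurable M list_borel"
  shows "Measurable.pred M (\<lambda>x. \<forall>y\<in>set (f x). P x y)"
proof -
  have "(\<forall>y\<in>set (f x). P x y) \<longleftrightarrow> (\<forall>i. i < length (f x) \<longrightarrow> P x (nth_default 0 (f x) i))" for x
    by (auto simp: in_set_conv_nth nth_default_def) (metis nth_mem)+
  then show ?thesis by simp
qed

lemma measurable_hd_list_borel [measurable (raw)]:
  assumes [measurable]: "f \<in> measurable M list_borel"
  shows "(\<lambda>x. hd (f x)) \<in> borel_measurable M"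
proof -
  have *: "hd (f x) = (if length (f x) = 0 then hd [] else nth_default 0 (f x) 0)" for x
    by (cases "f x") auto
  show ?thesis unfolding * by measurable
qed

lemma measurable_last_list_borel [measurable (raw)]:
  assumes [measurable]: "f \<in> measurable M list_borel"
  shows "(\<lambda>x. last (f x)) \<in> borel_measurable M"
proof -
  have *: "last (f x) = (if length (f x) = 0 then last [] else nth_default 0 (f x) (length (f x) - 1))" for x
    by (auto simp: nth_default_def last_conv_nth)
  show ?thesis unfolding * by measurable
qed

text \<open>The sets that are approximated in both measures by unions of atoms of the partitions
  form a $\sigma$-algebra.\<close>

lemma emeasure_le_of_partitions:
  fixes D :: "nat \<Rightarrow> 'a \<Rightarrow> 'b::countable"
  assumes fin: "finite_measure M" "finite_measure N"
    and sets_eq: "sets M = sets N"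
    and D: "\<And>k. D k \<in> measurable N (count_space UNIV)"
    and refine: "\<And>k x. D k x = R k (D (Suc k) x)"
    and gen: "sets N \<subseteq> sigma_sets (space N) {D k -` {c} \<inter> space N | k c. True}"
    and le: "\<And>k c. emeasure M (D k -` {c} \<inter> space N) \<le> emeasure N (D k -` {c} \<inter> space N)"
    and A: "A \<in> sets N"
  shows "emeasure M A \<le> emeasure N A"
proof -
  interpret M: finite_measure M by fact
  interpret N: finite_measure N by fact
  have space_eq: "space M = space N" using sets_eq_imp_space_eq[OF sets_eq] .
  \<comment> \<open>Unions of atoms of a single level. They form an algebra because two levels have
    a common refinement.\<close>
  define G where "G = {D k -` S \<inter> space N | k S. True}"
  have G_sets: "B \<in> sets N" if "B \<in> G" for B
    using that D by (auto simp: G_def intro: measurable_sets)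
  have refine': "\<exists>r. \<forall>x. D k x = r (D (k + j) x)" for k j
  proof (induction j)
    case 0 show ?case by (intro exI[of _ "\<lambda>x. x"]) simp
  next
    case (Suc j)
    then obtain r where "\<And>x. D k x = r (D (k + j) x)" by blast
    then have "D k x = (r \<circ> R (k + j)) (D (k + Suc j) x)" for x
      using refine[of "k + j" x] by simp
    then show ?case by blast
  qed
  have up: "\<exists>S'. D k -` S \<inter> space N = D (k + j) -` S' \<inter> space N" for k j S
  proof -
    obtain r where "\<And>x. D k x = r (D (k + j) x)" using refine' by blast
    then have "D k -` S \<inter> space N = D (k + j) -` (r -` S) \<inter> space N" by auto
    then show ?thesis by blast
  qed
  have G_Un: "B \<union> C \<in> G" if "B \<in> G" "C \<in> G" for B C
  proof -
    from that obtain k S j U where "B = D k -` S \<inter> space N" "C = D j -` U \<inter> space N"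
      by (auto simp: G_def)
    moreover obtain S' where "D k -` S \<inter> space N = D (k + j) -` S' \<inter> space N"
      using up[of k S j] by (elim exE)
    moreover obtain U' where "D j -` U \<inter> space N = D (k + j) -` U' \<inter> space N"
      using up[of j U k] unfolding add.commute[of j k] by (elim exE)
    ultimately have "B \<union> C = (D (k + j) -` S' \<inter> space N) \<union> (D (k + j) -` U' \<inter> space N)" by (simp only:)
    also have "\<dots> = D (k + j) -` (S' \<union> U') \<inter> space N" by blast
    finally have "B \<union> C = D (k + j) -` (S' \<union> U') \<inter> space N" .
    then show ?thesis unfolding G_def by (intro CollectI exI conjI TrueI)
  qed
  have G_empty: "{} \<in> G" unfolding G_def by (auto intro!: exI[of _ "{}"])
  have G_UN: "(\<Union>i<n. B i) \<in> G" if "\<And>i. B i \<in> G" for B :: "nat \<Rightarrow> _" and n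
    by (induction n) (auto simp: lessThan_Suc G_empty intro: G_Un that)
  have G_compl: "space N - B \<in> G" if "B \<in> G" for B
  proof -
    from that obtain k S where "B = D k -` S \<inter> space N" by (auto simp: G_def)
    then have "space N - B = D k -` (- S) \<inter> space N" by auto
    then show ?thesis by (auto simp: G_def)
  qed
  have G_le: "emeasure M B \<le> emeasure N B" if "B \<in> G" for B
  proof -
    from that obtain k S where B: "B = D k -` S \<inter> space N" by (auto simp: G_def)
    have D': "D k \<in> measurable M (count_space UNIV)"
      using D[of k] sets_eq by (simp cong: measurable_cong_sets)
    have "emeasure M B = emeasure (distr M (count_space UNIV) (D k)) S"
      by (simp add: emeasure_distr D' B space_eq)
    also have "\<dots> = (\<integral>\<^sup>+ c. emeasure (distr M (count_space UNIV) (D k)) {c} \<partial>count_space S)"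
      by (rule emeasure_countable_singleton) auto
    also have "\<dots> \<le> (\<integral>\<^sup>+ c. emeasure (distr N (count_space UNIV) (D k)) {c} \<partial>count_space S)"
      by (intro nn_integral_mono) (simp add: emeasure_distr D D' le space_eq)
    also have "\<dots> = emeasure (distr N (count_space UNIV) (D k)) S"
      by (rule emeasure_countable_singleton[symmetric]) auto
    also have "\<dots> = emeasure N B"
      by (simp add: emeasure_distr D B)
    finally show ?thesis .
  qed
  \<comment> \<open>One set \<open>B\<close> has to approximate \<open>X\<close> in both measures at
    once; this is the property carried through the induction over the generated
    sigma-algebra.\<close>
  define d where "d e X B \<longleftrightarrow> measure M (X - B \<union> (B - X)) < e \<and> measure N (X - B \<union> (B - X)) < (e::real)"
    for e X B
  have approx: "X \<in> sets N \<and> (\<forall>e>0. \<exists>B\<in>G. d e X B)"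
    if "X \<in> sigma_sets (space N) {D k -` {c} \<inter> space N | k c. True}" for X
    using that
  proof (induction rule: sigma_sets.induct)
    case (Basic a)
    then have "a \<in> G" by (auto simp: G_def)
    then show ?case using G_sets by (auto simp: d_def intro!: bexI[of _ a])
  next
    case Empty
    then show ?case using G_empty by (auto simp: d_def intro!: bexI[of _ "{}"])
  next
    case (Compl a)
    show ?case
    proof (intro conjI allI impI)
      show "space N - a \<in> sets N" using Compl by auto
      fix e :: real assume "e > 0"
      with Compl obtain B where B: "B \<in> G" "d e a B" by blast
      have "(space N - a) - (space N - B) \<union> ((space N - B) - (space N - a)) = a - B \<union> (B - a)"
        using Compl B G_sets[of B] sets.sets_into_space by blast
      then have "d e (space N - a) (space N - B)" using B by (simp add: d_def)
      then show "\<exists>B\<in>G. d e (space N - a) B" using G_compl B by blast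
    qed
  next
    case (Union a)
    have a_sets: "a i \<in> sets N" for i using Union by auto
    then have a_sets': "a i \<in> sets M" for i using sets_eq by simp
    show ?case
    proof (intro conjI allI impI)
      show "(\<Union>i. a i) \<in> sets N" using a_sets by auto
      fix e :: real assume e: "e > 0"
      have lim: "(\<lambda>n. measure P (\<Union>i<n. a i)) \<longlonglongrightarrow> measure P (\<Union>i. a i)"
        if "finite_measure P" "sets P = sets N" for P
      proof -
        interpret P: finite_measure P by fact
        have "(\<lambda>n. measure P (\<Union>i<n. a i)) \<longlonglongrightarrow> measure P (\<Union>n. \<Union>i<n. a i)"
        proof (rule P.finite_Lim_measure_incseq)
          show "range (\<lambda>n. \<Union>i<n. a i) \<subseteq> sets P" using a_sets that by auto
          show "incseq (\<lambda>n. \<Union>i<n. a i)" unfolding incseq_def by (auto intro: less_le_trans)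
        qed
        moreover have "(\<Union>n. \<Union>i<n. a i) = (\<Union>i. a i)" by auto
        ultimately show ?thesis by simp
      qed
      have "eventually (\<lambda>n. measure M (\<Union>i<n. a i) > measure M (\<Union>i. a i) - e/2) sequentially"
        using order_tendstoD(1)[OF lim[OF fin(1) sets_eq], of "measure M (\<Union>i. a i) - e/2"] e by simp
      moreover have "eventually (\<lambda>n. measure N (\<Union>i<n. a i) > measure N (\<Union>i. a i) - e/2) sequentially"
        using order_tendstoD(1)[OF lim[OF fin(2) refl], of "measure N (\<Union>i. a i) - e/2"] e by simp
      ultimately obtain n where
        n: "measure M (\<Union>i<n. a i) > measure M (\<Union>i. a i) - e/2"
           "measure N (\<Union>i<n. a i) > measure N (\<Union>i. a i) - e/2"
        by (metis (mono_tags, lifting) eventually_conj eventually_sequentially order_refl)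
      \<comment> \<open>Half of \<open>e\<close> is spent on cutting the union after
        \<open>n\<close> sets, the other half is shared by these \<open>n\<close> sets;
        \<open>Suc n\<close> avoids a division by zero.\<close>
      have "\<exists>B\<in>G. d (e / (2 * real (Suc n))) (a i) B" for i
        using Union.IH[of i] e by auto
      then obtain B where B: "\<And>i. B i \<in> G" "\<And>i. d (e / (2 * real (Suc n))) (a i) (B i)"
        by metis
      have B_sets: "B i \<in> sets N" for i using B G_sets by blast
      define C where "C = (\<Union>i<n. B i)"
      have C_sets: "C \<in> sets N" using B_sets by (auto simp: C_def)
      have bound: "measure P ((\<Union>i. a i) - C \<union> (C - (\<Union>i. a i))) < e"
        if "finite_measure P" "sets P = sets N" "measure P (\<Union>i<n. a i) > measure P (\<Union>i. a i) - e/2"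
          "\<And>i. measure P (a i - B i \<union> (B i - a i)) < e / (2 * real (Suc n))" for P
      proof -
        interpret P: finite_measure P by fact
        note [measurable_cong] = that(2)
        have [measurable]: "a i \<in> sets P" "B i \<in> sets P" "C \<in> sets P" for i
          using a_sets B_sets C_sets that(2) by auto
        have "measure P ((\<Union>i. a i) - C \<union> (C - (\<Union>i. a i)))
            \<le> measure P (((\<Union>i. a i) - (\<Union>i<n. a i)) \<union> (\<Union>i<n. a i - B i \<union> (B i - a i)))"
          by (intro P.finite_measure_mono) (auto simp: C_def)
        also have "\<dots> \<le> measure P ((\<Union>i. a i) - (\<Union>i<n. a i)) + measure P (\<Union>i<n. a i - B i \<union> (B i - a i))"
          by (intro measure_Un_le) auto
        also have "measure P ((\<Union>i. a i) - (\<Union>i<n. a i)) = measure P (\<Union>i. a i) - measure P (\<Union>i<n. a i)"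
          by (rule P.finite_measure_Diff) auto
        also have "measure P (\<Union>i<n. a i - B i \<union> (B i - a i)) \<le> (\<Sum>i<n. measure P (a i - B i \<union> (B i - a i)))"
          by (intro measure_UNION_le) auto
        also have "\<dots> \<le> (\<Sum>i<n. e / (2 * real (Suc n)))"
          by (intro sum_mono less_imp_le that(4))
        also have "\<dots> = e / 2 * (real n / real (Suc n))" by (simp add: field_simps)
        also have "\<dots> \<le> e / 2 * 1" using e by (intro mult_left_mono) auto
        finally show ?thesis using that(3) by simp
      qed
      have "d e (\<Union>i. a i) C"
        unfolding d_def
        using bound[OF fin(1) sets_eq n(1)] bound[OF fin(2) refl n(2)] B(2) by (auto simp: d_def)
      moreover have "C \<in> G" unfolding C_def by (rule G_UN) (rule B)
      ultimately show "\<exists>B\<in>G. d e (\<Union>i. a i) B" by blast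
    qed
  qed
  have "measure M A \<le> measure N A"
  proof (rule field_le_epsilon)
    fix e :: real assume "e > 0"
    \<comment> \<open>The symmetric difference is paid for twice, once in each measure.\<close>
    then obtain B where B: "B \<in> G" "d (e / 2) A B"
      using approx[of A] gen A by (meson half_gt_zero subsetD)
    have [measurable]: "A \<in> sets N" "B \<in> sets N" using A B G_sets by auto
    then have [measurable]: "A \<in> sets M" "B \<in> sets M" using sets_eq by auto
    have "measure M A \<le> measure M (B \<union> (A - B \<union> (B - A)))"
      by (intro M.finite_measure_mono) auto
    also have "\<dots> \<le> measure M B + measure M (A - B \<union> (B - A))"
      by (intro measure_Un_le) auto
    also have "measure M B \<le> measure N B"
      using G_le[OF B(1)] by (simp add: M.emeasure_eq_measure N.emeasure_eq_measure)
    also have "measure N B \<le> measure N (A \<union> (A - B \<union> (B - A)))"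
      by (intro N.finite_measure_mono) auto
    also have "\<dots> \<le> measure N A + measure N (A - B \<union> (B - A))"
      by (intro measure_Un_le) auto
    finally show "measure M A \<le> measure N A + e" using B(2) by (simp add: d_def)
  qed
  then show ?thesis by (simp add: M.emeasure_eq_measure N.emeasure_eq_measure)
qed

text \<open>The m-fold product of Lebesgue measure on [0,T], transported to lists of length m. No
  order is imposed here; increasing tuples are selected by the integrands.\<close>

primrec points :: "real \<Rightarrow> nat \<Rightarrow> real list measure" where
  "points T 0 = return list_borel []"
| "points T (Suc m) =
     distr (density lborel (indicator {0..T}) \<Otimes>\<^sub>M points T m) list_borel (\<lambda>(x, l). x # l)"

lemma sets_points [measurable_cong, simp]: "sets (points T m) = sets list_borel"
  by (cases m) simp_all

lemma space_points [simp]: "space (points T m) = UNIV"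
  using sets_eq_imp_space_eq[OF sets_points] by simp

lemma finite_measure_interval: "finite_measure (density lborel (indicator {0..T::real}))"
  by (intro finite_measureI) (simp add: emeasure_density emeasure_lborel_Icc_eq)

lemma finite_measure_points: "finite_measure (points T m)"
proof (induction m)
  case 0
  show ?case using prob_space_return[of "[]" list_borel] by (auto simp: prob_space_def)
next
  case (Suc m)
  interpret A: finite_measure "density lborel (indicator {0..T::real})" by (rule finite_measure_interval)
  interpret B: finite_measure "points T m" by fact
  interpret P: finite_measure "density lborel (indicator {0..T::real}) \<Otimes>\<^sub>M points T m"
    by (rule finite_measure_pair_measure) unfold_locales
  show ?case unfolding points.simps by (rule P.finite_measure_distr) measurable
qed

lemma nn_integral_points_Suc:
  assumes [measurable]: "F \<in> borel_measurable list_borel"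
  shows "(\<integral>\<^sup>+ l. F l \<partial>points T (Suc m)) = (\<integral>\<^sup>+ x\<in>{0..T}. (\<integral>\<^sup>+ l. F (x # l) \<partial>points T m) \<partial>lborel)"
proof -
  interpret B: finite_measure "points T m" by (rule finite_measure_points)
  have "(\<integral>\<^sup>+ l. F l \<partial>points T (Suc m))
      = (\<integral>\<^sup>+ z. F (case z of (x, l) \<Rightarrow> x # l) \<partial>(density lborel (indicator {0..T}) \<Otimes>\<^sub>M points T m))"
    unfolding points.simps by (rule nn_integral_distr) measurable
  also have "\<dots> = (\<integral>\<^sup>+ x. (\<integral>\<^sup>+ l. F (x # l) \<partial>points T m) \<partial>density lborel (indicator {0..T}))"
    by (subst B.nn_integral_fst[symmetric]) auto
  also have "\<dots> = (\<integral>\<^sup>+ x\<in>{0..T}. (\<integral>\<^sup>+ l. F (x # l) \<partial>points T m) \<partial>lborel)"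
    by (subst nn_integral_density) (auto simp: mult.commute)
  finally show ?thesis .
qed

lemma nn_integral_points_0:
  "F \<in> borel_measurable list_borel \<Longrightarrow> (\<integral>\<^sup>+ l. F l \<partial>points T 0) = F []"
  by (simp add: nn_integral_return)

lemma AE_length_points: "AE l in points T m. length l = m"
proof -
  have "(\<integral>\<^sup>+ l. (if length l = m then 0 else 1) \<partial>points T m) = 0"
  proof (induction m)
    case 0
    have "(\<integral>\<^sup>+ l. (if length l = 0 then 0 else 1) \<partial>points T 0) = (if length ([]::real list) = 0 then 0 else 1)"
      by (rule nn_integral_points_0) measurable
    then show ?case by simp
  next
    case (Suc m)
    show ?case
      by (subst nn_integral_points_Suc) (simp_all add: Suc del: points.simps)
  qed
  then have "AE l in points T m. (if length l = m then 0 else 1) = (0::ennreal)"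
    by (subst nn_integral_0_iff_AE[symmetric]) (auto simp del: points.simps)
  then show ?thesis by eventually_elim (auto split: if_splits)
qed

section \<open>Distinguishing one coordinate of a tuple\<close>

definition remove_nth :: "nat \<Rightarrow> 'b list \<Rightarrow> 'b list" where
  "remove_nth i l = take i l @ drop (Suc i) l"

lemma remove_nth_Cons_0 [simp]: "remove_nth 0 (x # l) = l"
  and remove_nth_Cons_Suc [simp]: "remove_nth (Suc i) (x # l) = x # remove_nth i l"
  by (simp_all add: remove_nth_def)

lemma mset_remove_nth: "i < length l \<Longrightarrow> mset l = add_mset (l ! i) (mset (remove_nth i l))"
proof (induction l arbitrary: i)
  case (Cons a l) then show ?case by (cases i) auto
qed simp

lemma length_remove_nth: "i < length l \<Longrightarrow> length (remove_nth i l) = length l - 1"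
  by (simp add: remove_nth_def)

lemma measurable_remove_nth [measurable (raw)]:
  assumes [measurable]: "f \<in> measurable M list_borel" "i \<in> measurable M (count_space UNIV)"
  shows "(\<lambda>x. remove_nth (i x) (f x)) \<in> measurable M list_borel"
  unfolding remove_nth_def by measurable

text \<open>The sum in a reduced Campbell formula: each entry in turn is the distinguished point,
  and \<open>u\<close> sees it together with the configuration of the others.\<close>

definition picks :: "(real \<Rightarrow> real list \<Rightarrow> ennreal) \<Rightarrow> real list \<Rightarrow> ennreal" where
  "picks u l = (\<Sum>i<length l. u (nth_default 0 l i) (remove_nth i l))"

lemma picks_Nil [simp]: "picks u [] = 0"
  by (simp add: picks_def)

lemma picks_Cons: "picks u (x # l) = u x l + picks (\<lambda>y w. u y (x # w)) l"
  by (simp add: picks_def sum.lessThan_Suc_shift del: sum.lessThan_Suc)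

lemma measurable_picks [measurable (raw)]:
  assumes [measurable]: "(\<lambda>(x, y, w). u x y w) \<in> borel_measurable (M \<Otimes>\<^sub>M borel \<Otimes>\<^sub>M list_borel)"
    "l \<in> measurable M list_borel"
  shows "(\<lambda>x. picks (u x) (l x)) \<in> borel_measurable M"
proof -
  have "(\<lambda>x. \<Sum>i<n. u x (nth_default 0 (l x) i) (remove_nth i (l x))) \<in> borel_measurable M" for n
  proof (rule borel_measurable_sum)
    fix i
    have "(\<lambda>x. (x, nth_default 0 (l x) i, remove_nth i (l x))) \<in> M \<rightarrow>\<^sub>M M \<Otimes>\<^sub>M borel \<Otimes>\<^sub>M list_borel"
      by measurable
    from measurable_compose[OF this assms(1)]
    show "(\<lambda>x. u x (nth_default 0 (l x) i) (remove_nth i (l x))) \<in> borel_measurable M" by simp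
  qed
  from measurable_compose_countable[where g="\<lambda>x. length (l x)", OF this]
  show ?thesis by (simp add: picks_def)
qed


lemma borel_measurable_nn_integral_points [measurable (raw)]:
  "(\<lambda>(x, l). F x l) \<in> borel_measurable (M \<Otimes>\<^sub>M list_borel) \<Longrightarrow>
    (\<lambda>x. \<integral>\<^sup>+ l. F x l \<partial>points T m) \<in> borel_measurable M"
proof -
  interpret B: finite_measure "points T m" by (rule finite_measure_points)
  assume "(\<lambda>(x, l). F x l) \<in> borel_measurable (M \<Otimes>\<^sub>M list_borel)"
  then have "(\<lambda>(x, l). F x l) \<in> borel_measurable (M \<Otimes>\<^sub>M points T m)"
    by (subst measurable_cong_sets[OF sets_pair_measure_cong[OF refl sets_points] refl])
  then show ?thesis by (rule B.borel_measurable_nn_integral)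
qed

text \<open>The lower end \<open>a\<close> is a parameter so that an induction can pass to the tail
  of the tuple with the head as new lower end.\<close>

abbreviation incr :: "real \<Rightarrow> real list \<Rightarrow> ennreal" where
  "incr a l \<equiv> (if sorted_wrt (<) (a # l) then 1 else 0)"

lemma incr_Cons: "incr a (x # l) = (if a < x then 1 else 0) * incr x l"
  by (auto intro: less_trans)

text \<open>Removing the $i$-th coordinate of an increasing tuple leaves an increasing tuple, and
  each position of the removed coordinate occurs exactly once.\<close>

lemma nn_integral_picks:
  assumes [measurable]: "(\<lambda>(x, l). u x l) \<in> borel_measurable (borel \<Otimes>\<^sub>M list_borel)"
  shows "(\<integral>\<^sup>+ l. incr a l * picks u l \<partial>points T (Suc m))
    = (\<integral>\<^sup>+ x\<in>{0..T}. (if a < x then 1 else 0) * (\<integral>\<^sup>+ w. incr a w * u x w \<partial>points T m) \<partial>lborel)"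
  using assms
proof (induction m arbitrary: a u)
  case 0
  note [measurable] = 0
  have "(\<integral>\<^sup>+ l. incr a l * picks u l \<partial>points T (Suc 0))
      = (\<integral>\<^sup>+ x\<in>{0..T}. (\<integral>\<^sup>+ l. incr a (x # l) * picks u (x # l) \<partial>points T 0) \<partial>lborel)"
    by (rule nn_integral_points_Suc) measurable
  also have "\<dots> = (\<integral>\<^sup>+ x\<in>{0..T}. (if a < x then 1 else 0) * (\<integral>\<^sup>+ w. incr a w * u x w \<partial>points T 0) \<partial>lborel)"
    by (subst (1 2) nn_integral_points_0; (measurable)?)
      (auto simp: picks_Cons intro!: nn_integral_cong)
  finally show ?case .
next
  case (Suc m)
  note [measurable] = Suc.prems
  let ?lt = "\<lambda>a x. if a < (x::real) then 1 else 0 :: ennreal"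
  have "(\<integral>\<^sup>+ l. incr a l * picks u l \<partial>points T (Suc (Suc m)))
      = (\<integral>\<^sup>+ t\<in>{0..T}. (\<integral>\<^sup>+ l. incr a (t # l) * picks u (t # l) \<partial>points T (Suc m)) \<partial>lborel)"
    by (rule nn_integral_points_Suc) measurable
  \<comment> \<open>Either the head \<open>t\<close> is the distinguished coordinate, or this
    coordinate lies in the tail, to which the induction hypothesis applies with lower end
    \<open>t\<close>.\<close>
  also have "\<dots> = (\<integral>\<^sup>+ t\<in>{0..T}. ?lt a t * (\<integral>\<^sup>+ l. incr t l * u t l \<partial>points T (Suc m))
      + ?lt a t * (\<integral>\<^sup>+ l. incr t l * picks (\<lambda>y w. u y (t # w)) l \<partial>points T (Suc m)) \<partial>lborel)"
    unfolding incr_Cons picks_Cons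
    by (simp add: mult.assoc distrib_left nn_integral_add nn_integral_cmult
        del: points.simps sorted_wrt.simps)
  also have "\<dots> = (\<integral>\<^sup>+ t\<in>{0..T}. ?lt a t * (\<integral>\<^sup>+ l. incr t l * u t l \<partial>points T (Suc m)) \<partial>lborel)
      + (\<integral>\<^sup>+ t\<in>{0..T}. ?lt a t * (\<integral>\<^sup>+ l. incr t l * picks (\<lambda>y w. u y (t # w)) l \<partial>points T (Suc m)) \<partial>lborel)"
    by (subst distrib_right, subst nn_integral_add) (simp_all del: points.simps sorted_wrt.simps)
  also have "(\<integral>\<^sup>+ t\<in>{0..T}. ?lt a t * (\<integral>\<^sup>+ l. incr t l * u t l \<partial>points T (Suc m)) \<partial>lborel)
      = (\<integral>\<^sup>+ x\<in>{0..T}. \<integral>\<^sup>+ t\<in>{0..T}. ?lt a x * ?lt x t * (\<integral>\<^sup>+ w. incr t w * u x (t # w) \<partial>points T m) \<partial>lborel \<partial>lborel)"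
    by (subst nn_integral_points_Suc, measurable)
      (simp add: incr_Cons nn_integral_cmult mult.assoc del: points.simps sorted_wrt.simps)
  also have "(\<integral>\<^sup>+ t\<in>{0..T}. ?lt a t * (\<integral>\<^sup>+ l. incr t l * picks (\<lambda>y w. u y (t # w)) l \<partial>points T (Suc m)) \<partial>lborel)
      = (\<integral>\<^sup>+ t. \<integral>\<^sup>+ x. indicator {0..T} t * indicator {0..T} x * ?lt a t * ?lt t x * (\<integral>\<^sup>+ w. incr t w * u x (t # w) \<partial>points T m) \<partial>lborel \<partial>lborel)"
    by (subst Suc.IH, measurable)
      (simp add: nn_integral_cmult[symmetric] mult_ac del: points.simps sorted_wrt.simps)
  also have "\<dots> = (\<integral>\<^sup>+ x. \<integral>\<^sup>+ t. indicator {0..T} t * indicator {0..T} x * ?lt a t * ?lt t x * (\<integral>\<^sup>+ w. incr t w * u x (t # w) \<partial>points T m) \<partial>lborel \<partial>lborel)"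
    by (rule lborel_pair.Fubini') measurable
  also have "(\<integral>\<^sup>+ x\<in>{0..T}. \<integral>\<^sup>+ t\<in>{0..T}. ?lt a x * ?lt x t * (\<integral>\<^sup>+ w. incr t w * u x (t # w) \<partial>points T m) \<partial>lborel \<partial>lborel) + \<dots>
     = (\<integral>\<^sup>+ x. \<integral>\<^sup>+ t. indicator {0..T} x * indicator {0..T} t * (?lt a x * ?lt x t + ?lt a t * ?lt t x)
          * (\<integral>\<^sup>+ w. incr t w * u x (t # w) \<partial>points T m) \<partial>lborel \<partial>lborel)"
    by (simp add: nn_integral_add[symmetric] nn_integral_cmult[symmetric] distrib_left distrib_right mult_ac
        del: points.simps sorted_wrt.simps)
  \<comment> \<open>Off the null diagonal exactly one of x < t and t < x holds, so the two orders
    add up to a constraint that no longer compares x with t.\<close>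
  also have "\<dots> = (\<integral>\<^sup>+ x. \<integral>\<^sup>+ t. indicator {0..T} x * indicator {0..T} t * (?lt a x * ?lt a t)
          * (\<integral>\<^sup>+ w. incr t w * u x (t # w) \<partial>points T m) \<partial>lborel \<partial>lborel)"
  proof (rule nn_integral_cong, rule nn_integral_cong_AE)
    fix x :: real
    have "AE t in lborel. t \<noteq> x" by (rule AE_lborel_singleton)
    then show "AE t in lborel. indicator {0..T} x * indicator {0..T} t * (?lt a x * ?lt x t + ?lt a t * ?lt t x)
          * (\<integral>\<^sup>+ w. incr t w * u x (t # w) \<partial>points T m) = indicator {0..T} x * indicator {0..T} t * (?lt a x * ?lt a t)
          * (\<integral>\<^sup>+ w. incr t w * u x (t # w) \<partial>points T m)"
      by eventually_elim (auto simp del: points.simps)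
  qed
  also have "\<dots> = (\<integral>\<^sup>+ x\<in>{0..T}. ?lt a x * (\<integral>\<^sup>+ w. incr a w * u x w \<partial>points T (Suc m)) \<partial>lborel)"
    by (subst nn_integral_points_Suc, measurable)
      (simp add: incr_Cons nn_integral_cmult[symmetric] mult_ac del: points.simps sorted_wrt.simps)
  finally show ?case .
qed

section \<open>Integrals of bounded functions over intervals\<close>

lemma set_integrable_bounded:
  fixes f :: "real \<Rightarrow> real"
  assumes [measurable]: "f \<in> borel_measurable borel" and "\<And>x. \<bar>f x\<bar> \<le> R"
  shows "set_integrable lborel {a..b} f"
  unfolding set_integrable_def
proof (rule Bochner_Integration.integrable_bound[of _ "\<lambda>x. indicator {a..b} x *\<^sub>R R"])
  show "integrable lborel (\<lambda>x. indicator {a..b} x *\<^sub>R R)"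
    by (simp add: emeasure_lborel_Icc_eq)
  have "\<bar>f x\<bar> \<le> \<bar>R\<bar>" for x using assms(2)[of x] by linarith
  then show "AE x in lborel. norm (indicator {a..b} x *\<^sub>R f x) \<le> norm (indicator {a..b} x *\<^sub>R R)"
    by (auto simp: indicator_def)
qed measurable

lemma LBINT_split:
  fixes f :: "real \<Rightarrow> real"
  assumes "f \<in> borel_measurable borel" and "\<And>x. \<bar>f x\<bar> \<le> R" and "a \<le> b" "b \<le> c"
  shows "(LBINT x:{a..c}. f x) = (LBINT x:{a..b}. f x) + (LBINT x:{b..c}. f x)"
proof -
  have I: "set_integrable lborel {x..y} f" for x y by (rule set_integrable_bounded[OF assms(1,2)])
  have "integral {a..b} f + integral {b..c} f = integral {a..c} f"
    by (rule Henstock_Kurzweil_Integration.integral_combine[OF assms(3,4) set_borel_integral_eq_integral(1)[OF I]])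
  then show ?thesis unfolding set_borel_integral_eq_integral(2)[OF I] by (rule sym)
qed

lemma measurable_LBINT_Icc [measurable (raw)]:
  fixes f :: "'a \<Rightarrow> real \<Rightarrow> real"
  assumes [measurable]: "(\<lambda>(x, u). f x u) \<in> borel_measurable (M \<Otimes>\<^sub>M borel)"
    "a \<in> borel_measurable M" "b \<in> borel_measurable M"
  shows "(\<lambda>x. LBINT u:{a x..b x}. f x u) \<in> borel_measurable M"
proof -
  have [measurable]: "(\<lambda>z. f (fst z) (snd z)) \<in> borel_measurable (M \<Otimes>\<^sub>M borel)"
    using assms(1) by (simp add: case_prod_beta')
  have "(\<lambda>z. (if a (fst z) \<le> snd z \<and> snd z \<le> b (fst z) then f (fst z) (snd z) else 0)) \<in> borel_measurable (M \<Otimes>\<^sub>M borel)"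
    by measurable
  then have "(\<lambda>(x, u). (if a x \<le> u \<and> u \<le> b x then f x u else 0)) \<in> borel_measurable (M \<Otimes>\<^sub>M borel)"
    by (simp add: case_prod_beta')
  then have "(\<lambda>(x, u). (if a x \<le> u \<and> u \<le> b x then f x u else 0)) \<in> borel_measurable (M \<Otimes>\<^sub>M lborel)"
    by (subst measurable_cong_sets[OF sets_pair_measure_cong[OF refl sets_lborel] refl])
  then have "(\<lambda>x. LINT u|lborel. (if a x \<le> u \<and> u \<le> b x then f x u else 0)) \<in> borel_measurable M"
    by (rule sigma_finite_measure.borel_measurable_lebesgue_integral[OF sigma_finite_lborel])
  also have "(\<lambda>x. LINT u|lborel. (if a x \<le> u \<and> u \<le> b x then f x u else 0)) = (\<lambda>x. LBINT u:{a x..b x}. f x u)"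
    unfolding set_lebesgue_integral_def by (intro ext Bochner_Integration.integral_cong) auto
  finally show ?thesis .
qed

text \<open>As \<open>f\<close> is only bounded and measurable, exp(-Y) need not be differentiable,
  where Y is the integral of \<open>f\<close> from \<open>s\<close>. Instead the sum
  \<open>k\<close> of the left-hand integral and exp(-Y) has increments of quadratic order; its
  derivative is therefore zero at every point, and \<open>k\<close> is constant.\<close>

lemma nn_integral_exp_neg_LBINT:
  fixes f :: "real \<Rightarrow> real"
  assumes [measurable]: "f \<in> borel_measurable borel" and f0: "\<And>x. 0 \<le> f x" and fR: "\<And>x. f x \<le> R"
    and su: "s \<le> u"
  shows "(\<integral>\<^sup>+ t\<in>{s..u}. ennreal (f t * exp (- (LBINT v:{s..t}. f v))) \<partial>lborel)
    = ennreal (1 - exp (- (LBINT v:{s..u}. f v)))"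
proof -
  define Y where "Y t = (LBINT v:{s..t}. f v)" for t
  have R: "\<bar>f x\<bar> \<le> R" for x using f0[of x] fR[of x] by simp
  have R0: "0 \<le> R" using f0[of 0] fR[of 0] by simp
  have Y_meas [measurable]: "Y \<in> borel_measurable borel"
    unfolding Y_def by (rule measurable_LBINT_Icc) measurable
  have Y_nonneg: "0 \<le> Y t" for t unfolding Y_def set_lebesgue_integral_def
    by (intro integral_nonneg_AE) (auto simp: f0)
  define g where "g t = f t * exp (- Y t)" for t
  have g_meas [measurable]: "g \<in> borel_measurable borel" unfolding g_def by measurable
  have g_bd: "\<bar>g x\<bar> \<le> R" for x
  proof -
    have "f x * exp (- Y x) \<le> R * 1"
      using f0[of x] fR[of x] Y_nonneg[of x] by (intro mult_mono) auto
    then show ?thesis using f0[of x] by (simp add: g_def)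
  qed
  have Y_diff: "Y b - Y a = (LBINT v:{a..b}. f v)" if "s \<le> a" "a \<le> b" for a b
    using LBINT_split[OF _ R that] by (simp add: Y_def)
  have Y_diff0: "0 \<le> Y b - Y a" if "s \<le> a" "a \<le> b" for a b
    unfolding Y_diff[OF that] set_lebesgue_integral_def by (intro integral_nonneg_AE) (auto simp: f0)
  have Y_diffR: "Y b - Y a \<le> R * (b - a)" if "s \<le> a" "a \<le> b" for a b
  proof -
    have "(LBINT v:{a..b}. f v) \<le> (LBINT v:{a..b}. R)"
      by (intro set_integral_mono set_integrable_bounded[OF _ R] set_integrable_bounded[of "\<lambda>_. R" "\<bar>R\<bar>"] fR) auto
    also have "\<dots> = R * (b - a)" using that
      by (simp add: set_integral_const emeasure_lborel_Icc_eq mult.commute measure_lborel_Icc)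
    finally show ?thesis using Y_diff[OF that] by simp
  qed
  define k where "k x = (LBINT t:{s..x}. g t) + exp (- Y x)" for x
  \<comment> \<open>Both the integral of \<open>g\<close> over [a,b] and exp(-Y a) - exp(-Y b) lie
    between exp(-Y b) d and exp(-Y a) d with d = Y b - Y a. These two bounds differ by at most d^2,
    and d is at most R (b - a).\<close>
  have k_diff: "\<bar>k b - k a\<bar> \<le> R\<^sup>2 * (b - a)\<^sup>2" if ab: "s \<le> a" "a \<le> b" for a b
  proof -
    let ?d = "Y b - Y a"
    have gI: "set_integrable lborel {a..b} g" by (rule set_integrable_bounded[OF _ g_bd]) simp
    have fI: "set_integrable lborel {a..b} (\<lambda>v. c * f v)" for c
      by (intro set_integrable_mult_right impI set_integrable_bounded[OF _ R]) simp
    have 1: "(LBINT t:{a..b}. g t) \<le> (LBINT t:{a..b}. exp (- Y a) * f t)"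
      using Y_diff0[of a] ab f0 by (intro set_integral_mono gI fI) (auto simp: g_def mult.commute intro!: mult_left_mono)
    have 2: "(LBINT t:{a..b}. exp (- Y b) * f t) \<le> (LBINT t:{a..b}. g t)"
      using Y_diff0[of _ b] ab f0 by (intro set_integral_mono gI fI) (auto simp: g_def mult.commute intro!: mult_left_mono)
    have 3: "k b - k a = (LBINT t:{a..b}. g t) - (exp (- Y a) - exp (- Y b))"
      using LBINT_split[OF g_meas g_bd ab] by (simp add: k_def)
    have 4: "(LBINT t:{a..b}. g t) \<le> exp (- Y a) * ?d" "exp (- Y b) * ?d \<le> (LBINT t:{a..b}. g t)"
      using 1 2 Y_diff[OF ab] by simp_all
    have e: "exp (- Y b) = exp (- Y a) * exp (- ?d)" by (simp add: exp_add[symmetric])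
    have e': "exp (- Y a) = exp (- Y b) * exp ?d" by (simp add: exp_add[symmetric])
    have 5: "exp (- Y a) - exp (- Y b) \<le> exp (- Y a) * ?d"
    proof -
      have "1 - exp (- ?d) \<le> ?d" using exp_ge_add_one_self[of "- ?d"] by linarith
      then have "exp (- Y a) * (1 - exp (- ?d)) \<le> exp (- Y a) * ?d" by (intro mult_left_mono) auto
      then show ?thesis unfolding e by (simp add: algebra_simps)
    qed
    have 6: "exp (- Y b) * ?d \<le> exp (- Y a) - exp (- Y b)"
    proof -
      have "?d \<le> exp ?d - 1" using exp_ge_add_one_self[of ?d] by linarith
      then have "exp (- Y b) * ?d \<le> exp (- Y b) * (exp ?d - 1)" by (intro mult_left_mono) auto
      then show ?thesis unfolding e' by (simp add: algebra_simps)
    qed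
    have "\<bar>k b - k a\<bar> \<le> exp (- Y a) * ?d - exp (- Y b) * ?d"
      using 3 4 5 6 by linarith
    also have "\<dots> = (exp (- Y a) - exp (- Y b)) * ?d" by (simp add: algebra_simps)
    also have "\<dots> \<le> ?d * ?d"
    proof (rule mult_right_mono)
      have "exp (- Y a) * ?d \<le> 1 * ?d" using Y_nonneg[of a] Y_diff0[OF ab] by (intro mult_right_mono) auto
      then show "exp (- Y a) - exp (- Y b) \<le> ?d" using 5 by simp
    qed (use Y_diff0[OF ab] in simp)
    also have "\<dots> \<le> (R * (b - a)) * (R * (b - a))"
      using Y_diff0[OF ab] Y_diffR[OF ab] by (intro mult_mono) auto
    finally show ?thesis by (simp add: power2_eq_square mult_ac)
  qed
  have deriv: "(k has_field_derivative 0) (at x within {s..u})" if "x \<in> {s..u}" for x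
    unfolding has_field_derivative_iff
  proof (rule Lim_null_comparison)
    show "eventually (\<lambda>y. norm ((k y - k x) / (y - x)) \<le> R\<^sup>2 * \<bar>y - x\<bar>) (at x within {s..u})"
      unfolding eventually_at_filter
    proof (intro always_eventually allI impI)
      fix y assume y: "y \<noteq> x" "y \<in> {s..u}"
      have "\<bar>k y - k x\<bar> \<le> R\<^sup>2 * (y - x)\<^sup>2"
        using k_diff[of x y] k_diff[of y x] y that by (cases "x \<le> y") (auto simp: abs_minus_commute power2_commute)
      then show "norm ((k y - k x) / (y - x)) \<le> R\<^sup>2 * \<bar>y - x\<bar>"
        using y by (simp add: divide_le_eq abs_mult_self_eq power2_eq_square mult.assoc flip: abs_mult)
    qed
    show "((\<lambda>y. R\<^sup>2 * \<bar>y - x\<bar>) \<longlongrightarrow> 0) (at x within {s..u})"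
      by (rule tendsto_eq_intros refl tendsto_ident_at | simp)+
  qed
  have "\<exists>c. \<forall>x\<in>{s..u}. k x = c"
    by (rule has_field_derivative_zero_constant) (auto intro: deriv)
  then have "k u = k s" using su by force
  moreover have "Y s = 0" "(LBINT t:{s..s}. g t) = 0"
    using LBINT_split[OF assms(1) R, where a=s and b=s and c=s] LBINT_split[OF g_meas g_bd, where a=s and b=s and c=s] by (simp_all add: Y_def)
  ultimately have I: "(LBINT t:{s..u}. g t) = 1 - exp (- Y u)" by (simp add: k_def)
  have "(\<integral>\<^sup>+ t\<in>{s..u}. ennreal (g t) \<partial>lborel) = ennreal (LBINT t:{s..u}. g t)"
    unfolding set_lebesgue_integral_def
    using set_integrable_bounded[OF g_meas g_bd, of s u]
    by (subst nn_integral_eq_integral[symmetric])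
      (auto simp: set_integrable_def g_def f0 intro!: nn_integral_cong split: split_indicator)
  then show ?thesis unfolding I by (simp add: g_def Y_def)
qed

section \<open>The density of the jump times\<close>

locale hawkes_kernel =
  fixes T \<mu> :: real and \<Phi> :: "real \<Rightarrow> real"
  assumes T_pos: "0 < T" and \<mu>_nonneg: "0 \<le> \<mu>"
    and \<Phi>_nonneg: "\<And>t. t \<in> {0..T} \<Longrightarrow> 0 \<le> \<Phi> t"
    and \<Phi>_antimono: "antimono_on {0..T} \<Phi>"
begin

lemma \<Phi>_le: "0 \<le> u \<Longrightarrow> u \<le> v \<Longrightarrow> v \<le> T \<Longrightarrow> \<Phi> v \<le> \<Phi> u"
  using \<Phi>_antimono by (auto simp: monotone_on_def)

text \<open>The left-continuous version of \<open>\<Phi>\<close>: it is the limit of \<open>\<Phi>\<close> along the distances of the left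
  end point of a cell to the right end point of an earlier one.\<close>

definition ker :: "real \<Rightarrow> real" where
  "ker u = (if 0 < u \<and> u \<le> T then Inf (\<Phi> ` {0..<u}) else 0)"

lemma \<Phi>_bdd_below: "u \<le> T \<Longrightarrow> bdd_below (\<Phi> ` {0..<u})"
  by (intro bdd_belowI[of _ 0]) (auto intro: \<Phi>_nonneg)

lemma ker_nonneg [simp]: "0 \<le> ker u"
  unfolding ker_def by (auto intro!: cINF_greatest \<Phi>_nonneg)

lemma ker_le: "0 < u \<Longrightarrow> u \<le> T \<Longrightarrow> 0 \<le> v \<Longrightarrow> v < u \<Longrightarrow> ker u \<le> \<Phi> v"
  unfolding ker_def by (auto intro!: cINF_lower \<Phi>_bdd_below)

lemma ker_0: "u \<le> 0 \<Longrightarrow> ker u = 0"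
  by (simp add: ker_def)

lemma ker_le_\<Phi>0: "ker u \<le> \<Phi> 0"
  using ker_le[of u 0] \<Phi>_nonneg[of 0] T_pos by (cases "0 < u \<and> u \<le> T") (auto simp: ker_def)

lemma ker_antimono: "0 < u \<Longrightarrow> u \<le> v \<Longrightarrow> v \<le> T \<Longrightarrow> ker v \<le> ker u"
  unfolding ker_def by (auto intro!: cInf_superset_mono \<Phi>_bdd_below)

lemma ker_measurable [measurable]: "ker \<in> borel_measurable borel"
proof -
  have "(\<lambda>u. - ker u) \<in> borel_measurable borel"
  proof (rule borel_measurable_piecewise_mono[of "{{..0}, {0<..T}, {T<..}}"])
    fix c assume "c \<in> {{..0}, {0<..T}, {T<..}}"
    then show "mono_on c (\<lambda>u. - ker u)"
      by (auto simp: monotone_on_def ker_antimono) (auto simp: ker_def)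
  qed (use T_pos in auto)
  then have "(\<lambda>u. - (- ker u)) \<in> borel_measurable borel" by measurable
  then show ?thesis by simp
qed

lemma ker_tendsto: assumes "0 < u" "u \<le> T" shows "(\<Phi> \<longlongrightarrow> ker u) (at_left u)"
proof (rule tendstoI)
  fix e :: real assume "e > 0"
  have "Inf (\<Phi> ` {0..<u}) < ker u + e" using \<open>e > 0\<close> assms by (simp add: ker_def)
  then obtain v where v: "0 \<le> v" "v < u" "\<Phi> v < ker u + e"
    using assms by (subst (asm) cInf_less_iff) (auto intro!: \<Phi>_bdd_below)
  have "eventually (\<lambda>x. v < x \<and> x < u) (at_left u)"
    using v eventually_at_left_real[of v u] by (simp add: greaterThanLessThan_def Int_def conj_commute)
  then show "eventually (\<lambda>x. dist (\<Phi> x) (ker u) < e) (at_left u)"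
  proof eventually_elim
    case (elim x)
    have "\<Phi> x \<le> \<Phi> v" using elim v assms by (intro \<Phi>_le) auto
    moreover have "ker u \<le> \<Phi> x" using elim v assms by (intro ker_le) auto
    ultimately show ?case using v by (simp add: dist_real_def)
  qed
qed

text \<open>At an interior continuity point both values are the left limit of \<open>\<Phi>\<close>,
  and a monotone function has countably many discontinuities. The end point T is added by
  hand.\<close>

lemma countable_ker_neq: "countable {u \<in> {0<..T}. ker u \<noteq> \<Phi> u}"
proof -
  have "mono_on {0<..<T} (\<lambda>u. - \<Phi> u)" by (auto simp: monotone_on_def intro!: \<Phi>_le)
  then have "countable {u \<in> {0<..<T}. \<not> isCont (\<lambda>u. - \<Phi> u) u}"
    by (intro mono_on_ctble_discont_open) auto
  moreover have "{u \<in> {0<..T}. ker u \<noteq> \<Phi> u} \<subseteq> insert T {u \<in> {0<..<T}. \<not> isCont (\<lambda>u. - \<Phi> u) u}"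
  proof safe
    fix u assume u: "u \<in> {0<..T}" "ker u \<noteq> \<Phi> u" "u \<noteq> T"
    then show "u \<in> {0<..<T}" by auto
    assume "isCont (\<lambda>u. - \<Phi> u) u"
    then have "isCont (\<lambda>u. - (- \<Phi> u)) u" by (rule continuous_minus)
    then have "isCont \<Phi> u" by (simp only: minus_minus)
    then have "(\<Phi> \<longlongrightarrow> \<Phi> u) (at_left u)"
      unfolding isCont_def by (rule tendsto_mono[rotated]) (simp add: at_le)
    with ker_tendsto[of u] u have "ker u = \<Phi> u"
      by (intro tendsto_unique[of "at_left u" \<Phi>]) auto
    then show False using u by simp
  qed
  ultimately show ?thesis by (meson countable_insert countable_subset)
qed

text \<open>The exceptional \<open>x\<close> form the reflection of a countable set.\<close>

lemma AE_ker_diff: "AE x in lborel. 0 < v - x \<and> v - x \<le> T \<longrightarrow> ker (v - x) = \<Phi> (v - x)"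
proof -
  have "countable ((\<lambda>u. v - u) ` {u \<in> {0<..T}. ker u \<noteq> \<Phi> u})"
    using countable_ker_neq by (rule countable_image)
  then have "AE x in lborel. x \<notin> (\<lambda>u. v - u) ` {u \<in> {0<..T}. ker u \<noteq> \<Phi> u}"
    by (intro AE_not_in countable_imp_null_set_lborel)
  then show ?thesis by eventually_elim (force simp: image_iff)
qed

text \<open>The history may be given in any order and need not be cut at \<open>t\<close>: entries
  at or after \<open>t\<close> contribute 0.\<close>

definition lam :: "real list \<Rightarrow> real \<Rightarrow> real" where
  "lam l t = \<mu> + (\<Sum>x\<leftarrow>l. ker (t - x))"

definition Lam :: "real list \<Rightarrow> real \<Rightarrow> real \<Rightarrow> real" where
  "Lam l s t = (LBINT u:{s..t}. lam l u)"

lemma measurable_lam [measurable (raw)]: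
  assumes [measurable]: "l \<in> measurable M list_borel" "t \<in> borel_measurable M"
  shows "(\<lambda>x. lam (l x) (t x)) \<in> borel_measurable M"
  unfolding lam_def by measurable

lemma measurable_Lam [measurable (raw)]:
  assumes [measurable]: "l \<in> measurable M list_borel" "s \<in> borel_measurable M" "t \<in> borel_measurable M"
  shows "(\<lambda>x. Lam (l x) (s x) (t x)) \<in> borel_measurable M"
  unfolding Lam_def by measurable

lemma lam_mset: "mset l = mset l' \<Longrightarrow> lam l = lam l'"
  unfolding lam_def by (metis (no_types) mset_map sum_mset_sum_list)

lemma lam_Nil [simp]: "lam [] t = \<mu>"
  by (simp add: lam_def)

lemma lam_Cons: "lam (x # l) t = lam l t + ker (t - x)"
  by (simp add: lam_def)

lemma \<mu>_le_lam: "\<mu> \<le> lam l t"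
  by (auto simp: lam_def intro!: sum_list_nonneg)

lemma lam_nonneg [simp]: "0 \<le> lam l t"
  using \<mu>_le_lam \<mu>_nonneg by (rule order_trans[rotated])

lemma lam_le: "lam l t \<le> \<mu> + real (length l) * \<Phi> 0"
proof (induction l)
  case (Cons x l)
  then show ?case using ker_le_\<Phi>0[of "t - x"] by (simp add: lam_Cons algebra_simps)
qed simp

lemma lam_abs_le: "\<bar>lam l t\<bar> \<le> \<mu> + real (length l) * \<Phi> 0"
  using lam_le[of l t] by simp

lemma lam_irrelevant: "(\<And>x. x \<in> set l' \<Longrightarrow> t \<le> x) \<Longrightarrow> lam (l' @ l) t = lam l t"
  by (induction l') (auto simp: lam_Cons ker_0)

lemma Lam_split: "s \<le> u \<Longrightarrow> u \<le> t \<Longrightarrow> Lam l s t = Lam l s u + Lam l u t"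
  unfolding Lam_def by (intro LBINT_split[OF _ lam_abs_le]) auto

lemma Lam_nonneg [simp]: "0 \<le> Lam l s t"
  unfolding Lam_def set_lebesgue_integral_def by (intro integral_nonneg_AE) auto

lemma Lam_cong: "(\<And>u. s \<le> u \<Longrightarrow> u \<le> t \<Longrightarrow> lam l u = lam l' u) \<Longrightarrow> Lam l s t = Lam l' s t"
  unfolding Lam_def by (intro set_lebesgue_integral_cong) auto

lemma nn_integral_lam_exp:
  "s \<le> u \<Longrightarrow> (\<integral>\<^sup>+ t\<in>{s..u}. ennreal (lam l t * exp (- Lam l s t)) \<partial>lborel) = ennreal (1 - exp (- Lam l s u))"
  unfolding Lam_def by (rule nn_integral_exp_neg_LBINT) (auto intro: lam_le)

text \<open>The density of the jumps \<open>w\<close> after time \<open>s\<close> given the history \<open>l\<close>. The intensity at a jump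
  may be evaluated with all of \<open>w\<close>, since \<open>ker\<close> vanishes on nonpositive arguments.\<close>

definition dens :: "real list \<Rightarrow> real \<Rightarrow> real list \<Rightarrow> real" where
  "dens l s w = (if sorted_wrt (<) (s # w) \<and> (\<forall>x\<in>set w. x \<le> T)
     then (\<Prod>t\<leftarrow>w. lam (w @ l) t) * exp (- Lam (w @ l) s T) else 0)"

lemma dens_nonneg [simp]: "0 \<le> dens l s w"
  by (auto simp: dens_def intro!: mult_nonneg_nonneg prod_list_nonneg)

lemma measurable_dens [measurable (raw)]:
  assumes [measurable]: "l \<in> measurable M list_borel" "s \<in> borel_measurable M" "w \<in> measurable M list_borel"
  shows "(\<lambda>x. dens (l x) (s x) (w x)) \<in> borel_measurable M"
  unfolding dens_def by measurable

lemma dens_Nil: "dens l s [] = exp (- Lam l s T)"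
  by (simp add: dens_def)

text \<open>Conditioning on the first jump \<open>t\<close>: the later jumps do not influence the
  intensity up to \<open>t\<close>, the integrated intensity splits at \<open>t\<close>, and after
  \<open>t\<close> this jump belongs to the history.\<close>

lemma dens_Cons: "dens l s (t # w) =
  (if s < t \<and> t \<le> T then lam l t * exp (- Lam l s t) * dens (t # l) t w else 0)"
proof (cases "sorted_wrt (<) (s # t # w) \<and> (\<forall>x\<in>set (t # w). x \<le> T)")
  case True
  then have gt: "\<And>x. x \<in> set w \<Longrightarrow> t < x" by auto
  have eq: "lam (t # w @ l) = lam (w @ t # l)" by (rule lam_mset) simp
  have eqL: "Lam (t # w @ l) = Lam (w @ t # l)" unfolding Lam_def eq ..
  have "lam (w @ t # l) t = lam l t"
    using gt by (subst lam_irrelevant) (auto simp: lam_Cons ker_0 less_imp_le)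
  moreover have "Lam (w @ t # l) s T = Lam (w @ t # l) s t + Lam (w @ t # l) t T"
    using True by (intro Lam_split) auto
  moreover have "Lam (w @ t # l) s t = Lam l s t"
  proof (rule Lam_cong)
    fix u assume "u \<le> t"
    then show "lam (w @ t # l) u = lam l u"
      using gt by (subst lam_irrelevant) (force simp: lam_Cons ker_0)+
  qed
  ultimately show ?thesis
    using True by (simp add: dens_def eq eqL exp_add exp_diff exp_minus field_simps)
next
  case False
  then show ?thesis by (auto simp: dens_def intro: less_trans)
qed

end

text \<open>The square [s,T]^2 is cut along its null diagonal into two triangles of equal mass. This
  is the integrated form of the derivative of a squared tail integral, without any differentiability
  of that tail.\<close>

lemma nn_integral_Icc_square:
  fixes a :: "real \<Rightarrow> ennreal"
  assumes [measurable]: "a \<in> borel_measurable borel"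
  shows "(\<integral>\<^sup>+ u\<in>{s..T}. a u \<partial>lborel)\<^sup>2 = (\<integral>\<^sup>+ u\<in>{s..T}. a u * (2 * (\<integral>\<^sup>+ v\<in>{u..T}. a v \<partial>lborel)) \<partial>lborel)"
proof -
  let ?b = "\<lambda>u. if s \<le> u \<and> u \<le> T then a u else 0"
  let ?le = "\<lambda>u v. if u \<le> (v::real) then 1 else 0 :: ennreal"
  have b: "(\<integral>\<^sup>+ u\<in>{s..T}. a u \<partial>lborel) = (\<integral>\<^sup>+ u. ?b u \<partial>lborel)"
    by (intro nn_integral_cong) auto
  have 1: "(\<integral>\<^sup>+ u. \<integral>\<^sup>+ v. ?le v u * (?b u * ?b v) \<partial>lborel \<partial>lborel) = (\<integral>\<^sup>+ u. \<integral>\<^sup>+ v. ?le u v * (?b u * ?b v) \<partial>lborel \<partial>lborel)"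
    by (subst lborel_pair.Fubini') (auto simp: mult.commute)
  have 2: "(\<integral>\<^sup>+ v. ?le u v * (?b u * ?b v) \<partial>lborel) = (a u * (\<integral>\<^sup>+ v\<in>{u..T}. a v \<partial>lborel)) * indicator {s..T} u" for u
    by (subst nn_integral_cmult[symmetric], measurable, subst nn_integral_multc[symmetric], measurable, rule nn_integral_cong)
      (auto simp: indicator_def)
  have "(\<integral>\<^sup>+ u. ?b u \<partial>lborel)\<^sup>2 = (\<integral>\<^sup>+ u. ?b u * (\<integral>\<^sup>+ v. ?b v \<partial>lborel) \<partial>lborel)"
    by (simp add: power2_eq_square nn_integral_multc)
  also have "\<dots> = (\<integral>\<^sup>+ u. (\<integral>\<^sup>+ v. ?b u * ?b v \<partial>lborel) \<partial>lborel)"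
    by (simp add: nn_integral_cmult)
  also have "\<dots> = (\<integral>\<^sup>+ u. (\<integral>\<^sup>+ v. (?le u v + ?le v u) * (?b u * ?b v) \<partial>lborel) \<partial>lborel)"
  proof (rule nn_integral_cong, rule nn_integral_cong_AE)
    fix u :: real
    show "AE v in lborel. ?b u * ?b v = (?le u v + ?le v u) * (?b u * ?b v)"
      using AE_lborel_singleton[of u] by eventually_elim auto
  qed
  also have "\<dots> = (\<integral>\<^sup>+ u. (\<integral>\<^sup>+ v. ?le u v * (?b u * ?b v) \<partial>lborel) + (\<integral>\<^sup>+ v. ?le v u * (?b u * ?b v) \<partial>lborel) \<partial>lborel)"
    unfolding distrib_right by (intro nn_integral_cong nn_integral_add) measurable
  also have "\<dots> = (\<integral>\<^sup>+ u. (\<integral>\<^sup>+ v. ?le u v * (?b u * ?b v) \<partial>lborel) \<partial>lborel) + (\<integral>\<^sup>+ u. (\<integral>\<^sup>+ v. ?le v u * (?b u * ?b v) \<partial>lborel) \<partial>lborel)"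
    by (rule nn_integral_add) measurable
  also have "\<dots> = 2 * (\<integral>\<^sup>+ u. (\<integral>\<^sup>+ v. ?le u v * (?b u * ?b v) \<partial>lborel) \<partial>lborel)"
    unfolding 1 by (simp add: mult_2)
  also have "\<dots> = (\<integral>\<^sup>+ u. 2 * (\<integral>\<^sup>+ v. ?le u v * (?b u * ?b v) \<partial>lborel) \<partial>lborel)"
    by (rule nn_integral_cmult[symmetric]) measurable
  also have "\<dots> = (\<integral>\<^sup>+ u\<in>{s..T}. a u * (2 * (\<integral>\<^sup>+ v\<in>{u..T}. a v \<partial>lborel)) \<partial>lborel)"
    unfolding 2 by (simp add: mult_ac)
  finally show ?thesis unfolding b .
qed

context hawkes_kernel begin

section \<open>Moments of the number of jumps\<close>

text \<open>Plays the part of the probability of exactly \<open>m\<close> further jumps in (s,T]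
  given the history \<open>l\<close>.\<close>

definition cprob :: "nat \<Rightarrow> real list \<Rightarrow> real \<Rightarrow> ennreal" where
  "cprob m l s = (\<integral>\<^sup>+ w. ennreal (dens l s w) \<partial>points T m)"

lemma measurable_cprob [measurable (raw)]:
  assumes [measurable]: "l \<in> measurable M list_borel" "s \<in> borel_measurable M"
  shows "(\<lambda>x. cprob m (l x) (s x)) \<in> borel_measurable M"
  unfolding cprob_def by measurable

lemma cprob_0: "cprob 0 l s = ennreal (exp (- Lam l s T))"
  unfolding cprob_def by (subst nn_integral_points_0) (simp_all add: dens_Nil)

lemma cprob_Suc:
  assumes "0 \<le> s"
  shows "cprob (Suc m) l s = (\<integral>\<^sup>+ t\<in>{s..T}. ennreal (lam l t * exp (- Lam l s t)) * cprob m (t # l) t \<partial>lborel)"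
proof -
  have "cprob (Suc m) l s = (\<integral>\<^sup>+ t\<in>{0..T}. (\<integral>\<^sup>+ w. ennreal (dens l s (t # w)) \<partial>points T m) \<partial>lborel)"
    unfolding cprob_def by (rule nn_integral_points_Suc) measurable
  also have "\<dots> = (\<integral>\<^sup>+ t\<in>{s..T}. ennreal (lam l t * exp (- Lam l s t)) * cprob m (t # l) t \<partial>lborel)"
  proof (rule nn_integral_cong_AE)
    show "AE t in lborel. (\<integral>\<^sup>+ w. ennreal (dens l s (t # w)) \<partial>points T m) * indicator {0..T} t
      = ennreal (lam l t * exp (- Lam l s t)) * cprob m (t # l) t * indicator {s..T} t"
      using AE_lborel_singleton[of s]
    proof eventually_elim
      case (elim t)
      have "(\<integral>\<^sup>+ w. ennreal (lam l t * exp (- Lam l s t)) * ennreal (dens (t # l) t w) \<partial>points T m)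
          = ennreal (lam l t * exp (- Lam l s t)) * cprob m (t # l) t"
        unfolding cprob_def by (rule nn_integral_cmult) measurable
      then show ?case using elim assms
        by (auto simp: dens_Cons ennreal_mult indicator_def)
    qed
  qed
  finally show ?thesis .
qed

text \<open>A supersolution of the recursion over the first jump dominates the expectation of
  \<open>wt\<close> at the final number of jumps, where \<open>k\<close> counts those already made.
  The induction on the truncation \<open>r\<close> works with finite sums only.\<close>

lemma sum_cprob_le:
  fixes wt :: "nat \<Rightarrow> ennreal"
  assumes super: "\<And>l s k. 0 \<le> s \<Longrightarrow> s \<le> T \<Longrightarrow>
      wt k * ennreal (exp (- Lam l s T))
      + (\<integral>\<^sup>+ t\<in>{s..T}. ennreal (lam l t * exp (- Lam l s t)) * G (t # l) t (Suc k) \<partial>lborel) \<le> G l s k"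
    and s: "0 \<le> s" "s \<le> T"
  shows "(\<Sum>m\<le>r. wt (k + m) * cprob m l s) \<le> G l s k"
  using s
proof (induction r arbitrary: k l s)
  case 0
  have "wt k * ennreal (exp (- Lam l s T)) \<le> G l s k"
    using super[OF 0, of k l] by (rule order_trans[rotated]) simp
  then show ?case by (simp add: cprob_0)
next
  case (Suc r)
  have "(\<Sum>m\<le>Suc r. wt (k + m) * cprob m l s)
      = wt k * cprob 0 l s + (\<Sum>m\<le>r. wt (Suc k + m) * cprob (Suc m) l s)"
    by (simp add: sum.atMost_Suc_shift del: sum.atMost_Suc)
  moreover have "(\<Sum>m\<le>r. wt (Suc k + m) * cprob (Suc m) l s)
      \<le> (\<integral>\<^sup>+ t\<in>{s..T}. ennreal (lam l t * exp (- Lam l s t)) * G (t # l) t (Suc k) \<partial>lborel)"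
  proof -
    have "(\<Sum>m\<le>r. wt (Suc k + m) * cprob (Suc m) l s)
      = (\<Sum>m\<le>r. \<integral>\<^sup>+ t\<in>{s..T}. ennreal (lam l t * exp (- Lam l s t)) * (wt (Suc k + m) * cprob m (t # l) t) \<partial>lborel)"
    unfolding cprob_Suc[OF Suc.prems(1)]
    by (subst nn_integral_cmult[symmetric]) (auto simp: mult_ac)
  also have "\<dots> = (\<integral>\<^sup>+ t. (\<Sum>m\<le>r. ennreal (lam l t * exp (- Lam l s t)) * (wt (Suc k + m) * cprob m (t # l) t) * indicator {s..T} t) \<partial>lborel)"
    by (rule nn_integral_sum[symmetric]) measurable
  also have "\<dots> = (\<integral>\<^sup>+ t\<in>{s..T}. ennreal (lam l t * exp (- Lam l s t)) * (\<Sum>m\<le>r. wt (Suc k + m) * cprob m (t # l) t) \<partial>lborel)"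
    by (simp add: sum_distrib_left sum_distrib_right)
  also have "\<dots> \<le> (\<integral>\<^sup>+ t\<in>{s..T}. ennreal (lam l t * exp (- Lam l s t)) * G (t # l) t (Suc k) \<partial>lborel)"
  proof (rule nn_integral_mono)
    fix t
    have "(\<Sum>m\<le>r. wt (Suc k + m) * cprob m (t # l) t) \<le> G (t # l) t (Suc k)" if "s \<le> t" "t \<le> T"
      by (rule Suc.IH) (use that Suc.prems in auto)
    then show "ennreal (lam l t * exp (- Lam l s t)) * (\<Sum>m\<le>r. wt (Suc k + m) * cprob m (t # l) t) * indicator {s..T} t
      \<le> ennreal (lam l t * exp (- Lam l s t)) * G (t # l) t (Suc k) * indicator {s..T} t"
      by (cases "t \<in> {s..T}") (simp_all add: mult_left_mono del: add_Suc)
  qed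
    finally show ?thesis .
  qed
  ultimately have "(\<Sum>m\<le>Suc r. wt (k + m) * cprob m l s) \<le> wt k * cprob 0 l s
      + (\<integral>\<^sup>+ t\<in>{s..T}. ennreal (lam l t * exp (- Lam l s t)) * G (t # l) t (Suc k) \<partial>lborel)"
    by (simp only: add_left_mono)
  also have "\<dots> \<le> G l s k" unfolding cprob_0 by (rule super[OF Suc.prems])
  finally show ?case .
qed

text \<open>The martingale property up to the first jump: \<open>g\<close> decreases at rate
  \<open>lam l\<close> times \<gamma> as long as nothing happens and is raised by \<gamma> at the
  jump, so its mean at the first jump or at T is its starting value.\<close>

lemma lam_exp_identity:
  fixes k0 :: ennreal and \<gamma> :: "real \<Rightarrow> ennreal" and l :: "real list"
  assumes [measurable]: "\<gamma> \<in> borel_measurable borel" and s: "s \<le> T"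
  defines "g \<equiv> \<lambda>t. k0 + (\<integral>\<^sup>+ u\<in>{t..T}. ennreal (lam l u) * \<gamma> u \<partial>lborel)"
  shows "k0 * ennreal (exp (- Lam l s T))
    + (\<integral>\<^sup>+ t\<in>{s..T}. ennreal (lam l t * exp (- Lam l s t)) * (g t + \<gamma> t) \<partial>lborel) = g s"
proof -
  let ?e = "\<lambda>t. ennreal (lam l t * exp (- Lam l s t))"
  let ?i = "\<lambda>a u b. if a \<le> u \<and> u \<le> (b::real) then 1 else 0 :: ennreal"
  have i: "indicator {a..b} u = ?i a u b" for a b u by (simp add: indicator_def)
  have 1: "(\<integral>\<^sup>+ t\<in>{s..u}. ?e t \<partial>lborel) = ennreal (1 - exp (- Lam l s u))" if "s \<le> u" for u
    by (rule nn_integral_lam_exp[OF that])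
  have "(\<integral>\<^sup>+ t\<in>{s..T}. ?e t * (g t + \<gamma> t) \<partial>lborel)
      = (\<integral>\<^sup>+ t. k0 * (?e t * ?i s t T)
          + ((\<integral>\<^sup>+ u. (?e t * ?i s t T) * (ennreal (lam l u) * \<gamma> u * ?i t u T) \<partial>lborel)
            + ?e t * \<gamma> t * ?i s t T) \<partial>lborel)"
  proof (rule nn_integral_cong)
    fix t
    have "(\<integral>\<^sup>+ u. (?e t * ?i s t T) * (ennreal (lam l u) * \<gamma> u * ?i t u T) \<partial>lborel)
        = (?e t * ?i s t T) * (\<integral>\<^sup>+ u. ennreal (lam l u) * \<gamma> u * ?i t u T \<partial>lborel)"
      by (rule nn_integral_cmult) measurable
    moreover have "e * (k0 + X + y) * j = k0 * (e * j) + (e * j * X + e * y * j)" for e k0 X y j :: ennreal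
      by (simp add: distrib_left distrib_right mult.commute mult.left_commute add.assoc)
    ultimately show "?e t * (g t + \<gamma> t) * indicator {s..T} t = k0 * (?e t * ?i s t T)
          + ((\<integral>\<^sup>+ u. (?e t * ?i s t T) * (ennreal (lam l u) * \<gamma> u * ?i t u T) \<partial>lborel)
            + ?e t * \<gamma> t * ?i s t T)"
      unfolding g_def i by (simp only:)
  qed
  also have "\<dots> = (\<integral>\<^sup>+ t. k0 * (?e t * ?i s t T) \<partial>lborel)
       + ((\<integral>\<^sup>+ t. \<integral>\<^sup>+ u. (?e t * ?i s t T) * (ennreal (lam l u) * \<gamma> u * ?i t u T) \<partial>lborel \<partial>lborel)
       + (\<integral>\<^sup>+ t. ?e t * \<gamma> t * ?i s t T \<partial>lborel))"
    by (rule trans[OF nn_integral_add], measurable, rule arg_cong2[where f="(+)", OF refl nn_integral_add], measurable)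
  also have "(\<integral>\<^sup>+ t. k0 * (?e t * ?i s t T) \<partial>lborel) = k0 * ennreal (1 - exp (- Lam l s T))"
    unfolding 1[OF s, symmetric] i by (rule nn_integral_cmult) measurable
  also have "(\<integral>\<^sup>+ t. \<integral>\<^sup>+ u. (?e t * ?i s t T) * (ennreal (lam l u) * \<gamma> u * ?i t u T) \<partial>lborel \<partial>lborel)
     = (\<integral>\<^sup>+ u. \<integral>\<^sup>+ t. (?e t * ?i s t T) * (ennreal (lam l u) * \<gamma> u * ?i t u T) \<partial>lborel \<partial>lborel)"
    by (rule lborel_pair.Fubini') measurable
  also have "\<dots> = (\<integral>\<^sup>+ u. ennreal (lam l u) * \<gamma> u * ?i s u T * ennreal (1 - exp (- Lam l s u)) \<partial>lborel)"
  proof (rule nn_integral_cong)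
    fix u
    have "(\<integral>\<^sup>+ t. (?e t * ?i s t T) * (ennreal (lam l u) * \<gamma> u * ?i t u T) \<partial>lborel)
        = (\<integral>\<^sup>+ t. (ennreal (lam l u) * \<gamma> u * ?i s u T) * (?e t * ?i s t u) \<partial>lborel)"
      by (intro nn_integral_cong) (auto simp: mult_ac)
    also have "\<dots> = (ennreal (lam l u) * \<gamma> u * ?i s u T) * (\<integral>\<^sup>+ t\<in>{s..u}. ?e t \<partial>lborel)"
      unfolding i by (rule nn_integral_cmult) measurable
    also have "\<dots> = ennreal (lam l u) * \<gamma> u * ?i s u T * ennreal (1 - exp (- Lam l s u))"
      using 1[of u] by (auto simp del: nn_integral_indicator_singleton)
    finally show "(\<integral>\<^sup>+ t. (?e t * ?i s t T) * (ennreal (lam l u) * \<gamma> u * ?i t u T) \<partial>lborel)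
      = ennreal (lam l u) * \<gamma> u * ?i s u T * ennreal (1 - exp (- Lam l s u))" .
  qed
  also have "\<dots> + (\<integral>\<^sup>+ t. ?e t * \<gamma> t * ?i s t T \<partial>lborel)
      = (\<integral>\<^sup>+ u. ennreal (lam l u) * \<gamma> u * ?i s u T * ennreal (1 - exp (- Lam l s u)) + ?e u * \<gamma> u * ?i s u T \<partial>lborel)"
    by (rule nn_integral_add[symmetric]) measurable
  \<comment> \<open>The mass at \<open>u\<close> comes from \<open>g\<close> if the first jump is
    before \<open>u\<close>, with weight 1 - exp(-Lam l s u), and from the gain at a first jump in
    \<open>u\<close>, with weight exp(-Lam l s u).\<close>
  also have "\<dots> = (\<integral>\<^sup>+ u. ennreal (lam l u) * \<gamma> u * ?i s u T \<partial>lborel)"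
  proof (rule nn_integral_cong)
    fix u
    have "ennreal (1 - exp (- Lam l s u)) + ennreal (exp (- Lam l s u)) = 1"
      by (subst ennreal_plus[symmetric]) auto
    then have "ennreal (lam l u) * \<gamma> u * ?i s u T * (ennreal (1 - exp (- Lam l s u)) + ennreal (exp (- Lam l s u)))
        = ennreal (lam l u) * \<gamma> u * ?i s u T" by simp
    then show "ennreal (lam l u) * \<gamma> u * ?i s u T * ennreal (1 - exp (- Lam l s u)) + ?e u * \<gamma> u * ?i s u T
        = ennreal (lam l u) * \<gamma> u * ?i s u T"
      by (simp add: ennreal_mult distrib_left mult_ac)
  qed
  finally have "k0 * ennreal (exp (- Lam l s T)) + (\<integral>\<^sup>+ t\<in>{s..T}. ?e t * (g t + \<gamma> t) \<partial>lborel)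
    = k0 * (ennreal (exp (- Lam l s T)) + ennreal (1 - exp (- Lam l s T))) + (\<integral>\<^sup>+ u. ennreal (lam l u) * \<gamma> u * ?i s u T \<partial>lborel)"
    by (simp add: distrib_left add.assoc)
  also have "ennreal (exp (- Lam l s T)) + ennreal (1 - exp (- Lam l s T)) = 1"
    by (subst ennreal_plus[symmetric]) auto
  finally show ?thesis by (simp add: g_def i)
qed

lemma sum_cprob_le_1:
  assumes "0 \<le> s" "s \<le> T"
  shows "(\<Sum>m\<le>r. cprob m l s) \<le> 1"
proof -
  have "(\<Sum>m\<le>r. 1 * cprob m l s) \<le> 1"
    using lam_exp_identity[of "\<lambda>_. 0" _ 1] assms
    by (intro sum_cprob_le[where wt="\<lambda>_. 1" and G="\<lambda>_ _ _. 1" and k=0]) auto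
  then show ?thesis by simp
qed

text \<open>\<open>p1\<close> and \<open>p2\<close> are the first two moments of the size of the cluster of an immigrant;
  $(k + A)^2 + B$ is the second moment of the final number of points given $k$ earlier ones.\<close>

lemma sum_square_cprob_le:
  fixes p1 p2 :: "real \<Rightarrow> ennreal"
  assumes [measurable]: "p1 \<in> borel_measurable borel" "p2 \<in> borel_measurable borel"
    and p1: "\<And>t. t \<in> {0..T} \<Longrightarrow> p1 t = 1 + (\<integral>\<^sup>+ u\<in>{0..t}. ennreal (ker (t - u)) * p1 u \<partial>lborel)"
    and p2: "\<And>t. t \<in> {0..T} \<Longrightarrow> p2 t = (p1 t)\<^sup>2 + (\<integral>\<^sup>+ u\<in>{0..t}. ennreal (ker (t - u)) * p2 u \<partial>lborel)"
    and s: "0 \<le> s" "s \<le> T"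
  shows "(\<Sum>m\<le>r. (of_nat m)\<^sup>2 * cprob m l s)
    \<le> (\<integral>\<^sup>+ u\<in>{s..T}. ennreal (lam l u) * p1 (T - u) \<partial>lborel)\<^sup>2
      + (\<integral>\<^sup>+ u\<in>{s..T}. ennreal (lam l u) * p2 (T - u) \<partial>lborel)"
proof -
  define A where "A l t = (\<integral>\<^sup>+ u\<in>{t..T}. ennreal (lam l u) * p1 (T - u) \<partial>lborel)" for l t
  define B where "B l t = (\<integral>\<^sup>+ u\<in>{t..T}. ennreal (lam l u) * p2 (T - u) \<partial>lborel)" for l t
  define G where "G l t k = (of_nat k + A l t)\<^sup>2 + B l t" for l t and k :: nat
  have A_measurable [measurable]: "(\<lambda>t. A l t) \<in> borel_measurable borel" for l
  proof -
    have "(\<lambda>t. A l t) = (\<lambda>t. \<integral>\<^sup>+ u. (if t \<le> u \<and> u \<le> T then ennreal (lam l u) * p1 (T - u) else 0) \<partial>lborel)"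
      unfolding A_def by (intro ext nn_integral_cong) (auto simp: indicator_def)
    also have "\<dots> \<in> borel_measurable borel" by measurable
    finally show ?thesis .
  qed
  have flip: "(\<integral>\<^sup>+ u\<in>{t..T}. ennreal (ker (u - t)) * p (T - u) \<partial>lborel)
      = (\<integral>\<^sup>+ u\<in>{0..T-t}. ennreal (ker (T - t - u)) * p u \<partial>lborel)"
    if [measurable]: "p \<in> borel_measurable borel" for p :: "real \<Rightarrow> ennreal" and t
  proof -
    have "(\<integral>\<^sup>+ u\<in>{t..T}. ennreal (ker (u - t)) * p (T - u) \<partial>lborel)
        = (\<integral>\<^sup>+ u. ennreal (ker (T + - 1 * u - t)) * p (T - (T + - 1 * u)) * indicator {t..T} (T + - 1 * u) \<partial>lborel)"
      by (subst nn_integral_real_affine[where c="-1" and t=T]) auto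
    also have "\<dots> = (\<integral>\<^sup>+ u\<in>{0..T-t}. ennreal (ker (T - t - u)) * p u \<partial>lborel)"
      by (intro nn_integral_cong) (auto simp: indicator_def algebra_simps)
    finally show ?thesis .
  qed
  have step: "(\<integral>\<^sup>+ u\<in>{t..T}. ennreal (lam (t # l) u) * p (T - u) \<partial>lborel)
      = (\<integral>\<^sup>+ u\<in>{t..T}. ennreal (lam l u) * p (T - u) \<partial>lborel)
        + (\<integral>\<^sup>+ u\<in>{0..T-t}. ennreal (ker (T - t - u)) * p u \<partial>lborel)"
    if [measurable]: "p \<in> borel_measurable borel" for p :: "real \<Rightarrow> ennreal" and t l
  proof -
    have "(\<integral>\<^sup>+ u\<in>{t..T}. ennreal (lam (t # l) u) * p (T - u) \<partial>lborel)
      = (\<integral>\<^sup>+ u. ennreal (lam l u) * p (T - u) * indicator {t..T} u + ennreal (ker (u - t)) * p (T - u) * indicator {t..T} u \<partial>lborel)"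
      by (intro nn_integral_cong) (simp add: lam_Cons distrib_right)
    also have "\<dots> = (\<integral>\<^sup>+ u\<in>{t..T}. ennreal (lam l u) * p (T - u) \<partial>lborel)
        + (\<integral>\<^sup>+ u\<in>{t..T}. ennreal (ker (u - t)) * p (T - u) \<partial>lborel)"
      by (rule nn_integral_add) measurable
    finally show ?thesis unfolding flip[OF that] .
  qed
  \<comment> \<open>A point at \<open>t\<close> raises the expected number of future points by its
    mean cluster size without the root. The root is put on the left to avoid a subtraction in
    [0,\<infinity>].\<close>
  have A_Cons: "A (t # l) t + 1 = A l t + p1 (T - t)" if "0 \<le> t" "t \<le> T" for t l
    using that p1[of "T - t"] unfolding A_def step[OF assms(1)] by (simp add: add_ac)
  have B_Cons: "B (t # l) t + (p1 (T - t))\<^sup>2 = B l t + p2 (T - t)" if "0 \<le> t" "t \<le> T" for t l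
    using that p2[of "T - t"] unfolding B_def step[OF assms(2)] by (simp add: add_ac)
  have super: "(of_nat k)\<^sup>2 * ennreal (exp (- Lam l s T))
      + (\<integral>\<^sup>+ t\<in>{s..T}. ennreal (lam l t * exp (- Lam l s t)) * G (t # l) t (Suc k) \<partial>lborel) \<le> G l s k"
    if s: "0 \<le> s" "s \<le> T" for l s and k :: nat
  proof -
    \<comment> \<open>The increase of (k + A)^2 + B at a jump: (k + A + p1)^2 - (k + A)^2 from the
      square and p2 - p1^2 from \<open>B\<close>, so that the squares of p1 cancel.\<close>
    define \<gamma> where "\<gamma> u = 2 * (of_nat k + A l u) * p1 (T - u) + p2 (T - u)" for u
    have [measurable]: "\<gamma> \<in> borel_measurable borel" unfolding \<gamma>_def by measurable
    have G_Suc: "G (t # l) t (Suc k) = G l t k + \<gamma> t" if "0 \<le> t" "t \<le> T" for t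
    proof -
      have "G (t # l) t (Suc k) = (of_nat k + (A (t # l) t + 1))\<^sup>2 + B (t # l) t"
        by (simp add: G_def add_ac)
      also have "\<dots> = (of_nat k + A l t)\<^sup>2 + 2 * (of_nat k + A l t) * p1 (T - t) + (B (t # l) t + (p1 (T - t))\<^sup>2)"
        unfolding A_Cons[OF that] add.assoc[symmetric] power2_sum by (simp add: add_ac)
      also have "\<dots> = G l t k + \<gamma> t"
        unfolding B_Cons[OF that] by (simp add: G_def \<gamma>_def add_ac)
      finally show ?thesis .
    qed
    \<comment> \<open>Along a path without jumps the derivative of (k + A)^2 + B is -lam \<gamma>;
      this is the integrated form, with the squared part supplied by
      \<open>nn_integral_Icc_square\<close>.\<close>
    have G_eq: "G l t k = (of_nat k)\<^sup>2 + (\<integral>\<^sup>+ u\<in>{t..T}. ennreal (lam l u) * \<gamma> u \<partial>lborel)" for t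
    proof -
      let ?a = "\<lambda>u. ennreal (lam l u) * p1 (T - u)"
      have sq: "(A l t)\<^sup>2 = (\<integral>\<^sup>+ u\<in>{t..T}. ?a u * (2 * A l u) \<partial>lborel)"
        unfolding A_def by (rule nn_integral_Icc_square[where a="?a"]) measurable
      have "(\<integral>\<^sup>+ u\<in>{t..T}. ennreal (lam l u) * \<gamma> u \<partial>lborel)
        = (\<integral>\<^sup>+ u. 2 * of_nat k * (?a u * indicator {t..T} u) + (?a u * (2 * A l u) * indicator {t..T} u
            + ennreal (lam l u) * p2 (T - u) * indicator {t..T} u) \<partial>lborel)"
      proof (rule nn_integral_cong)
        fix u
        have "L * (2 * (k + a) * p + q) * i = 2 * k * (L * p * i) + (L * p * (2 * a) * i + L * q * i)"
          for L k a p q i :: ennreal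
          by (simp add: distrib_left distrib_right mult_ac add_ac)
        then show "ennreal (lam l u) * \<gamma> u * indicator {t..T} u
          = 2 * of_nat k * (?a u * indicator {t..T} u) + (?a u * (2 * A l u) * indicator {t..T} u
            + ennreal (lam l u) * p2 (T - u) * indicator {t..T} u)"
          unfolding \<gamma>_def .
      qed
      also have "\<dots> = 2 * of_nat k * A l t + ((A l t)\<^sup>2 + B l t)"
      proof -
        have "(\<integral>\<^sup>+ u. 2 * of_nat k * (?a u * indicator {t..T} u) \<partial>lborel) = 2 * of_nat k * A l t"
          unfolding A_def by (rule nn_integral_cmult) measurable
        then show ?thesis
          unfolding sq B_def
          by (intro trans[OF nn_integral_add] arg_cong2[where f="(+)"] nn_integral_add) measurable
      qed
      finally show ?thesis by (simp add: G_def power2_sum add_ac)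
    qed
    have "(\<integral>\<^sup>+ t\<in>{s..T}. ennreal (lam l t * exp (- Lam l s t)) * G (t # l) t (Suc k) \<partial>lborel)
        = (\<integral>\<^sup>+ t\<in>{s..T}. ennreal (lam l t * exp (- Lam l s t)) * (G l t k + \<gamma> t) \<partial>lborel)"
      using s by (intro nn_integral_cong) (auto simp: indicator_def G_Suc)
    then show ?thesis
      using lam_exp_identity[of \<gamma> s "(of_nat k)\<^sup>2" l] s unfolding G_eq by simp
  qed
  have "(\<Sum>m\<le>r. (of_nat (0 + m))\<^sup>2 * cprob m l s) \<le> G l s 0"
    by (rule sum_cprob_le[where wt="\<lambda>k. (of_nat k)\<^sup>2"]) (use super s in auto)
  then show ?thesis by (simp add: G_def A_def B_def)
qed

end

text \<open>Mass of \<open>P\<close> at 0 in excess of \<open>w 0\<close> is moved to the places where \<open>P\<close> is smaller than \<open>w\<close>,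
  at which \<open>a\<close> is at least \<open>a 0\<close>.\<close>

lemma suminf_mult_le_of_dominated:
  fixes P w a :: "nat \<Rightarrow> ennreal"
  assumes le: "\<And>p. P (Suc p) \<le> w (Suc p)" and P: "(\<Sum>p. P p) \<le> 1" and w: "1 \<le> (\<Sum>p. w p)"
    and a: "\<And>p. a 0 \<le> a p"
  shows "(\<Sum>p. P p * a p) \<le> (\<Sum>p. w p * a p)"
proof (cases "P 0 \<le> w 0")
  case True
  then have "P p \<le> w p" for p using le by (cases p) auto
  then show ?thesis by (intro suminf_le mult_right_mono) auto
next
  case False
  have split: "(\<Sum>p. f p) = f 0 + (\<Sum>p. f (Suc p))" for f :: "nat \<Rightarrow> ennreal"
    using suminf_offset[of f 1] by (simp add: add.commute)
  have fin: "P 0 + (\<Sum>p. P (Suc p)) \<le> 1" using P unfolding split[of P] .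
  have fin_P: "(\<Sum>p. P (Suc p)) \<noteq> \<infinity>"
  proof
    assume "(\<Sum>p. P (Suc p)) = \<infinity>"
    with fin show False by (simp add: top_unique)
  qed
  have fin_P0: "P 0 \<noteq> \<infinity>"
  proof
    assume "P 0 = \<infinity>"
    with fin show False by (simp add: top_unique)
  qed
  have fin_w: "w 0 \<noteq> \<infinity>" using False fin_P0 by (auto simp: not_le)
  define d where "d = P 0 - w 0"
  have P0: "P 0 = w 0 + d" using False by (simp add: d_def add_diff_inverse_ennreal)
  define e where "e p = w (Suc p) - P (Suc p)" for p
  have e: "w (Suc p) = P (Suc p) + e p" for p
    using le[of p] by (simp add: e_def add_diff_inverse_ennreal)
  \<comment> \<open>The total mass of \<open>P\<close> is at most 1 and that of \<open>w\<close> at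
    least 1, so the excess \<open>d\<close> at 0 fits into the deficits \<open>e\<close> elsewhere.
    Cancelling the common terms requires them to be finite.\<close>
  have "w 0 + d + (\<Sum>p. P (Suc p)) \<le> w 0 + (\<Sum>p. w (Suc p))"
    using order_trans[OF fin w] unfolding P0 split[of w] .
  also have "(\<Sum>p. w (Suc p)) = (\<Sum>p. P (Suc p)) + (\<Sum>p. e p)"
    unfolding e by (rule suminf_add[symmetric]) auto
  finally have "(w 0 + (\<Sum>p. P (Suc p))) + d \<le> (w 0 + (\<Sum>p. P (Suc p))) + (\<Sum>p. e p)"
    by (simp add: add_ac)
  then have d: "d \<le> (\<Sum>p. e p)"
    using fin_P fin_w by (simp add: ennreal_add_left_cancel_le)
  have "(\<Sum>p. P p * a p) = w 0 * a 0 + (d * a 0 + (\<Sum>p. P (Suc p) * a (Suc p)))"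
    unfolding split[of "\<lambda>p. P p * a p"] by (simp add: P0 distrib_right add.assoc)
  also have "\<dots> \<le> w 0 * a 0 + ((\<Sum>p. e p * a (Suc p)) + (\<Sum>p. P (Suc p) * a (Suc p)))"
  proof (intro add_left_mono add_right_mono)
    have "d * a 0 \<le> (\<Sum>p. e p) * a 0" using d by (rule mult_right_mono) simp
    also have "\<dots> = (\<Sum>p. e p * a 0)" by simp
    also have "\<dots> \<le> (\<Sum>p. e p * a (Suc p))" by (intro suminf_le mult_left_mono a) auto
    finally show "d * a 0 \<le> (\<Sum>p. e p * a (Suc p))" .
  qed
  also have "(\<Sum>p. e p * a (Suc p)) + (\<Sum>p. P (Suc p) * a (Suc p)) = (\<Sum>p. w (Suc p) * a (Suc p))"
    unfolding e by (subst suminf_add) (auto simp: distrib_right add.commute)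
  also have "w 0 * a 0 + (\<Sum>p. w (Suc p) * a (Suc p)) = (\<Sum>p. w p * a p)"
    by (rule split[of "\<lambda>p. w p * a p", symmetric])
  finally show ?thesis .
qed

section \<open>Expansion along chains of jumps\<close>

text \<open>\<open>Gc c cs\<close> stands for the expected product of the claim \<open>g\<close> of the distinguished jump and of
  \<open>h\<close>, with \<open>c\<close> the discount factor of that jump and \<open>cs\<close> those of the others. Chains are lists
  $[v_n, \dots, v_1]$, so that the distinguished jump is their last element.\<close>

locale hawkes_claims = hawkes_kernel +
  fixes \<kappa> :: real and Gc :: "real \<Rightarrow> real list \<Rightarrow> ennreal" and wt :: "nat \<Rightarrow> nat \<Rightarrow> ennreal"
  assumes \<kappa>_nonneg: "0 \<le> \<kappa>"
    and Gc_measurable: "(\<lambda>(c, cs). Gc c cs) \<in> borel_measurable (borel \<Otimes>\<^sub>M list_borel)"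
    and Gc_mset: "\<And>c cs ds. mset cs = mset ds \<Longrightarrow> Gc c cs = Gc c ds"
    and Gc_mono: "\<And>c cs ds. (\<And>d. d \<in> set ds \<Longrightarrow> d \<le> 1) \<Longrightarrow> Gc c (cs @ ds) \<le> Gc c (cs @ replicate (length ds) 1)"
    and Gc_append: "\<And>c cs p. Gc c cs \<le> Gc c (cs @ replicate p 1)"
    and cprob_le_wt: "\<And>vs p. cprob (Suc p) vs 0 \<le> wt (length vs) (Suc p)"
    and wt_ge_1: "\<And>n. 1 \<le> (\<Sum>p. wt n p)"
begin

definition disc :: "real \<Rightarrow> real" where "disc t = exp (- \<kappa> * (T - t))"

lemma disc_measurable [measurable]: "disc \<in> borel_measurable borel"
  unfolding disc_def by measurable

lemma disc_le_1: "t \<le> T \<Longrightarrow> disc t \<le> 1"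
  using \<kappa>_nonneg by (simp add: disc_def)

lemma measurable_Gc [measurable (raw)]:
  assumes [measurable]: "c \<in> borel_measurable M" "cs \<in> measurable M list_borel"
  shows "(\<lambda>x. Gc (c x) (cs x)) \<in> borel_measurable M"
proof -
  have "(\<lambda>x. (c x, cs x)) \<in> measurable M (borel \<Otimes>\<^sub>M list_borel)" by measurable
  from measurable_compose[OF this Gc_measurable] show ?thesis by simp
qed

definition claims_given :: "real list \<Rightarrow> real list \<Rightarrow> ennreal" where
  "claims_given vs w = Gc (disc (last vs)) (map disc (butlast vs) @ map disc w)"

definition capped_claims :: "real list \<Rightarrow> nat \<Rightarrow> ennreal" where
  "capped_claims vs p = Gc (disc (last vs)) (map disc (butlast vs) @ replicate p 1)"

text \<open>Becomes \<beta> once \<open>Gc\<close> and \<open>wt\<close> are specialised.\<close>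

definition weighted_claims :: "real list \<Rightarrow> ennreal" where
  "weighted_claims vs = (\<Sum>p. wt (length vs) p * capped_claims vs p)"

definition later_claims :: "real list \<Rightarrow> nat \<Rightarrow> ennreal" where
  "later_claims vs p = (\<integral>\<^sup>+ w. ennreal (dens vs 0 w) * claims_given vs w \<partial>points T p)"

text \<open>What remains to be expanded for a chain: the intensity at its earliest point
  \<open>hd vs\<close> caused by \<mu> and by the jumps \<open>w\<close> outside the chain.\<close>

definition weighted_past :: "real list \<Rightarrow> nat \<Rightarrow> ennreal" where
  "weighted_past vs p = (\<integral>\<^sup>+ w. ennreal (lam w (hd vs)) * (ennreal (dens vs 0 w) * claims_given vs w) \<partial>points T p)"

lemma measurable_claims_given [measurable (raw)]:
  assumes [measurable]: "vs \<in> measurable M list_borel" "w \<in> measurable M list_borel"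
  shows "(\<lambda>x. claims_given (vs x) (w x)) \<in> borel_measurable M"
  unfolding claims_given_def by measurable

lemma measurable_weighted_claims [measurable (raw)]:
  assumes [measurable]: "vs \<in> measurable M list_borel"
  shows "(\<lambda>x. weighted_claims (vs x)) \<in> borel_measurable M"
  unfolding weighted_claims_def capped_claims_def by measurable

lemma measurable_weighted_past [measurable (raw)]:
  assumes [measurable]: "vs \<in> measurable M list_borel"
  shows "(\<lambda>x. weighted_past (vs x) p) \<in> borel_measurable M"
  unfolding weighted_past_def by measurable

lemma later_claims_le: "later_claims vs p \<le> cprob p vs 0 * capped_claims vs p"
proof -
  have "later_claims vs p \<le> (\<integral>\<^sup>+ w. ennreal (dens vs 0 w) * capped_claims vs p \<partial>points T p)"
    unfolding later_claims_def
  proof (rule nn_integral_mono_AE, use AE_length_points[where T=T and m=p] in eventually_elim)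
    case (elim w)
    show ?case
    proof (cases "\<forall>x\<in>set w. x \<le> T")
      case True
      then have "claims_given vs w \<le> capped_claims vs p"
      proof -
        have "Gc (disc (last vs)) (map disc (butlast vs) @ map disc w)
            \<le> Gc (disc (last vs)) (map disc (butlast vs) @ replicate (length (map disc w)) 1)"
          using True by (intro Gc_mono) (auto intro: disc_le_1)
        then show ?thesis using elim by (simp add: claims_given_def capped_claims_def)
      qed
      then show ?thesis by (rule mult_left_mono) simp
    next
      case False
      then have "dens vs 0 w = 0" by (auto simp: dens_def)
      then show ?thesis by simp
    qed
  qed
  also have "\<dots> = cprob p vs 0 * capped_claims vs p"
    unfolding cprob_def by (rule nn_integral_multc) measurable
  finally show ?thesis .
qed

text \<open>Capping the discount factors makes the claim term depend on the number of remaining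
  jumps alone, and this term is smallest for no remaining jump; the masses \<open>cprob\<close> can
  then be exchanged for the weights \<open>wt\<close>.\<close>

lemma suminf_later_claims_le: "(\<Sum>p. later_claims vs p) \<le> weighted_claims vs"
proof -
  have "(\<Sum>p. later_claims vs p) \<le> (\<Sum>p. cprob p vs 0 * capped_claims vs p)"
    by (intro suminf_le later_claims_le) auto
  also have "\<dots> \<le> weighted_claims vs"
    unfolding weighted_claims_def
  proof (rule suminf_mult_le_of_dominated)
    show "(\<Sum>p. cprob p vs 0) \<le> 1"
    proof (rule suminf_le_const)
      fix n show "(\<Sum>p<n. cprob p vs 0) \<le> 1"
        using sum_cprob_le_1[where s=0 and r=n and l=vs] T_pos
        by (intro order_trans[OF sum_mono2[of "{..n}" "{..<n}"]]) auto
    qed auto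
    show "capped_claims vs 0 \<le> capped_claims vs p" for p
      unfolding capped_claims_def using Gc_append[of _ "map disc (butlast vs)" p] by simp
  qed (use cprob_le_wt wt_ge_1 in auto)
  finally show ?thesis .
qed

text \<open>Unlike \<open>dens\<close> this is symmetric in \<open>w\<close>; it agrees with \<open>dens\<close> on increasing lists.\<close>

definition split_dens :: "real list \<Rightarrow> real list \<Rightarrow> real" where
  "split_dens vs w = (if \<forall>x\<in>set w. x \<le> T then (\<Prod>t\<leftarrow>w. lam (w @ vs) t) * exp (- Lam (w @ vs) 0 T) else 0)"

lemma measurable_split_dens [measurable (raw)]:
  assumes [measurable]: "vs \<in> measurable M list_borel" "w \<in> measurable M list_borel"
  shows "(\<lambda>x. split_dens (vs x) (w x)) \<in> borel_measurable M"
  unfolding split_dens_def by measurable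

lemma dens_split_dens: "ennreal (dens vs 0 w) = incr 0 w * ennreal (split_dens vs w)"
  by (simp add: dens_def split_dens_def)

lemma split_dens_nonneg [simp]: "0 \<le> split_dens vs w"
  by (auto simp: split_dens_def intro!: mult_nonneg_nonneg prod_list_nonneg)

lemma Lam_mset: "mset l = mset l' \<Longrightarrow> Lam l = Lam l'"
  unfolding Lam_def by (subst lam_mset) auto

lemma split_dens_mset: assumes "mset w = mset w'" shows "split_dens vs w = split_dens vs w'"
proof -
  have "mset (w @ vs) = mset (w' @ vs)" using assms by simp
  note * = lam_mset[OF this] Lam_mset[OF this]
  have "(\<Prod>t\<leftarrow>w. lam (w @ vs) t) = (\<Prod>t\<leftarrow>w'. lam (w @ vs) t)"
    using assms by (metis mset_map prod_mset_prod_list)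
  then show ?thesis unfolding split_dens_def * mset_eq_setD[OF assms] by simp
qed

text \<open>Moving the earliest point \<open>x\<close> from the remaining jumps into the chain only
  pulls out its own intensity factor. The chain lies at or after \<open>x\<close>, so that factor
  depends on \<open>w\<close> alone.\<close>

lemma split_dens_Cons:
  assumes "\<And>v. v \<in> set vs \<Longrightarrow> x \<le> v" and "x \<le> T"
  shows "split_dens vs (x # w) = lam w x * split_dens (x # vs) w"
proof -
  have "mset ((x # w) @ vs) = mset (w @ x # vs)" by simp
  note * = lam_mset[OF this] Lam_mset[OF this]
  have "mset (w @ x # vs) = mset ((x # vs) @ w)" by simp
  then have "lam (w @ x # vs) x = lam ((x # vs) @ w) x" by (subst lam_mset) auto
  also have "\<dots> = lam w x" using assms by (intro lam_irrelevant) auto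
  finally show ?thesis using assms(2) unfolding split_dens_def * by simp
qed

text \<open>The hypothesis lets \<open>u\<close> depend on the remaining list only through the
  common factor \<open>c\<close>, so the sum over positions runs over \<alpha> alone.\<close>

lemma picks_symmetric:
  assumes "\<And>x w'. mset (x # w') = mset w \<Longrightarrow> u x w' = \<alpha> x * c"
  shows "picks u w = (\<Sum>x\<leftarrow>w. \<alpha> x) * c"
proof -
  have "u (nth_default 0 w i) (remove_nth i w) = \<alpha> (nth_default 0 w i) * c" if "i < length w" for i
    using that mset_remove_nth[of i w] by (intro assms) (simp add: nth_default_nth)
  then show ?thesis
    unfolding picks_def sum_list_nth_default[where d=0] sum_distrib_right by (intro sum.cong) auto
qed

text \<open>Turns a sum over a jump outside the chain into an integral over a new chain point.
  \<open>nn_integral_picks\<close> applies because the density is symmetric apart from the order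
  constraint; \<alpha> confines the new point to the times not after the chain, and the factor
  \<open>lam w x\<close> is the next one to be expanded.\<close>

lemma nn_integral_picks_dens:
  assumes [measurable]: "\<alpha> \<in> borel_measurable borel"
    and \<alpha>: "\<And>x. \<exists>v\<in>set vs. v < x \<Longrightarrow> \<alpha> x = 0"
    and [measurable]: "(\<lambda>(x, w). R x w) \<in> borel_measurable (borel \<Otimes>\<^sub>M list_borel)"
  shows "(\<integral>\<^sup>+ w. picks (\<lambda>x w'. \<alpha> x * R x w') w * ennreal (dens vs 0 w) \<partial>points T (Suc p))
    = (\<integral>\<^sup>+ x\<in>{0..T}. \<alpha> x * (\<integral>\<^sup>+ w. ennreal (lam w x) * (ennreal (dens (x # vs) 0 w) * R x w) \<partial>points T p) \<partial>lborel)"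
proof -
  have "picks (\<lambda>x w'. \<alpha> x * R x w') w * ennreal (dens vs 0 w)
      = incr 0 w * picks (\<lambda>x w'. \<alpha> x * R x w' * ennreal (split_dens vs (x # w'))) w" for w
  proof -
    have "ennreal (split_dens vs (nth_default 0 w i # remove_nth i w)) = ennreal (split_dens vs w)" if "i < length w" for i
      using mset_remove_nth[OF that] that by (subst split_dens_mset[of _ w]) (simp_all add: nth_default_nth)
    then have "picks (\<lambda>x w'. \<alpha> x * R x w' * ennreal (split_dens vs (x # w'))) w
        = picks (\<lambda>x w'. \<alpha> x * R x w') w * ennreal (split_dens vs w)"
      unfolding picks_def sum_distrib_right by (intro sum.cong) auto
    then show ?thesis by (simp add: dens_split_dens mult_ac)
  qed
  then have "(\<integral>\<^sup>+ w. picks (\<lambda>x w'. \<alpha> x * R x w') w * ennreal (dens vs 0 w) \<partial>points T (Suc p))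
      = (\<integral>\<^sup>+ w. incr 0 w * picks (\<lambda>x w'. \<alpha> x * R x w' * ennreal (split_dens vs (x # w'))) w \<partial>points T (Suc p))"
    by (simp only:)
  also have "\<dots> = (\<integral>\<^sup>+ x\<in>{0..T}. (if 0 < x then 1 else 0) * (\<integral>\<^sup>+ w. incr 0 w * (\<alpha> x * R x w * ennreal (split_dens vs (x # w))) \<partial>points T p) \<partial>lborel)"
    by (rule nn_integral_picks) measurable
  also have "\<dots> = (\<integral>\<^sup>+ x\<in>{0..T}. \<alpha> x * (\<integral>\<^sup>+ w. ennreal (lam w x) * (ennreal (dens (x # vs) 0 w) * R x w) \<partial>points T p) \<partial>lborel)"
  proof (rule nn_integral_cong_AE, use AE_lborel_singleton[of 0] in eventually_elim)
    case (elim x)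
    show ?case
    proof (cases "\<alpha> x = 0 \<or> x \<notin> {0..T}")
      case False
      then have "split_dens vs (x # w) = lam w x * split_dens (x # vs) w" for w
        using \<alpha>[of x] by (intro split_dens_Cons) force+
      then have "(\<integral>\<^sup>+ w. incr 0 w * (\<alpha> x * R x w * ennreal (split_dens vs (x # w))) \<partial>points T p)
        = (\<integral>\<^sup>+ w. \<alpha> x * (ennreal (lam w x) * (ennreal (dens (x # vs) 0 w) * R x w)) \<partial>points T p)"
        by (simp add: dens_split_dens ennreal_mult mult_ac)
      also have "\<dots> = \<alpha> x * (\<integral>\<^sup>+ w. (ennreal (lam w x) * (ennreal (dens (x # vs) 0 w) * R x w)) \<partial>points T p)"
        by (rule nn_integral_cmult) measurable
      finally show ?thesis using False elim by simp
    qed auto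
  qed
  finally show ?thesis .
qed

lemma weighted_past_0: "weighted_past vs 0 = ennreal \<mu> * later_claims vs 0"
  unfolding weighted_past_def later_claims_def by (subst (1 2) nn_integral_points_0, (measurable)[2], simp)

text \<open>The factor \<open>lam w (hd vs)\<close> is \<mu> plus a sum over earlier jumps. The part
  \<mu> ends the chain; a summand \<open>ker (hd vs - x)\<close> makes \<open>x\<close> the new
  earliest chain point and leaves one jump fewer outside.\<close>

lemma weighted_past_Suc:
  assumes "vs \<noteq> []" "sorted_wrt (<) vs"
  shows "weighted_past vs (Suc p) = ennreal \<mu> * later_claims vs (Suc p)
    + (\<integral>\<^sup>+ x\<in>{0..T}. ennreal (ker (hd vs - x)) * weighted_past (x # vs) p \<partial>lborel)"
proof -
  let ?\<alpha> = "\<lambda>x. ennreal (ker (hd vs - x))"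
  \<comment> \<open>All discount factors except that of the distinguished jump enter symmetrically,
    so moving \<open>x\<close> into the chain leaves the claim term unchanged.\<close>
  have claims_given: "claims_given (x # vs) w' = claims_given vs (x # w')" for x w'
    using assms(1) by (auto simp: claims_given_def intro!: Gc_mset)
  have claims_given_mset: "claims_given vs w = claims_given vs w'" if "mset w = mset w'" for w w'
    unfolding claims_given_def using that by (intro Gc_mset) simp
  have pick: "picks (\<lambda>x w'. ?\<alpha> x * claims_given (x # vs) w') w = (\<Sum>x\<leftarrow>w. ?\<alpha> x) * claims_given vs w" for w
    unfolding claims_given by (rule picks_symmetric) (metis claims_given_mset)
  have lam: "ennreal (lam w (hd vs)) = ennreal \<mu> + (\<Sum>x\<leftarrow>w. ?\<alpha> x)" for w
  proof -
    have nonneg: "0 \<le> (\<Sum>x\<leftarrow>w. ker (hd vs - x))" for w by (rule sum_list_nonneg) auto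
    have "ennreal (\<Sum>x\<leftarrow>w. ker (hd vs - x)) = (\<Sum>x\<leftarrow>w. ?\<alpha> x)"
      by (induction w) (simp_all add: nonneg)
    then show ?thesis
      unfolding lam_def using \<mu>_nonneg by (subst ennreal_plus) (auto intro!: sum_list_nonneg)
  qed
  have "weighted_past vs (Suc p) = (\<integral>\<^sup>+ w. ennreal \<mu> * (ennreal (dens vs 0 w) * claims_given vs w)
      + picks (\<lambda>x w'. ?\<alpha> x * claims_given (x # vs) w') w * ennreal (dens vs 0 w) \<partial>points T (Suc p))"
    unfolding weighted_past_def lam pick by (intro nn_integral_cong) (simp add: distrib_left distrib_right mult_ac)
  also have "\<dots> = (\<integral>\<^sup>+ w. ennreal \<mu> * (ennreal (dens vs 0 w) * claims_given vs w) \<partial>points T (Suc p))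
      + (\<integral>\<^sup>+ w. picks (\<lambda>x w'. ?\<alpha> x * claims_given (x # vs) w') w * ennreal (dens vs 0 w) \<partial>points T (Suc p))"
    by (rule nn_integral_add) measurable
  also have "(\<integral>\<^sup>+ w. ennreal \<mu> * (ennreal (dens vs 0 w) * claims_given vs w) \<partial>points T (Suc p)) = ennreal \<mu> * later_claims vs (Suc p)"
    unfolding later_claims_def by (rule nn_integral_cmult) measurable
  also have "(\<integral>\<^sup>+ w. picks (\<lambda>x w'. ?\<alpha> x * claims_given (x # vs) w') w * ennreal (dens vs 0 w) \<partial>points T (Suc p))
      = (\<integral>\<^sup>+ x\<in>{0..T}. ?\<alpha> x * (\<integral>\<^sup>+ w. ennreal (lam w x) * (ennreal (dens (x # vs) 0 w) * claims_given (x # vs) w) \<partial>points T p) \<partial>lborel)"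
  proof (rule nn_integral_picks_dens)
    fix x assume "\<exists>v\<in>set vs. v < x"
    then have "hd vs < x" using assms by (cases vs) (auto intro: less_trans)
    then show "?\<alpha> x = 0" by (simp add: ker_0)
  qed measurable
  finally show ?thesis by (simp add: weighted_past_def)
qed

text \<open>Each new point is integrated over all of [0,T]; the descending order is enforced by
  \<open>ker\<close>, which vanishes unless the new point precedes \<open>hd vs\<close>.\<close>

primrec chain_integral :: "nat \<Rightarrow> real list \<Rightarrow> ennreal" where
  "chain_integral 0 vs = weighted_claims vs"
| "chain_integral (Suc i) vs = (\<integral>\<^sup>+ x\<in>{0..T}. ennreal (ker (hd vs - x)) * chain_integral i (x # vs) \<partial>lborel)"

lemma measurable_chain_integral [measurable (raw)]:
  assumes "vs \<in> measurable M list_borel"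
  shows "(\<lambda>x. chain_integral i (vs x)) \<in> borel_measurable M"
proof -
  have "chain_integral i \<in> borel_measurable list_borel"
  proof (induction i)
    case 0
    show ?case using measurable_weighted_claims[of "\<lambda>x. x" list_borel] by simp
  next
    case (Suc i)
    note [measurable] = Suc
    show ?case by simp
  qed
  from measurable_compose[OF assms this] show ?thesis .
qed

text \<open>Every prolongation of the chain uses up one outside jump, so truncating the number of
  outside jumps at \<open>P\<close> leaves at most \<open>P\<close> prolongations. All numbers
  \<open>p\<close> are treated together, because only the sum of \<open>later_claims\<close> over
  \<open>p\<close>, not its single terms, is to be bounded by
  \<open>weighted_claims\<close>.\<close>

lemma sum_weighted_past_le:
  assumes "vs \<noteq> []" "sorted_wrt (<) vs"
  shows "(\<Sum>p\<le>P. weighted_past vs p) \<le> ennreal \<mu> * (\<Sum>i\<le>P. chain_integral i vs)"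
  using assms
proof (induction P arbitrary: vs)
  case 0
  have "later_claims vs 0 \<le> weighted_claims vs"
    using suminf_later_claims_le[of vs] sum_le_suminf[of "later_claims vs" "{0}"] by simp
  then show ?case by (simp add: weighted_past_0 mult_left_mono)
next
  case (Suc P)
  have "(\<Sum>p\<le>Suc P. weighted_past vs p) = ennreal \<mu> * (\<Sum>p\<le>Suc P. later_claims vs p)
      + (\<Sum>p\<le>P. \<integral>\<^sup>+ x\<in>{0..T}. ennreal (ker (hd vs - x)) * weighted_past (x # vs) p \<partial>lborel)"
    unfolding sum.atMost_Suc_shift[of _ P] weighted_past_Suc[OF Suc.prems] weighted_past_0
    by (simp add: sum.distrib distrib_left sum_distrib_left add_ac)
  moreover have "(\<Sum>p\<le>P. \<integral>\<^sup>+ x\<in>{0..T}. ennreal (ker (hd vs - x)) * weighted_past (x # vs) p \<partial>lborel)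
      \<le> ennreal \<mu> * (\<Sum>i\<le>P. chain_integral (Suc i) vs)"
  proof -
    have "(\<Sum>p\<le>P. \<integral>\<^sup>+ x\<in>{0..T}. ennreal (ker (hd vs - x)) * weighted_past (x # vs) p \<partial>lborel)
     = (\<integral>\<^sup>+ x. (\<Sum>p\<le>P. ennreal (ker (hd vs - x)) * weighted_past (x # vs) p * indicator {0..T} x) \<partial>lborel)"
    by (rule nn_integral_sum[symmetric]) measurable
  also have "\<dots> \<le> (\<integral>\<^sup>+ x. ennreal \<mu> * (\<Sum>i\<le>P. ennreal (ker (hd vs - x)) * chain_integral i (x # vs) * indicator {0..T} x) \<partial>lborel)"
  proof (rule nn_integral_mono)
    fix x
    show "(\<Sum>p\<le>P. ennreal (ker (hd vs - x)) * weighted_past (x # vs) p * indicator {0..T} x)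
      \<le> ennreal \<mu> * (\<Sum>i\<le>P. ennreal (ker (hd vs - x)) * chain_integral i (x # vs) * indicator {0..T} x)"
    proof (cases "x < hd vs")
      case True
      then have "sorted_wrt (<) (x # vs)" using Suc.prems by (cases vs) (auto intro: less_trans)
      then have "(\<Sum>p\<le>P. weighted_past (x # vs) p) \<le> ennreal \<mu> * (\<Sum>i\<le>P. chain_integral i (x # vs))"
        by (intro Suc.IH) auto
      then have "ennreal (ker (hd vs - x)) * indicator {0..T} x * (\<Sum>p\<le>P. weighted_past (x # vs) p)
          \<le> ennreal (ker (hd vs - x)) * indicator {0..T} x * (ennreal \<mu> * (\<Sum>i\<le>P. chain_integral i (x # vs)))"
        by (rule mult_left_mono) simp
      moreover have "(\<Sum>p\<le>P. k * A p * i) = k * i * (\<Sum>p\<le>P. A p)" for k i :: ennreal and A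
        by (simp add: sum_distrib_left mult_ac)
      ultimately show ?thesis by (simp only: mult.left_commute)
    qed (simp add: ker_0)
  qed
  also have "\<dots> = ennreal \<mu> * (\<integral>\<^sup>+ x. (\<Sum>i\<le>P. ennreal (ker (hd vs - x)) * chain_integral i (x # vs) * indicator {0..T} x) \<partial>lborel)"
    by (rule nn_integral_cmult) measurable
  also have "(\<integral>\<^sup>+ x. (\<Sum>i\<le>P. ennreal (ker (hd vs - x)) * chain_integral i (x # vs) * indicator {0..T} x) \<partial>lborel)
      = (\<Sum>i\<le>P. \<integral>\<^sup>+ x\<in>{0..T}. ennreal (ker (hd vs - x)) * chain_integral i (x # vs) \<partial>lborel)"
    by (rule nn_integral_sum) measurable
    finally show ?thesis by simp
  qed
  moreover have "(\<Sum>p\<le>Suc P. later_claims vs p) \<le> weighted_claims vs"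
    using suminf_later_claims_le[of vs] sum_le_suminf[of "later_claims vs" "{..Suc P}"] by (simp del: sum.atMost_Suc)
  ultimately have "(\<Sum>p\<le>Suc P. weighted_past vs p) \<le> ennreal \<mu> * weighted_claims vs + ennreal \<mu> * (\<Sum>i\<le>P. chain_integral (Suc i) vs)"
    by (simp add: mult_left_mono add_mono del: sum.atMost_Suc)
  also have "\<dots> = ennreal \<mu> * (\<Sum>i\<le>Suc P. chain_integral i vs)"
    unfolding sum.atMost_Suc_shift[of _ P] distrib_left by simp
  finally show ?case .
qed

lemma suminf_weighted_past_le:
  assumes "vs \<noteq> []" "sorted_wrt (<) vs"
  shows "(\<Sum>p. weighted_past vs p) \<le> ennreal \<mu> * (\<Sum>i. chain_integral i vs)"
proof (rule suminf_le_const)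
  fix n
  have "(\<Sum>p<n. weighted_past vs p) \<le> (\<Sum>p\<le>n. weighted_past vs p)" by (intro sum_mono2) auto
  also have "\<dots> \<le> ennreal \<mu> * (\<Sum>i\<le>n. chain_integral i vs)" by (rule sum_weighted_past_le[OF assms])
  also have "\<dots> \<le> ennreal \<mu> * (\<Sum>i. chain_integral i vs)"
    by (intro mult_left_mono sum_le_suminf) auto
  finally show "(\<Sum>p<n. weighted_past vs p) \<le> ennreal \<mu> * (\<Sum>i. chain_integral i vs)" .
qed simp

text \<open>The distinguished jump starts the chain. Lists without jumps contribute nothing, and
  lists of length m + 1 yield chains of one point with m outside jumps.\<close>

lemma suminf_picks_le:
  "(\<Sum>m. \<integral>\<^sup>+ l. picks (\<lambda>x w. ennreal (disc x) * Gc (disc x) (map disc w)) l * ennreal (dens [] 0 l) \<partial>points T m)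
    \<le> ennreal \<mu> * (\<Sum>i. \<integral>\<^sup>+ x\<in>{0..T}. ennreal (disc x) * chain_integral i [x] \<partial>lborel)"
proof -
  let ?\<Gamma> = "\<lambda>l. picks (\<lambda>x w. ennreal (disc x) * Gc (disc x) (map disc w)) l * ennreal (dens [] 0 l)"
  have [measurable]: "(\<lambda>(x, w). ennreal (disc x) * Gc (disc x) (map disc w)) \<in> borel_measurable (borel \<Otimes>\<^sub>M list_borel)"
    by measurable
  have [measurable]: "(\<lambda>l. picks (\<lambda>x w. ennreal (disc x) * Gc (disc x) (map disc w)) l) \<in> borel_measurable list_borel"
    by (rule measurable_picks) measurable
  have 0: "(\<integral>\<^sup>+ l. ?\<Gamma> l \<partial>points T 0) = 0"
  proof -
    have "?\<Gamma> \<in> borel_measurable list_borel" by measurable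
    from nn_integral_points_0[OF this] show ?thesis by (simp del: points.simps)
  qed
  have Suc: "(\<integral>\<^sup>+ l. ?\<Gamma> l \<partial>points T (Suc m)) = (\<integral>\<^sup>+ x\<in>{0..T}. ennreal (disc x) * weighted_past [x] m \<partial>lborel)" for m
    by (subst nn_integral_picks_dens) (auto simp: weighted_past_def claims_given_def)
  have "(\<Sum>m. \<integral>\<^sup>+ l. ?\<Gamma> l \<partial>points T m) = (\<Sum>m. \<integral>\<^sup>+ l. ?\<Gamma> l \<partial>points T (Suc m))"
    using suminf_offset[of "\<lambda>m. \<integral>\<^sup>+ l. ?\<Gamma> l \<partial>points T m" 1] 0 by simp
  also have "\<dots> = (\<integral>\<^sup>+ x. (\<Sum>m. ennreal (disc x) * weighted_past [x] m * indicator {0..T} x) \<partial>lborel)"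
    unfolding Suc by (rule nn_integral_suminf[symmetric]) measurable
  also have "\<dots> \<le> (\<integral>\<^sup>+ x. ennreal \<mu> * (\<Sum>i. ennreal (disc x) * chain_integral i [x] * indicator {0..T} x) \<partial>lborel)"
  proof (rule nn_integral_mono)
    fix x
    have "(\<Sum>m. weighted_past [x] m) \<le> ennreal \<mu> * (\<Sum>i. chain_integral i [x])" by (rule suminf_weighted_past_le) auto
    then have "ennreal (disc x) * (\<Sum>m. weighted_past [x] m) * indicator {0..T} x
        \<le> ennreal (disc x) * (ennreal \<mu> * (\<Sum>i. chain_integral i [x])) * indicator {0..T} x"
      by (intro mult_right_mono mult_left_mono) auto
    then show "(\<Sum>m. ennreal (disc x) * weighted_past [x] m * indicator {0..T} x)
      \<le> ennreal \<mu> * (\<Sum>i. ennreal (disc x) * chain_integral i [x] * indicator {0..T} x)"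
      by (simp add: mult_ac)
  qed
  also have "\<dots> = ennreal \<mu> * (\<integral>\<^sup>+ x. (\<Sum>i. ennreal (disc x) * chain_integral i [x] * indicator {0..T} x) \<partial>lborel)"
    by (rule nn_integral_cmult) measurable
  also have "(\<integral>\<^sup>+ x. (\<Sum>i. ennreal (disc x) * chain_integral i [x] * indicator {0..T} x) \<partial>lborel)
      = (\<Sum>i. \<integral>\<^sup>+ x\<in>{0..T}. ennreal (disc x) * chain_integral i [x] \<partial>lborel)"
    by (rule nn_integral_suminf) measurable
  finally show ?thesis .
qed

text \<open>Written with \<open>\<Phi>\<close> and not \<open>ker\<close>, since it is the
  coefficient of the claimed bound; the discount factor is that of the distinguished jump
  only.\<close>

definition chain_coeff :: "nat \<Rightarrow> (nat \<Rightarrow> real) \<Rightarrow> real" where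
  "chain_coeff n v = (\<Prod>i=2..n. \<Phi> (v (i - 1) - v i)) * disc (v 1)"

lemma chain_coeff_Suc:
  "1 \<le> n \<Longrightarrow> chain_coeff (Suc n) (v(Suc n := x)) = chain_coeff n v * \<Phi> (v n - x)"
proof -
  assume n: "1 \<le> n"
  have "(\<Prod>i=2..n. \<Phi> ((v(Suc n := x)) (i - 1) - (v(Suc n := x)) i)) = (\<Prod>i=2..n. \<Phi> (v (i - 1) - v i))"
    by (rule prod.cong) auto
  then show ?thesis using n by (simp add: chain_coeff_def)
qed

text \<open>For almost every new point \<open>x\<close> either \<open>ker\<close> vanishes, which
  cuts the range [0,T] down to [0,v n], or it equals \<open>\<Phi>\<close>. The list is reversed
  because chains grow at the head while the coordinates of \<open>v\<close> are numbered from the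
  distinguished jump.\<close>

lemma chain_integral_le_iter_integral:
  assumes \<beta>: "\<And>n v. 1 \<le> n \<Longrightarrow> weighted_claims (rev (map v [1..<Suc n])) \<le> \<beta> n v"
    and "1 \<le> n" "0 \<le> chain_coeff n v" "0 \<le> v n" "v n \<le> T"
  shows "ennreal (chain_coeff n v) * chain_integral i (rev (map v [1..<Suc n]))
    \<le> iter_integral (\<lambda>v. ennreal (chain_coeff (n + i) v) * \<beta> (n + i) v) i (Suc n) (v n) v"
  using assms(2-)
proof (induction i arbitrary: n v)
  case 0
  then show ?case using \<beta>[of n v] by (simp add: mult_left_mono)
next
  case (Suc i)
  let ?vs = "rev (map v [1..<Suc n])"
  let ?F = "\<lambda>v. ennreal (chain_coeff (n + Suc i) v) * \<beta> (n + Suc i) v"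
  have hd: "hd ?vs = v n" using Suc.prems(1) by simp
  have Cons: "rev (map (v(Suc n := x)) [1..<Suc (Suc n)]) = x # ?vs" for x
    using Suc.prems(1) by simp
  have "ennreal (chain_coeff n v) * chain_integral (Suc i) ?vs
      = (\<integral>\<^sup>+ x. ennreal (chain_coeff n v) * (ennreal (ker (v n - x)) * chain_integral i (x # ?vs) * indicator {0..T} x) \<partial>lborel)"
    unfolding chain_integral.simps hd by (rule nn_integral_cmult[symmetric]) measurable
  also have "\<dots> \<le> (\<integral>\<^sup>+ x\<in>{0..v n}. iter_integral ?F i (Suc (Suc n)) x (v(Suc n := x)) \<partial>lborel)"
  proof (rule nn_integral_mono_AE, use AE_ker_diff[of "v n"] AE_lborel_singleton[of "v n"] in eventually_elim)
    case (elim x)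
    show ?case
    proof (cases "0 \<le> x \<and> x < v n")
      case True
      then have ker: "ker (v n - x) = \<Phi> (v n - x)" using elim Suc.prems by auto
      have \<Phi>0: "0 \<le> \<Phi> (v n - x)" using True Suc.prems by (intro \<Phi>_nonneg) auto
      have "ennreal (chain_coeff (Suc n) (v(Suc n := x))) * chain_integral i (rev (map (v(Suc n := x)) [1..<Suc (Suc n)]))
        \<le> iter_integral (\<lambda>v. ennreal (chain_coeff (Suc n + i) v) * \<beta> (Suc n + i) v) i (Suc (Suc n)) ((v(Suc n := x)) (Suc n)) (v(Suc n := x))"
        using True Suc.prems \<Phi>0 by (intro Suc.IH) (auto simp: chain_coeff_Suc simp del: fun_upd_apply, auto)
      then have "ennreal (chain_coeff n v * \<Phi> (v n - x)) * chain_integral i (x # ?vs)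
        \<le> iter_integral ?F i (Suc (Suc n)) x (v(Suc n := x))"
        unfolding chain_coeff_Suc[OF Suc.prems(1)] Cons by simp
      then show ?thesis
        using True Suc.prems \<Phi>0 by (simp add: ker ennreal_mult mult.assoc)
    next
      case False
      then have "ker (v n - x) = 0 \<or> x < 0" using elim by (auto intro: ker_0)
      then show ?thesis by auto
    qed
  qed
  finally show ?case by simp
qed

lemma suminf_chain_integral_le:
  assumes \<beta>: "\<And>n v. 1 \<le> n \<Longrightarrow> weighted_claims (rev (map v [1..<Suc n])) \<le> \<beta> n v"
  shows "ennreal \<mu> * (\<Sum>i. \<integral>\<^sup>+ x\<in>{0..T}. ennreal (disc x) * chain_integral i [x] \<partial>lborel)
    \<le> ennreal \<mu> * (\<integral>\<^sup>+ v1\<in>{0..T}. ennreal (exp (- \<kappa> * (T - v1))) * \<beta> 1 (\<lambda>_. v1) \<partial>lborel)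
      + ennreal \<mu> * (\<Sum>m. simplex_integral (m + 2) T
          (\<lambda>v. ennreal ((\<Prod>i=2..m + 2. \<Phi> (v (i - 1) - v i)) * exp (- \<kappa> * (T - v 1)))
                * \<beta> (m + 2) v))"
proof -
  let ?I = "\<lambda>i. \<integral>\<^sup>+ x\<in>{0..T}. ennreal (disc x) * chain_integral i [x] \<partial>lborel"
  have 0: "?I 0 \<le> (\<integral>\<^sup>+ v1\<in>{0..T}. ennreal (exp (- \<kappa> * (T - v1))) * \<beta> 1 (\<lambda>_. v1) \<partial>lborel)"
    unfolding disc_def using \<beta>[of 1 "\<lambda>_. _"] by (intro nn_integral_mono mult_right_mono mult_left_mono) auto
  have Suc: "?I (Suc m) \<le> simplex_integral (m + 2) T
          (\<lambda>v. ennreal ((\<Prod>i=2..m + 2. \<Phi> (v (i - 1) - v i)) * exp (- \<kappa> * (T - v 1)))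
                * \<beta> (m + 2) v)" for m
  proof -
    let ?F = "\<lambda>v. ennreal (chain_coeff (m + 2) v) * \<beta> (m + 2) v"
    have F: "(\<lambda>v. ennreal ((\<Prod>i=2..m + 2. \<Phi> (v (i - 1) - v i)) * exp (- \<kappa> * (T - v 1))) * \<beta> (m + 2) v) = ?F"
      by (simp add: chain_coeff_def disc_def fun_eq_iff)
    have s: "simplex_integral (m + 2) T ?F
      = (\<integral>\<^sup>+ x\<in>{0..T}. iter_integral ?F (Suc m) (Suc 1) x ((\<lambda>_. 0)(1 := x)) \<partial>lborel)"
      unfolding simplex_integral_def by (simp add: numeral_2_eq_2)
    have "?I (Suc m) \<le> (\<integral>\<^sup>+ x\<in>{0..T}. iter_integral ?F (Suc m) (Suc 1) x ((\<lambda>_. 0)(1 := x)) \<partial>lborel)"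
    proof (rule nn_integral_mono)
      fix x
      let ?v = "(\<lambda>_. 0)(1 := x) :: nat \<Rightarrow> real"
      have "ennreal (disc x) * chain_integral (Suc m) [x] \<le> iter_integral ?F (Suc m) (Suc 1) x ?v" if "0 \<le> x" "x \<le> T"
      proof -
        have "ennreal (chain_coeff 1 ?v) * chain_integral (Suc m) (rev (map ?v [1..<Suc 1]))
          \<le> iter_integral (\<lambda>v. ennreal (chain_coeff (1 + Suc m) v) * \<beta> (1 + Suc m) v) (Suc m) (Suc 1) (?v 1) ?v"
          using that by (intro chain_integral_le_iter_integral \<beta>) (auto simp: chain_coeff_def disc_def)
        moreover have "chain_coeff 1 ?v = disc x" by (simp add: chain_coeff_def)
        moreover have "rev (map ?v [1..<Suc 1]) = [x]" by simp
        moreover have "1 + Suc m = m + 2" "?v 1 = x" by simp_all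
        ultimately show ?thesis by (simp only:)
      qed
      then show "ennreal (disc x) * chain_integral (Suc m) [x] * indicator {0..T} x
        \<le> iter_integral ?F (Suc m) (Suc 1) x ?v * indicator {0..T} x"
        by (cases "x \<in> {0..T}") (auto simp del: chain_integral.simps iter_integral.simps)
    qed
    then show ?thesis unfolding F s .
  qed
  have "(\<Sum>i. ?I i) = ?I 0 + (\<Sum>m. ?I (Suc m))"
    using suminf_offset[of ?I 1] by (simp add: add.commute del: chain_integral.simps)
  also have "\<dots> \<le> (\<integral>\<^sup>+ v1\<in>{0..T}. ennreal (exp (- \<kappa> * (T - v1))) * \<beta> 1 (\<lambda>_. v1) \<partial>lborel)
      + (\<Sum>m. simplex_integral (m + 2) T
          (\<lambda>v. ennreal ((\<Prod>i=2..m + 2. \<Phi> (v (i - 1) - v i)) * exp (- \<kappa> * (T - v 1)))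
                * \<beta> (m + 2) v))"
    by (intro add_mono 0 suminf_le Suc) auto
  finally show ?thesis unfolding distrib_left[symmetric] by (rule mult_left_mono) simp
qed

end

section \<open>Integrating out the claims\<close>

lemma (in prob_space) indep_sets_reindex:
  assumes "indep_sets F (\<iota> ` J)" "inj_on \<iota> J"
  shows "indep_sets (\<lambda>j. F (\<iota> j)) J"
proof (rule indep_setsI)
  show "F (\<iota> j) \<subseteq> events" if "j \<in> J" for j
    using assms(1) that by (auto simp: indep_sets_def)
  fix A K assume K: "K \<noteq> {}" "K \<subseteq> J" "finite K" "\<forall>j\<in>K. A j \<in> F (\<iota> j)"
  have inj: "inj_on \<iota> K" using assms(2) K(2) by (rule inj_on_subset)
  let ?A = "\<lambda>i. A (inv_into K \<iota> i)"
  have inv: "inv_into K \<iota> (\<iota> j) = j" if "j \<in> K" for j using inj that by (rule inv_into_f_f)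
  have "prob (\<Inter>i\<in>\<iota> ` K. ?A i) = (\<Prod>i\<in>\<iota> ` K. prob (?A i))"
    using K inv by (intro indep_setsD[OF assms(1)]) auto
  also have "(\<Inter>i\<in>\<iota> ` K. ?A i) = (\<Inter>j\<in>K. A j)" using inv by auto
  also have "(\<Prod>i\<in>\<iota> ` K. prob (?A i)) = (\<Prod>j\<in>K. prob (A j))"
    using inv by (simp add: prod.reindex[OF inj])
  finally show "prob (\<Inter>j\<in>K. A j) = (\<Prod>j\<in>K. prob (A j))" .
qed

locale claim_space = prob_space M for M :: "'a measure" +
  fixes T :: real and N :: "'a \<Rightarrow> (real \<times> real) measure"
    and \<eta> \<theta> \<eta>b \<theta>b :: "nat \<Rightarrow> 'a \<Rightarrow> real"
    and f h :: "real \<Rightarrow> real" and g :: "real \<times> real \<Rightarrow> real"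
  assumes claims: "claims_model T N \<eta> \<theta> \<eta>b \<theta>b"
    and f_meas: "set_borel_measurable borel {0..} f"
    and f_nonneg: "\<And>x. 0 \<le> x \<Longrightarrow> 0 \<le> f x"
    and g_meas: "set_borel_measurable borel ({0..} \<times> {0..}) g"
    and g_nonneg: "\<And>x y. 0 \<le> x \<Longrightarrow> 0 \<le> y \<Longrightarrow> 0 \<le> g (x, y)"
    and h_meas: "set_borel_measurable borel {0..} h"
    and h_nonneg: "\<And>x. 0 \<le> x \<Longrightarrow> 0 \<le> h x"
    and h_mono: "mono_on {0..} h"
begin

text \<open>\<open>f\<close>, \<open>g\<close>, \<open>h\<close> are arbitrary outside the nonnegative arguments, hence the cutoffs.\<close>

definition f' :: "real \<Rightarrow> real" where "f' x = (if 0 \<le> x then f x else 0)"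
definition h' :: "real \<Rightarrow> real" where "h' x = (if 0 \<le> x then h x else 0)"
definition g' :: "real \<times> real \<Rightarrow> real" where "g' z = (if z \<in> {0..} \<times> {0..} then g z else 0)"

lemma f'_measurable [measurable]: "f' \<in> borel_measurable borel"
  using f_meas unfolding set_borel_measurable_def f'_def
  by (rule subst[rotated, where P="\<lambda>k. k \<in> borel_measurable borel"]) (auto simp: indicator_def)

lemma h'_measurable [measurable]: "h' \<in> borel_measurable borel"
  using h_meas unfolding set_borel_measurable_def h'_def
  by (rule subst[rotated, where P="\<lambda>k. k \<in> borel_measurable borel"]) (auto simp: indicator_def)

lemma g'_measurable [measurable]: "g' \<in> borel_measurable borel"
  using g_meas unfolding set_borel_measurable_def g'_def
  by (rule subst[rotated, where P="\<lambda>k. k \<in> borel_measurable borel"]) (auto simp: indicator_def)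

definition fz :: "real \<times> real \<Rightarrow> real" where "fz z = f' (fst z)"

lemma fz_measurable [measurable]: "fz \<in> borel_measurable borel"
  unfolding fz_def borel_prod[symmetric] by measurable

lemma fz_component: "i \<in> I \<Longrightarrow> (\<lambda>z. fz (z i)) \<in> borel_measurable (\<Pi>\<^sub>M j\<in>I. borel)"
proof -
  assume "i \<in> I"
  then have "(\<lambda>z. z i) \<in> measurable (\<Pi>\<^sub>M j\<in>I. (borel :: (real \<times> real) measure)) borel"
    by (rule measurable_component_singleton)
  from measurable_compose[OF this fz_measurable] show ?thesis .
qed

lemma fz_nonneg [simp]: "0 \<le> fz z"
  by (simp add: fz_def f'_def f_nonneg)

lemma h'_mono: "x \<le> y \<Longrightarrow> h' x \<le> h' y"
  using h_mono by (auto simp: h'_def h_nonneg monotone_on_def)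

section \<open>Joint law of the claims\<close>

definition Z :: "bool \<times> nat \<Rightarrow> 'a \<Rightarrow> real \<times> real" where
  "Z j \<omega> = (if fst j then (\<eta>b (snd j) \<omega>, \<theta>b (snd j) \<omega>) else (\<eta> (snd j) \<omega>, \<theta> (snd j) \<omega>))"

lemma Z_simps: "Z (True, i) = (\<lambda>\<omega>. (\<eta>b i \<omega>, \<theta>b i \<omega>))" "Z (False, i) = (\<lambda>\<omega>. (\<eta> i \<omega>, \<theta> i \<omega>))"
  by (simp_all add: Z_def fun_eq_iff)

abbreviation "inds \<equiv> (UNIV :: bool set) \<times> {1::nat..}"

definition \<rho> :: "(real \<times> real) measure" where "\<rho> = distr M borel (Z (True, 1))"

lemma Z_rv: "j \<in> inds \<Longrightarrow> random_variable borel (Z j)"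
proof -
  have "\<forall>i\<ge>1. random_variable borel (Z (False, i)) \<and> random_variable borel (Z (True, i))"
    using claims unfolding claims_model_def Z_simps by (elim conjE)
  then show "j \<in> inds \<Longrightarrow> random_variable borel (Z j)"
    by (cases j; cases "fst j") auto
qed

lemma Z_nonneg: "j \<in> inds \<Longrightarrow> \<omega> \<in> space M \<Longrightarrow> 0 \<le> fst (Z j \<omega>) \<and> 0 \<le> snd (Z j \<omega>)"
proof -
  have "\<forall>i\<ge>1. \<forall>\<omega>\<in>space M. 0 \<le> \<eta> i \<omega> \<and> 0 \<le> \<theta> i \<omega> \<and> 0 \<le> \<eta>b i \<omega> \<and> 0 \<le> \<theta>b i \<omega>"
    using claims unfolding claims_model_def by (elim conjE)
  then show "j \<in> inds \<Longrightarrow> \<omega> \<in> space M \<Longrightarrow> 0 \<le> fst (Z j \<omega>) \<and> 0 \<le> snd (Z j \<omega>)"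
    by (cases j; cases "fst j") (auto simp: Z_simps)
qed

lemma distr_Z: "j \<in> inds \<Longrightarrow> distr M borel (Z j) = \<rho>"
proof -
  have *: "\<forall>i\<ge>1. distr M borel (Z (False, i)) = distr M borel (Z (False, 1)) \<and>
      distr M borel (Z (True, i)) = distr M borel (Z (False, 1))"
    using claims unfolding claims_model_def Z_simps by (elim conjE)
  have "distr M borel (Z (b, i)) = distr M borel (Z (False, 1))" if "1 \<le> i" for b i
    using *[rule_format, OF that] by (cases b) auto
  from this[of "snd j" "fst j"] this[of 1 True]
  show "j \<in> inds \<Longrightarrow> distr M borel (Z j) = \<rho>" by (auto simp: \<rho>_def)
qed

definition claim_sets :: "(bool \<times> nat) option \<Rightarrow> 'a set set" where
  "claim_sets j = (case j of None \<Rightarrow> sets (natural_filtration M T N T)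
     | Some k \<Rightarrow> {Z k -` A \<inter> space M | A. A \<in> sets borel})"

lemma indep_claim_sets: "indep_sets claim_sets (insert None (Some ` inds))"
proof -
  have "(case j of None \<Rightarrow> sets (natural_filtration M T N T)
            | Some (b, i) \<Rightarrow> sets (vimage_algebra (space M)
                (if b then (\<lambda>\<omega>. (\<eta>b i \<omega>, \<theta>b i \<omega>)) else (\<lambda>\<omega>. (\<eta> i \<omega>, \<theta> i \<omega>)))
                (borel :: (real \<times> real) measure))) = claim_sets j" for j
  proof (cases j)
    case (Some k)
    then show ?thesis
      by (cases k; cases "fst k") (simp_all add: claim_sets_def Z_simps sets_vimage_algebra2)
  qed (simp add: claim_sets_def)
  moreover have "indep_sets
       (\<lambda>j. case j of
              None \<Rightarrow> sets (natural_filtration M T N T)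
            | Some (b, i) \<Rightarrow> sets (vimage_algebra (space M)
                (if b then (\<lambda>\<omega>. (\<eta>b i \<omega>, \<theta>b i \<omega>)) else (\<lambda>\<omega>. (\<eta> i \<omega>, \<theta> i \<omega>)))
                (borel :: (real \<times> real) measure)))
       (insert None (Some ` inds))"
    using claims unfolding claims_model_def by (elim conjE)
  ultimately show ?thesis by (simp only:)
qed

lemma indep_Z: assumes "inj_on \<iota> J" "\<iota> ` J \<subseteq> inds"
  shows "indep_vars (\<lambda>_. borel) (\<lambda>j. Z (\<iota> j)) J"
  unfolding indep_vars_def2
proof (intro conjI ballI)
  show "random_variable borel (Z (\<iota> j))" if "j \<in> J" for j
    using assms(2) that by (intro Z_rv) auto
  have "indep_sets (\<lambda>j. claim_sets ((Some \<circ> \<iota>) j)) J"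
  proof (rule indep_sets_reindex[where F=claim_sets and \<iota>="Some \<circ> \<iota>"])
    show "indep_sets claim_sets ((Some \<circ> \<iota>) ` J)"
      using assms(2) by (intro indep_sets_mono_index[OF _ indep_claim_sets]) auto
    show "inj_on (Some \<circ> \<iota>) J" using assms(1) by (intro comp_inj_on) auto
  qed
  then show "indep_sets (\<lambda>i. {Z (\<iota> i) -` A \<inter> space M |A. A \<in> sets borel}) J"
    by (simp add: claim_sets_def)
qed

lemma prob_space_\<rho>: "prob_space \<rho>"
  unfolding \<rho>_def by (rule prob_space_distr) (rule Z_rv, simp)

lemma sets_\<rho> [simp, measurable_cong]: "sets \<rho> = sets borel"
  by (simp add: \<rho>_def)

lemma nn_integral_Z:
  assumes "inj_on \<iota> J" "\<iota> ` J \<subseteq> inds" "J \<noteq> {}"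
    and F: "F \<in> borel_measurable (\<Pi>\<^sub>M j\<in>J. borel)"
  shows "(\<integral>\<^sup>+ \<omega>. F (\<lambda>j\<in>J. Z (\<iota> j) \<omega>) \<partial>M) = (\<integral>\<^sup>+ z. F z \<partial>(\<Pi>\<^sub>M j\<in>J. \<rho>))"
proof -
  have rv: "random_variable borel (Z (\<iota> j))" if "j \<in> J" for j
    using assms(2) that by (intro Z_rv) auto
  have "distr M (\<Pi>\<^sub>M j\<in>J. borel) (\<lambda>\<omega>. \<lambda>j\<in>J. Z (\<iota> j) \<omega>) = (\<Pi>\<^sub>M j\<in>J. distr M borel (Z (\<iota> j)))"
    using indep_Z[OF assms(1,2)] by (subst (asm) indep_vars_iff_distr_eq_PiM'[OF assms(3)]) (auto intro: rv)
  also have "\<dots> = (\<Pi>\<^sub>M j\<in>J. \<rho>)"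
    using assms(2) by (intro PiM_cong) (auto intro!: distr_Z)
  finally have *: "(\<Pi>\<^sub>M j\<in>J. \<rho>) = distr M (\<Pi>\<^sub>M j\<in>J. borel) (\<lambda>\<omega>. \<lambda>j\<in>J. Z (\<iota> j) \<omega>)" ..
  show ?thesis unfolding *
  proof (rule nn_integral_distr[symmetric])
    show "(\<lambda>\<omega>. \<lambda>j\<in>J. Z (\<iota> j) \<omega>) \<in> M \<rightarrow>\<^sub>M (\<Pi>\<^sub>M j\<in>J. borel)"
      by (intro measurable_restrict rv)
  qed (use F in simp)
qed

text \<open>The coordinate 0 carries the distinguished claim.\<close>

definition \<Omega> :: "real \<Rightarrow> real list \<Rightarrow> (nat \<Rightarrow> real \<times> real) \<Rightarrow> ennreal" where
  "\<Omega> c cs z = ennreal (g' (z 0)) *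
     ennreal (h' (c * fz (z 0) + (\<Sum>j<length cs. cs ! j * fz (z (Suc j)))))"

text \<open>One admissible labelling: the distinguished claim is a barred copy and the others are
  claims of jumps. By \<open>Gc_eq\<close> any other injective labelling would give the same
  \<open>Gc\<close>.\<close>

definition \<iota>0 :: "nat \<Rightarrow> bool \<times> nat" where
  "\<iota>0 j = (case j of 0 \<Rightarrow> (True, 1) | Suc j \<Rightarrow> (False, Suc j))"

definition Gc :: "real \<Rightarrow> real list \<Rightarrow> ennreal" where
  "Gc c cs = (\<integral>\<^sup>+ \<omega>. \<Omega> c cs (\<lambda>j. Z (\<iota>0 j) \<omega>) \<partial>M)"

lemma \<Omega>_restrict: "\<Omega> c cs (restrict z {..length cs}) = \<Omega> c cs z"
  unfolding \<Omega>_def by (intro arg_cong2[where f="(*)"] arg_cong[where f=ennreal] arg_cong[where f=h']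
      arg_cong2[where f="(+)"] sum.cong) auto

lemma \<Omega>_measurable: "\<Omega> c cs \<in> borel_measurable (\<Pi>\<^sub>M j\<in>{..length cs}. borel)"
proof -
  have [measurable]: "(\<lambda>z. z j) \<in> borel_measurable (\<Pi>\<^sub>M j\<in>{..length cs}. (borel :: (real \<times> real) measure))"
    if "j \<le> length cs" for j
    using that by (intro measurable_component_singleton) auto
  have [measurable]: "(\<lambda>z. fz (z (Suc j))) \<in> borel_measurable (\<Pi>\<^sub>M j\<in>{..length cs}. (borel :: (real \<times> real) measure))"
    if "j < length cs" for j
    using that by (intro fz_component) auto
  have [measurable]: "(\<lambda>z. \<Sum>j<length cs. cs ! j * fz (z (Suc j))) \<in> borel_measurable (\<Pi>\<^sub>M j\<in>{..length cs}. (borel :: (real \<times> real) measure))"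
    by (intro borel_measurable_sum borel_measurable_times) auto
  show ?thesis unfolding \<Omega>_def by measurable
qed

text \<open>The pairs are independent with one common law, so only the injectivity of the labelling
  matters. This links the labels occurring in \<beta> with those occurring along the jumps.\<close>

lemma Gc_eq:
  assumes "inj_on \<iota> {..length cs}" "\<iota> ` {..length cs} \<subseteq> inds"
  shows "(\<integral>\<^sup>+ \<omega>. \<Omega> c cs (\<lambda>j. Z (\<iota> j) \<omega>) \<partial>M) = Gc c cs"
proof -
  have *: "(\<integral>\<^sup>+ \<omega>. \<Omega> c cs (\<lambda>j. Z (\<iota> j) \<omega>) \<partial>M) = (\<integral>\<^sup>+ z. \<Omega> c cs z \<partial>(\<Pi>\<^sub>M j\<in>{..length cs}. \<rho>))"
    if "inj_on \<iota> {..length cs}" "\<iota> ` {..length cs} \<subseteq> inds" for \<iota>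
    using nn_integral_Z[OF that _ \<Omega>_measurable] by (simp add: \<Omega>_restrict)
  have "inj_on \<iota>0 {..length cs}" by (auto simp: inj_on_def \<iota>0_def split: nat.splits)
  moreover have "\<iota>0 ` {..length cs} \<subseteq> inds" by (auto simp: \<iota>0_def split: nat.splits)
  ultimately show ?thesis unfolding Gc_def using *[of \<iota>] *[of \<iota>0] assms by simp
qed

lemma Gc_measurable: "(\<lambda>(c, cs). Gc c cs) \<in> borel_measurable (borel \<Otimes>\<^sub>M list_borel)"
proof -
  have [measurable]: "(\<lambda>\<omega>. Z (\<iota>0 j) \<omega>) \<in> borel_measurable M" for j
    by (rule Z_rv) (auto simp: \<iota>0_def split: nat.splits)
  have "(\<lambda>z. \<Sum>j<m. nth_default 0 (snd (fst z)) j * fz (Z (\<iota>0 (Suc j)) (snd z)))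
      \<in> borel_measurable ((borel \<Otimes>\<^sub>M list_borel) \<Otimes>\<^sub>M M)" for m
    by measurable
  from measurable_compose_countable[where g="\<lambda>z. length (snd (fst z))", OF this]
  have [measurable]: "(\<lambda>z. \<Sum>j<length (snd (fst z)). nth_default 0 (snd (fst z)) j * fz (Z (\<iota>0 (Suc j)) (snd z)))
      \<in> borel_measurable ((borel \<Otimes>\<^sub>M list_borel) \<Otimes>\<^sub>M M)"
    by simp
  have "(\<lambda>z. \<Omega> (fst (fst z)) (snd (fst z)) (\<lambda>j. Z (\<iota>0 j) (snd z))) = (\<lambda>z. ennreal (g' (Z (\<iota>0 0) (snd z))) *
     ennreal (h' (fst (fst z) * fz (Z (\<iota>0 0) (snd z)) +
       (\<Sum>j<length (snd (fst z)). nth_default 0 (snd (fst z)) j * fz (Z (\<iota>0 (Suc j)) (snd z))))))"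
    unfolding \<Omega>_def by (auto simp: nth_default_nth)
  also have "\<dots> \<in> borel_measurable ((borel \<Otimes>\<^sub>M list_borel) \<Otimes>\<^sub>M M)" by measurable
  finally have "(\<lambda>(x, \<omega>). \<Omega> (fst x) (snd x) (\<lambda>j. Z (\<iota>0 j) \<omega>)) \<in> borel_measurable ((borel \<Otimes>\<^sub>M list_borel) \<Otimes>\<^sub>M M)"
    by (simp add: case_prod_beta')
  then have "(\<lambda>x. Gc (fst x) (snd x)) \<in> borel_measurable (borel \<Otimes>\<^sub>M list_borel)"
    unfolding Gc_def by (rule borel_measurable_nn_integral)
  then show ?thesis by (simp add: case_prod_beta')
qed

text \<open>Exchangeability: a permutation of the discount factors is undone by permuting the labels
  of the nondistinguished claims.\<close>

lemma Gc_mset: assumes "mset cs = mset ds" shows "Gc c cs = Gc c ds"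
proof -
  obtain p where p: "p permutes {..<length ds}" "permute_list p ds = cs"
    using mset_eq_permutation[OF assms] by blast
  have len: "length cs = length ds" using mset_eq_length[OF assms] .
  define \<iota> where "\<iota> j = (case j of 0 \<Rightarrow> (True, 1::nat) | Suc j \<Rightarrow> (False, Suc (p j)))" for j
  have inj_p: "p i = p j \<longleftrightarrow> i = j" for i j using permutes_inj[OF p(1)] by (auto dest: injD)
  have "inj_on \<iota> {..length cs}" "\<iota> ` {..length cs} \<subseteq> inds"
    by (auto simp: inj_on_def \<iota>_def inj_p split: nat.splits)
  then have "Gc c cs = (\<integral>\<^sup>+ \<omega>. \<Omega> c cs (\<lambda>j. Z (\<iota> j) \<omega>) \<partial>M)" by (rule Gc_eq[symmetric])
  also have "\<dots> = Gc c ds"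
    unfolding Gc_def
  proof (rule nn_integral_cong)
    fix \<omega>
    have "(\<Sum>j<length cs. cs ! j * fz (Z (\<iota> (Suc j)) \<omega>))
        = (\<Sum>j<length ds. ds ! p j * fz (Z (False, Suc (p j)) \<omega>))"
      using p by (intro sum.cong) (auto simp: len \<iota>_def permute_list_nth)
    also have "\<dots> = (\<Sum>j<length ds. ds ! j * fz (Z (False, Suc j) \<omega>))"
      using permutes_imp_bij[OF p(1)] by (rule sum.reindex_bij_betw)
    finally show "\<Omega> c cs (\<lambda>j. Z (\<iota> j) \<omega>) = \<Omega> c ds (\<lambda>j. Z (\<iota>0 j) \<omega>)"
      unfolding \<Omega>_def by (simp add: \<iota>0_def \<iota>_def)
  qed
  finally show ?thesis .
qed

lemma \<Omega>_mono:
  assumes "(\<Sum>j<length cs. cs ! j * fz (z (Suc j))) \<le> (\<Sum>j<length ds. ds ! j * fz (z (Suc j)))"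
  shows "\<Omega> c cs z \<le> \<Omega> c ds z"
  unfolding \<Omega>_def using assms by (intro mult_left_mono ennreal_leI h'_mono) auto

lemma Gc_mono:
  assumes "\<And>d. d \<in> set ds \<Longrightarrow> d \<le> 1"
  shows "Gc c (cs @ ds) \<le> Gc c (cs @ replicate (length ds) 1)"
  unfolding Gc_def
proof (intro nn_integral_mono \<Omega>_mono)
  fix \<omega>
  have "(cs @ ds) ! j \<le> (cs @ replicate (length ds) 1) ! j" if "j < length (cs @ ds)" for j
    using that assms by (auto simp: nth_append)
  then show "(\<Sum>j<length (cs @ ds). (cs @ ds) ! j * fz (Z (\<iota>0 (Suc j)) \<omega>))
    \<le> (\<Sum>j<length (cs @ replicate (length ds) 1). (cs @ replicate (length ds) 1) ! j * fz (Z (\<iota>0 (Suc j)) \<omega>))"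
    by (auto intro!: sum_mono mult_right_mono)
qed

lemma Gc_append: "Gc c cs \<le> Gc c (cs @ replicate p 1)"
  unfolding Gc_def
proof (intro nn_integral_mono \<Omega>_mono)
  fix \<omega>
  let ?z = "\<lambda>j. fz (Z (\<iota>0 (Suc j)) \<omega>)"
  have "(\<Sum>j<length cs. cs ! j * ?z j) = (\<Sum>j<length cs. (cs @ replicate p 1) ! j * ?z j)"
    by (intro sum.cong) (auto simp: nth_append)
  also have "\<dots> \<le> (\<Sum>j<length (cs @ replicate p 1). (cs @ replicate p 1) ! j * ?z j)"
    by (intro sum_mono2) (auto simp: nth_append)
  finally show "(\<Sum>j<length cs. cs ! j * ?z j) \<le> (\<Sum>j<length (cs @ replicate p 1). (cs @ replicate p 1) ! j * ?z j)" .
qed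


section \<open>The conditional expectation given the first component of the distinguished
  claim\<close>

definition csum :: "real list \<Rightarrow> (nat \<Rightarrow> real \<times> real) \<Rightarrow> real" where
  "csum cs z = (\<Sum>j<length cs. cs ! j * fz (z (Suc j)))"

lemma csum_measurable: "csum cs \<in> borel_measurable (\<Pi>\<^sub>M j\<in>{1..length cs}. borel)"
  unfolding csum_def
proof (intro borel_measurable_sum borel_measurable_times borel_measurable_const)
  fix j assume "j \<in> {..<length cs}"
  then show "(\<lambda>z. fz (z (Suc j))) \<in> borel_measurable (\<Pi>\<^sub>M j\<in>{1..length cs}. borel)"
    by (intro fz_component) auto
qed

text \<open>The expectation of the \<open>h\<close> factor when the first component of the
  distinguished claim is frozen at \<open>x\<close>; it serves as an explicit version of the
  conditional expectation.\<close>

definition Gx :: "real \<Rightarrow> real list \<Rightarrow> real \<Rightarrow> ennreal" where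
  "Gx c cs x = (\<integral>\<^sup>+ z. ennreal (h' (c * f' x + csum cs z)) \<partial>(\<Pi>\<^sub>M j\<in>{1..length cs}. \<rho>))"

lemma Gx_measurable [measurable]: "Gx c cs \<in> borel_measurable borel"
proof -
  interpret \<rho>: prob_space \<rho> by (rule prob_space_\<rho>)
  interpret P: product_sigma_finite "\<lambda>_::nat. \<rho>" by unfold_locales
  interpret F: finite_product_sigma_finite "\<lambda>_::nat. \<rho>" "{1..length cs}" by unfold_locales simp
  have [measurable]: "csum cs \<in> borel_measurable (\<Pi>\<^sub>M j\<in>{1..length cs}. \<rho>)"
    using csum_measurable by (subst measurable_cong_sets[OF sets_PiM_cong[OF refl sets_\<rho>] refl])
  have "(\<lambda>(x, z). ennreal (h' (c * f' x + csum cs z))) \<in> borel_measurable (borel \<Otimes>\<^sub>M (\<Pi>\<^sub>M j\<in>{1..length cs}. \<rho>))"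
    by measurable
  then show ?thesis unfolding Gx_def by (rule F.borel_measurable_nn_integral)
qed

text \<open>Only the distinguished claim is correlated with \<open>k\<close>, so the other ones can be integrated out.\<close>

lemma nn_integral_integrate_out:
  assumes \<iota>: "inj_on \<iota> {..length cs}" "\<iota> ` {..length cs} \<subseteq> inds"
    and [measurable]: "k \<in> borel_measurable borel"
  shows "(\<integral>\<^sup>+ \<omega>. k (Z (\<iota> 0) \<omega>) * ennreal (h' (c * fz (Z (\<iota> 0) \<omega>) + csum cs (\<lambda>j. Z (\<iota> j) \<omega>))) \<partial>M)
    = (\<integral>\<^sup>+ \<omega>. k (Z (\<iota> 0) \<omega>) * Gx c cs (fst (Z (\<iota> 0) \<omega>)) \<partial>M)"
proof -
  interpret \<rho>: prob_space \<rho> by (rule prob_space_\<rho>)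
  interpret P: product_sigma_finite "\<lambda>_::nat. \<rho>" by unfold_locales
  let ?J = "{1..length cs}"
  have J: "{..length cs} = insert 0 ?J" by auto
  define F where "F z = k (z 0) * ennreal (h' (c * fz (z 0) + csum cs z))" for z
  have csum_restrict: "csum cs (restrict z {..length cs}) = csum cs z" for z
    unfolding csum_def by (intro sum.cong) auto
  have csum_upd: "csum cs (z(0 := y)) = csum cs z" for z y
    unfolding csum_def by (intro sum.cong) auto
  have c1: "csum cs \<in> borel_measurable (\<Pi>\<^sub>M j\<in>{..length cs}. borel)"
    unfolding csum_def
    by (intro borel_measurable_sum borel_measurable_times borel_measurable_const
        fz_component) auto
  have c0: "(\<lambda>z. z 0) \<in> borel_measurable (\<Pi>\<^sub>M j\<in>{..length cs}. (borel :: (real \<times> real) measure))"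
    by (rule measurable_component_singleton) simp
  have F: "F \<in> borel_measurable (\<Pi>\<^sub>M j\<in>{..length cs}. borel)"
  proof -
    note [measurable] = c0 c1
    show ?thesis unfolding F_def by measurable
  qed
  have F': "F \<in> borel_measurable (\<Pi>\<^sub>M j\<in>insert 0 ?J. \<rho>)"
    using F unfolding J by (subst measurable_cong_sets[OF sets_PiM_cong[OF refl sets_\<rho>] refl])
  have c2: "csum cs \<in> borel_measurable (\<Pi>\<^sub>M j\<in>?J. \<rho>)"
    using csum_measurable by (subst measurable_cong_sets[OF sets_PiM_cong[OF refl sets_\<rho>] refl])
  have "(\<integral>\<^sup>+ \<omega>. k (Z (\<iota> 0) \<omega>) * ennreal (h' (c * fz (Z (\<iota> 0) \<omega>) + csum cs (\<lambda>j. Z (\<iota> j) \<omega>))) \<partial>M)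
      = (\<integral>\<^sup>+ \<omega>. F (\<lambda>j\<in>{..length cs}. Z (\<iota> j) \<omega>) \<partial>M)"
    unfolding F_def csum_restrict by simp
  also have "\<dots> = (\<integral>\<^sup>+ z. F z \<partial>(\<Pi>\<^sub>M j\<in>{..length cs}. \<rho>))"
    by (rule nn_integral_Z[OF \<iota> _ F]) simp
  also have "\<dots> = (\<integral>\<^sup>+ y. \<integral>\<^sup>+ z. F (z(0 := y)) \<partial>(\<Pi>\<^sub>M j\<in>?J. \<rho>) \<partial>\<rho>)"
    unfolding J by (rule P.product_nn_integral_insert_rev[OF _ _ F']) auto
  also have "\<dots> = (\<integral>\<^sup>+ y. k y * Gx c cs (fst y) \<partial>\<rho>)"
  proof (rule nn_integral_cong)
    fix y
    have "(\<integral>\<^sup>+ z. F (z(0 := y)) \<partial>(\<Pi>\<^sub>M j\<in>?J. \<rho>))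
        = (\<integral>\<^sup>+ z. k y * ennreal (h' (c * f' (fst y) + csum cs z)) \<partial>(\<Pi>\<^sub>M j\<in>?J. \<rho>))"
      unfolding F_def csum_upd by (simp add: fz_def)
    also have "\<dots> = k y * Gx c cs (fst y)"
      unfolding Gx_def by (intro nn_integral_cmult measurable_compose[OF _ measurable_ennreal]
          measurable_compose[OF _ h'_measurable] borel_measurable_add c2) simp
    finally show "(\<integral>\<^sup>+ z. F (z(0 := y)) \<partial>(\<Pi>\<^sub>M j\<in>?J. \<rho>)) = k y * Gx c cs (fst y)" .
  qed
  also have "\<dots> = (\<integral>\<^sup>+ \<omega>. k (Z (\<iota> 0) \<omega>) * Gx c cs (fst (Z (\<iota> 0) \<omega>)) \<partial>M)"
  proof -
    have 0: "\<iota> 0 \<in> inds" using \<iota>(2) by auto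
    have "fst \<in> borel_measurable (borel :: (real \<times> real) measure)"
      unfolding borel_prod[symmetric] by (rule measurable_fst)
    from measurable_compose[OF this Gx_measurable]
    have "(\<lambda>y :: real \<times> real. Gx c cs (fst y)) \<in> borel_measurable borel" .
    then have m: "(\<lambda>y. k y * Gx c cs (fst y)) \<in> borel_measurable borel"
      using assms(3) by (intro borel_measurable_times_ennreal)
    show ?thesis unfolding distr_Z[OF 0, symmetric]
      by (rule nn_integral_distr[OF Z_rv[OF 0]]) (use m in simp)
  qed
  finally show ?thesis .
qed

text \<open>The argument of \<open>h\<close> involves the first pair only through its first
  component, and the other claims are independent of this pair. Hence \<open>Gx\<close> is a version
  of the conditional expectation, and integrating it against the claim \<open>g\<close> gives back
  the unconditional expectation.\<close>

lemma claim_expectation_eq: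
  fixes n p :: nat and v :: "nat \<Rightarrow> real" and \<kappa> :: real
  assumes n: "1 \<le> n"
  defines "e \<equiv> \<lambda>k. exp (- \<kappa> * (T - v k))"
  shows "claim_expectation M T \<kappa> f g h \<eta> \<eta>b \<theta>b n p v
    = Gc (e 1) (map e [2..<Suc n] @ replicate p 1)"
proof -
  define cs where "cs = map e [2..<Suc n] @ replicate p 1"
  have len: "length cs = n - 1 + p" by (simp add: cs_def del: upt_Suc)
  \<comment> \<open>The coordinates below n take the barred claims 1, ..., n, and the next p
    coordinates the unbarred claims 1, ..., p.\<close>
  define \<iota> where "\<iota> j = (if j < n then (True, Suc j) else (False, Suc (j - n)))" for j
  have \<iota>: "inj_on \<iota> {..length cs}" "\<iota> ` {..length cs} \<subseteq> inds"
    by (auto simp: inj_on_def \<iota>_def split: if_splits)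
  have \<iota>0: "\<iota> 0 = (True, 1)" using n by (simp add: \<iota>_def)
  define R where "R \<omega> = ennreal (h' (e 1 * fz (Z (\<iota> 0) \<omega>) + csum cs (\<lambda>j. Z (\<iota> j) \<omega>)))" for \<omega>
  have Z_inds: "\<iota> j \<in> inds" for j by (auto simp: \<iota>_def)
  have [measurable]: "random_variable borel (Z (\<iota> j))" for j by (rule Z_rv[OF Z_inds])
  have R_meas [measurable]: "R \<in> borel_measurable M" unfolding R_def csum_def by measurable
  have csum: "csum cs z = (\<Sum>k=2..n. e k * fz (z (k - 1))) + (\<Sum>i=1..p. fz (z (n - 1 + i)))" for z
  proof -
    have "csum cs z = (\<Sum>j<n - 1 + p. cs ! j * fz (z (Suc j)))" by (simp add: csum_def len)
    also have "\<dots> = (\<Sum>j<n - 1. cs ! j * fz (z (Suc j))) + (\<Sum>j=n-1..<n - 1 + p. cs ! j * fz (z (Suc j)))"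
      by (simp add: lessThan_atLeast0 sum.atLeastLessThan_concat)
    also have "(\<Sum>j<n - 1. cs ! j * fz (z (Suc j))) = (\<Sum>k=2..n. e k * fz (z (k - 1)))"
      by (rule sum.reindex_bij_witness[of _ "\<lambda>k. k - 2" "\<lambda>j. j + 2"])
        (use n in \<open>auto simp: cs_def nth_append simp del: upt_Suc\<close>)
    also have "(\<Sum>j=n-1..<n - 1 + p. cs ! j * fz (z (Suc j))) = (\<Sum>i=1..p. fz (z (n - 1 + i)))"
      by (rule sum.reindex_bij_witness[of _ "\<lambda>i. n + i - 2" "\<lambda>j. j + 2 - n"])
        (use n in \<open>auto simp: cs_def nth_append simp del: upt_Suc\<close>)
    finally show ?thesis .
  qed
  have R_eq: "ennreal (h ((\<Sum>k=1..n. e k * f (\<eta>b k \<omega>)) + (\<Sum>i=1..p. f (\<eta> i \<omega>)))) = R \<omega>"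
    if "\<omega> \<in> space M" for \<omega>
  proof -
    have pos: "0 \<le> \<eta>b k \<omega>" "0 \<le> \<eta> k \<omega>" if "1 \<le> k" for k
      using Z_nonneg[of "(True, k)" \<omega>] Z_nonneg[of "(False, k)" \<omega>] that \<open>\<omega> \<in> space M\<close> by (auto simp: Z_simps)
    have s: "(\<Sum>k=1..n. e k * f (\<eta>b k \<omega>)) = e 1 * f (\<eta>b 1 \<omega>) + (\<Sum>k=2..n. e k * f (\<eta>b k \<omega>))"
      using n by (subst sum.atLeast_Suc_atMost) (auto simp: numeral_2_eq_2)
    have 1: "fz (Z (\<iota> 0) \<omega>) = f (\<eta>b 1 \<omega>)"
      using pos by (simp add: \<iota>0 Z_simps fz_def f'_def)
    have 2: "(\<Sum>k=2..n. e k * fz (Z (\<iota> (k - 1)) \<omega>)) = (\<Sum>k=2..n. e k * f (\<eta>b k \<omega>))"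
      by (intro sum.cong) (auto simp: \<iota>_def Z_simps fz_def f'_def pos)
    have 3: "(\<Sum>i=1..p. fz (Z (\<iota> (n - 1 + i)) \<omega>)) = (\<Sum>i=1..p. f (\<eta> i \<omega>))"
    proof (rule sum.cong[OF refl])
      fix i assume i: "i \<in> {1..p}"
      then have "\<iota> (n - 1 + i) = (False, i)" using n by (auto simp: \<iota>_def)
      then show "fz (Z (\<iota> (n - 1 + i)) \<omega>) = f (\<eta> i \<omega>)"
        using i pos by (simp add: Z_simps fz_def f'_def)
    qed
    have e0: "0 \<le> e k" for k by (simp add: e_def)
    have "0 \<le> (\<Sum>k=1..n. e k * f (\<eta>b k \<omega>)) + (\<Sum>i=1..p. f (\<eta> i \<omega>))"
      by (intro add_nonneg_nonneg sum_nonneg mult_nonneg_nonneg e0 f_nonneg pos) auto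
    then show ?thesis unfolding R_def csum 1 2 3 s by (simp add: h'_def add.assoc)
  qed
  have \<eta>b1 [measurable]: "\<eta>b 1 \<in> borel_measurable M"
  proof -
    have "(\<lambda>\<omega>. fst (Z (True, 1) \<omega>)) \<in> borel_measurable M"
      using Z_rv[of "(True, 1)"] unfolding borel_prod[symmetric] by simp
    then show ?thesis by (simp add: Z_simps)
  qed
  define F where "F = vimage_algebra (space M) (\<eta>b 1) (borel :: real measure)"
  have sub: "subalgebra M F"
    unfolding subalgebra_def F_def
    by (auto simp: sets_vimage_algebra2 simp del: One_nat_def intro: measurable_sets[OF \<eta>b1])
  interpret F: finite_measure_subalgebra M F by unfold_locales (rule sub)
  have G_meas: "(\<lambda>\<omega>. Gx (e 1) cs (\<eta>b 1 \<omega>)) \<in> borel_measurable F"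
    unfolding F_def by (rule measurable_compose[OF measurable_vimage_algebra1 Gx_measurable]) auto
  have int_out: "(\<integral>\<^sup>+ \<omega>. k (Z (\<iota> 0) \<omega>) * R \<omega> \<partial>M) = (\<integral>\<^sup>+ \<omega>. k (Z (\<iota> 0) \<omega>) * Gx (e 1) cs (\<eta>b 1 \<omega>) \<partial>M)"
    if "k \<in> borel_measurable borel" for k
    using nn_integral_integrate_out[OF \<iota> that, of "e 1"] by (simp add: R_def \<iota>0 Z_simps)
  have AE1: "AE \<omega> in M. Gx (e 1) cs (\<eta>b 1 \<omega>) = nn_cond_exp M F R \<omega>"
  \<comment> \<open>The defining identity of the conditional expectation is the formula for
    integrating out, tested with indicators of sets in the first component.\<close>
  proof (rule F.nn_cond_exp_charact[OF _ R_meas G_meas])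
    fix A assume "A \<in> sets F"
    then obtain B where B: "B \<in> sets borel" "A = \<eta>b 1 -` B \<inter> space M"
      unfolding F_def by (auto simp: sets_vimage_algebra2)
    have "(\<lambda>z. indicator B (fst z) :: ennreal) \<in> borel_measurable (borel :: (real \<times> real) measure)"
      using B(1) unfolding borel_prod[symmetric] by measurable
    from int_out[OF this] have "(\<integral>\<^sup>+ \<omega>. indicator B (\<eta>b 1 \<omega>) * R \<omega> \<partial>M)
        = (\<integral>\<^sup>+ \<omega>. indicator B (\<eta>b 1 \<omega>) * Gx (e 1) cs (\<eta>b 1 \<omega>) \<partial>M)"
      by (simp add: \<iota>0 Z_simps)
    moreover have "(\<integral>\<^sup>+ \<omega>\<in>A. X \<omega> \<partial>M) = (\<integral>\<^sup>+ \<omega>. indicator B (\<eta>b 1 \<omega>) * X \<omega> \<partial>M)" for X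
      by (intro nn_integral_cong) (auto simp: B(2) indicator_def)
    ultimately show "(\<integral>\<^sup>+ \<omega>\<in>A. R \<omega> \<partial>M) = (\<integral>\<^sup>+ \<omega>\<in>A. Gx (e 1) cs (\<eta>b 1 \<omega>) \<partial>M)" by simp
  qed
  have AE2: "AE \<omega> in M. nn_cond_exp M F R \<omega> = nn_cond_exp M F
      (\<lambda>\<omega>'. ennreal (h ((\<Sum>k=1..n. e k * f (\<eta>b k \<omega>')) + (\<Sum>i=1..p. f (\<eta> i \<omega>'))))) \<omega>"
  proof (rule F.nn_cond_exp_cong)
    show "AE \<omega> in M. R \<omega> = ennreal (h ((\<Sum>k=1..n. e k * f (\<eta>b k \<omega>)) + (\<Sum>i=1..p. f (\<eta> i \<omega>))))"
      by (rule AE_I2) (rule R_eq[symmetric])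
    show "(\<lambda>\<omega>. ennreal (h ((\<Sum>k=1..n. e k * f (\<eta>b k \<omega>)) + (\<Sum>i=1..p. f (\<eta> i \<omega>))))) \<in> borel_measurable M"
      using R_meas by (subst measurable_cong[OF R_eq]) auto
  qed (rule R_meas)
  have "claim_expectation M T \<kappa> f g h \<eta> \<eta>b \<theta>b n p v
      = (\<integral>\<^sup>+ \<omega>. ennreal (g' (Z (\<iota> 0) \<omega>)) * Gx (e 1) cs (\<eta>b 1 \<omega>) \<partial>M)"
    unfolding claim_expectation_def F_def[symmetric]
  proof (rule nn_integral_cong_AE, use AE1 AE2 AE_space in eventually_elim)
    case (elim \<omega>)
    have "g (\<eta>b 1 \<omega>, \<theta>b 1 \<omega>) = g' (Z (\<iota> 0) \<omega>)"
      using Z_nonneg[of "(True, 1)" \<omega>] elim(3) by (simp add: g'_def \<iota>0 Z_simps)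
    then show ?case unfolding elim(1) elim(2) by (simp add: e_def)
  qed
  also have "\<dots> = (\<integral>\<^sup>+ \<omega>. ennreal (g' (Z (\<iota> 0) \<omega>)) * R \<omega> \<partial>M)"
    by (rule int_out[symmetric]) measurable
  also have "\<dots> = (\<integral>\<^sup>+ \<omega>. \<Omega> (e 1) cs (\<lambda>j. Z (\<iota> j) \<omega>) \<partial>M)"
    by (simp add: R_def \<Omega>_def csum_def)
  also have "\<dots> = Gc (e 1) cs" by (rule Gc_eq[OF \<iota>])
  finally show ?thesis by (simp add: cs_def)
qed

section \<open>Claims along the list of jump times\<close>

lemma g'_nonneg [simp]: "0 \<le> g' z"
  by (cases z) (auto simp: g'_def g_nonneg)

lemma h'_nonneg [simp]: "0 \<le> h' x"
  by (auto simp: h'_def h_nonneg)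

lemma nth_remove_nth:
  "i < length l \<Longrightarrow> j < length l - 1 \<Longrightarrow> remove_nth i l ! j = l ! (if j < i then j else Suc j)"
  by (auto simp: remove_nth_def nth_append min_def)

lemma sum_remove_index:
  fixes a :: "nat \<Rightarrow> real"
  assumes "i < m"
  shows "(\<Sum>j<m. a j) = a i + (\<Sum>j<m - 1. a (if j < i then j else Suc j))"
proof -
  have "(\<Sum>j<m. a j) = a i + (\<Sum>j\<in>{..<m} - {i}. a j)"
    using assms by (intro sum.remove) auto
  also have "(\<Sum>j\<in>{..<m} - {i}. a j) = (\<Sum>j<m - 1. a (if j < i then j else Suc j))"
    by (rule sum.reindex_bij_witness[of _ "\<lambda>j. if j < i then j else Suc j" "\<lambda>j. if j < i then j else j - 1"])
      (use assms in auto)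
  finally show ?thesis .
qed

text \<open>K_T h(L_T) as a function of the list of jump times and of the sequence of claims, with
  \<open>e\<close> as discount factor.\<close>

definition W :: "(real \<Rightarrow> real) \<Rightarrow> real list \<Rightarrow> (nat \<Rightarrow> real \<times> real) \<Rightarrow> ennreal" where
  "W e l z = ennreal ((\<Sum>i<length l. e (l ! i) * g' (z i)) * h' (\<Sum>j<length l. e (l ! j) * fz (z j)))"

text \<open>K_T is a sum over jumps, so each jump is distinguished once; its claim is relabelled as
  coordinate 0 and the others keep their order.\<close>

lemma W_eq_sum:
  assumes "\<And>x. 0 \<le> e x"
  shows "W e l z = (\<Sum>i<length l. ennreal (e (l ! i)) *
    \<Omega> (e (l ! i)) (map e (remove_nth i l)) (\<lambda>j. case j of 0 \<Rightarrow> z i | Suc j \<Rightarrow> z (if j < i then j else Suc j)))"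
proof -
  have "W e l z = ennreal (\<Sum>i<length l. e (l ! i) * g' (z i) * h' (\<Sum>j<length l. e (l ! j) * fz (z j)))"
    by (simp add: W_def sum_distrib_right)
  also have "\<dots> = (\<Sum>i<length l. ennreal (e (l ! i) * g' (z i) * h' (\<Sum>j<length l. e (l ! j) * fz (z j))))"
    by (rule sum_ennreal[symmetric]) (simp add: assms)
  also have "\<dots> = (\<Sum>i<length l. ennreal (e (l ! i)) *
    \<Omega> (e (l ! i)) (map e (remove_nth i l)) (\<lambda>j. case j of 0 \<Rightarrow> z i | Suc j \<Rightarrow> z (if j < i then j else Suc j)))"
  proof (rule sum.cong[OF refl])
    fix i assume "i \<in> {..<length l}"
    then have i: "i < length l" by simp
    have "(\<Sum>j<length (map e (remove_nth i l)). map e (remove_nth i l) ! j *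
        fz (case Suc j of 0 \<Rightarrow> z i | Suc j \<Rightarrow> z (if j < i then j else Suc j)))
      = (\<Sum>j<length l - 1. e (l ! (if j < i then j else Suc j)) * fz (z (if j < i then j else Suc j)))"
      using i by (intro sum.cong) (auto simp: length_remove_nth nth_remove_nth)
    then have "(\<Sum>j<length l. e (l ! j) * fz (z j)) = e (l ! i) * fz (z i)
      + (\<Sum>j<length (map e (remove_nth i l)). map e (remove_nth i l) ! j *
        fz (case Suc j of 0 \<Rightarrow> z i | Suc j \<Rightarrow> z (if j < i then j else Suc j)))"
      by (simp only: sum_remove_index[OF i, of "\<lambda>j. e (l ! j) * fz (z j)"])
    then show "ennreal (e (l ! i) * g' (z i) * h' (\<Sum>j<length l. e (l ! j) * fz (z j)))
      = ennreal (e (l ! i)) *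
    \<Omega> (e (l ! i)) (map e (remove_nth i l)) (\<lambda>j. case j of 0 \<Rightarrow> z i | Suc j \<Rightarrow> z (if j < i then j else Suc j))"
      unfolding \<Omega>_def by (simp add: ennreal_mult assms mult.assoc)
  qed
  finally show ?thesis .
qed

text \<open>Claims are numbered from 1, positions in a list from 0.\<close>

definition \<zeta> :: "'a \<Rightarrow> nat \<Rightarrow> real \<times> real" where "\<zeta> \<omega> j = Z (False, Suc j) \<omega>"

lemma \<zeta>_measurable [measurable]: "\<zeta> \<in> measurable M (\<Pi>\<^sub>M j\<in>UNIV. borel)"
  unfolding \<zeta>_def[abs_def] by (rule measurable_PiM_single') (auto intro: Z_rv)

lemma nn_integral_W:
  assumes e: "\<And>x. 0 \<le> e x"
  shows "(\<integral>\<^sup>+ \<omega>. W e l (\<zeta> \<omega>) \<partial>M) = picks (\<lambda>x w. ennreal (e x) * Gc (e x) (map e w)) l"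
proof -
  \<comment> \<open>Sends coordinate 0 to the claim of the distinguished jump and the other
    coordinates, in order, to the remaining claims.\<close>
  define \<iota> where "\<iota> i j = (case j of 0 \<Rightarrow> (False, Suc i) | Suc j \<Rightarrow> (False, Suc (if j < i then j else Suc j)))"
    for i j :: nat
  have \<iota>: "inj_on (\<iota> i) A" "\<iota> i ` A \<subseteq> inds" for i A
    by (auto simp: inj_on_def \<iota>_def split: nat.splits if_splits)
  have \<iota>_inds: "\<iota> i j \<in> inds" for i j using \<iota>(2)[of i UNIV] by blast
  have eq: "(\<lambda>j. case j of 0 \<Rightarrow> \<zeta> \<omega> i | Suc j \<Rightarrow> \<zeta> \<omega> (if j < i then j else Suc j)) = (\<lambda>j. Z (\<iota> i j) \<omega>)" for i \<omega>
    by (auto simp: \<zeta>_def \<iota>_def fun_eq_iff split: nat.splits)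
  have [measurable]: "(\<lambda>\<omega>. \<Omega> c cs (\<lambda>j. Z (\<iota> i j) \<omega>)) \<in> borel_measurable M" for c cs i
  proof -
    have [measurable]: "random_variable borel (Z (\<iota> i j))" for j by (rule Z_rv[OF \<iota>_inds])
    show ?thesis unfolding \<Omega>_def by measurable
  qed
  have "(\<integral>\<^sup>+ \<omega>. W e l (\<zeta> \<omega>) \<partial>M) = (\<integral>\<^sup>+ \<omega>. (\<Sum>i<length l. ennreal (e (l ! i)) *
      \<Omega> (e (l ! i)) (map e (remove_nth i l)) (\<lambda>j. Z (\<iota> i j) \<omega>)) \<partial>M)"
    unfolding W_eq_sum[OF e] eq ..
  also have "\<dots> = (\<Sum>i<length l. \<integral>\<^sup>+ \<omega>. ennreal (e (l ! i)) *
      \<Omega> (e (l ! i)) (map e (remove_nth i l)) (\<lambda>j. Z (\<iota> i j) \<omega>) \<partial>M)"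
    by (rule nn_integral_sum) measurable
  also have "\<dots> = (\<Sum>i<length l. ennreal (e (l ! i)) * Gc (e (l ! i)) (map e (remove_nth i l)))"
  proof (rule sum.cong[OF refl])
    fix i
    have "(\<integral>\<^sup>+ \<omega>. ennreal (e (l ! i)) * \<Omega> (e (l ! i)) (map e (remove_nth i l)) (\<lambda>j. Z (\<iota> i j) \<omega>) \<partial>M)
      = ennreal (e (l ! i)) * (\<integral>\<^sup>+ \<omega>. \<Omega> (e (l ! i)) (map e (remove_nth i l)) (\<lambda>j. Z (\<iota> i j) \<omega>) \<partial>M)"
      by (rule nn_integral_cmult) measurable
    then show "(\<integral>\<^sup>+ \<omega>. ennreal (e (l ! i)) * \<Omega> (e (l ! i)) (map e (remove_nth i l)) (\<lambda>j. Z (\<iota> i j) \<omega>) \<partial>M)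
      = ennreal (e (l ! i)) * Gc (e (l ! i)) (map e (remove_nth i l))"
      using Gc_eq[OF \<iota>] by simp
  qed
  also have "\<dots> = picks (\<lambda>x w. ennreal (e x) * Gc (e x) (map e w)) l"
    unfolding picks_def by (intro sum.cong) (auto simp: nth_default_nth)
  finally show ?thesis .
qed

lemma Int_stable_claim_sets: "Int_stable (claim_sets j)"
proof (cases j)
  case None
  then show ?thesis using sets.Int_stable[of "natural_filtration M T N T"] by (simp add: claim_sets_def)
next
  case (Some k)
  show ?thesis unfolding Some claim_sets_def option.case
  proof (rule Int_stableI, safe)
    fix A B :: "(real \<times> real) set" assume "A \<in> sets borel" "B \<in> sets borel"
    then show "\<exists>C. Z k -` A \<inter> space M \<inter> (Z k -` B \<inter> space M) = Z k -` C \<inter> space M \<and> C \<in> sets borel"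
      by (intro exI[of _ "A \<inter> B"]) auto
  qed
qed

lemma space_natural_filtration [simp]: "space (natural_filtration M T N t) = space M"
  unfolding natural_filtration_def by (rule space_measure_of) auto

lemma sets_natural_filtration: "sets (natural_filtration M T N T) \<subseteq> sets M"
  using indep_claim_sets unfolding indep_sets_def by (auto simp: claim_sets_def dest!: bspec[of _ _ None])

lemma measurable_natural_filtration:
  "X \<in> measurable (natural_filtration M T N T) L \<Longrightarrow> X \<in> measurable M L"
  using sets_natural_filtration by (auto simp: measurable_def)

text \<open>The mutually independent family is grouped into two blocks, the sigma-algebra of
  \<open>N\<close> and that generated by all unbarred pairs. The hypothesis places \<open>X\<close>
  in the first block, and \<zeta> is measurable with respect to the second.\<close>

lemma distr_claims:
  assumes X: "X \<in> measurable (natural_filtration M T N T) list_borel"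
  shows "distr M list_borel X \<Otimes>\<^sub>M distr M (\<Pi>\<^sub>M j\<in>UNIV. borel) \<zeta>
    = distr M (list_borel \<Otimes>\<^sub>M (\<Pi>\<^sub>M j\<in>UNIV. borel)) (\<lambda>\<omega>. (X \<omega>, \<zeta> \<omega>))"
proof -
  let ?I = "case_bool {None} (Some ` ({False} \<times> {1::nat..})) :: bool \<Rightarrow> (bool \<times> nat) option set"
  have "indep_sets (\<lambda>b. sigma_sets (space M) (\<Union>i\<in>?I b. claim_sets i)) UNIV"
  proof (rule indep_sets_collect_sigma)
    have "(\<Union>b\<in>UNIV. ?I b) \<subseteq> insert None (Some ` inds)" by (auto split: bool.splits)
    then show "indep_sets claim_sets (\<Union>b\<in>UNIV. ?I b)"
      by (rule indep_sets_mono_index[OF _ indep_claim_sets])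
    show "disjoint_family_on ?I UNIV" by (auto simp: disjoint_family_on_def split: bool.splits)
  qed (rule Int_stable_claim_sets)
  moreover have "sigma_sets (space M) {X -` A \<inter> space M | A. A \<in> sets list_borel}
      \<subseteq> sigma_sets (space M) (\<Union>i\<in>?I True. claim_sets i)"
  proof (rule sigma_sets_mono, safe)
    fix A assume "A \<in> sets list_borel"
    then have "X -` A \<inter> space M \<in> sets (natural_filtration M T N T)"
      using measurable_sets[OF X] by simp
    then show "X -` A \<inter> space M \<in> sigma_sets (space M) (\<Union>i\<in>?I True. claim_sets i)"
      by (intro sigma_sets.Basic) (simp add: claim_sets_def)
  qed
  moreover have "sigma_sets (space M) {\<zeta> -` A \<inter> space M | A. A \<in> sets (\<Pi>\<^sub>M j\<in>UNIV. borel)}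
      \<subseteq> sigma_sets (space M) (\<Union>i\<in>?I False. claim_sets i)"
  proof (rule sigma_sets_mono, safe)
    fix A assume A: "A \<in> sets (\<Pi>\<^sub>M j\<in>(UNIV :: nat set). (borel :: (real \<times> real) measure))"
    let ?S = "sigma (space M) (\<Union>i\<in>?I False. claim_sets i)"
    have sub: "(\<Union>i\<in>?I False. claim_sets i) \<subseteq> Pow (space M)" by (auto simp: claim_sets_def)
    have "\<zeta> \<in> measurable ?S (\<Pi>\<^sub>M j\<in>UNIV. borel)"
    proof (rule measurable_PiM_single')
      fix j
      show "(\<lambda>\<omega>. \<zeta> \<omega> j) \<in> borel_measurable ?S"
      proof (rule measurableI)
        fix B :: "(real \<times> real) set" assume "B \<in> sets borel"
        then have "(\<lambda>\<omega>. \<zeta> \<omega> j) -` B \<inter> space M \<in> claim_sets (Some (False, Suc j))"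
          by (auto simp: claim_sets_def \<zeta>_def)
        moreover have "Some (False, Suc j) \<in> ?I False" by auto
        ultimately have "(\<lambda>\<omega>. \<zeta> \<omega> j) -` B \<inter> space M \<in> (\<Union>i\<in>?I False. claim_sets i)"
          by (rule UN_I[rotated])
        then show "(\<lambda>\<omega>. \<zeta> \<omega> j) -` B \<inter> space ?S \<in> sets ?S"
          unfolding space_measure_of[OF sub] sets_measure_of[OF sub] by (rule sigma_sets.Basic)
      qed simp
    qed simp
    from measurable_sets[OF this A]
    show "\<zeta> -` A \<inter> space M \<in> sigma_sets (space M) (\<Union>i\<in>?I False. claim_sets i)"
      unfolding space_measure_of[OF sub] sets_measure_of[OF sub] .
  qed
  ultimately have ind: "indep_set (sigma_sets (space M) {X -` A \<inter> space M | A. A \<in> sets list_borel})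
     (sigma_sets (space M) {\<zeta> -` A \<inter> space M | A. A \<in> sets (\<Pi>\<^sub>M j\<in>UNIV. borel)})"
    unfolding indep_set_def by (rule_tac indep_sets_mono_sets) (auto split: bool.split)
  have rv [measurable]: "random_variable list_borel X"
    by (rule measurable_natural_filtration[OF X])
  interpret D1: prob_space "distr M list_borel X" by (rule prob_space_distr) simp
  interpret D2: prob_space "distr M (\<Pi>\<^sub>M j\<in>UNIV. borel) \<zeta>" by (rule prob_space_distr) simp
  show ?thesis
  proof (rule pair_measure_eqI)
    fix A B assume A: "A \<in> sets (distr M list_borel X)" and B: "B \<in> sets (distr M (\<Pi>\<^sub>M j\<in>UNIV. borel) \<zeta>)"
    then have [measurable]: "A \<in> sets list_borel" "B \<in> sets (\<Pi>\<^sub>M j\<in>UNIV. borel)" by auto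
    have "prob ((X -` A \<inter> space M) \<inter> (\<zeta> -` B \<inter> space M)) = prob (X -` A \<inter> space M) * prob (\<zeta> -` B \<inter> space M)"
      using A B by (intro indep_setD[OF ind] sigma_sets.Basic) auto
    moreover have "(X -` A \<inter> space M) \<inter> (\<zeta> -` B \<inter> space M) = (\<lambda>\<omega>. (X \<omega>, \<zeta> \<omega>)) -` (A \<times> B) \<inter> space M"
      by auto
    ultimately show "emeasure (distr M list_borel X) A * emeasure (distr M (\<Pi>\<^sub>M j\<in>UNIV. borel) \<zeta>) B
      = emeasure (distr M (list_borel \<Otimes>\<^sub>M (\<Pi>\<^sub>M j\<in>UNIV. borel)) (\<lambda>\<omega>. (X \<omega>, \<zeta> \<omega>))) (A \<times> B)"
      by (simp add: emeasure_distr emeasure_eq_measure ennreal_mult)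
  qed (auto intro: D1.sigma_finite_measure_axioms D2.sigma_finite_measure_axioms)
qed

text \<open>By independence the claims can be integrated first, for a fixed list of jump
  times.\<close>

lemma nn_integral_claims:
  assumes X: "X \<in> measurable (natural_filtration M T N T) list_borel"
    and [measurable]: "e \<in> borel_measurable borel" and e: "\<And>x. 0 \<le> e x"
  shows "(\<integral>\<^sup>+ \<omega>. W e (X \<omega>) (\<zeta> \<omega>) \<partial>M)
    = (\<integral>\<^sup>+ l. picks (\<lambda>x w. ennreal (e x) * Gc (e x) (map e w)) l \<partial>distr M list_borel X)"
proof -
  let ?P = "\<Pi>\<^sub>M j\<in>(UNIV :: nat set). (borel :: (real \<times> real) measure)"
  have rv [measurable]: "random_variable list_borel X"
    by (rule measurable_natural_filtration[OF X])
  interpret D: prob_space "distr M ?P \<zeta>" by (rule prob_space_distr) simp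
  have "(\<lambda>q. (\<Sum>i<m. e (nth_default 0 (fst q) i) * g' (snd q i)) * h' (\<Sum>j<m. e (nth_default 0 (fst q) j) * fz (snd q j)))
      \<in> borel_measurable (list_borel \<Otimes>\<^sub>M ?P)" for m
    by measurable
  from measurable_compose_countable[where g="\<lambda>q. length (fst q)", OF this]
  have "(\<lambda>q. (\<Sum>i<length (fst q). e (nth_default 0 (fst q) i) * g' (snd q i)) * h' (\<Sum>j<length (fst q). e (nth_default 0 (fst q) j) * fz (snd q j)))
      \<in> borel_measurable (list_borel \<Otimes>\<^sub>M ?P)"
    by simp
  moreover have "W e l z = ennreal ((\<Sum>i<length l. e (nth_default 0 l i) * g' (z i)) * h' (\<Sum>j<length l. e (nth_default 0 l j) * fz (z j)))" for l z
    unfolding W_def by (simp add: nth_default_nth)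
  ultimately have W [measurable]: "(\<lambda>q. W e (fst q) (snd q)) \<in> borel_measurable (list_borel \<Otimes>\<^sub>M ?P)"
    by simp
  have "(\<integral>\<^sup>+ \<omega>. W e (X \<omega>) (\<zeta> \<omega>) \<partial>M) = (\<integral>\<^sup>+ q. W e (fst q) (snd q) \<partial>distr M (list_borel \<Otimes>\<^sub>M ?P) (\<lambda>\<omega>. (X \<omega>, \<zeta> \<omega>)))"
    by (subst nn_integral_distr) auto
  also have "distr M (list_borel \<Otimes>\<^sub>M ?P) (\<lambda>\<omega>. (X \<omega>, \<zeta> \<omega>)) = distr M list_borel X \<Otimes>\<^sub>M distr M ?P \<zeta>"
    by (rule distr_claims[OF X, symmetric])
  also have "(\<integral>\<^sup>+ q. W e (fst q) (snd q) \<partial>(distr M list_borel X \<Otimes>\<^sub>M distr M ?P \<zeta>))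
      = (\<integral>\<^sup>+ l. \<integral>\<^sup>+ z. W e l z \<partial>distr M ?P \<zeta> \<partial>distr M list_borel X)"
    by (subst D.nn_integral_fst[symmetric]) (auto simp: case_prod_beta')
  also have "\<dots> = (\<integral>\<^sup>+ l. \<integral>\<^sup>+ \<omega>. W e l (\<zeta> \<omega>) \<partial>M \<partial>distr M list_borel X)"
  proof (rule nn_integral_cong)
    fix l
    have "(\<lambda>z. W e (fst (l, z)) (snd (l, z))) \<in> borel_measurable ?P" by measurable
    then show "(\<integral>\<^sup>+ z. W e l z \<partial>distr M ?P \<zeta>) = (\<integral>\<^sup>+ \<omega>. W e l (\<zeta> \<omega>) \<partial>M)"
      by (intro nn_integral_distr) auto
  qed
  finally show ?thesis unfolding nn_integral_W[OF e] .
qed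

end

section \<open>Paths\<close>

text \<open>If \<open>F\<close> is not right-continuous, then \<open>interval_measure F\<close> may be the zero measure.\<close>

lemma interval_measure_cases:
  "(\<forall>a b. a \<le> b \<longrightarrow> emeasure (interval_measure F) {a<..b} = ennreal (F b - F a))
    \<or> (\<forall>A. emeasure (interval_measure F) A = 0)"
proof (cases "(\<exists>\<mu>'. (\<forall>i\<in>{(a, b). a \<le> b}. \<mu>' (case i of (a, b) \<Rightarrow> {a<..b}) = (case i of (a, b) \<Rightarrow> ennreal (F b - F a)))
    \<and> measure_space UNIV (sigma_sets UNIV ((\<lambda>(a, b). {a<..b}) ` {(a, b :: real). a \<le> b})) \<mu>')
    \<and> \<not> (\<forall>i\<in>{(a, b). a \<le> b}. (case i of (a, b) \<Rightarrow> ennreal (F b - F a)) = 0)")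
  case True
  then obtain \<mu>' where \<mu>': "\<And>a b. a \<le> b \<Longrightarrow> \<mu>' {a<..b} = ennreal (F b - F a)"
    "measure_space UNIV (sigma_sets UNIV ((\<lambda>(a, b). {a<..b}) ` {(a, b :: real). a \<le> b})) \<mu>'"
    by force
  have s: "sets (interval_measure F) = sigma_sets UNIV ((\<lambda>(a, b). {a<..b}) ` {(a, b :: real). a \<le> b})"
    unfolding interval_measure_def by (rule sets_extend_measure) auto
  have pc: "positive (sets (interval_measure F)) \<mu>'" "countably_additive (sets (interval_measure F)) \<mu>'"
    using \<mu>'(2) unfolding measure_space_def s by blast+
  have "emeasure (interval_measure F) {a<..b} = ennreal (F b - F a)" if "a \<le> b" for a b
    by (rule emeasure_extend_measure_Pair[OF interval_measure_def _ _ pc]) (auto simp: \<mu>'(1) that)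
  then show ?thesis by blast
next
  case False
  then have "interval_measure F = measure_of UNIV ((\<lambda>(a, b). {a<..b}) ` {(a, b). a \<le> b}) (\<lambda>_. 0)"
    unfolding interval_measure_def extend_measure_def by (rule if_not_P)
  then show ?thesis by (simp add: emeasure_measure_of_conv)
qed

lemma continuous_at_right_of_LIMSEQ:
  fixes F :: "real \<Rightarrow> real"
  assumes mono: "\<And>x y. x \<le> y \<Longrightarrow> F x \<le> F y" and lim: "(\<lambda>n. F (a + 1 / Suc n)) \<longlonglongrightarrow> F a"
  shows "continuous (at_right a) F"
proof -
  have "\<forall>e>0. \<exists>d>0. F (a + d) - F a < e"
  proof (intro allI impI)
  fix e :: real assume "e > 0"
  then have "eventually (\<lambda>n. F (a + 1 / Suc n) < F a + e) sequentially"
    by (intro order_tendstoD(2)[OF lim]) simp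
  then obtain n where "F (a + 1 / Suc n) < F a + e" by (auto simp: eventually_sequentially)
  then show "\<exists>d>0. F (a + d) - F a < e" by (intro exI[of _ "1 / real (Suc n)"]) auto
  qed
  moreover have "continuous (at_right a) F \<longleftrightarrow> (\<forall>e>0. \<exists>d>0. F (a + d) - F a < e)"
    by (rule continuous_at_right_real_increasing) (rule mono)
  ultimately show ?thesis by simp
qed

lemma measurable_fst_strip [measurable]: "fst \<in> borel_measurable (strip_measure T)"
proof -
  have "(\<lambda>x. x) \<in> restrict_space lborel {0..T} \<rightarrow>\<^sub>M borel"
    by (intro measurable_restrict_space1) simp
  from measurable_compose[OF measurable_fst this] show ?thesis by (simp add: strip_measure_def)
qed

lemma measurable_snd_strip [measurable]: "snd \<in> borel_measurable (strip_measure T)"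
proof -
  have "(\<lambda>x. x) \<in> restrict_space lborel {0::real..} \<rightarrow>\<^sub>M borel"
    by (intro measurable_restrict_space1) simp
  from measurable_compose[OF measurable_snd this] show ?thesis by (simp add: strip_measure_def)
qed

lemma space_strip: "space (strip_measure T) = {0..T} \<times> {0..}"
  by (simp add: strip_measure_def space_pair_measure space_restrict_space)

text \<open>One realisation outside the exceptional null set. Beyond the two equations nothing is
  assumed about the path, neither right-continuity of \<open>H\<close> nor measurability of
  \<Lambda>.\<close>

locale hawkes_path = hawkes_kernel +
  fixes \<nu> :: "(real \<times> real) measure" and H :: "real \<Rightarrow> nat" and \<Lambda> :: "real \<Rightarrow> real"
  assumes sets_\<nu>: "sets \<nu> = sets (strip_measure T)"
    and H_eq: "\<And>t. t \<in> {0..T} \<Longrightarrow>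
      of_nat (H t) = (\<integral>\<^sup>+ (s, \<theta>). indicator {0<..t} s * indicator {..\<Lambda> s} \<theta> \<partial>\<nu>)"
    and \<Lambda>_eq: "\<And>t. t \<in> {0..T} \<Longrightarrow>
      \<Lambda> t = \<mu> + (LINT u:{0<..<t}|interval_measure (\<lambda>u. real (H (max 0 (min T u)))). \<Phi> (t - u))"
begin

definition F :: "real \<Rightarrow> real" where "F u = real (H (max 0 (min T u)))"

lemma clamp: "max 0 (min T u) \<in> {0..T}"
  using T_pos by auto

lemma F_eq: "t \<in> {0..T} \<Longrightarrow> F t = real (H t)"
  by (auto simp: F_def min_def max_def)

lemma H_mono: assumes "s \<in> {0..T}" "t \<in> {0..T}" "s \<le> t" shows "H s \<le> H t"
proof -
  have "(of_nat (H s) :: ennreal) \<le> of_nat (H t)"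
    unfolding H_eq[OF assms(1)] H_eq[OF assms(2)]
    using assms(3) by (intro nn_integral_mono) (auto simp: indicator_def)
  then show ?thesis by simp
qed

lemma H_0: "H 0 = 0"
proof -
  have "(of_nat (H 0) :: ennreal) = 0" using T_pos by (subst H_eq) (auto simp: case_prod_beta')
  then show ?thesis by simp
qed

lemma F_mono: "x \<le> y \<Longrightarrow> F x \<le> F y"
  unfolding F_def using clamp[of x] clamp[of y] by (auto intro!: H_mono)

definition S :: "real \<Rightarrow> (real \<times> real) set" where
  "S t = {z \<in> space \<nu>. 0 < fst z \<and> fst z \<le> t \<and> snd z \<le> \<Lambda> (fst z)}"

lemma space_\<nu>: "space \<nu> = {0..T} \<times> {0..}"
  using sets_eq_imp_space_eq[OF sets_\<nu>] by (simp add: space_strip)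

lemma measurable_fst_\<nu> [measurable]: "fst \<in> borel_measurable \<nu>"
  and measurable_snd_\<nu> [measurable]: "snd \<in> borel_measurable \<nu>"
  by (simp_all cong: measurable_cong_sets add: sets_\<nu> measurable_fst_strip measurable_snd_strip)

text \<open>Measurability of the region below \<Lambda> needs a Borel function that agrees with
  \<Lambda> on [0,T]; such a function becomes available only in the course of the argument.\<close>

lemma S_sets_of:
  assumes [measurable]: "q \<in> borel_measurable borel" and q: "\<And>s. s \<in> {0..T} \<Longrightarrow> \<Lambda> s = q s"
  shows "S t \<in> sets \<nu>"
proof -
  have "S t = {z \<in> space \<nu>. 0 < fst z \<and> fst z \<le> t \<and> snd z \<le> q (fst z)}"
    unfolding S_def by (auto simp: space_\<nu> q)
  also have "\<dots> \<in> sets \<nu>" by measurable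
  finally show ?thesis .
qed

lemma emeasure_S_of:
  assumes "S t \<in> sets \<nu>" "t \<in> {0..T}"
  shows "emeasure \<nu> (S t) = of_nat (H t)"
proof -
  have "of_nat (H t) = (\<integral>\<^sup>+ z. indicator (S t) z \<partial>\<nu>)"
    unfolding H_eq[OF assms(2)] by (intro nn_integral_cong) (auto simp: S_def indicator_def)
  then show ?thesis using assms(1) by simp
qed

text \<open>If the Stieltjes measure is zero, then \<Lambda> is the constant \<mu>. The region below
  it is thus measurable, \<open>H\<close> is its \<nu>-measure, and continuity from above of \<nu>
  gives right-continuity.\<close>

lemma F_right_cont_of_null:
  assumes "\<And>A. emeasure (interval_measure F) A = 0"
  shows "continuous (at_right a) F"
proof (rule continuous_at_right_of_LIMSEQ)
  have "\<Lambda> s = \<mu>" if "s \<in> {0..T}" for s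
  proof -
    have "AE u in interval_measure F. False"
      by (rule AE_I[of _ _ UNIV]) (auto simp: assms)
    then have "(LINT u:{0<..<s}|interval_measure F. \<Phi> (s - u)) = 0"
      unfolding set_lebesgue_integral_def by (intro integral_eq_zero_AE) auto
    then show ?thesis using \<Lambda>_eq[OF that] by (simp add: F_def[abs_def])
  qed
  then have S: "S t \<in> sets \<nu>" for t by (intro S_sets_of[of "\<lambda>_. \<mu>"]) auto
  define c where "c n = max 0 (min T (a + 1 / Suc n))" for n
  have c: "c n \<in> {0..T}" for n unfolding c_def by (rule clamp)
  have "decseq c" unfolding c_def
    by (intro decseq_SucI max.mono min.mono order_refl add_left_mono) (auto simp: field_simps)
  have c_lim: "c \<longlonglongrightarrow> max 0 (min T a)"
    unfolding c_def by (rule tendsto_eq_intros LIMSEQ_Suc[OF lim_1_over_n] refl | simp)+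
  have "(\<lambda>n. emeasure \<nu> (S (c n))) \<longlonglongrightarrow> emeasure \<nu> (\<Inter>n. S (c n))"
  proof (rule Lim_emeasure_decseq)
    show "decseq (\<lambda>n. S (c n))"
      using \<open>decseq c\<close> by (fastforce simp: decseq_def S_def)
    show "emeasure \<nu> (S (c n)) \<noteq> \<infinity>" for n
      using emeasure_S_of[OF S c] by simp
  qed (use S in auto)
  moreover have "(\<Inter>n. S (c n)) = S (max 0 (min T a))"
  proof -
    have "(\<forall>n. x \<le> c n) \<longleftrightarrow> x \<le> max 0 (min T a)" for x
    proof
      assume "\<forall>n. x \<le> c n" then show "x \<le> max 0 (min T a)"
        by (intro tendsto_lowerbound[OF c_lim]) auto
    next
      assume "x \<le> max 0 (min T a)"
      also have "\<dots> \<le> c n" for n unfolding c_def by (intro max.mono min.mono) auto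
      finally show "\<forall>n. x \<le> c n" by blast
    qed
    then show ?thesis unfolding S_def by auto
  qed
  ultimately have "(\<lambda>n. (of_nat (H (c n)) :: ennreal)) \<longlonglongrightarrow> of_nat (H (max 0 (min T a)))"
    using emeasure_S_of[OF S c] emeasure_S_of[OF S clamp] by simp
  then have "(\<lambda>n. ennreal (real (H (c n)))) \<longlonglongrightarrow> ennreal (real (H (max 0 (min T a))))"
    by (simp add: ennreal_of_nat_eq_real_of_nat)
  then have "(\<lambda>n. real (H (c n))) \<longlonglongrightarrow> real (H (max 0 (min T a)))"
    by (subst (asm) tendsto_ennreal_iff) auto
  then show "(\<lambda>n. F (a + 1 / real (Suc n))) \<longlonglongrightarrow> F a"
    by (simp add: F_def c_def)
qed (rule F_mono)

text \<open>If the Stieltjes measure is not zero, it gives half-open intervals their increments, and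
  continuity from above of this measure yields the claim. The two cases break the circle between the
  regularity of \<open>H\<close> and the meaning of its Stieltjes measure.\<close>

lemma F_right_cont: "continuous (at_right a) F"
proof (cases "\<forall>A. emeasure (interval_measure F) A = 0")
  case True
  then show ?thesis by (intro F_right_cont_of_null) auto
next
  case False
  then have I: "emeasure (interval_measure F) {a<..b} = ennreal (F b - F a)" if "a \<le> b" for a b
    using interval_measure_cases[of F] that by auto
  show ?thesis
  proof (rule continuous_at_right_of_LIMSEQ)
    have "(\<lambda>n. emeasure (interval_measure F) {a<..a + 1 / Suc n}) \<longlonglongrightarrow> emeasure (interval_measure F) (\<Inter>n. {a<..a + 1 / Suc n})"
    proof (rule Lim_emeasure_decseq)
      show "decseq (\<lambda>n. {a<..a + 1 / Suc n})"
        by (rule decseq_SucI) (auto simp: field_simps intro: order_trans)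
      show "emeasure (interval_measure F) {a<..a + 1 / Suc n} \<noteq> \<infinity>" for n
        by (subst I) auto
    qed auto
    moreover have "(\<Inter>n. {a<..a + 1 / real (Suc n)}) = {}"
    proof (rule ccontr)
      assume "(\<Inter>n. {a<..a + 1 / real (Suc n)}) \<noteq> {}"
      then obtain x where "x \<in> (\<Inter>n. {a<..a + 1 / real (Suc n)})" by blast
      then have x: "a < x" "\<And>n. x \<le> a + 1 / real (Suc n)" by (auto simp del: of_nat_Suc)
      obtain n where "inverse (real (Suc n)) < x - a"
        using x(1) reals_Archimedean[of "x - a"] by (auto simp del: of_nat_Suc)
      with x(2)[of n] show False by (simp add: inverse_eq_divide)
    qed
    ultimately have "(\<lambda>n. ennreal (F (a + 1 / Suc n) - F a)) \<longlonglongrightarrow> ennreal 0"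
      by (simp add: I)
    moreover have "\<forall>\<^sub>F n in sequentially. 0 \<le> F (a + 1 / Suc n) - F a"
      by (intro always_eventually allI) (auto intro: F_mono)
    ultimately have "(\<lambda>n. F (a + 1 / Suc n) - F a) \<longlonglongrightarrow> 0"
      using tendsto_ennreal_iff[of "\<lambda>n. F (a + 1 / Suc n) - F a" sequentially 0] by blast
    from tendsto_add[OF this tendsto_const[of "F a"]]
    show "(\<lambda>n. F (a + 1 / real (Suc n))) \<longlonglongrightarrow> F a" by simp
  qed (rule F_mono)
qed

lemma emeasure_F: "a \<le> b \<Longrightarrow> emeasure (interval_measure F) {a<..b} = ennreal (F b - F a)"
  by (rule emeasure_interval_measure_Ioc) (auto intro: F_mono F_right_cont)

section \<open>Jump times of a path\<close>

definition m :: nat where "m = H T"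

definition \<tau> :: "nat \<Rightarrow> real" where "\<tau> i = Inf {t \<in> {0..T}. i \<le> H t}"

lemma
  assumes "1 \<le> i" "i \<le> m"
  shows \<tau>_le_iff: "\<And>t. t \<in> {0..T} \<Longrightarrow> \<tau> i \<le> t \<longleftrightarrow> i \<le> H t"
    and \<tau>_pos: "0 < \<tau> i" and \<tau>_le_T: "\<tau> i \<le> T"
proof -
  let ?E = "{t \<in> {0..T}. i \<le> H t}"
  have T: "T \<in> ?E" using assms(2) T_pos by (simp add: m_def)
  have bdd: "bdd_below ?E" by (intro bdd_belowI[of _ 0]) auto
  show le_T: "\<tau> i \<le> T" unfolding \<tau>_def by (rule cInf_lower[OF T bdd])
  have ge_0: "0 \<le> \<tau> i" unfolding \<tau>_def using T by (intro cInf_greatest) auto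
  have in_E: "\<tau> i \<in> ?E"
  proof (cases "\<tau> i = T")
    case True then show ?thesis using T by simp
  next
    case False
    have "continuous (at_right (\<tau> i)) F \<longleftrightarrow> (\<forall>e>0. \<exists>d>0. F (\<tau> i + d) - F (\<tau> i) < e)"
      by (rule continuous_at_right_real_increasing) (rule F_mono)
    \<comment> \<open>Values of \<open>H\<close> are integers, so an increment below 1 is none: the
      level \<open>i\<close> reached right after \<open>\<tau> i\<close> is already reached at
      \<open>\<tau> i\<close>.\<close>
    then obtain d where d: "d > 0" "F (\<tau> i + d) - F (\<tau> i) < 1"
      using F_right_cont[of "\<tau> i"] zero_less_one by blast
    have "\<tau> i < min T (\<tau> i + d)" using False le_T d(1) by auto
    then obtain t where t: "t \<in> ?E" "t < min T (\<tau> i + d)"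
      unfolding \<tau>_def using T bdd by (subst (asm) cInf_less_iff) auto
    have "real i \<le> F t" using t F_eq[of t] by auto
    also have "\<dots> \<le> F (\<tau> i + d)" using t by (intro F_mono) auto
    also have "\<dots> < F (\<tau> i) + 1" using d(2) by simp
    also have "F (\<tau> i) = real (H (\<tau> i))" using ge_0 le_T by (intro F_eq) auto
    finally show ?thesis using ge_0 le_T by auto
  qed
  show "\<tau> i \<le> t \<longleftrightarrow> i \<le> H t" if "t \<in> {0..T}" for t
  proof
    assume "\<tau> i \<le> t"
    then have "H (\<tau> i) \<le> H t" using in_E that by (intro H_mono) auto
    then show "i \<le> H t" using in_E by auto
  next
    assume "i \<le> H t" then show "\<tau> i \<le> t"
      unfolding \<tau>_def using that bdd by (intro cInf_lower) auto
  qed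
  show "0 < \<tau> i" using in_E ge_0 H_0 assms(1) by (cases "\<tau> i = 0") auto
qed

definition X :: "real list" where "X = map \<tau> [1..<Suc m]"

lemma length_X [simp]: "length X = m"
  by (simp add: X_def del: upt_Suc)

lemma set_X: "set X = \<tau> ` {1..m}"
  by (auto simp: X_def)

lemma X_bounds: "x \<in> set X \<Longrightarrow> 0 < x \<and> x \<le> T"
  by (auto simp: set_X \<tau>_pos \<tau>_le_T)

lemma sum_X: "(\<Sum>x\<leftarrow>X. f x) = (\<Sum>i=1..m. f (\<tau> i))"
proof -
  have "(\<Sum>x\<leftarrow>X. f x) = (\<Sum>i\<leftarrow>[1..<Suc m]. f (\<tau> i))" by (simp add: X_def comp_def)
  also have "\<dots> = (\<Sum>i\<in>set [1..<Suc m]. f (\<tau> i))" by (rule sum_list_distinct_conv_sum_set) simp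
  also have "set [1..<Suc m] = {1..m}" by auto
  finally show ?thesis .
qed

lemma H_eq_card: assumes "t \<in> {0..T}" shows "H t = card {i\<in>{1..m}. \<tau> i \<le> t}"
proof -
  have "H t \<le> m" unfolding m_def using assms T_pos by (intro H_mono) auto
  then have "{i\<in>{1..m}. \<tau> i \<le> t} = {1..H t}" using \<tau>_le_iff[OF _ _ assms] by auto
  then show ?thesis by simp
qed

text \<open>The Stieltjes measure is a sum of unit masses at the jump times. Both measures are
  finite on right half-lines and agree there, by counting the jumps after \<open>x\<close>.\<close>

lemma interval_measure_F: "interval_measure F = distr (count_space {1..m}) borel \<tau>"
proof (rule measure_eqI_lessThan)
  fix x :: real
  have tail: "emeasure (interval_measure F) {x<..} = ennreal (real m - F x)"
  proof -
    have "emeasure (interval_measure F) {x<..} = (SUP n. emeasure (interval_measure F) {x<..x + real n})"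
    proof -
      have "{x<..} = (\<Union>n. {x<..x + real n})"
      proof safe
        fix y assume "x < y"
        obtain n where "y - x \<le> real n" using real_arch_simple by blast
        then show "y \<in> (\<Union>n. {x<..x + real n})" using \<open>x < y\<close> by (intro UN_I[of n]) auto
      qed auto
      moreover have "(SUP n. emeasure (interval_measure F) {x<..x + real n}) = emeasure (interval_measure F) (\<Union>n. {x<..x + real n})"
        by (rule SUP_emeasure_incseq) (auto simp: incseq_def)
      ultimately show ?thesis by simp
    qed
    also have "\<dots> = ennreal (real m - F x)"
    proof (rule antisym)
      have "F (x + real n) \<le> real m" for n
        unfolding F_def m_def using clamp T_pos by (intro of_nat_mono H_mono) auto
      then show "(SUP n. emeasure (interval_measure F) {x<..x + real n}) \<le> ennreal (real m - F x)"
        by (intro SUP_least) (auto simp: emeasure_F intro!: ennreal_leI)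
      obtain n where n: "T - x \<le> real n" using real_arch_simple by blast
      then have "F (x + real n) = real m" using T_pos by (simp add: F_def m_def)
      then have "ennreal (real m - F x) = emeasure (interval_measure F) {x<..x + real n}"
        by (simp add: emeasure_F)
      also have "\<dots> \<le> (SUP n. emeasure (interval_measure F) {x<..x + real n})" by (rule SUP_upper) simp
      finally show "ennreal (real m - F x) \<le> (SUP n. emeasure (interval_measure F) {x<..x + real n})" .
    qed
    finally show ?thesis .
  qed
  then show "emeasure (interval_measure F) {x<..} < \<infinity>" by simp
  have "emeasure (distr (count_space {1..m}) borel \<tau>) {x<..} = of_nat (card {i\<in>{1..m}. x < \<tau> i})"
  proof -
    have "emeasure (distr (count_space {1..m}) borel \<tau>) {x<..}
        = emeasure (count_space {1..m}) (\<tau> -` {x<..} \<inter> space (count_space {1..m}))"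
      by (rule emeasure_distr) auto
    also have "\<tau> -` {x<..} \<inter> space (count_space {1..m}) = {i\<in>{1..m}. x < \<tau> i}" by auto
    also have "emeasure (count_space {1..m}) {i\<in>{1..m}. x < \<tau> i} = of_nat (card {i\<in>{1..m}. x < \<tau> i})"
      by (rule emeasure_count_space_finite) auto
    finally show ?thesis .
  qed
  also have "card {i\<in>{1..m}. x < \<tau> i} = m - H (max 0 (min T x))"
  proof -
    have "{i\<in>{1..m}. x < \<tau> i} = {1..m} - {i\<in>{1..m}. \<tau> i \<le> max 0 (min T x)}"
    proof (intro set_eqI iffI)
      fix i assume "i \<in> {i\<in>{1..m}. x < \<tau> i}"
      then have i: "1 \<le> i" "i \<le> m" "x < \<tau> i" by auto
      have "\<not> \<tau> i \<le> max 0 (min T x)" using \<tau>_pos[OF i(1,2)] i(3) by linarith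
      then show "i \<in> {1..m} - {i\<in>{1..m}. \<tau> i \<le> max 0 (min T x)}" using i by simp
    next
      fix i assume "i \<in> {1..m} - {i\<in>{1..m}. \<tau> i \<le> max 0 (min T x)}"
      then have i: "1 \<le> i" "i \<le> m" "\<not> \<tau> i \<le> max 0 (min T x)" by auto
      have "x < \<tau> i" using \<tau>_le_T[OF i(1,2)] i(3) by linarith
      then show "i \<in> {i\<in>{1..m}. x < \<tau> i}" using i by simp
    qed
    moreover have "card ({1..m} - {i\<in>{1..m}. \<tau> i \<le> max 0 (min T x)})
        = card {1..m} - card {i\<in>{1..m}. \<tau> i \<le> max 0 (min T x)}"
      by (rule card_Diff_subset) auto
    ultimately show ?thesis unfolding H_eq_card[OF clamp, of x] by simp
  qed
  also have "of_nat (m - H (max 0 (min T x))) = ennreal (real m - F x)"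
  proof -
    have "H (max 0 (min T x)) \<le> m" unfolding m_def using clamp T_pos by (intro H_mono) auto
    then show ?thesis by (simp add: F_def ennreal_of_nat_eq_real_of_nat of_nat_diff)
  qed
  finally show "emeasure (interval_measure F) {x<..} = emeasure (distr (count_space {1..m}) borel \<tau>) {x<..}"
    using tail by simp
qed auto

text \<open>Keeps the true values of \<open>\<Phi>\<close> on (0,T], unlike \<open>ker\<close>:
  along a fixed path the intensity is needed at every time, not only almost everywhere.\<close>

definition \<Phi>0 :: "real \<Rightarrow> real" where "\<Phi>0 u = (if 0 < u \<and> u \<le> T then \<Phi> u else 0)"

lemma \<Phi>0_measurable [measurable]: "\<Phi>0 \<in> borel_measurable borel"
proof -
  have "(\<lambda>u. - \<Phi>0 u) \<in> borel_measurable borel"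
  proof (rule borel_measurable_piecewise_mono[of "{{..0}, {0<..T}, {T<..}}"])
    fix c assume "c \<in> {{..0}, {0<..T}, {T<..}}"
    then show "mono_on c (\<lambda>u. - \<Phi>0 u)"
      by (auto simp: monotone_on_def \<Phi>0_def intro!: \<Phi>_le)
  qed (use T_pos in auto)
  then have "(\<lambda>u. - (- \<Phi>0 u)) \<in> borel_measurable borel" by measurable
  then show ?thesis by simp
qed

lemma \<Lambda>_X: assumes "t \<in> {0..T}" shows "\<Lambda> t = \<mu> + (\<Sum>x\<leftarrow>X. \<Phi>0 (t - x))"
proof -
  have "(LINT u:{0<..<t}|interval_measure F. \<Phi> (t - u)) = (LINT u|interval_measure F. indicator {0<..} u *\<^sub>R \<Phi>0 (t - u))"
    unfolding set_lebesgue_integral_def using assms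
    by (intro Bochner_Integration.integral_cong refl) (auto simp: \<Phi>0_def indicator_def)
  also have "\<dots> = (LINT i|count_space {1..m}. indicator {0<..} (\<tau> i) *\<^sub>R \<Phi>0 (t - \<tau> i))"
    unfolding interval_measure_F by (subst integral_distr) auto
  also have "\<dots> = (\<Sum>i=1..m. indicator {0<..} (\<tau> i) *\<^sub>R \<Phi>0 (t - \<tau> i))"
    by (rule lebesgue_integral_count_space_finite) simp
  also have "\<dots> = (\<Sum>i=1..m. \<Phi>0 (t - \<tau> i))"
    by (intro sum.cong) (auto simp: \<tau>_pos)
  finally show ?thesis using \<Lambda>_eq[OF assms] by (simp add: sum_X F_def[abs_def])
qed

lemma S_sets [measurable]: "S t \<in> sets \<nu>"
  by (rule S_sets_of[of "\<lambda>t. \<mu> + (\<Sum>x\<leftarrow>X. \<Phi>0 (t - x))"]) (auto simp: \<Lambda>_X)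

lemma emeasure_S: "t \<in> {0..T} \<Longrightarrow> emeasure \<nu> (S t) = of_nat (H t)"
  by (rule emeasure_S_of) measurable

lemma emeasure_S_diff:
  assumes "a \<in> {0..T}" "b \<in> {0..T}" "a \<le> b"
  shows "emeasure \<nu> {z \<in> space \<nu>. a < fst z \<and> fst z \<le> b \<and> snd z \<le> \<Lambda> (fst z)} = of_nat (H b - H a)"
proof -
  have eq: "{z \<in> space \<nu>. a < fst z \<and> fst z \<le> b \<and> snd z \<le> \<Lambda> (fst z)} = S b - S a"
    using assms by (auto simp: S_def)
  have "S a \<subseteq> S b" using assms(3) by (auto simp: S_def)
  then have "emeasure \<nu> (S b - S a) = emeasure \<nu> (S b) - emeasure \<nu> (S a)"
    by (intro emeasure_Diff S_sets) (simp add: emeasure_S[OF assms(1)])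
  also have "\<dots> = of_nat (H b - H a)"
  proof -
    have "(of_nat (H b) :: ennreal) = of_nat (H a) + of_nat (H b - H a)"
      unfolding of_nat_add[symmetric] using H_mono[OF assms] by simp
    then show ?thesis unfolding emeasure_S[OF assms(1)] emeasure_S[OF assms(2)]
      by (simp only:) (rule ennreal_add_diff_cancel_left, simp)
  qed
  finally show ?thesis unfolding eq .
qed

end

context hawkes_kernel begin

section \<open>Discretisation\<close>

definition width :: "nat \<Rightarrow> real" where "width k = T / 2 ^ k"

definition cell :: "nat \<Rightarrow> real \<Rightarrow> int" where "cell k x = \<lceil>x / width k\<rceil>"

definition cells :: "nat \<Rightarrow> int set" where "cells k = {1..2 ^ k}"

text \<open>Two points in cells x < c have a distance between (c - 1 - x) and (c + 1 - x) widths. As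
  \<open>\<Phi>\<close> is non-increasing, the smaller distance bounds the contribution from above
  in \<open>up\<close>, the larger one from below in \<open>lo\<close>.\<close>

definition up :: "nat \<Rightarrow> int set \<Rightarrow> int \<Rightarrow> real" where
  "up k C c = \<mu> + (\<Sum>x\<in>C. if x < c then \<Phi> (of_int (c - 1 - x) * width k) else 0)"

definition lo :: "nat \<Rightarrow> int set \<Rightarrow> int \<Rightarrow> real" where
  "lo k C c = \<mu> + (\<Sum>x\<in>C. if x < c then \<Phi> (of_int (c + 1 - x) * width k) else 0)"

lemma width_pos [simp]: "0 < width k" using T_pos by (simp add: width_def)

lemma width_nonneg [simp]: "0 \<le> width k" by (rule less_imp_le[OF width_pos])

lemma width_T: "2 ^ k * width k = T" by (simp add: width_def)

lemma cell_iff: "cell k x = c \<longleftrightarrow> (of_int c - 1) * width k < x \<and> x \<le> of_int c * width k"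
  unfolding cell_def ceiling_eq_iff by (simp add: pos_less_divide_eq pos_divide_le_eq)

lemma cell_bounds: "(of_int (cell k x) - 1) * width k < x" "x \<le> of_int (cell k x) * width k"
  using cell_iff[of k x "cell k x"] by auto

lemma cell_mono: "x \<le> y \<Longrightarrow> cell k x \<le> cell k y"
  unfolding cell_def by (intro ceiling_mono divide_right_mono) auto

lemma cell_in_cells: "cell k x \<in> cells k \<longleftrightarrow> 0 < x \<and> x \<le> T"
proof -
  have "1 \<le> cell k x \<longleftrightarrow> 0 < x"
    unfolding cell_def by (simp add: le_ceiling_iff pos_less_divide_eq)
  moreover have "cell k x \<le> 2 ^ k \<longleftrightarrow> x \<le> T"
    unfolding cell_def ceiling_le_iff by (simp add: pos_divide_le_eq width_T)
  ultimately show ?thesis by (simp add: cells_def)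
qed

text \<open>Cells are open on the left and closed on the right, so the cells 2c - 1 and 2c of the
  finer level make up cell c.\<close>

lemma cell_refine: "cell k x = \<lceil>real_of_int (cell (Suc k) x) / 2\<rceil>"
proof -
  have *: "width k = 2 * width (Suc k)" by (simp add: width_def)
  let ?c = "cell (Suc k) x"
  have "real_of_int (\<lceil>real_of_int ?c / 2\<rceil> * 2 - 2) < real_of_int ?c" by linarith
  then have "\<lceil>real_of_int ?c / 2\<rceil> * 2 - 2 \<le> ?c - 1" by (simp only: of_int_less_iff)
  then have "real_of_int (\<lceil>real_of_int ?c / 2\<rceil> * 2 - 2) \<le> real_of_int (?c - 1)" by (simp only: of_int_le_iff)
  then have "\<lceil>real_of_int ?c / 2\<rceil> * 2 - 2 \<le> real_of_int ?c - 1" by simp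
  moreover have "real_of_int ?c \<le> \<lceil>real_of_int ?c / 2\<rceil> * 2" by linarith
  ultimately have "(\<lceil>real_of_int ?c / 2\<rceil> * 2 - 2) * width (Suc k) \<le> (real_of_int ?c - 1) * width (Suc k)"
    "real_of_int ?c * width (Suc k) \<le> (\<lceil>real_of_int ?c / 2\<rceil> * 2) * width (Suc k)"
    by (auto intro!: mult_right_mono less_imp_le)
  moreover have "(of_int \<lceil>real_of_int ?c / 2\<rceil> - 1) * (2 * width (Suc k)) = (\<lceil>real_of_int ?c / 2\<rceil> * 2 - 2) * width (Suc k)"
    "of_int \<lceil>real_of_int ?c / 2\<rceil> * (2 * width (Suc k)) = (\<lceil>real_of_int ?c / 2\<rceil> * 2) * width (Suc k)"
    by (simp_all add: algebra_simps)
  ultimately show ?thesis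
    unfolding cell_iff * using cell_bounds[where k="Suc k" and x=x] by linarith
qed

lemma cell_arg: "c \<in> cells k \<Longrightarrow> x \<in> cells k \<Longrightarrow> x < c \<Longrightarrow>
    0 \<le> of_int (c - 1 - x) * width k \<and> of_int (c - 1 - x) * width k \<le> T
    \<and> 0 \<le> of_int (c + 1 - x) * width k \<and> of_int (c + 1 - x) * width k \<le> T"
proof -
  assume "c \<in> cells k" "x \<in> cells k" "x < c"
  then have "0 \<le> c - 1 - x" "c + 1 - x \<le> 2 ^ k" "0 \<le> c + 1 - x" "c - 1 - x \<le> 2 ^ k" by (auto simp: cells_def)
  moreover have "real_of_int z * width k \<le> T" if "z \<le> 2 ^ k" for z
  proof -
    have "real_of_int z \<le> real_of_int (2 ^ k)" using that by (simp only: of_int_le_iff)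
    then have "real_of_int z * width k \<le> 2 ^ k * width k" by (intro mult_right_mono) auto
    then show ?thesis by (simp add: width_T)
  qed
  moreover have "0 \<le> real_of_int z * width k" if "0 \<le> z" for z
    using that by (intro mult_nonneg_nonneg) auto
  ultimately show ?thesis by blast
qed

lemma finite_cells [simp]: "finite (cells k)" by (simp add: cells_def)

lemma lo_nonneg: assumes "C \<subseteq> cells k" "c \<in> cells k" shows "0 \<le> lo k C c"
  unfolding lo_def
proof (intro add_nonneg_nonneg \<mu>_nonneg sum_nonneg)
  fix x assume "x \<in> C"
  then show "0 \<le> (if x < c then \<Phi> (of_int (c + 1 - x) * width k) else 0)"
    using cell_arg[OF assms(2), of x] assms(1) by (auto intro!: \<Phi>_nonneg simp del: of_int_diff of_int_add)
qed

lemma up_nonneg: assumes "C \<subseteq> cells k" "c \<in> cells k" shows "0 \<le> up k C c"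
  unfolding up_def
proof (intro add_nonneg_nonneg \<mu>_nonneg sum_nonneg)
  fix x assume "x \<in> C"
  then show "0 \<le> (if x < c then \<Phi> (of_int (c - 1 - x) * width k) else 0)"
    using cell_arg[OF assms(2), of x] assms(1) by (auto intro!: \<Phi>_nonneg simp del: of_int_diff of_int_add)
qed

lemma \<Phi>_le_\<Phi>0: "0 \<le> u \<Longrightarrow> u \<le> T \<Longrightarrow> \<Phi> u \<le> \<Phi> 0"
  by (rule \<Phi>_le) auto

lemma \<Phi>0_ge_0: "0 \<le> \<Phi> 0" using T_pos by (intro \<Phi>_nonneg) auto

lemma ker_abs_le: "\<bar>ker u\<bar> \<le> \<Phi> 0"
  using ker_le_\<Phi>0[of u] by simp

lemma LBINT_ker_le: "a \<le> b \<Longrightarrow> (\<And>s. a \<le> s \<Longrightarrow> s \<le> b \<Longrightarrow> ker s \<le> B) \<Longrightarrow> (LBINT s:{a..b}. ker s) \<le> (b - a) * B"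
proof -
  assume ab: "a \<le> b" and le: "\<And>s. a \<le> s \<Longrightarrow> s \<le> b \<Longrightarrow> ker s \<le> B"
  have "(LBINT s:{a..b}. ker s) \<le> (LBINT s:{a..b}. B)"
    by (intro set_integral_mono set_integrable_bounded[OF _ ker_abs_le] set_integrable_bounded[of "\<lambda>_. B" "\<bar>B\<bar>"]) (auto intro: le)
  also have "\<dots> = (b - a) * B"
    using ab by (simp add: set_integral_const emeasure_lborel_Icc_eq measure_lborel_Icc)
  finally show ?thesis .
qed

text \<open>On the interval from j d to (j + 1) d the kernel is at most \<Phi>((j - 1) d): as a left
  limit it is bounded by values of \<open>\<Phi>\<close> at strictly smaller arguments, hence the
  shift by a full step. The first interval has no earlier grid point and costs d \<Phi>(0).\<close>

lemma LBINT_ker_step: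
  assumes "real n * d \<le> T" "0 < d"
  shows "(LBINT s:{0..real n * d}. ker s) \<le> d * \<Phi> 0 + (\<Sum>j<n - 1. d * \<Phi> (real j * d))"
  using assms(1)
proof (induction n)
  case 0
  have "(LBINT s:{0..0::real}. ker s) \<le> (0 - 0) * \<Phi> 0" by (rule LBINT_ker_le) (auto intro: ker_le_\<Phi>0)
  moreover have "0 \<le> d * \<Phi> 0" using assms(2) \<Phi>0_ge_0 by simp
  ultimately show ?case by simp
next
  case (Suc n)
  have split: "(LBINT s:{0..real (Suc n) * d}. ker s) = (LBINT s:{0..real n * d}. ker s) + (LBINT s:{real n * d..real (Suc n) * d}. ker s)"
    using assms(2) by (intro LBINT_split[OF _ ker_abs_le]) (auto simp: algebra_simps)
  have IH: "(LBINT s:{0..real n * d}. ker s) \<le> d * \<Phi> 0 + (\<Sum>j<n - 1. d * \<Phi> (real j * d))"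
    using Suc.prems assms(2) by (intro Suc.IH) (simp add: algebra_simps)
  show ?case
  proof (cases n)
    case 0
    have "(LBINT s:{0..d}. ker s) \<le> (d - 0) * \<Phi> 0"
      using assms(2) by (intro LBINT_ker_le) (auto intro: ker_le_\<Phi>0)
    then show ?thesis using 0 by simp
  next
    case (Suc n')
    have "(LBINT s:{real n * d..real (Suc n) * d}. ker s) \<le> (real (Suc n) * d - real n * d) * \<Phi> (real n' * d)"
    proof (rule LBINT_ker_le)
      fix s assume s: "real n * d \<le> s" "s \<le> real (Suc n) * d"
      have "real n' * d < real n * d" using assms(2) Suc by (simp add: algebra_simps)
      then have 1: "real n' * d < s" using s by linarith
      have 0: "0 \<le> real n' * d" using assms(2) by simp
      show "ker s \<le> \<Phi> (real n' * d)"
        using 1 0 s Suc.prems by (intro ker_le) linarith+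
    qed (use assms(2) in \<open>simp add: algebra_simps\<close>)
    also have "\<dots> = d * \<Phi> (real n' * d)" by (simp add: algebra_simps)
    finally show ?thesis using split IH Suc by simp
  qed
qed

text \<open>The number n counts the cells from that of \<open>t\<close> to the end. The upper sum
  has one term \<Phi>(0) and the values at the multiples 0, ..., n - 2 of the width; the lower sum
  has those at 2, ..., n. The multiples 0 and 1 and the extra term make up the factor 3.\<close>

lemma LBINT_ker_shift_le:
  assumes t: "0 < t" "t \<le> T"
  shows "(LBINT s:{0..T}. ker (s - t)) \<le> width k * (3 * \<Phi> 0 + (\<Sum>c\<in>cells k. if cell k t < c then \<Phi> (of_int (c + 1 - cell k t) * width k) else 0))"
proof -
  let ?x = "cell k t"
  have x: "1 \<le> ?x" "?x \<le> 2 ^ k" using t cell_in_cells[of k t] by (auto simp: cells_def)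
  define n where "n = nat (2 ^ k - ?x + 1)"
  have n: "1 \<le> n" "int n = 2 ^ k - ?x + 1" using x by (auto simp: n_def)
  have nT: "real n * width k \<le> T"
  proof -
    have "int n \<le> 2 ^ k" using n(2) x by simp
    then have "real_of_int (int n) \<le> real_of_int (2 ^ k)" by (simp only: of_int_le_iff)
    then have "real n \<le> 2 ^ k" by simp
    then have "real n * width k \<le> 2 ^ k * width k" by (intro mult_right_mono) auto
    then show ?thesis by (simp add: width_T)
  qed
  have Tt: "T - t \<le> real n * width k"
  proof -
    have "real_of_int (int n) = real_of_int (2 ^ k - ?x + 1)" unfolding n(2) ..
    then have "real n = 2 ^ k - of_int ?x + 1" by simp
    then have "real n * width k = (2 ^ k - of_int ?x + 1) * width k" by (simp only:)
    also have "\<dots> = 2 ^ k * width k - (of_int ?x - 1) * width k" by (simp add: algebra_simps)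
    also have "\<dots> = T - (of_int ?x - 1) * width k" unfolding width_T ..
    finally have "real n * width k = T - (of_int ?x - 1) * width k" .
    then show ?thesis using cell_bounds(1)[where k=k and x=t] by simp
  qed
  have "(LBINT s:{0..T}. ker (s - t)) = (LBINT s:{0..T - t}. ker s)"
  proof -
    have "(LBINT s:{0..T}. ker (s - t)) = (LBINT s. indicator {0..T} (t + 1 * s) *\<^sub>R ker (t + 1 * s - t))"
      unfolding set_lebesgue_integral_def
      by (subst lborel_integral_real_affine[where c=1 and t=t]) auto
    also have "\<dots> = (LBINT s:{0..T - t}. ker s)"
      unfolding set_lebesgue_integral_def
    proof (rule Bochner_Integration.integral_cong[OF refl])
      fix s show "indicator {0..T} (t + 1 * s) *\<^sub>R ker (t + 1 * s - t) = indicator {0..T - t} s *\<^sub>R ker s"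
        using t by (cases "0 < s") (auto simp: indicator_def ker_0)
    qed
    finally show ?thesis .
  qed
  also have "\<dots> \<le> (LBINT s:{0..T - t}. ker s) + (LBINT s:{T - t..real n * width k}. ker s)"
    unfolding set_lebesgue_integral_def by (simp add: integral_nonneg_AE)
  also have "\<dots> = (LBINT s:{0..real n * width k}. ker s)"
    using t Tt by (intro LBINT_split[OF _ ker_abs_le, symmetric]) auto
  also have "\<dots> \<le> width k * \<Phi> 0 + (\<Sum>j<n - 1. width k * \<Phi> (real j * width k))"
    by (rule LBINT_ker_step[OF nT]) simp
  also have "(\<Sum>j<n - 1. width k * \<Phi> (real j * width k)) \<le> width k * (2 * \<Phi> 0) + (\<Sum>j=2..n. width k * \<Phi> (real j * width k))"
  proof -
    have bd: "0 \<le> \<Phi> (real j * width k) \<and> \<Phi> (real j * width k) \<le> \<Phi> 0" if "j \<le> n" for j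
    proof -
      have "real j * width k \<le> real n * width k" using that by (intro mult_right_mono) auto
      then have "real j * width k \<le> T" using nT by (rule order_trans)
      moreover have "0 \<le> real j * width k" by simp
      ultimately show ?thesis by (auto intro: \<Phi>_nonneg \<Phi>_le_\<Phi>0)
    qed
    have "(\<Sum>j<n - 1. width k * \<Phi> (real j * width k)) \<le> (\<Sum>j\<in>{0,1} \<union> {2..n}. if j \<le> n then width k * \<Phi> (real j * width k) else 0)"
    proof -
      have "(\<Sum>j<n - 1. width k * \<Phi> (real j * width k)) = (\<Sum>j<n - 1. if j \<le> n then width k * \<Phi> (real j * width k) else 0)"
        by (intro sum.cong) auto
      also have "\<dots> \<le> (\<Sum>j\<in>{0,1} \<union> {2..n}. if j \<le> n then width k * \<Phi> (real j * width k) else 0)"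
        by (intro sum_mono2) (auto simp: bd less_imp_le)
      finally show ?thesis .
    qed
    also have "\<dots> = (\<Sum>j\<in>{0,1}. if j \<le> n then width k * \<Phi> (real j * width k) else 0) + (\<Sum>j=2..n. if j \<le> n then width k * \<Phi> (real j * width k) else 0)"
      by (intro sum.union_disjoint) auto
    also have "(\<Sum>j\<in>{0,1}. if j \<le> n then width k * \<Phi> (real j * width k) else 0) \<le> width k * (2 * \<Phi> 0)"
      using bd[of 0] bd[of 1] n(1) by (simp add: algebra_simps)
    also have "(\<Sum>j=2..n. if j \<le> n then width k * \<Phi> (real j * width k) else 0) = (\<Sum>j=2..n. width k * \<Phi> (real j * width k))"
      by (intro sum.cong) auto
    finally show ?thesis by simp
  qed
  also have "(\<Sum>j=2..n. width k * \<Phi> (real j * width k)) = width k * (\<Sum>c\<in>cells k. if ?x < c then \<Phi> (of_int (c + 1 - ?x) * width k) else 0)"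
  proof -
    have "(\<Sum>c\<in>cells k. if ?x < c then \<Phi> (of_int (c + 1 - ?x) * width k) else 0) = (\<Sum>c\<in>{c\<in>cells k. ?x < c}. \<Phi> (of_int (c + 1 - ?x) * width k))"
      by (rule sum.inter_filter[symmetric]) simp
    also have "\<dots> = (\<Sum>j=2..n. \<Phi> (real j * width k))"
      by (rule sum.reindex_bij_witness[of _ "\<lambda>j. int j + ?x - 1" "\<lambda>c. nat (c + 1 - ?x)"])
        (use n x in \<open>auto simp: cells_def\<close>)
    finally show ?thesis by (simp add: sum_distrib_left)
  qed
  finally show ?thesis by (simp add: algebra_simps)
qed

lemma Lam_eq: "Lam l 0 T = T * \<mu> + (\<Sum>x\<leftarrow>l. LBINT s:{0..T}. ker (s - x))"
proof (induction l)
  case Nil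
  show ?case using T_pos by (simp add: Lam_def set_integral_const emeasure_lborel_Icc_eq measure_lborel_Icc)
next
  case (Cons x l)
  have "Lam (x # l) 0 T = (LBINT s:{0..T}. lam l s) + (LBINT s:{0..T}. ker (s - x))"
    unfolding Lam_def lam_Cons
    by (intro set_integral_add set_integrable_bounded[OF _ lam_abs_le] set_integrable_bounded[OF _ ker_abs_le]) auto
  then show ?case using Cons by (simp add: Lam_def)
qed

text \<open>The error per width with m points: the m occupied cells lose m \<mu> and at most m * m *
  \<Phi>(0) of the lower sum, and discretising the kernel costs 3 \<Phi>(0) for each point.\<close>

definition \<kappa>m :: "nat \<Rightarrow> real" where "\<kappa>m m = real m * \<mu> + 3 * real m * \<Phi> 0 + real m * real m * \<Phi> 0"

text \<open>Compares the integrated intensity with its lower sum over the empty cells. Points in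
  distinct cells allow a sum over points to be read as a sum over occupied cells.\<close>

lemma sum_lo_ge:
  assumes l: "\<And>x. x \<in> set l \<Longrightarrow> 0 < x \<and> x \<le> T" and dist: "distinct (map (cell k) l)"
  defines "C \<equiv> set (map (cell k) l)"
  shows "Lam l 0 T - width k * \<kappa>m (length l) \<le> (\<Sum>c\<in>cells k - C. width k * lo k C c)"
proof -
  let ?m = "length l"
  let ?f = "\<lambda>c x. if x < c then \<Phi> (of_int (c + 1 - x) * width k) else 0"
  have C: "C \<subseteq> cells k" unfolding C_def using l by (auto simp: cell_in_cells)
  have fin: "finite C" by (simp add: C_def)
  have card: "card C = ?m" unfolding C_def using distinct_card[OF dist] by simp
  have card_cells: "card (cells k) = 2 ^ k" by (simp add: cells_def nat_power_eq)
  have cardD: "real (card (cells k - C)) = 2 ^ k - real ?m"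
    using card_Diff_subset[OF fin C] card_mono[OF _ C] card card_cells by (simp add: of_nat_diff)
  have "(\<Sum>x\<in>C. (\<Sum>c\<in>cells k. ?f c x) - real ?m * \<Phi> 0) \<le> (\<Sum>x\<in>C. \<Sum>c\<in>cells k - C. ?f c x)"
  proof (rule sum_mono)
    fix x assume x: "x \<in> C"
    have "(\<Sum>c\<in>cells k. ?f c x) = (\<Sum>c\<in>cells k - C. ?f c x) + (\<Sum>c\<in>C. ?f c x)"
      using C by (intro sum.subset_diff) auto
    moreover have "(\<Sum>c\<in>C. ?f c x) \<le> (\<Sum>c\<in>C. \<Phi> 0)"
      using x C cell_arg[of _ k x] \<Phi>0_ge_0 by (intro sum_mono) (auto intro!: \<Phi>_le_\<Phi>0)
    ultimately show "(\<Sum>c\<in>cells k. ?f c x) - real ?m * \<Phi> 0 \<le> (\<Sum>c\<in>cells k - C. ?f c x)"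
      by (simp add: card)
  qed
  moreover have "(\<Sum>c\<in>cells k - C. lo k C c) = (2 ^ k - real ?m) * \<mu> + (\<Sum>x\<in>C. \<Sum>c\<in>cells k - C. ?f c x)"
    unfolding lo_def sum.distrib by (subst sum.swap) (simp add: cardD)
  ultimately have 1: "(2 ^ k - real ?m) * \<mu> + (\<Sum>x\<in>C. (\<Sum>c\<in>cells k. ?f c x) - real ?m * \<Phi> 0) \<le> (\<Sum>c\<in>cells k - C. lo k C c)"
    by simp
  have "(\<Sum>x\<leftarrow>l. LBINT s:{0..T}. ker (s - x)) \<le> (\<Sum>x\<leftarrow>l. width k * (3 * \<Phi> 0 + (\<Sum>c\<in>cells k. ?f c (cell k x))))"
    by (intro sum_list_mono LBINT_ker_shift_le) (use l in auto)
  also have "\<dots> = (\<Sum>x\<leftarrow>map (cell k) l. width k * (3 * \<Phi> 0 + (\<Sum>c\<in>cells k. ?f c x)))"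
    by (simp add: comp_def)
  also have "\<dots> = (\<Sum>x\<in>C. width k * (3 * \<Phi> 0 + (\<Sum>c\<in>cells k. ?f c x)))"
    unfolding C_def by (rule sum_list_distinct_conv_sum_set[OF dist])
  also have "\<dots> = width k * (3 * real ?m * \<Phi> 0 + (\<Sum>x\<in>C. \<Sum>c\<in>cells k. ?f c x))"
    by (simp add: sum.distrib card flip: sum_distrib_left)
  finally have "Lam l 0 T \<le> 2 ^ k * width k * \<mu> + width k * (3 * real ?m * \<Phi> 0 + (\<Sum>x\<in>C. \<Sum>c\<in>cells k. ?f c x))"
    unfolding Lam_eq width_T by simp
  also have "\<dots> = width k * ((2 ^ k - real ?m) * \<mu> + (\<Sum>x\<in>C. (\<Sum>c\<in>cells k. ?f c x) - real ?m * \<Phi> 0)) + width k * \<kappa>m ?m"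
    by (simp add: sum_subtractf card \<kappa>m_def algebra_simps)
  also have "\<dots> \<le> width k * (\<Sum>c\<in>cells k - C. lo k C c) + width k * \<kappa>m ?m"
    using 1 by (intro add_right_mono mult_left_mono) auto
  finally show ?thesis by (simp add: sum_distrib_left)
qed

end

definition (in hawkes_kernel) rect :: "nat \<Rightarrow> int \<Rightarrow> real \<Rightarrow> (real \<times> real) set" where
  "rect k c u = {z \<in> space (strip_measure T). (of_int c - 1) * width k < fst z \<and> fst z \<le> of_int c * width k \<and> snd z \<le> u}"

lemma (in hawkes_kernel) rect_sets [measurable]: "rect k c u \<in> sets (strip_measure T)"
  unfolding rect_def by measurable

section \<open>What a path with given cells implies for the point measure on rectangles\<close>

context hawkes_path begin

lemma rect_eq: "rect k c u = {z \<in> space \<nu>. (of_int c - 1) * width k < fst z \<and> fst z \<le> of_int c * width k \<and> snd z \<le> u}"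
  unfolding rect_def using sets_eq_imp_space_eq[OF sets_\<nu>] by simp

lemma rect_sets_\<nu> [measurable]: "rect k c u \<in> sets \<nu>"
  using rect_sets sets_\<nu> by simp

lemma \<tau>_mono: assumes "1 \<le> i" "i \<le> j" "j \<le> m" shows "\<tau> i \<le> \<tau> j"
proof -
  have t: "\<tau> j \<in> {0..T}" using \<tau>_pos[of j] \<tau>_le_T[of j] assms by auto
  have "j \<le> H (\<tau> j)" using \<tau>_le_iff[of j "\<tau> j"] t assms by auto
  then show ?thesis using \<tau>_le_iff[of i "\<tau> j"] t assms by auto
qed

lemma sorted_X: "sorted X"
  unfolding X_def sorted_map
proof (rule sorted_wrt_mono_rel)
  show "sorted_wrt (\<lambda>i j. i \<le> j) [1..<Suc m]" by (rule sorted_upt)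
  fix i j assume "i \<in> set [1..<Suc m]" "j \<in> set [1..<Suc m]" "i \<le> j"
  then show "\<tau> i \<le> \<tau> j" by (intro \<tau>_mono) auto
qed

text \<open>The jump times of a path are only known to be weakly increasing; coinciding jumps count
  as a collision of cells and are excluded in the limit together with the other collisions.\<close>

lemma sorted_cells_X: "sorted_wrt (<) (map (cell k) X) \<longleftrightarrow> distinct (map (cell k) X)"
proof -
  have "sorted (map (cell k) X)"
    unfolding sorted_map by (rule sorted_wrt_mono_rel[OF _ sorted_X]) (rule cell_mono)
  then show ?thesis by (simp only: strict_sorted_iff simp_thms)
qed

lemma H_diff:
  assumes "a \<in> {0..T}" "b \<in> {0..T}" "a \<le> b"
  shows "H b - H a = card {i\<in>{1..m}. a < \<tau> i \<and> \<tau> i \<le> b}"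
proof -
  have "{i\<in>{1..m}. a < \<tau> i \<and> \<tau> i \<le> b} = {i\<in>{1..m}. \<tau> i \<le> b} - {i\<in>{1..m}. \<tau> i \<le> a}" by auto
  moreover have "card ({i\<in>{1..m}. \<tau> i \<le> b} - {i\<in>{1..m}. \<tau> i \<le> a}) = card {i\<in>{1..m}. \<tau> i \<le> b} - card {i\<in>{1..m}. \<tau> i \<le> a}"
    using assms(3) by (intro card_Diff_subset) auto
  ultimately show ?thesis unfolding H_eq_card[OF assms(1)] H_eq_card[OF assms(2)] by simp
qed

lemma cell_ends:
  assumes "c \<in> cells k"
  shows "(of_int c - 1) * width k \<in> {0..T}" "of_int c * width k \<in> {0..T}" "(of_int c - 1) * width k \<le> of_int c * width k"
proof -
  have c: "1 \<le> c" "c \<le> 2 ^ k" using assms by (auto simp: cells_def)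
  have 1: "(1::real) \<le> of_int c" using c(1) by simp
  have "real_of_int c \<le> real_of_int (2 ^ k)" using c(2) by (simp only: of_int_le_iff)
  then have "real_of_int c * width k \<le> 2 ^ k * width k" by (intro mult_right_mono) auto
  then have 2: "of_int c * width k \<le> T" by (simp add: width_T)
  have 3: "0 \<le> (of_int c - 1) * width k" using 1 by simp
  show 4: "(of_int c - 1) * width k \<le> of_int c * width k" by (intro mult_right_mono) auto
  show "(of_int c - 1) * width k \<in> {0..T}" "of_int c * width k \<in> {0..T}"
    unfolding atLeastAtMost_iff using 2 3 4 by linarith+
qed

lemma cell_X: "x \<in> set X \<Longrightarrow> cell k x \<in> cells k"
  using X_bounds cell_in_cells by blast

lemma sum_cells_X:
  assumes "distinct (map (cell k) X)"
  shows "(\<Sum>x\<in>set (map (cell k) X). f x) = (\<Sum>x\<leftarrow>X. f (cell k x))"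
  using sum_list_distinct_conv_sum_set[OF assms, of f] by (simp add: comp_def)

text \<open>A cell without jumps has no point of \<nu> below the graph of \<Lambda>, and
  \<open>lo\<close> stays below \<Lambda> on the whole cell.\<close>

lemma emeasure_lower_rect:
  assumes dist: "distinct (map (cell k) X)" and c: "c \<in> cells k" "c \<notin> set (map (cell k) X)"
  shows "emeasure \<nu> (rect k c (lo k (set (map (cell k) X)) c)) = 0"
proof -
  let ?a = "(of_int c - 1) * width k" and ?b = "of_int c * width k"
  let ?C = "set (map (cell k) X)"
  have le: "lo k ?C c \<le> \<Lambda> s" if s: "?a < s" "s \<le> ?b" for s
  proof -
    have "(\<Sum>x\<leftarrow>X. if cell k x < c then \<Phi> (of_int (c + 1 - cell k x) * width k) else 0) \<le> (\<Sum>x\<leftarrow>X. \<Phi>0 (s - x))"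
    proof (rule sum_list_mono)
      fix x assume x: "x \<in> set X"
      show "(if cell k x < c then \<Phi> (of_int (c + 1 - cell k x) * width k) else 0) \<le> \<Phi>0 (s - x)"
      proof (cases "cell k x < c")
        case True
        have "of_int (cell k x) \<le> (of_int c - 1 :: real)" using True by linarith
        then have "of_int (cell k x) * width k \<le> ?a" by (intro mult_right_mono) auto
        then have 0: "0 < s - x" using s cell_bounds(2)[where k=k and x=x] by linarith
        have 1: "s - x \<le> of_int (c + 1 - cell k x) * width k"
          using s cell_bounds(1)[where k=k and x=x] by (simp add: algebra_simps)
        have "\<Phi> (of_int (c + 1 - cell k x) * width k) \<le> \<Phi> (s - x)"
          using 0 1 cell_arg[OF c(1) cell_X[OF x] True] by (intro \<Phi>_le) auto
        then show ?thesis using True 0 1 cell_arg[OF c(1) cell_X[OF x] True] by (simp add: \<Phi>0_def)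
      qed (auto simp: \<Phi>0_def intro!: \<Phi>_nonneg)
    qed
    moreover have "s \<in> {0..T}" using s cell_ends[OF c(1)] by auto
    ultimately show ?thesis unfolding lo_def sum_cells_X[OF dist] by (simp add: \<Lambda>_X)
  qed
  have "{i\<in>{1..m}. ?a < \<tau> i \<and> \<tau> i \<le> ?b} = {}"
  proof (rule ccontr)
    assume "{i\<in>{1..m}. ?a < \<tau> i \<and> \<tau> i \<le> ?b} \<noteq> {}"
    then obtain i where i: "i \<in> {1..m}" "cell k (\<tau> i) = c" by (auto simp: cell_iff)
    then have "c \<in> ?C" by (auto simp: set_X)
    then show False using c by blast
  qed
  then have "H ?b - H ?a = 0" using H_diff[OF cell_ends[OF c(1)]] by simp
  then have 0: "emeasure \<nu> {z \<in> space \<nu>. ?a < fst z \<and> fst z \<le> ?b \<and> snd z \<le> \<Lambda> (fst z)} = 0"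
    using emeasure_S_diff[OF cell_ends[OF c(1)]] by simp
  have "{z \<in> space \<nu>. ?a < fst z \<and> fst z \<le> ?b \<and> snd z \<le> \<Lambda> (fst z)} = S ?b - S ?a"
    using cell_ends[OF c(1)] by (auto simp: S_def)
  then have "{z \<in> space \<nu>. ?a < fst z \<and> fst z \<le> ?b \<and> snd z \<le> \<Lambda> (fst z)} \<in> sets \<nu>" by simp
  moreover have "rect k c (lo k ?C c) \<subseteq> {z \<in> space \<nu>. ?a < fst z \<and> fst z \<le> ?b \<and> snd z \<le> \<Lambda> (fst z)}"
    unfolding rect_eq using le by (auto intro: order_trans)
  ultimately have "emeasure \<nu> (rect k c (lo k ?C c)) \<le> emeasure \<nu> {z \<in> space \<nu>. ?a < fst z \<and> fst z \<le> ?b \<and> snd z \<le> \<Lambda> (fst z)}"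
    by (intro emeasure_mono)
  then show ?thesis using 0 by simp
qed

text \<open>The jump in the cell forces a point of \<nu> below \<Lambda> at some time up to the
  jump, where \<open>up\<close> bounds \<Lambda>.\<close>

lemma emeasure_upper_rect:
  assumes dist: "distinct (map (cell k) X)" and c: "c \<in> set (map (cell k) X)"
  shows "1 \<le> emeasure \<nu> (rect k c (up k (set (map (cell k) X)) c))"
proof -
  let ?a = "(of_int c - 1) * width k" and ?b = "of_int c * width k"
  let ?C = "set (map (cell k) X)"
  obtain j where j: "1 \<le> j" "j \<le> m" "cell k (\<tau> j) = c" using c by (auto simp: set_X)
  let ?x = "\<tau> j"
  have xX: "?x \<in> set X" using j by (auto simp: set_X)
  have cc: "c \<in> cells k" using cell_X[OF xX, of k] j(3) by simp
  have x: "?a < ?x" "?x \<le> ?b" using j(3) by (auto simp: cell_iff)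
  have xT: "?x \<in> {0..T}" using X_bounds[OF xX] by auto
  have inj: "inj_on (cell k) (set X)" using dist by (simp add: distinct_map)
  \<comment> \<open>Only times up to the jump \<open>?x\<close> are covered: past it the jump itself
    would contribute to \<Lambda>, and \<open>up\<close> does not account for points of the same
    cell. By distinctness every earlier jump lies in an earlier cell.\<close>
  have le: "\<Lambda> s \<le> up k ?C c" if s: "?a < s" "s \<le> ?x" for s
  proof -
    have sT: "s \<in> {0..T}" using s xT cell_ends[OF cc] by auto
    have "(\<Sum>x\<leftarrow>X. \<Phi>0 (s - x)) \<le> (\<Sum>x\<leftarrow>X. if cell k x < c then \<Phi> (of_int (c - 1 - cell k x) * width k) else 0)"
    proof (rule sum_list_mono)
      fix y assume y: "y \<in> set X"
      show "\<Phi>0 (s - y) \<le> (if cell k y < c then \<Phi> (of_int (c - 1 - cell k y) * width k) else 0)"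
      proof (cases "y < s")
        case True
        then have "cell k y \<le> c" using s cell_mono[of y ?x k] j(3) by auto
        moreover have "cell k y \<noteq> c" using inj_onD[OF inj _ y xX] j(3) True s by auto
        ultimately have lt: "cell k y < c" by simp
        have "of_int (c - 1 - cell k y) * width k \<le> s - y"
          using s cell_bounds(2)[where k=k and x=y] by (simp add: algebra_simps)
        moreover have "s - y \<le> T" using sT X_bounds[OF y] by auto
        ultimately have "\<Phi> (s - y) \<le> \<Phi> (of_int (c - 1 - cell k y) * width k)"
          using cell_arg[OF cc cell_X[OF y] lt] by (intro \<Phi>_le) auto
        then show ?thesis using lt True \<open>s - y \<le> T\<close> by (simp add: \<Phi>0_def)
      next
        case False
        then show ?thesis using cell_arg[OF cc cell_X[OF y]] by (auto simp: \<Phi>0_def intro!: \<Phi>_nonneg simp del: of_int_diff)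
      qed
    qed
    then show ?thesis unfolding up_def sum_cells_X[OF dist] by (simp add: \<Lambda>_X[OF sT])
  qed
  have "{j} \<subseteq> {i\<in>{1..m}. ?a < \<tau> i \<and> \<tau> i \<le> ?x}" using j x by auto
  then have "card {j} \<le> card {i\<in>{1..m}. ?a < \<tau> i \<and> \<tau> i \<le> ?x}"
    by (intro card_mono) auto
  then have "1 \<le> H ?x - H ?a" using H_diff[OF cell_ends(1)[OF cc] xT] x by simp
  then have "(of_nat 1 :: ennreal) \<le> of_nat (H ?x - H ?a)" by (simp only: of_nat_le_iff)
  then have "(1::ennreal) \<le> of_nat (H ?x - H ?a)" by simp
  also have "\<dots> = emeasure \<nu> {z \<in> space \<nu>. ?a < fst z \<and> fst z \<le> ?x \<and> snd z \<le> \<Lambda> (fst z)}"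
    using emeasure_S_diff[OF cell_ends(1)[OF cc] xT] x by simp
  also have "\<dots> \<le> emeasure \<nu> (rect k c (up k ?C c))"
    unfolding rect_eq by (rule emeasure_mono) (use le x rect_sets_\<nu>[unfolded rect_eq] in \<open>auto intro: order_trans\<close>)
  finally show ?thesis .
qed

text \<open>Colliding jumps leave only the crude bound \<mu> + m \<Phi>(0) on \<Lambda>; it
  suffices, since two points of \<open>N\<close> over one cell at a fixed height are
  improbable.\<close>

lemma emeasure_collision_rect:
  assumes "\<not> distinct (map (cell k) X)"
  shows "\<exists>c\<in>cells k. 2 \<le> emeasure \<nu> (rect k c (\<mu> + real m * \<Phi> 0))"
proof -
  obtain p q where pq: "p < m" "q < m" "p \<noteq> q" "cell k (X ! p) = cell k (X ! q)"
    using assms by (auto simp: distinct_conv_nth)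
  define c where "c = cell k (X ! p)"
  have nth: "X ! i = \<tau> (Suc i)" if "i < m" for i using that by (simp add: X_def del: upt_Suc)
  have cc: "c \<in> cells k" unfolding c_def using pq by (intro cell_X) simp
  let ?a = "(of_int c - 1) * width k" and ?b = "of_int c * width k"
  have "{Suc p, Suc q} \<subseteq> {i\<in>{1..m}. ?a < \<tau> i \<and> \<tau> i \<le> ?b}"
    using pq nth cell_iff[of k "X ! p" c] cell_iff[of k "X ! q" c] by (auto simp: c_def)
  then have "card {Suc p, Suc q} \<le> card {i\<in>{1..m}. ?a < \<tau> i \<and> \<tau> i \<le> ?b}"
    by (intro card_mono) auto
  then have "2 \<le> H ?b - H ?a" using pq(3) H_diff[OF cell_ends[OF cc]] by simp
  then have "(of_nat 2 :: ennreal) \<le> of_nat (H ?b - H ?a)" by (simp only: of_nat_le_iff)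
  then have "(2::ennreal) \<le> of_nat (H ?b - H ?a)" by simp
  also have "\<dots> = emeasure \<nu> {z \<in> space \<nu>. ?a < fst z \<and> fst z \<le> ?b \<and> snd z \<le> \<Lambda> (fst z)}"
    using emeasure_S_diff[OF cell_ends[OF cc]] by simp
  also have "\<dots> \<le> emeasure \<nu> (rect k c (\<mu> + real m * \<Phi> 0))"
    unfolding rect_eq
  proof (rule emeasure_mono)
    show "{z \<in> space \<nu>. ?a < fst z \<and> fst z \<le> ?b \<and> snd z \<le> \<mu> + real m * \<Phi> 0} \<in> sets \<nu>"
      using rect_sets_\<nu>[unfolded rect_eq] .
    have "\<Lambda> s \<le> \<mu> + real m * \<Phi> 0" if "s \<in> {0..T}" for s
    proof -
      have "(\<Sum>x\<leftarrow>X. \<Phi>0 (s - x)) \<le> (\<Sum>x\<leftarrow>X. \<Phi> 0)"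
        by (intro sum_list_mono) (auto simp: \<Phi>0_def intro!: \<Phi>_le_\<Phi>0 \<Phi>0_ge_0)
      then show ?thesis by (simp add: \<Lambda>_X[OF that] sum_list_triv)
    qed
    then show "{z \<in> space \<nu>. ?a < fst z \<and> fst z \<le> ?b \<and> snd z \<le> \<Lambda> (fst z)}
      \<subseteq> {z \<in> space \<nu>. ?a < fst z \<and> fst z \<le> ?b \<and> snd z \<le> \<mu> + real m * \<Phi> 0}"
      by (auto simp: space_\<nu> intro: order_trans)
  qed
  finally show ?thesis using cc by blast
qed

end

context hawkes_kernel begin

lemma cells_measurable [measurable]: "map (cell k) \<in> measurable list_borel (count_space UNIV)"
proof (rule measurable_count_space_eq2_countable[THEN iffD2], safe)
  fix c :: "int list"
  have "(map (cell k) l = c) \<longleftrightarrow> length l = length c \<and> (\<forall>i. i < length c \<longrightarrow> cell k (nth_default 0 l i) = c ! i)" for l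
    by (auto simp: list_eq_iff_nth_eq nth_default_def)
  then have "map (cell k) -` {c} \<inter> space list_borel
      = {l \<in> space list_borel. length l = length c \<and> (\<forall>i. i < length c \<longrightarrow> cell k (nth_default 0 l i) = c ! i)}"
    by auto
  also have "\<dots> \<in> sets list_borel" unfolding cell_iff by measurable
  finally show "map (cell k) -` {c} \<inter> space list_borel \<in> sets list_borel" .
qed auto

end

section \<open>The law of the jump times\<close>

locale hawkes_model = prob_space M + hawkes_kernel T \<mu> \<Phi>
  for M :: "'a measure" and T \<mu> :: real and \<Phi> :: "real \<Rightarrow> real" +
  fixes N :: "'a \<Rightarrow> (real \<times> real) measure" and H :: "real \<Rightarrow> 'a \<Rightarrow> nat" and \<Lambda> :: "real \<Rightarrow> 'a \<Rightarrow> real"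
  assumes poisson: "poisson_random_measure (strip_measure T) N"
    and hawkes: "hawkes_solution M T \<mu> \<Phi> N H \<Lambda>"
begin

lemma N_sets: "\<omega> \<in> space M \<Longrightarrow> sets (N \<omega>) = sets (strip_measure T)"
  using poisson unfolding poisson_random_measure_def by blast

lemma N_measurable [measurable]: "A \<in> sets (strip_measure T) \<Longrightarrow> (\<lambda>\<omega>. emeasure (N \<omega>) A) \<in> borel_measurable M"
  using poisson unfolding poisson_random_measure_def by blast

lemma prob_N: "A \<in> sets (strip_measure T) \<Longrightarrow> emeasure (strip_measure T) A < \<infinity> \<Longrightarrow>
    prob {\<omega> \<in> space M. emeasure (N \<omega>) A = of_nat k}
      = measure (strip_measure T) A ^ k / fact k * exp (- measure (strip_measure T) A)"
  using poisson unfolding poisson_random_measure_def by blast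

lemma indep_N:
  fixes A :: "nat \<Rightarrow> (real \<times> real) set"
  assumes "finite I" "\<And>i. i \<in> I \<Longrightarrow> A i \<in> sets (strip_measure T)" "disjoint_family_on A I"
  shows "indep_vars (\<lambda>_. borel) (\<lambda>i \<omega>. emeasure (N \<omega>) (A i)) I"
proof -
  have "\<forall>(A :: nat \<Rightarrow> (real \<times> real) set) I. finite I \<and> (\<forall>i\<in>I. A i \<in> sets (strip_measure T)) \<and> disjoint_family_on A I \<longrightarrow>
        indep_vars (\<lambda>_. borel) (\<lambda>i \<omega>. emeasure (N \<omega>) (A i)) I"
    using poisson unfolding poisson_random_measure_def by (elim conjE)
  from this[rule_format, of I A] assms show ?thesis by simp
qed

lemma prob_N_eq_0:
  assumes A: "A \<in> sets (strip_measure T)" "emeasure (strip_measure T) A = ennreal a" "0 \<le> a"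
  shows "prob {\<omega> \<in> space M. emeasure (N \<omega>) A = 0} = exp (- a)"
  using prob_N[OF A(1), of 0] A by (simp add: measure_def)

lemma prob_N_ge_1:
  assumes A: "A \<in> sets (strip_measure T)" "emeasure (strip_measure T) A = ennreal a" "0 \<le> a"
  shows "prob {\<omega> \<in> space M. 1 \<le> emeasure (N \<omega>) A} \<le> a"
proof -
  have [measurable]: "A \<in> sets (strip_measure T)" by fact
  have "{\<omega> \<in> space M. 1 \<le> emeasure (N \<omega>) A} \<subseteq> space M - {\<omega> \<in> space M. emeasure (N \<omega>) A = 0}" by auto
  then have "prob {\<omega> \<in> space M. 1 \<le> emeasure (N \<omega>) A} \<le> prob (space M - {\<omega> \<in> space M. emeasure (N \<omega>) A = 0})"
    by (intro finite_measure_mono) measurable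
  also have "\<dots> = 1 - exp (- a)"
    using prob_N_eq_0[OF A] by (subst prob_compl) auto
  also have "\<dots> \<le> a" using exp_ge_add_one_self[of "- a"] by simp
  finally show ?thesis .
qed

lemma prob_N_ge_2:
  assumes A: "A \<in> sets (strip_measure T)" "emeasure (strip_measure T) A = ennreal a" "0 \<le> a"
  shows "prob {\<omega> \<in> space M. 2 \<le> emeasure (N \<omega>) A} \<le> a\<^sup>2"
proof -
  have [measurable]: "A \<in> sets (strip_measure T)" by fact
  let ?E = "\<lambda>k. {\<omega> \<in> space M. emeasure (N \<omega>) A = k}"
  have "{\<omega> \<in> space M. 2 \<le> emeasure (N \<omega>) A} \<subseteq> space M - (?E 0 \<union> ?E 1)" by auto
  then have "prob {\<omega> \<in> space M. 2 \<le> emeasure (N \<omega>) A} \<le> prob (space M - (?E 0 \<union> ?E 1))"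
    by (intro finite_measure_mono) measurable
  also have "\<dots> = 1 - prob (?E 0 \<union> ?E 1)" by (rule prob_compl) measurable
  also have "prob (?E 0 \<union> ?E 1) = prob (?E 0) + prob (?E 1)"
    by (rule finite_measure_Union) auto
  also have "prob (?E 0) = exp (- a)" by (rule prob_N_eq_0[OF A])
  also have "prob (?E 1) = a * exp (- a)"
    using prob_N[OF A(1), of 1] A by (simp add: measure_def)
  also have "1 - (exp (- a) + a * exp (- a)) \<le> a\<^sup>2"
  proof -
    have "(1 - a) * (1 + a) \<le> exp (- a) * (1 + a)"
      using exp_ge_add_one_self[of "- a"] A(3) by (intro mult_right_mono) auto
    then show ?thesis by (simp add: algebra_simps power2_eq_square)
  qed
  finally show ?thesis .
qed

text \<open>Independence is given for families indexed by natural numbers, so the finite index set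
  is enumerated.\<close>

lemma prob_N_indep:
  assumes J: "finite J" and R: "\<And>c. c \<in> J \<Longrightarrow> R c \<in> sets (strip_measure T)" "disjoint_family_on R J"
    and B: "\<And>c. c \<in> J \<Longrightarrow> B c \<in> sets borel"
  shows "prob {\<omega> \<in> space M. \<forall>c\<in>J. emeasure (N \<omega>) (R c) \<in> B c}
    = (\<Prod>c\<in>J. prob {\<omega> \<in> space M. emeasure (N \<omega>) (R c) \<in> B c})"
proof (cases "J = {}")
  case True
  then show ?thesis by (simp add: prob_space)
next
  case False
  obtain e where e: "bij_betw e {0..<card J} J" using ex_bij_betw_nat_finite[OF J] by blast
  let ?I = "{0..<card J}"
  have im: "e ` ?I = J" and inj: "inj_on e ?I" using e by (auto simp: bij_betw_def)
  have ind: "indep_vars (\<lambda>_. borel) (\<lambda>i \<omega>. emeasure (N \<omega>) (R (e i))) ?I"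
  proof (rule indep_N)
    show "disjoint_family_on (\<lambda>i. R (e i)) ?I"
      unfolding disjoint_family_on_def
    proof (intro ballI impI)
      fix i j assume ij: "i \<in> ?I" "j \<in> ?I" "i \<noteq> j"
      then have "e i \<noteq> e j" using inj by (auto dest: inj_onD)
      moreover have "e i \<in> J" "e j \<in> J" using ij im by auto
      ultimately show "R (e i) \<inter> R (e j) = {}" using R(2) by (auto simp: disjoint_family_on_def)
    qed
  next
    fix i assume "i \<in> ?I"
    then have "e i \<in> J" using im by auto
    then show "R (e i) \<in> sets (strip_measure T)" by (rule R(1))
  qed simp
  have "prob (\<Inter>i\<in>?I. (\<lambda>\<omega>. emeasure (N \<omega>) (R (e i))) -` B (e i) \<inter> space M)
      = (\<Prod>i\<in>?I. prob ((\<lambda>\<omega>. emeasure (N \<omega>) (R (e i))) -` B (e i) \<inter> space M))"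
  proof (rule indep_varsD_finite[OF ind])
    show "?I \<noteq> {}" using False J by (auto simp: card_gt_0_iff)
    fix i assume "i \<in> ?I"
    then have "e i \<in> J" using im by auto
    then show "B (e i) \<in> sets borel" by (rule B)
  qed simp
  moreover have "(\<Inter>i\<in>?I. (\<lambda>\<omega>. emeasure (N \<omega>) (R (e i))) -` B (e i) \<inter> space M)
      = {\<omega> \<in> space M. \<forall>c\<in>J. emeasure (N \<omega>) (R c) \<in> B c}"
  proof -
    have "?I \<noteq> {}" using False J by (auto simp: card_gt_0_iff)
    moreover have "(\<forall>c\<in>J. P c) \<longleftrightarrow> (\<forall>i\<in>?I. P (e i))" for P
      using im by (metis (no_types, lifting) image_iff)
    ultimately show ?thesis by auto
  qed
  moreover have "(\<Prod>i\<in>?I. prob ((\<lambda>\<omega>. emeasure (N \<omega>) (R (e i))) -` B (e i) \<inter> space M))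
      = (\<Prod>c\<in>J. prob ((\<lambda>\<omega>. emeasure (N \<omega>) (R c)) -` B c \<inter> space M))"
    by (rule prod.reindex_bij_betw[OF e])
  ultimately show ?thesis by (simp add: vimage_def Int_def conj_commute)
qed

lemma emeasure_rect:
  assumes c: "c \<in> cells k" and u: "0 \<le> u"
  shows "emeasure (strip_measure T) (rect k c u) = ennreal (width k * u)"
proof -
  define a where "a = (of_int c - 1) * width k"
  define b where "b = of_int c * width k"
  have ba: "b - a = width k" by (simp add: a_def b_def algebra_simps)
  have ab: "0 \<le> a" "b \<le> T" "a \<le> b"
    unfolding a_def b_def
  proof -
    let ?a = "(of_int c - 1) * width k" and ?b = "of_int c * width k"
    have c': "1 \<le> c" "c \<le> 2 ^ k" using c by (auto simp: cells_def)
    then show "0 \<le> ?a" by simp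
    show "?a \<le> ?b" by (intro mult_right_mono) auto
    have "real_of_int c \<le> real_of_int (2 ^ k)" using c'(2) by (simp only: of_int_le_iff)
    then have "?b \<le> 2 ^ k * width k" by (intro mult_right_mono) auto
    then show "?b \<le> T" by (simp add: width_T)
  qed
  have eq: "rect k c u = {a<..b} \<times> {0..u}"
    unfolding rect_def space_strip a_def[symmetric] b_def[symmetric] using ab by auto
  interpret S: sigma_finite_measure "restrict_space lborel {0::real..}"
    by (rule sigma_finite_measure_restrict_space[OF sigma_finite_lborel]) simp
  have s1: "{a<..b} \<in> sets (restrict_space lborel {0..T})"
    using ab by (subst sets_restrict_space_iff) auto
  have s2: "{0..u} \<in> sets (restrict_space lborel {0::real..})"
    by (subst sets_restrict_space_iff) auto
  have "emeasure (strip_measure T) (rect k c u)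
      = emeasure (restrict_space lborel {0..T}) {a<..b} * emeasure (restrict_space lborel {0::real..}) {0..u}"
    unfolding eq strip_measure_def by (rule S.emeasure_pair_measure_Times[OF s1 s2])
  also have "emeasure (restrict_space lborel {0..T}) {a<..b} = ennreal (width k)"
    using ab by (subst emeasure_restrict_space) (auto simp: ba)
  also have "emeasure (restrict_space lborel {0::real..}) {0..u} = ennreal u"
    using u by (subst emeasure_restrict_space) auto
  finally show ?thesis using u by (simp add: ennreal_mult)
qed

text \<open>The heights of the rectangles depend on the set \<open>C\<close> of occupied cells and
  not on \<omega>. They are therefore deterministic and disjoint, and the probability factorises
  although the intensity depends on the past.\<close>

lemma prob_cells_le:
  assumes C: "C \<subseteq> cells k"
  shows "prob {\<omega> \<in> space M. (\<forall>c\<in>C. 1 \<le> emeasure (N \<omega>) (rect k c (up k C c))) \<and>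
      (\<forall>c\<in>cells k - C. emeasure (N \<omega>) (rect k c (lo k C c)) = 0)}
    \<le> (\<Prod>c\<in>C. width k * up k C c) * exp (- (\<Sum>c\<in>cells k - C. width k * lo k C c))"
proof -
  define R where "R c = rect k c (if c \<in> C then up k C c else lo k C c)" for c
  define B where "B c = (if c \<in> C then {1..} else {0 :: ennreal})" for c
  have fin: "finite C" by (rule finite_subset[OF C finite_cells])
  have "prob {\<omega> \<in> space M. \<forall>c\<in>cells k. emeasure (N \<omega>) (R c) \<in> B c}
      = (\<Prod>c\<in>cells k. prob {\<omega> \<in> space M. emeasure (N \<omega>) (R c) \<in> B c})"
  proof (rule prob_N_indep)
    show "disjoint_family_on R (cells k)"
      unfolding disjoint_family_on_def
    proof (intro ballI impI)
      fix c d :: int assume "c \<noteq> d"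
      have "z \<notin> R c \<inter> R d" for z
      proof
        assume "z \<in> R c \<inter> R d"
        then have "cell k (fst z) = c" "cell k (fst z) = d" unfolding R_def rect_def cell_iff by auto
        then show False using \<open>c \<noteq> d\<close> by simp
      qed
      then show "R c \<inter> R d = {}" by blast
    qed
  qed (auto simp: R_def B_def)
  also have "\<dots> = (\<Prod>c\<in>C. prob {\<omega> \<in> space M. emeasure (N \<omega>) (R c) \<in> B c})
      * (\<Prod>c\<in>cells k - C. prob {\<omega> \<in> space M. emeasure (N \<omega>) (R c) \<in> B c})"
    using prod.subset_diff[OF C, of "\<lambda>c. prob {\<omega> \<in> space M. emeasure (N \<omega>) (R c) \<in> B c}"] by (simp add: mult.commute)
  also have "\<dots> \<le> (\<Prod>c\<in>C. width k * up k C c) * (\<Prod>c\<in>cells k - C. exp (- (width k * lo k C c)))"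
  proof (intro mult_mono prod_mono prod_nonneg)
    fix c assume c: "c \<in> C"
    then have cc: "c \<in> cells k" using C by auto
    note up0 = up_nonneg[OF C cc]
    have "prob {\<omega> \<in> space M. 1 \<le> emeasure (N \<omega>) (rect k c (up k C c))} \<le> width k * up k C c"
      using up0 by (intro prob_N_ge_1 emeasure_rect[OF cc up0]) auto
    then show "0 \<le> prob {\<omega> \<in> space M. emeasure (N \<omega>) (R c) \<in> B c} \<and> prob {\<omega> \<in> space M. emeasure (N \<omega>) (R c) \<in> B c} \<le> width k * up k C c"
      using c by (simp add: R_def B_def)
    show "0 \<le> width k * up k C c" using up0 by simp
  next
    fix c assume c: "c \<in> cells k - C"
    then have cc: "c \<in> cells k" by auto
    note lo0 = lo_nonneg[OF C cc]
    have "prob {\<omega> \<in> space M. emeasure (N \<omega>) (rect k c (lo k C c)) = 0} = exp (- (width k * lo k C c))"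
      using lo0 by (intro prob_N_eq_0 emeasure_rect[OF cc lo0]) auto
    then show "0 \<le> prob {\<omega> \<in> space M. emeasure (N \<omega>) (R c) \<in> B c} \<and> prob {\<omega> \<in> space M. emeasure (N \<omega>) (R c) \<in> B c} \<le> exp (- (width k * lo k C c))"
      using c by (simp add: R_def B_def)
  qed auto
  also have "(\<Prod>c\<in>cells k - C. exp (- (width k * lo k C c))) = exp (- (\<Sum>c\<in>cells k - C. width k * lo k C c))"
    by (simp add: exp_sum sum_negf[symmetric] del: sum_negf)
  also have "{\<omega> \<in> space M. \<forall>c\<in>cells k. emeasure (N \<omega>) (R c) \<in> B c}
    = {\<omega> \<in> space M. (\<forall>c\<in>C. 1 \<le> emeasure (N \<omega>) (rect k c (up k C c))) \<and>
      (\<forall>c\<in>cells k - C. emeasure (N \<omega>) (rect k c (lo k C c)) = 0)}"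
    using C by (auto simp: R_def B_def)
  finally show ?thesis .
qed

lemma AE_path: "AE \<omega> in M. hawkes_path T \<mu> \<Phi> (N \<omega>) (\<lambda>t. H t \<omega>) (\<lambda>t. \<Lambda> t \<omega>)"
proof -
  have "AE \<omega> in M. \<forall>t\<in>{0..T}.
        of_nat (H t \<omega>) =
          (\<integral>\<^sup>+ (s, \<theta>). indicator {0<..t} s * indicator {..\<Lambda> s \<omega>} \<theta> \<partial>N \<omega>) \<and>
        \<Lambda> t \<omega> = \<mu> + (LINT u:{0<..<t}|path_measure T H \<omega>. \<Phi> (t - u))"
    using hawkes unfolding hawkes_solution_def by blast
  with AE_space show ?thesis
  proof eventually_elim
    case (elim \<omega>)
    then show ?case
      by (intro hawkes_path.intro hawkes_path_axioms.intro hawkes_kernel_axioms N_sets)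
        (auto simp: path_measure_def)
  qed
qed

section \<open>Measurability of the list of jump times\<close>

definition grid :: "real set" where "grid = {q \<in> {0..T}. q \<in> \<rat> \<or> q = T}"

text \<open>The default T keeps the infimum over [0,T] and does not lower it, since jump times are
  at most T.\<close>

definition tau' :: "nat \<Rightarrow> 'a \<Rightarrow> real" where
  "tau' i \<omega> = (INF q\<in>grid. if i \<le> H q \<omega> then q else T)"

text \<open>The list of jump times, computed from countably many values of \<open>H\<close> so that it is measurable
  for the uncompleted filtration.\<close>

definition jumps :: "'a \<Rightarrow> real list" where
  "jumps \<omega> = map (\<lambda>i. tau' i \<omega>) [1..<Suc (H T \<omega>)]"

lemma countable_grid: "countable grid"
  by (rule countable_subset[of _ "insert T \<rat>"]) (auto simp: grid_def countable_rat)

definition filtration_gen :: "real \<Rightarrow> 'a set set" where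
  "filtration_gen t = {(\<lambda>\<omega>. emeasure (N \<omega>) A) -` B \<inter> space M | A B.
        A \<in> sets (strip_measure T) \<and> A \<subseteq> {0..t} \<times> {0..} \<and> B \<in> sets borel}"

lemma filtration_gen_Pow: "filtration_gen t \<subseteq> Pow (space M)"
  by (auto simp: filtration_gen_def)

lemma sets_filtration: "sets (natural_filtration M T N t) = sigma_sets (space M) (filtration_gen t)"
  unfolding natural_filtration_def filtration_gen_def[symmetric] by (rule sets_measure_of[OF filtration_gen_Pow])

lemma space_filtration: "space (natural_filtration M T N t) = space M"
  unfolding natural_filtration_def filtration_gen_def[symmetric] by (rule space_measure_of[OF filtration_gen_Pow])

lemma sets_filtration_subset: "sets (natural_filtration M T N t) \<subseteq> sets M"
  unfolding sets_filtration
proof (rule sets.sigma_sets_subset, rule subsetI)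
  fix E assume "E \<in> filtration_gen t"
  then obtain A B where AB: "E = (\<lambda>\<omega>. emeasure (N \<omega>) A) -` B \<inter> space M" "A \<in> sets (strip_measure T)" "B \<in> sets borel"
    unfolding filtration_gen_def by blast
  then show "E \<in> sets M" using measurable_sets[OF N_measurable[OF AB(2)] AB(3)] by simp
qed

lemma H_measurable:
  assumes t: "t \<in> {0..T}"
  shows "H t \<in> measurable (natural_filtration M T N T) (count_space UNIV)"
proof -
  have "H t \<in> measurable (natural_filtration M T N t) (count_space UNIV)"
    using hawkes t unfolding hawkes_solution_def by blast
  moreover have "sets (natural_filtration M T N t) \<subseteq> sets (natural_filtration M T N T)"
    unfolding sets_filtration
  proof (rule sigma_sets_mono')
    have sub: "{0..t} \<times> {0..} \<subseteq> {0..T} \<times> ({0..} :: real set)" using t by auto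
    show "filtration_gen t \<subseteq> filtration_gen T"
    proof (rule subsetI)
      fix E assume "E \<in> filtration_gen t"
      then obtain A B where AB: "E = (\<lambda>\<omega>. emeasure (N \<omega>) A) -` B \<inter> space M" "A \<in> sets (strip_measure T)"
          "A \<subseteq> {0..t} \<times> {0..}" "B \<in> sets borel"
        unfolding filtration_gen_def by blast
      have "A \<subseteq> {0..T} \<times> {0..}" using AB(3) sub by (rule subset_trans)
      then show "E \<in> filtration_gen T"
        unfolding filtration_gen_def mem_Collect_eq using AB by (intro exI[of _ A] exI[of _ B] conjI)
    qed
  qed
  ultimately show ?thesis unfolding measurable_def space_filtration by blast
qed

lemma jumps_measurable: "jumps \<in> measurable (natural_filtration M T N T) list_borel"
proof -
  let ?F = "natural_filtration M T N T"
  have [measurable]: "H q \<in> measurable ?F (count_space UNIV)" if "q \<in> {0..T}" for q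
    using that by (rule H_measurable)
  have [measurable]: "H T \<in> measurable ?F (count_space UNIV)" using T_pos by (intro H_measurable) auto
  have tau [measurable]: "tau' i \<in> borel_measurable ?F" for i
    unfolding tau'_def[abs_def]
  proof (rule borel_measurable_cINF[OF countable_grid])
    fix q assume "q \<in> grid"
    then have [measurable]: "H q \<in> measurable ?F (count_space UNIV)" by (intro H_measurable) (auto simp: grid_def)
    show "(\<lambda>x. if i \<le> H q x then q else T) \<in> borel_measurable ?F" by measurable
  next
    fix x show "bdd_below ((\<lambda>q. if i \<le> H q x then q else T) ` grid)"
      by (intro bdd_belowI[of _ 0]) (use T_pos in \<open>auto simp: grid_def\<close>)
  qed
  show ?thesis
  proof (rule measurable_list_borelI)
    show "(\<lambda>\<omega>. length (jumps \<omega>)) \<in> measurable ?F (count_space UNIV)"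
      by (simp add: jumps_def del: upt_Suc)
    fix i
    have "(\<lambda>\<omega>. nth_default 0 (jumps \<omega>) i) = (\<lambda>\<omega>. if i < H T \<omega> then tau' (Suc i) \<omega> else 0)"
      by (auto simp: jumps_def nth_default_def fun_eq_iff simp del: upt_Suc)
    also have "\<dots> \<in> borel_measurable ?F" by measurable
    finally show "(\<lambda>\<omega>. nth_default 0 (jumps \<omega>) i) \<in> borel_measurable ?F" .
  qed
qed

text \<open>As i \<le> H q means \<tau> i \<le> q, rational times just above \<tau> i approximate
  it. A jump at T has no such times above it within [0,T], which is why T belongs to the
  grid.\<close>

lemma jumps_eq:
  assumes "hawkes_path T \<mu> \<Phi> (N \<omega>) (\<lambda>t. H t \<omega>) (\<lambda>t. \<Lambda> t \<omega>)"
  shows "jumps \<omega> = hawkes_path.X T (\<lambda>t. H t \<omega>)"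
proof -
  interpret p: hawkes_path T \<mu> \<Phi> "N \<omega>" "\<lambda>t. H t \<omega>" "\<lambda>t. \<Lambda> t \<omega>" by fact
  have "tau' i \<omega> = p.\<tau> i" if i: "1 \<le> i" "i \<le> p.m" for i
  proof -
    let ?f = "\<lambda>q. if i \<le> H q \<omega> then q else T"
    have bdd: "bdd_below (?f ` grid)"
      by (intro bdd_belowI[of _ 0]) (use T_pos in \<open>auto simp: grid_def\<close>)
    have ne: "T \<in> grid" using T_pos by (simp add: grid_def)
    show ?thesis unfolding tau'_def
    proof (rule antisym)
      show "p.\<tau> i \<le> (INF q\<in>grid. ?f q)"
      proof (rule cINF_greatest)
        fix q assume "q \<in> grid"
        then have "q \<in> {0..T}" by (auto simp: grid_def)
        then show "p.\<tau> i \<le> ?f q" using p.\<tau>_le_iff[OF i] p.\<tau>_le_T[OF i] by auto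
      qed (use ne in auto)
      show "(INF q\<in>grid. ?f q) \<le> p.\<tau> i"
      proof (rule field_le_epsilon)
        fix e :: real assume e: "0 < e"
        show "(INF q\<in>grid. ?f q) \<le> p.\<tau> i + e"
        proof (cases "p.\<tau> i = T")
          case True
          have "(INF q\<in>grid. ?f q) \<le> ?f T" by (rule cINF_lower[OF bdd ne])
          then show ?thesis using True e by (auto split: if_splits)
        next
          case False
          then have "p.\<tau> i < min T (p.\<tau> i + e)" using p.\<tau>_le_T[OF i] e by auto
          then obtain q where q: "q \<in> \<rat>" "p.\<tau> i < q" "q < min T (p.\<tau> i + e)"
            using Rats_dense_in_real by blast
          then have qg: "q \<in> grid" using p.\<tau>_pos[OF i] by (auto simp: grid_def)
          then have "i \<le> H q \<omega>" using p.\<tau>_le_iff[OF i, of q] q by (auto simp: grid_def)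
          moreover have "(INF q\<in>grid. ?f q) \<le> ?f q" by (rule cINF_lower[OF bdd qg])
          ultimately show ?thesis using q by auto
        qed
      qed
    qed
  qed
  then show ?thesis unfolding jumps_def p.X_def p.m_def by (intro map_cong) auto
qed

lemma AE_jumps:
  "AE \<omega> in M. hawkes_path T \<mu> \<Phi> (N \<omega>) (\<lambda>t. H t \<omega>) (\<lambda>t. \<Lambda> t \<omega>) \<and> jumps \<omega> = hawkes_path.X T (\<lambda>t. H t \<omega>)"
  using AE_path by eventually_elim (auto intro: jumps_eq)

lemma jumps_rv [measurable]: "jumps \<in> measurable M list_borel"
proof -
  show ?thesis
    using jumps_measurable sets_filtration_subset[of T] unfolding measurable_def space_filtration by auto
qed

text \<open>Prescribing the cells fixes the heights \<open>up\<close> and \<open>lo\<close>, so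
  almost surely the event lies in an event about \<open>N\<close> on deterministic
  rectangles.\<close>

lemma prob_jumps_cells_le:
  assumes "sorted_wrt (<) c" "set c \<subseteq> cells k"
  shows "prob {\<omega> \<in> space M. map (cell k) (jumps \<omega>) = c}
    \<le> (\<Prod>x\<in>set c. width k * up k (set c) x) * exp (- (\<Sum>x\<in>cells k - set c. width k * lo k (set c) x))"
proof -
  have "prob {\<omega> \<in> space M. map (cell k) (jumps \<omega>) = c}
    \<le> prob {\<omega> \<in> space M. (\<forall>x\<in>set c. 1 \<le> emeasure (N \<omega>) (rect k x (up k (set c) x))) \<and>
      (\<forall>x\<in>cells k - set c. emeasure (N \<omega>) (rect k x (lo k (set c) x)) = 0)}"
  proof (rule finite_measure_mono_AE)
    show "AE \<omega> in M. \<omega> \<in> {\<omega> \<in> space M. map (cell k) (jumps \<omega>) = c} \<longrightarrow>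
      \<omega> \<in> {\<omega> \<in> space M. (\<forall>x\<in>set c. 1 \<le> emeasure (N \<omega>) (rect k x (up k (set c) x))) \<and>
      (\<forall>x\<in>cells k - set c. emeasure (N \<omega>) (rect k x (lo k (set c) x)) = 0)}"
      using AE_jumps
    proof eventually_elim
      case (elim \<omega>)
      interpret p: hawkes_path T \<mu> \<Phi> "N \<omega>" "\<lambda>t. H t \<omega>" "\<lambda>t. \<Lambda> t \<omega>" using elim by blast
      have X: "jumps \<omega> = p.X" using elim by blast
      have d: "distinct (map (cell k) p.X)" if "map (cell k) (jumps \<omega>) = c"
        using that assms(1) unfolding X p.sorted_cells_X[symmetric] by simp
      show ?case
        using p.emeasure_upper_rect[OF d] p.emeasure_lower_rect[OF d] X by auto
    qed
  qed measurable
  also have "\<dots> \<le> (\<Prod>x\<in>set c. width k * up k (set c) x) * exp (- (\<Sum>x\<in>cells k - set c. width k * lo k (set c) x))"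
    by (rule prob_cells_le[OF assms(2)])
  finally show ?thesis .
qed

text \<open>A union bound over 2^k cells, each with probability of order width^2, leaves one factor
  width, which tends to 0.\<close>

lemma prob_collision_le:
  "prob {\<omega> \<in> space M. length (jumps \<omega>) = m \<and> \<not> sorted_wrt (<) (map (cell k) (jumps \<omega>))}
    \<le> width k * (T * (\<mu> + real m * \<Phi> 0)\<^sup>2)"
proof -
  let ?R = "\<mu> + real m * \<Phi> 0"
  have R0: "0 \<le> ?R" using \<mu>_nonneg \<Phi>0_ge_0 by simp
  let ?E = "\<lambda>c. {\<omega> \<in> space M. 2 \<le> emeasure (N \<omega>) (rect k c ?R)}"
  have [measurable]: "Measurable.pred M (\<lambda>\<omega>. sorted_wrt (<) (map (cell k) (jumps \<omega>)))"
    by (rule measurable_compose[OF measurable_compose[OF jumps_rv cells_measurable]]) simp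
  have "prob {\<omega> \<in> space M. length (jumps \<omega>) = m \<and> \<not> sorted_wrt (<) (map (cell k) (jumps \<omega>))}
    \<le> prob (\<Union>c\<in>cells k. ?E c)"
  proof (rule finite_measure_mono_AE)
    show "AE \<omega> in M. \<omega> \<in> {\<omega> \<in> space M. length (jumps \<omega>) = m \<and> \<not> sorted_wrt (<) (map (cell k) (jumps \<omega>))}
      \<longrightarrow> \<omega> \<in> (\<Union>c\<in>cells k. ?E c)"
      using AE_jumps
    proof eventually_elim
      case (elim \<omega>)
      interpret p: hawkes_path T \<mu> \<Phi> "N \<omega>" "\<lambda>t. H t \<omega>" "\<lambda>t. \<Lambda> t \<omega>" using elim by blast
      have X: "jumps \<omega> = p.X" using elim by blast
      have len: "length (jumps \<omega>) = p.m" unfolding X by simp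
      have "sorted_wrt (<) (map (cell k) (jumps \<omega>)) \<longleftrightarrow> distinct (map (cell k) p.X)"
        unfolding X by (rule p.sorted_cells_X)
      then show ?case
        using p.emeasure_collision_rect[of k] len by auto
    qed
  qed measurable
  also have "\<dots> \<le> (\<Sum>c\<in>cells k. prob (?E c))"
    by (rule measure_UNION_le) auto
  also have "\<dots> \<le> (\<Sum>c\<in>cells k. (width k * ?R)\<^sup>2)"
    using R0 by (intro sum_mono prob_N_ge_2 emeasure_rect) auto
  also have "\<dots> = 2 ^ k * width k * width k * ?R\<^sup>2"
    by (simp add: cells_def nat_power_eq power2_eq_square)
  also have "\<dots> = width k * (T * ?R\<^sup>2)" by (simp add: width_T)
  finally show ?thesis .
qed

end

section \<open>Convergence of the cell bounds\<close>

context hawkes_kernel begin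

lemma emeasure_points_cells:
  assumes "set c \<subseteq> cells k"
  shows "(\<integral>\<^sup>+ l. (if map (cell k) l = c then 1 else 0) \<partial>points T (length c)) = ennreal (width k ^ length c)"
  using assms
proof (induction c)
  case Nil
  have m: "(\<lambda>l. if map (cell k) l = [] then 1 else 0 :: ennreal) \<in> borel_measurable list_borel"
    by (rule measurable_compose[OF cells_measurable[of k], where g="\<lambda>c. if c = [] then 1 else 0"]) simp
  show ?case using nn_integral_points_0[OF m, of T] by simp
next
  case (Cons x c)
  have cm: "map (cell k) \<in> measurable list_borel (count_space UNIV)" by (rule cells_measurable)
  have [measurable]: "Measurable.pred list_borel (\<lambda>l. map (cell k) l = d)" for d
    by (rule measurable_compose[OF cm]) simp
  have x: "x \<in> cells k" and c: "set c \<subseteq> cells k" using Cons.prems by auto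
  define a where "a = (of_int x - 1) * width k"
  define b where "b = of_int x * width k"
  have ba: "b - a = width k" by (simp add: a_def b_def algebra_simps)
  have "(\<integral>\<^sup>+ l. (if map (cell k) l = x # c then 1 else 0) \<partial>points T (Suc (length c)))
      = (\<integral>\<^sup>+ t\<in>{0..T}. (\<integral>\<^sup>+ l. (if map (cell k) (t # l) = x # c then 1 else 0) \<partial>points T (length c)) \<partial>lborel)"
    by (rule nn_integral_points_Suc) measurable
  also have "\<dots> = (\<integral>\<^sup>+ t. ennreal (width k ^ length c) * indicator {a<..b} t \<partial>lborel)"
  proof (rule nn_integral_cong)
    fix t
    show "(\<integral>\<^sup>+ l. (if map (cell k) (t # l) = x # c then 1 else 0) \<partial>points T (length c)) * indicator {0..T} t
      = ennreal (width k ^ length c) * indicator {a<..b} t"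
    proof (cases "cell k t = x")
      case True
      then have "0 < t" "t \<le> T" using x cell_in_cells[of k t] by auto
      moreover have "t \<in> {a<..b}" using True unfolding cell_iff a_def b_def by simp
      ultimately show ?thesis using True Cons.IH[OF c] by simp
    next
      case False
      then have "t \<notin> {a<..b}" unfolding cell_iff a_def b_def by simp
      then show ?thesis using False by simp
    qed
  qed
  also have "\<dots> = ennreal (width k ^ length c) * emeasure lborel {a<..b}"
    by (rule nn_integral_cmult_indicator) simp
  also have "emeasure lborel {a<..b} = ennreal (width k)"
    using ba width_nonneg[of k] by (subst emeasure_lborel_Ioc) (auto simp: a_def b_def mult_right_mono)
  finally show ?case by (simp add: ennreal_mult mult.commute del: points.simps)
qed

text \<open>The bounds of the cell probabilities as functions of the points themselves; they converge to
  the intensity and to the density.\<close>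

definition cell_intensity :: "nat \<Rightarrow> real list \<Rightarrow> real \<Rightarrow> real" where
  "cell_intensity k l t = \<mu> + (\<Sum>x\<leftarrow>l. if cell k x < cell k t then \<Phi> (of_int (cell k t - 1 - cell k x) * width k) else 0)"

text \<open>The term \<open>width k * \<kappa>m m\<close> in the exponent absorbs the error of the
  lower sum, so that this function dominates the cell bound at every level and not only in the
  limit.\<close>

definition cell_dens :: "nat \<Rightarrow> nat \<Rightarrow> real list \<Rightarrow> real" where
  "cell_dens m k l = (if sorted_wrt (<) (0 # l) \<and> (\<forall>x\<in>set l. x \<le> T)
     then (\<Prod>t\<leftarrow>l. cell_intensity k l t) * exp (- Lam l 0 T + width k * \<kappa>m m) else 0)"

lemma cell_real_measurable [measurable]: "cell k \<in> measurable borel (count_space UNIV)"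
  unfolding cell_def by measurable

lemma measurable_cell_intensity [measurable (raw)]:
  assumes [measurable]: "l \<in> measurable M list_borel" "t \<in> borel_measurable M"
  shows "(\<lambda>x. cell_intensity k (l x) (t x)) \<in> borel_measurable M"
  unfolding cell_intensity_def by measurable

lemma cell_dens_measurable [measurable]: "cell_dens m k \<in> borel_measurable list_borel"
  unfolding cell_dens_def[abs_def] by measurable

lemma width_tendsto: "width \<longlonglongrightarrow> 0"
  unfolding width_def[abs_def] by (rule LIMSEQ_divide_realpow_zero) simp

text \<open>The distance between the left end of the cell of \<open>t\<close> and the right end of
  that of \<open>x\<close> is strictly less than t - x and tends to it. Its image under
  \<open>\<Phi>\<close> therefore tends to the left limit.\<close>

lemma cell_intensity_term_tendsto:
  assumes "0 < x" "x \<le> T" "0 < t" "t \<le> T"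
  shows "(\<lambda>k. if cell k x < cell k t then \<Phi> (of_int (cell k t - 1 - cell k x) * width k) else 0) \<longlonglongrightarrow> ker (t - x)"
proof (cases "x < t")
  case False
  then have "\<not> cell k x < cell k t" for k using cell_mono[of t x k] by simp
  then show ?thesis using False by (simp add: ker_0)
next
  case True
  let ?a = "\<lambda>k. of_int (cell k t - 1 - cell k x) * width k"
  have lt: "?a k < t - x" for k
    using cell_bounds(1)[where k=k and x=t] cell_bounds(2)[where k=k and x=x] by (simp add: algebra_simps)
  have gt: "t - x - 2 * width k < ?a k" for k
    using cell_bounds(2)[where k=k and x=t] cell_bounds(1)[where k=k and x=x] by (simp add: algebra_simps)
  have "?a \<longlonglongrightarrow> t - x"
  proof (rule tendsto_sandwich)
    show "(\<lambda>k. t - x - 2 * width k) \<longlonglongrightarrow> t - x"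
      by (rule tendsto_eq_intros width_tendsto refl | simp)+
  qed (use lt gt in \<open>auto intro!: always_eventually less_imp_le simp del: of_int_diff\<close>)
  then have "filterlim ?a (at_left (t - x)) sequentially"
    unfolding filterlim_at using lt by (auto intro!: always_eventually simp del: of_int_diff) (metis less_irrefl)
  moreover have "(\<Phi> \<longlongrightarrow> ker (t - x)) (at_left (t - x))" using True assms by (intro ker_tendsto) auto
  ultimately have lim: "(\<lambda>k. \<Phi> (?a k)) \<longlonglongrightarrow> ker (t - x)" by (rule filterlim_compose[rotated])
  have "eventually (\<lambda>k. width k < t - x) sequentially"
    using True by (intro order_tendstoD(2)[OF width_tendsto]) simp
  \<comment> \<open>Once the width is below t - x, the integer c - 1 - x of the two cells exceeds
    -1, so the cells differ and the first branch applies.\<close>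
  then have "eventually (\<lambda>k. \<Phi> (?a k) = (if cell k x < cell k t then \<Phi> (?a k) else 0)) sequentially"
  proof eventually_elim
    case (elim k)
    have "- width k < ?a k" using gt[of k] elim by linarith
    then have "- 1 * width k < of_int (cell k t - 1 - cell k x) * width k" by simp
    then have "- 1 < real_of_int (cell k t - 1 - cell k x)" unfolding mult_less_cancel_right_pos[OF width_pos] .
    then show ?case by simp
  qed
  with lim show ?thesis by (rule Lim_transform_eventually)
qed

lemma cell_dens_tendsto: "(\<lambda>k. cell_dens (length l) k l) \<longlonglongrightarrow> dens [] 0 l"
proof (cases "sorted_wrt (<) (0 # l) \<and> (\<forall>x\<in>set l. x \<le> T)")
  case True
  then have b: "0 < x \<and> x \<le> T" if "x \<in> set l" for x using that by auto
  have cell_intensity: "(\<lambda>k. cell_intensity k l t) \<longlonglongrightarrow> lam l t" if "t \<in> set l" for t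
  proof -
    have "(\<lambda>k. \<Sum>i<length l. if cell k (l ! i) < cell k t then \<Phi> (of_int (cell k t - 1 - cell k (l ! i)) * width k) else 0)
        \<longlonglongrightarrow> (\<Sum>i<length l. ker (t - l ! i))"
    proof (rule tendsto_sum)
      fix i assume "i \<in> {..<length l}"
      then have "l ! i \<in> set l" by simp
      from b[OF this] b[OF that]
      show "(\<lambda>k. if cell k (l ! i) < cell k t then \<Phi> (of_int (cell k t - 1 - cell k (l ! i)) * width k) else 0) \<longlonglongrightarrow> ker (t - l ! i)"
        by (intro cell_intensity_term_tendsto) blast+
    qed
    from tendsto_add[OF tendsto_const[of \<mu>] this] show ?thesis
      unfolding cell_intensity_def lam_def sum_list_sum_nth by (simp add: atLeast0LessThan del: of_int_diff)
  qed
  have "(\<lambda>k. \<Prod>t\<leftarrow>l. cell_intensity k l t) \<longlonglongrightarrow> (\<Prod>t\<leftarrow>l. lam l t)"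
    unfolding prod_list_nth_default[where d=0]
    by (intro tendsto_prod cell_intensity) (auto simp: nth_default_nth)
  moreover have "(\<lambda>k. exp (- Lam l 0 T + width k * \<kappa>m (length l))) \<longlonglongrightarrow> exp (- Lam l 0 T)"
    by (rule tendsto_eq_intros width_tendsto refl | simp)+
  ultimately show ?thesis using True unfolding cell_dens_def dens_def by (simp add: tendsto_mult)
next
  case False
  then show ?thesis unfolding cell_dens_def dens_def if_not_P[OF False] by simp
qed

lemma cell_intensity_bounds:
  assumes "\<And>x. x \<in> set l \<Longrightarrow> 0 < x \<and> x \<le> T" "t \<in> set l"
  shows "0 \<le> cell_intensity k l t" "cell_intensity k l t \<le> \<mu> + real (length l) * \<Phi> 0"
proof -
  define G where "G x = (if cell k x < cell k t then \<Phi> (of_int (cell k t - 1 - cell k x) * width k) else 0)" for x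
  have *: "0 \<le> G x \<and> G x \<le> \<Phi> 0" if "x \<in> set l" for x
  proof (cases "cell k x < cell k t")
    case True
    have "cell k t \<in> cells k" "cell k x \<in> cells k"
      using assms(1)[OF that] assms(1)[OF assms(2)] by (auto simp: cell_in_cells)
    from cell_arg[OF this True] show ?thesis
      using True unfolding G_def by (auto intro!: \<Phi>_nonneg \<Phi>_le_\<Phi>0 simp del: of_int_diff)
  qed (simp add: G_def \<Phi>0_ge_0)
  have u: "cell_intensity k l t = \<mu> + (\<Sum>x\<leftarrow>l. G x)" unfolding cell_intensity_def G_def ..
  show "0 \<le> cell_intensity k l t" unfolding u
    using * \<mu>_nonneg by (intro add_nonneg_nonneg sum_list_nonneg) auto
  have "(\<Sum>x\<leftarrow>l. G x) \<le> (\<Sum>x\<leftarrow>l. \<Phi> 0)"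
    using * by (intro sum_list_mono) auto
  then show "cell_intensity k l t \<le> \<mu> + real (length l) * \<Phi> 0"
    unfolding u by (simp add: sum_list_triv)
qed

lemma \<kappa>m_nonneg: "0 \<le> \<kappa>m m"
  unfolding \<kappa>m_def using \<mu>_nonneg \<Phi>0_ge_0 by simp

text \<open>The majorant for dominated convergence: it does not depend on the level, because the
  width is at most T.\<close>

lemma cell_dens_le: "cell_dens (length l) k l \<le> (\<mu> + real (length l) * \<Phi> 0) ^ length l * exp (T * \<kappa>m (length l))"
proof (cases "sorted_wrt (<) (0 # l) \<and> (\<forall>x\<in>set l. x \<le> T)")
  case True
  then have b: "0 < x \<and> x \<le> T" if "x \<in> set l" for x using that by auto
  have "(\<Prod>t\<leftarrow>l. cell_intensity k l t) \<le> (\<Prod>i<length l. \<mu> + real (length l) * \<Phi> 0)"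
    unfolding prod_list_nth_default[where d=0]
    by (intro prod_mono) (auto simp: nth_default_nth b intro!: cell_intensity_bounds)
  moreover have "width k * \<kappa>m (length l) \<le> T * \<kappa>m (length l)"
    using T_pos by (intro mult_right_mono \<kappa>m_nonneg) (simp add: width_def divide_le_eq)
  then have "exp (- Lam l 0 T + width k * \<kappa>m (length l)) \<le> exp (T * \<kappa>m (length l))"
    using Lam_nonneg[of l 0 T] by (simp del: Lam_nonneg)
  ultimately have "(\<Prod>t\<leftarrow>l. cell_intensity k l t) * exp (- Lam l 0 T + width k * \<kappa>m (length l))
      \<le> (\<Prod>i<length l. \<mu> + real (length l) * \<Phi> 0) * exp (T * \<kappa>m (length l))"
    using \<mu>_nonneg \<Phi>0_ge_0 by (intro mult_mono prod_nonneg) auto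
  then show ?thesis using True by (simp add: cell_dens_def)
next
  case False
  then have "cell_dens (length l) k l = 0" by (auto simp: cell_dens_def)
  then show ?thesis using \<mu>_nonneg \<Phi>0_ge_0 by simp
qed

text \<open>Distinct cells turn the product over occupied cells into one over points, and
  \<open>sum_lo_ge\<close> replaces the empty cells by the integrated intensity up to the error
  allowed in \<open>cell_dens\<close>.\<close>

lemma cells_prod_le_cell_dens:
  assumes s: "sorted_wrt (<) (map (cell k) l)" and c: "set (map (cell k) l) \<subseteq> cells k"
  defines "C \<equiv> set (map (cell k) l)"
  shows "(\<Prod>x\<in>C. up k C x) * exp (- (\<Sum>x\<in>cells k - C. width k * lo k C x)) \<le> cell_dens (length l) k l"
proof -
  have dist: "distinct (map (cell k) l)" using s by (simp add: strict_sorted_iff)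
  have b: "0 < x \<and> x \<le> T" if "x \<in> set l" for x
  proof -
    have "cell k x \<in> cells k" using c that by auto
    then show ?thesis unfolding cell_in_cells .
  qed
  have lt: "x < y" if "cell k x < cell k y" for x y using that cell_mono[of y x k] by linarith
  have "sorted_wrt (<) l"
    using s unfolding sorted_wrt_map
    by (rule sorted_wrt_mono_rel[rotated]) (rule lt)
  then have sl: "sorted_wrt (<) (0 # l) \<and> (\<forall>x\<in>set l. x \<le> T)" using b by auto
  have up: "up k C (cell k t) = cell_intensity k l t" for t
    unfolding up_def cell_intensity_def C_def
    by (subst sum_list_distinct_conv_sum_set[OF dist, symmetric]) (simp add: comp_def)
  have "(\<Prod>x\<in>C. up k C x) = (\<Prod>x\<leftarrow>map (cell k) l. up k C x)"
    unfolding C_def by (rule prod.distinct_set_conv_list[OF dist])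
  also have "\<dots> = (\<Prod>t\<leftarrow>l. cell_intensity k l t)" by (simp add: comp_def up)
  finally have p: "(\<Prod>x\<in>C. up k C x) = (\<Prod>t\<leftarrow>l. cell_intensity k l t)" .
  have "Lam l 0 T - width k * \<kappa>m (length l) \<le> (\<Sum>x\<in>cells k - C. width k * lo k C x)"
    unfolding C_def by (rule sum_lo_ge[OF b dist])
  then have e: "exp (- (\<Sum>x\<in>cells k - C. width k * lo k C x)) \<le> exp (- Lam l 0 T + width k * \<kappa>m (length l))" by simp
  have "0 \<le> (\<Prod>t\<leftarrow>l. cell_intensity k l t)" unfolding prod_list_nth_default[where d=0]
    by (intro prod_nonneg) (auto simp: nth_default_nth b intro!: cell_intensity_bounds)
  then show ?thesis using e sl unfolding p cell_dens_def by (simp add: mult_left_mono)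
qed

lemma cell_refine': "\<exists>r. \<forall>x. cell k x = r (cell (k + j) x)"
proof (induction j)
  case 0 show ?case by (intro exI[of _ "\<lambda>x. x"]) simp
next
  case (Suc j)
  then obtain r where r: "\<And>x. cell k x = r (cell (k + j) x)" by blast
  show ?case
    using r cell_refine[of "k + j"] by (intro exI[of _ "\<lambda>c. r \<lceil>real_of_int c / 2\<rceil>"]) simp
qed

text \<open>The length can be read off from the cells of any level, and each entry is the limit of
  the right end points of its cells.\<close>

lemma sets_list_borel_subset:
  "sets list_borel \<subseteq> sigma_sets (space list_borel) {map (cell k) -` {c} \<inter> space list_borel | k c. True}"
proof -
  let ?G = "{map (cell k) -` {c} \<inter> space list_borel | k c. True}"
  let ?S = "sigma (space list_borel) ?G"
  have G: "?G \<subseteq> Pow (space list_borel)" by auto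
  have sp: "space ?S = UNIV" using space_measure_of[OF G] by simp
  have D: "map (cell k) \<in> measurable ?S (count_space UNIV)" for k
  proof (rule measurable_count_space_eq2_countable[THEN iffD2], safe)
    fix c :: "int list"
    have "map (cell k) -` {c} \<inter> space list_borel \<in> ?G" by blast
    then have "map (cell k) -` {c} \<inter> space list_borel \<in> sets ?S"
      unfolding sets_measure_of[OF G] by (rule sigma_sets.Basic)
    then show "map (cell k) -` {c} \<inter> space ?S \<in> sets ?S" unfolding sp by simp
  qed auto
  have id: "(\<lambda>l. l) \<in> measurable ?S list_borel"
  proof (rule measurable_list_borelI)
    have "(\<lambda>l. length (map (cell 0) l)) \<in> measurable ?S (count_space UNIV)"
      by (rule measurable_compose[OF D]) simp
    then show "length \<in> measurable ?S (count_space UNIV)" by simp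
    fix i
    show "(\<lambda>l. nth_default 0 l i) \<in> borel_measurable ?S"
    proof (rule borel_measurable_LIMSEQ_real)
      show "(\<lambda>l. if i < length (map (cell k) l) then of_int (map (cell k) l ! i) * width k else 0) \<in> borel_measurable ?S" for k
        by (rule measurable_compose[OF D, where g="\<lambda>c. if i < length c then of_int (c ! i) * width k else 0"]) simp
      fix l
      show "(\<lambda>k. if i < length (map (cell k) l) then of_int (map (cell k) l ! i) * width k else 0) \<longlonglongrightarrow> nth_default 0 l i"
      proof (cases "i < length l")
        case True
        have *: "l ! i \<le> of_int (cell k (l ! i)) * width k \<and> of_int (cell k (l ! i)) * width k \<le> l ! i + width k" for k
          using cell_bounds[where k=k and x="l ! i"] by (simp add: left_diff_distrib)
        have "(\<lambda>k. l ! i + width k) \<longlonglongrightarrow> l ! i + 0"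
          by (intro tendsto_add tendsto_const width_tendsto)
        then have "(\<lambda>k. l ! i + width k) \<longlonglongrightarrow> l ! i" by simp
        from tendsto_sandwich[OF _ _ tendsto_const this]
        have "(\<lambda>k. of_int (cell k (l ! i)) * width k) \<longlonglongrightarrow> l ! i"
          using * by simp
        then show ?thesis using True by (simp add: nth_default_nth)
      qed (simp add: nth_default_beyond)
    qed
  qed
  show ?thesis
  proof
    fix A assume "A \<in> sets list_borel"
    from measurable_sets[OF id this] have "A \<in> sets ?S" by (simp add: sp)
    then show "A \<in> sigma_sets (space list_borel) ?G" unfolding sets_measure_of[OF G] .
  qed
qed

lemma cprob_le_1: "0 \<le> s \<Longrightarrow> s \<le> T \<Longrightarrow> cprob m l s \<le> 1"
proof -
  assume s: "0 \<le> s" "s \<le> T"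
  have "cprob m l s \<le> (\<Sum>i\<le>m. cprob i l s)" by (rule member_le_sum) auto
  also have "\<dots> \<le> 1" by (rule sum_cprob_le_1[OF s])
  finally show ?thesis .
qed

end

section \<open>Domination of the law of the jump times\<close>

context hawkes_model begin

lemma AE_jumps_cells: "AE \<omega> in M. set (map (cell k) (jumps \<omega>)) \<subseteq> cells k"
  using AE_jumps
proof eventually_elim
  case (elim \<omega>)
  interpret p: hawkes_path T \<mu> \<Phi> "N \<omega>" "\<lambda>t. H t \<omega>" "\<lambda>t. \<Lambda> t \<omega>" using elim by blast
  have X: "jumps \<omega> = p.X" using elim by blast
  show ?case unfolding X using p.X_bounds by (auto simp: cell_in_cells)
qed

text \<open>The event about the coarse cells is split according to the fine cells: either two jumps
  collide in a fine cell, or the fine cells form one of finitely many increasing lists that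
  \<open>r\<close> maps to \<open>c0\<close>. Each list is bounded by the integral of
  \<open>cell_dens\<close> over its box, and these boxes are disjoint.\<close>

lemma prob_jumps_le_cell_dens:
  assumes r: "\<And>x. cell k0 x = r (cell k x)"
  shows "emeasure M {\<omega> \<in> space M. map (cell k0) (jumps \<omega>) = c0}
    \<le> ennreal (width k * (T * (\<mu> + real (length c0) * \<Phi> 0)\<^sup>2))
      + (\<integral>\<^sup>+ l. ennreal (cell_dens (length c0) k l) * indicator {l. map (cell k0) l = c0} l \<partial>points T (length c0))"
proof -
  define m where "m = length c0"
  have [measurable]: "(\<lambda>l. map (cell j) l) \<in> measurable list_borel (count_space UNIV)" for j by (rule cells_measurable)
  have pr [measurable]: "Measurable.pred list_borel (\<lambda>l. map (cell j) l = c)" for j c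
    by (rule measurable_compose[OF cells_measurable]) simp
  have [measurable]: "Measurable.pred M (\<lambda>\<omega>. map (cell j) (jumps \<omega>) = c)" for j c
    by (rule measurable_compose[OF jumps_rv pr])
  have [measurable]: "Measurable.pred M (\<lambda>\<omega>. sorted_wrt (<) (map (cell k) (jumps \<omega>)))"
    by (rule measurable_compose[OF measurable_compose[OF jumps_rv cells_measurable]]) simp
  have [measurable]: "{l. map (cell j) l = c} \<in> sets list_borel" for j c
    using pr[of j c] unfolding pred_def by simp
  define S where "S = {c. length c = m \<and> set c \<subseteq> cells k \<and> sorted_wrt (<) c \<and> map r c = c0}"
  have "finite {c. set c \<subseteq> cells k \<and> length c = m}" by (rule finite_lists_length_eq) simp
  then have finS: "finite S" by (rule finite_subset[rotated]) (auto simp: S_def)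
  define q where "q c = (\<Prod>x\<in>set c. up k (set c) x) * exp (- (\<Sum>x\<in>cells k - set c. width k * lo k (set c) x))" for c
  let ?C = "{\<omega> \<in> space M. length (jumps \<omega>) = m \<and> \<not> sorted_wrt (<) (map (cell k) (jumps \<omega>))}"
  let ?E = "\<lambda>c. {\<omega> \<in> space M. map (cell k) (jumps \<omega>) = c}"
  have mr: "map (cell k0) l = map r (map (cell k) l)" for l by (simp add: r)
  have q_le: "emeasure M (?E c) \<le> (\<integral>\<^sup>+ l. ennreal (cell_dens m k l) * indicator {l. map (cell k) l = c} l \<partial>points T m)"
    if "c \<in> S" for c
  proof -
    have c: "length c = m" "set c \<subseteq> cells k" "sorted_wrt (<) c" using that by (auto simp: S_def)
    have dist: "distinct c" using c(3) by (simp add: strict_sorted_iff)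
    have "q c \<ge> 0" unfolding q_def using c(2)
      by (intro mult_nonneg_nonneg prod_nonneg up_nonneg) auto
    have "prob (?E c) \<le> (\<Prod>x\<in>set c. width k * up k (set c) x) * exp (- (\<Sum>x\<in>cells k - set c. width k * lo k (set c) x))"
      by (rule prob_jumps_cells_le[OF c(3,2)])
    also have "\<dots> = q c * width k ^ m"
      using c(1) distinct_card[OF dist] by (simp add: q_def prod.distrib)
    finally have "emeasure M (?E c) \<le> ennreal (q c * width k ^ m)"
      unfolding emeasure_eq_measure by (rule ennreal_leI)
    also have "\<dots> = ennreal (q c) * ennreal (width k ^ m)" using \<open>q c \<ge> 0\<close> by (rule ennreal_mult) simp
    also have "\<dots> = ennreal (q c) * (\<integral>\<^sup>+ l. (if map (cell k) l = c then 1 else 0) \<partial>points T m)"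
      using emeasure_points_cells[OF c(2)] c(1) by simp
    also have "\<dots> = (\<integral>\<^sup>+ l. ennreal (q c) * (if map (cell k) l = c then 1 else 0) \<partial>points T m)"
      by (rule nn_integral_cmult[symmetric]) measurable
    also have "\<dots> \<le> (\<integral>\<^sup>+ l. ennreal (cell_dens m k l) * indicator {l. map (cell k) l = c} l \<partial>points T m)"
    proof (rule nn_integral_mono)
      fix l
      show "ennreal (q c) * (if map (cell k) l = c then 1 else 0) \<le> ennreal (cell_dens m k l) * indicator {l. map (cell k) l = c} l"
      proof (cases "map (cell k) l = c")
        case True
        have "length l = m" using True c(1) by auto
        moreover have "q c \<le> cell_dens (length l) k l"
          using cells_prod_le_cell_dens[of k l] c True unfolding q_def by simp
        ultimately show ?thesis using True by (simp add: ennreal_leI)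
      qed simp
    qed
    finally show ?thesis .
  qed
  have "emeasure M {\<omega> \<in> space M. map (cell k0) (jumps \<omega>) = c0} \<le> emeasure M (?C \<union> (\<Union>c\<in>S. ?E c))"
  proof (rule emeasure_mono_AE)
    show "AE \<omega> in M. \<omega> \<in> {\<omega> \<in> space M. map (cell k0) (jumps \<omega>) = c0} \<longrightarrow> \<omega> \<in> ?C \<union> (\<Union>c\<in>S. ?E c)"
      using AE_jumps_cells[of k]
    proof eventually_elim
      case (elim \<omega>)
      show ?case
      proof
        assume a: "\<omega> \<in> {\<omega> \<in> space M. map (cell k0) (jumps \<omega>) = c0}"
        then have c0: "map (cell k0) (jumps \<omega>) = c0" and \<omega>: "\<omega> \<in> space M" by auto
        have len: "length (jumps \<omega>) = m" unfolding m_def c0[symmetric] by simp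
        show "\<omega> \<in> ?C \<union> (\<Union>c\<in>S. ?E c)"
        proof (cases "sorted_wrt (<) (map (cell k) (jumps \<omega>))")
          case True
          then have "map (cell k) (jumps \<omega>) \<in> S"
            using elim len c0 unfolding S_def mr[of "jumps \<omega>"] by simp
          then show ?thesis using \<omega> by blast
        next
          case False
          then show ?thesis using \<omega> len by blast
        qed
      qed
    qed
    show "?C \<union> (\<Union>c\<in>S. ?E c) \<in> sets M" using finS by (intro sets.Un sets.finite_UN) measurable
  qed
  also have "\<dots> \<le> emeasure M ?C + emeasure M (\<Union>c\<in>S. ?E c)"
    using finS by (intro emeasure_subadditive sets.finite_UN) measurable
  also have "\<dots> \<le> ennreal (width k * (T * (\<mu> + real m * \<Phi> 0)\<^sup>2)) + (\<Sum>c\<in>S. emeasure M (?E c))"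
  proof (rule add_mono)
    show "emeasure M ?C \<le> ennreal (width k * (T * (\<mu> + real m * \<Phi> 0)\<^sup>2))"
      unfolding emeasure_eq_measure by (rule ennreal_leI[OF prob_collision_le])
    show "emeasure M (\<Union>c\<in>S. ?E c) \<le> (\<Sum>c\<in>S. emeasure M (?E c))"
      using finS by (intro emeasure_subadditive_finite) auto
  qed
  also have "(\<Sum>c\<in>S. emeasure M (?E c)) \<le> (\<Sum>c\<in>S. \<integral>\<^sup>+ l. ennreal (cell_dens m k l) * indicator {l. map (cell k) l = c} l \<partial>points T m)"
    by (rule sum_mono[OF q_le])
  also have "\<dots> = (\<integral>\<^sup>+ l. (\<Sum>c\<in>S. ennreal (cell_dens m k l) * indicator {l. map (cell k) l = c} l) \<partial>points T m)"
    by (rule nn_integral_sum[symmetric]) measurable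
  also have "\<dots> \<le> (\<integral>\<^sup>+ l. ennreal (cell_dens m k l) * indicator {l. map (cell k0) l = c0} l \<partial>points T m)"
  proof (rule nn_integral_mono)
    fix l
    have "(\<Sum>c\<in>S. indicator {l. map (cell k) l = c} l) \<le> (indicator {l. map (cell k0) l = c0} l :: ennreal)"
    proof (cases "map (cell k) l \<in> S")
      case True
      have "(\<Sum>c\<in>S. indicator {l. map (cell k) l = c} l) = (\<Sum>c\<in>S. if map (cell k) l = c then 1 else 0 :: ennreal)"
        by (rule sum.cong) auto
      also have "\<dots> = 1" using True finS by simp
      also have "\<dots> = indicator {l. map (cell k0) l = c0} l"
        using True unfolding S_def mr by simp
      finally show ?thesis by simp
    next
      case False
      then have "map (cell k) l \<noteq> c" if "c \<in> S" for c using that by blast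
      then have "(\<Sum>c\<in>S. indicator {l. map (cell k) l = c} l) = (0 :: ennreal)"
        by (intro sum.neutral) (simp add: indicator_def)
      then show ?thesis by simp
    qed
    then show "(\<Sum>c\<in>S. ennreal (cell_dens m k l) * indicator {l. map (cell k) l = c} l) \<le> ennreal (cell_dens m k l) * indicator {l. map (cell k0) l = c0} l"
      unfolding sum_distrib_left[symmetric] by (rule mult_left_mono) simp
  qed
  finally show ?thesis unfolding m_def by (simp add: add_left_mono)
qed

text \<open>The coarse event stays fixed while the fine level tends to infinity: the collision term
  vanishes with the width, and dominated convergence replaces \<open>cell_dens\<close> by the
  density.\<close>

lemma prob_jumps_le_dens:
  "emeasure M {\<omega> \<in> space M. map (cell k0) (jumps \<omega>) = c0}
    \<le> (\<integral>\<^sup>+ l. ennreal (dens [] 0 l) * indicator {l. map (cell k0) l = c0} l \<partial>points T (length c0))"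
proof -
  define m where "m = length c0"
  have pr [measurable]: "Measurable.pred list_borel (\<lambda>l. map (cell j) l = c)" for j c
    by (rule measurable_compose[OF cells_measurable]) simp
  have [measurable]: "{l. map (cell j) l = c} \<in> sets list_borel" for j c
    using pr[of j c] unfolding pred_def by simp
  let ?B = "ennreal ((\<mu> + real m * \<Phi> 0) ^ m * exp (T * \<kappa>m m))"
  let ?I = "indicator {l. map (cell k0) l = c0} :: real list \<Rightarrow> ennreal"
  let ?a = "\<lambda>j. ennreal (width (k0 + j) * (T * (\<mu> + real m * \<Phi> 0)\<^sup>2))"
  have width: "(\<lambda>j. width (k0 + j)) \<longlonglongrightarrow> 0"
    using LIMSEQ_ignore_initial_segment[OF width_tendsto, of k0] by (simp add: add.commute)
  interpret P: finite_measure "points T m" by (rule finite_measure_points)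
  have len: "AE l in points T m. length l = m" by (rule AE_length_points)
  have "(\<lambda>j. \<integral>\<^sup>+ l. ennreal (cell_dens m (k0 + j) l) * ?I l \<partial>points T m) \<longlonglongrightarrow> (\<integral>\<^sup>+ l. ennreal (dens [] 0 l) * ?I l \<partial>points T m)"
  proof (rule nn_integral_dominated_convergence[where w="\<lambda>_. ?B"])
    show "(\<lambda>l. ennreal (cell_dens m (k0 + j) l) * ?I l) \<in> borel_measurable (points T m)" for j by measurable
    show "(\<lambda>l. ennreal (dens [] 0 l) * ?I l) \<in> borel_measurable (points T m)" by measurable
    show "AE l in points T m. ennreal (cell_dens m (k0 + j) l) * ?I l \<le> ?B" for j
      using len
    proof eventually_elim
      case (elim l)
      have "ennreal (cell_dens m (k0 + j) l) \<le> ?B" using cell_dens_le[of l "k0 + j"] elim by (intro ennreal_leI) simp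
      then show ?case by (auto simp: indicator_def)
    qed
    show "(\<integral>\<^sup>+ l. ?B \<partial>points T m) < \<infinity>"
      using P.emeasure_finite[of "space (points T m)"]
      by (simp add: ennreal_mult_eq_top_iff less_top[symmetric] del: space_points)
    show "AE l in points T m. (\<lambda>j. ennreal (cell_dens m (k0 + j) l) * ?I l) \<longlonglongrightarrow> ennreal (dens [] 0 l) * ?I l"
      using len
    proof eventually_elim
      case (elim l)
      have "(\<lambda>j. cell_dens m (k0 + j) l) \<longlonglongrightarrow> dens [] 0 l"
        using LIMSEQ_ignore_initial_segment[OF cell_dens_tendsto[of l], of k0] elim by (simp add: add.commute)
      then have t: "(\<lambda>j. ennreal (cell_dens m (k0 + j) l)) \<longlonglongrightarrow> ennreal (dens [] 0 l)" by (rule tendsto_ennrealI)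
      show ?case
        by (cases "map (cell k0) l = c0") (use t in auto)
    qed
  qed simp
  moreover have "?a \<longlonglongrightarrow> ennreal (0 * (T * (\<mu> + real m * \<Phi> 0)\<^sup>2))"
    by (intro tendsto_ennrealI tendsto_mult_right width)
  ultimately have "(\<lambda>j. ?a j + (\<integral>\<^sup>+ l. ennreal (cell_dens m (k0 + j) l) * ?I l \<partial>points T m))
      \<longlonglongrightarrow> ennreal (0 * (T * (\<mu> + real m * \<Phi> 0)\<^sup>2)) + (\<integral>\<^sup>+ l. ennreal (dens [] 0 l) * ?I l \<partial>points T m)"
    by (rule tendsto_add[rotated])
  moreover have "emeasure M {\<omega> \<in> space M. map (cell k0) (jumps \<omega>) = c0}
      \<le> ?a j + (\<integral>\<^sup>+ l. ennreal (cell_dens m (k0 + j) l) * ?I l \<partial>points T m)" for j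
  proof -
    obtain r where "\<And>x. cell k0 x = r (cell (k0 + j) x)" using cell_refine'[of k0 j] by blast
    from prob_jumps_le_cell_dens[OF this, of c0] show ?thesis unfolding m_def .
  qed
  ultimately have "emeasure M {\<omega> \<in> space M. map (cell k0) (jumps \<omega>) = c0}
      \<le> ennreal (0 * (T * (\<mu> + real m * \<Phi> 0)\<^sup>2)) + (\<integral>\<^sup>+ l. ennreal (dens [] 0 l) * ?I l \<partial>points T m)"
    by (intro LIMSEQ_le_const) auto
  then show ?thesis unfolding m_def by simp
qed

text \<open>For each length the two measures are compared on the cells of all levels, which is
  enough by \<open>emeasure_le_of_partitions\<close>; the integral is then split by length.\<close>

lemma law_jumps_le:
  assumes [measurable]: "F \<in> borel_measurable list_borel"
  shows "(\<integral>\<^sup>+ l. F l \<partial>distr M list_borel jumps) \<le> (\<Sum>m. \<integral>\<^sup>+ l. F l * ennreal (dens [] 0 l) \<partial>points T m)"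
proof -
  have pr [measurable]: "Measurable.pred list_borel (\<lambda>l. map (cell j) l = c)" for j c
    by (rule measurable_compose[OF cells_measurable]) simp
  let ?D = "distr M list_borel jumps"
  let ?L = "\<lambda>m. density ?D (indicator {l. length l = m})"
  let ?N = "\<lambda>m. density (points T m) (\<lambda>l. ennreal (dens [] 0 l))"
  have [simp]: "UNIV \<in> sets list_borel" using sets.top[of list_borel] by simp
  have [measurable]: "{l :: real list. length l = m} \<in> sets list_borel" for m
  proof -
    have "Measurable.pred list_borel (\<lambda>l :: real list. length l = m)" by measurable
    then show ?thesis unfolding pred_def by simp
  qed
  have le: "?L m \<le> ?N m" for m
  proof -
    have "emeasure (?L m) A \<le> emeasure (?N m) A" if "A \<in> sets (?N m)" for A
    proof (rule emeasure_le_of_partitions[where D="\<lambda>k. map (cell k)" and R="\<lambda>k. map (\<lambda>c. \<lceil>real_of_int c / 2\<rceil>)", OF _ _ _ _ _ _ _ that])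
      show "finite_measure (?L m)"
      proof (rule finite_measureI)
        have "emeasure (?L m) (space (?L m)) = emeasure ?D {l. length l = m}"
          by (subst emeasure_density) (auto simp: nn_integral_indicator)
        also have "\<dots> \<noteq> \<infinity>" by (subst emeasure_distr) auto
        finally show "emeasure (?L m) (space (?L m)) \<noteq> \<infinity>" .
      qed
      show "finite_measure (?N m)"
      proof (rule finite_measureI)
        have "emeasure (?N m) (space (?N m)) = cprob m [] 0"
          unfolding cprob_def by (simp add: emeasure_density)
        also have "\<dots> \<le> 1" using T_pos by (intro cprob_le_1) auto
        finally show "emeasure (?N m) (space (?N m)) \<noteq> \<infinity>" by (auto simp: top_unique)
      qed
      show "sets (?L m) = sets (?N m)" by simp
      show "map (cell k) \<in> measurable (?N m) (count_space UNIV)" for k by measurable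
      show "map (cell k) x = map (\<lambda>c. \<lceil>real_of_int c / 2\<rceil>) (map (cell (Suc k)) x)" for k x
        using cell_refine[of k] by simp
      show "sets (?N m) \<subseteq> sigma_sets (space (?N m)) {map (cell k) -` {c} \<inter> space (?N m) |k c. True}"
        using sets_list_borel_subset by simp
      fix k c
      have sp: "map (cell k) -` {c} \<inter> space (?N m) = {l. map (cell k) l = c}" by auto
      have [measurable]: "{l. map (cell k) l = c} \<in> sets list_borel"
        using pr[of k c] unfolding pred_def by simp
      have L: "emeasure (?L m) {l. map (cell k) l = c} = emeasure M {\<omega> \<in> space M. length (jumps \<omega>) = m \<and> map (cell k) (jumps \<omega>) = c}"
      proof -
        have "emeasure (?L m) {l. map (cell k) l = c} = (\<integral>\<^sup>+ l. indicator {l. length l = m} l * indicator {l. map (cell k) l = c} l \<partial>?D)"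
          by (rule emeasure_density) auto
        also have "\<dots> = (\<integral>\<^sup>+ l. indicator ({l. length l = m} \<inter> {l. map (cell k) l = c}) l \<partial>?D)"
          by (intro nn_integral_cong) (simp add: indicator_inter_arith)
        also have "\<dots> = emeasure ?D ({l. length l = m} \<inter> {l. map (cell k) l = c})"
          by (rule nn_integral_indicator) auto
        also have "\<dots> = emeasure M (jumps -` ({l. length l = m} \<inter> {l. map (cell k) l = c}) \<inter> space M)"
          by (rule emeasure_distr) auto
        also have "jumps -` ({l. length l = m} \<inter> {l. map (cell k) l = c}) \<inter> space M = {\<omega> \<in> space M. length (jumps \<omega>) = m \<and> map (cell k) (jumps \<omega>) = c}"
          by auto
        finally show ?thesis .
      qed
      show "emeasure (?L m) (map (cell k) -` {c} \<inter> space (?N m)) \<le> emeasure (?N m) (map (cell k) -` {c} \<inter> space (?N m))"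
      proof (cases "length c = m")
        case True
        have "{\<omega> \<in> space M. length (jumps \<omega>) = m \<and> map (cell k) (jumps \<omega>) = c} = {\<omega> \<in> space M. map (cell k) (jumps \<omega>) = c}"
          using True by auto
        then have "emeasure (?L m) {l. map (cell k) l = c} \<le> (\<integral>\<^sup>+ l. ennreal (dens [] 0 l) * indicator {l. map (cell k) l = c} l \<partial>points T m)"
          unfolding L using prob_jumps_le_dens[of k c] True by simp
        also have "\<dots> = emeasure (?N m) {l. map (cell k) l = c}"
          by (rule emeasure_density[symmetric]) auto
        finally show ?thesis unfolding sp .
      next
        case False
        then have "{\<omega> \<in> space M. length (jumps \<omega>) = m \<and> map (cell k) (jumps \<omega>) = c} = {}" by auto
        then show ?thesis unfolding sp L by (simp only: emeasure_empty zero_le)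
      qed
    qed
    then show ?thesis by (intro le_measure[THEN iffD2]) auto
  qed
  have "(\<integral>\<^sup>+ l. F l \<partial>?D) = (\<integral>\<^sup>+ l. (\<Sum>m. indicator {l. length l = m} l * F l) \<partial>?D)"
  proof (rule nn_integral_cong)
    fix l :: "real list"
    have "(\<Sum>m. indicator {l. length l = m} l * F l) = (\<Sum>m\<in>{length l}. indicator {l. length l = m} l * F l)"
      by (rule suminf_finite) auto
    then show "F l = (\<Sum>m. indicator {l. length l = m} l * F l)" by simp
  qed
  also have "\<dots> = (\<Sum>m. \<integral>\<^sup>+ l. indicator {l. length l = m} l * F l \<partial>?D)"
    by (rule nn_integral_suminf) measurable
  also have "\<dots> = (\<Sum>m. \<integral>\<^sup>+ l. F l \<partial>?L m)"
    by (intro suminf_cong nn_integral_density[symmetric]) measurable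
  also have "\<dots> \<le> (\<Sum>m. \<integral>\<^sup>+ l. F l \<partial>?N m)"
    by (intro suminf_le allI nn_integral_mono_measure le) auto
  also have "\<dots> = (\<Sum>m. \<integral>\<^sup>+ l. F l * ennreal (dens [] 0 l) \<partial>points T m)"
    by (intro suminf_cong) (subst nn_integral_density, auto simp: mult.commute)
  finally show ?thesis .
qed

end

section \<open>The renewal equations\<close>

text \<open>An integrable \<open>f\<close> loses its negative part on the right; for any other
  \<open>f\<close> the left side is 0 by convention.\<close>

lemma ennreal_integral_le: "ennreal (integral\<^sup>L M f) \<le> (\<integral>\<^sup>+ x. ennreal (f x) \<partial>M)"
proof (cases "integrable M f")
  case True
  have "integral\<^sup>L M f \<le> enn2real (\<integral>\<^sup>+ x. ennreal (f x) \<partial>M)"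
    unfolding real_lebesgue_integral_def[OF True] by simp
  then have "ennreal (integral\<^sup>L M f) \<le> ennreal (enn2real (\<integral>\<^sup>+ x. ennreal (f x) \<partial>M))" by (rule ennreal_leI)
  also have "\<dots> \<le> (\<integral>\<^sup>+ x. ennreal (f x) \<partial>M)"
    by (cases "\<integral>\<^sup>+ x. ennreal (f x) \<partial>M") auto
  finally show ?thesis .
qed (simp add: not_integrable_integral_eq)

lemma nn_integral_Icc_reflect:
  fixes p :: "real \<Rightarrow> ennreal"
  assumes [measurable]: "p \<in> borel_measurable borel"
  shows "(\<integral>\<^sup>+ u\<in>{0..t}. p (t - u) \<partial>lborel) = (\<integral>\<^sup>+ u\<in>{0..t}. p u \<partial>lborel)"
proof -
  have "(\<integral>\<^sup>+ u\<in>{0..t}. p u \<partial>lborel) = (\<integral>\<^sup>+ u. p (t + - 1 * u) * indicator {0..t} (t + - 1 * u) \<partial>lborel)"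
    by (subst nn_integral_real_affine[where c="-1" and t=t]) auto
  also have "\<dots> = (\<integral>\<^sup>+ u\<in>{0..t}. p (t - u) \<partial>lborel)"
    by (intro nn_integral_cong) (auto simp: indicator_def)
  finally show ?thesis ..
qed

lemma LBINT_Icc_reflect:
  fixes f :: "real \<Rightarrow> real"
  shows "(LBINT u:{0..t}. f (t - u)) = (LBINT u:{0..t}. f u)"
proof -
  have "(LBINT u:{0..t}. f u) = (LBINT u. indicator {0..t} (t + - 1 * u) *\<^sub>R f (t + - 1 * u))"
    unfolding set_lebesgue_integral_def
    by (subst lborel_integral_real_affine[where c="-1" and t=t]) auto
  also have "\<dots> = (LBINT u:{0..t}. f (t - u))"
    unfolding set_lebesgue_integral_def
    by (intro Bochner_Integration.integral_cong) (auto simp: indicator_def)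
  finally show ?thesis ..
qed

context hawkes_kernel begin

text \<open>The kernels agree at t - s for almost all s in [0,t]; the end point s = t, where
  \<open>ker\<close> is 0, is a null set.\<close>

lemma LBINT_\<Phi>_eq_ker:
  assumes \<Phi>: "set_borel_measurable borel {0..T} \<Phi>" and x: "set_integrable lborel {0..T} x" and t: "t \<in> {0..T}"
  shows "(LBINT s:{0..t}. \<Phi> (t - s) * x s) = (LBINT s:{0..t}. ker (t - s) * x s)"
proof -
  have [measurable]: "(\<lambda>u. indicator {0..T} u *\<^sub>R \<Phi> u) \<in> borel_measurable borel"
    using \<Phi> unfolding set_borel_measurable_def .
  have [measurable]: "(\<lambda>u. indicator {0..T} u *\<^sub>R x u) \<in> borel_measurable borel"
    using borel_measurable_integrable[OF x[unfolded set_integrable_def]] by simp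
  have "(\<lambda>s. indicator {0..t} s *\<^sub>R ((indicator {0..T} (t - s) *\<^sub>R \<Phi> (t - s)) * (indicator {0..T} s *\<^sub>R x s))) \<in> borel_measurable borel"
    by measurable
  moreover have "(\<lambda>s. indicator {0..t} s *\<^sub>R ((indicator {0..T} (t - s) *\<^sub>R \<Phi> (t - s)) * (indicator {0..T} s *\<^sub>R x s)))
      = (\<lambda>s. indicator {0..t} s *\<^sub>R (\<Phi> (t - s) * x s))"
    using t by (auto simp: indicator_def fun_eq_iff)
  ultimately have m1: "(\<lambda>s. indicator {0..t} s *\<^sub>R (\<Phi> (t - s) * x s)) \<in> borel_measurable borel" by simp
  have "(\<lambda>s. indicator {0..t} s *\<^sub>R (ker (t - s) * (indicator {0..T} s *\<^sub>R x s))) \<in> borel_measurable borel"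
    by measurable
  moreover have "(\<lambda>s. indicator {0..t} s *\<^sub>R (ker (t - s) * (indicator {0..T} s *\<^sub>R x s)))
      = (\<lambda>s. indicator {0..t} s *\<^sub>R (ker (t - s) * x s))"
    using t by (auto simp: indicator_def fun_eq_iff)
  ultimately have m2: "(\<lambda>s. indicator {0..t} s *\<^sub>R (ker (t - s) * x s)) \<in> borel_measurable borel" by simp
  have "AE s in lborel. s \<noteq> t" by (rule AE_lborel_singleton)
  then have "AE s in lborel. indicator {0..t} s *\<^sub>R (\<Phi> (t - s) * x s) = indicator {0..t} s *\<^sub>R (ker (t - s) * x s)"
    using AE_ker_diff[of t]
  proof eventually_elim
    case (elim s)
    then show ?case using t by (cases "s \<in> {0..t}") auto
  qed
  then show ?thesis
    unfolding set_lebesgue_integral_def using m1 m2 by (intro integral_cong_AE) auto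
qed

text \<open>The convolution identity at t = T with the constant function 1, framed by two
  reflections.\<close>

lemma LBINT_ker_eq_\<Phi>:
  assumes \<Phi>: "set_borel_measurable borel {0..T} \<Phi>"
  shows "(LBINT s:{0..T}. ker s) = (LBINT s:{0..T}. \<Phi> s)"
proof -
  have one: "set_integrable lborel {0..T} (\<lambda>_. 1 :: real)" by (rule set_integrable_bounded[where R=1]) auto
  have "(LBINT s:{0..T}. ker s) = (LBINT s:{0..T}. ker (T - s))" by (rule LBINT_Icc_reflect[symmetric])
  also have "\<dots> = (LBINT s:{0..T}. \<Phi> (T - s))"
    using LBINT_\<Phi>_eq_ker[OF \<Phi> one, of T] T_pos by simp
  also have "\<dots> = (LBINT s:{0..T}. \<Phi> s)" by (rule LBINT_Icc_reflect)
  finally show ?thesis .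
qed

text \<open>The negative part of a solution is dominated by its own convolution with a kernel of mass
  less than one, so it vanishes.\<close>

lemma renewal_nn_integral:
  assumes norm: "(LBINT s:{0..T}. ker s) < 1"
    and x_int: "set_integrable lborel {0..T} x"
    and x: "\<And>t. t \<in> {0..T} \<Longrightarrow> x t = a t + (LBINT s:{0..t}. ker (t - s) * x s)"
    and a: "\<And>t. t \<in> {0..T} \<Longrightarrow> 0 \<le> a t"
    and t: "t \<in> {0..T}"
  shows "a t \<le> x t" "ennreal (x t) = ennreal (a t) + (\<integral>\<^sup>+ s\<in>{0..t}. ennreal (ker (t - s)) * ennreal (x s) \<partial>lborel)"
proof -
  define n where "n s = ennreal (- (indicator {0..T} s *\<^sub>R x s))" for s
  have x_meas [measurable]: "(\<lambda>u. indicator {0..T} u *\<^sub>R x u) \<in> borel_measurable borel"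
    using borel_measurable_integrable[OF x_int[unfolded set_integrable_def]] by simp
  have [measurable]: "n \<in> borel_measurable borel" unfolding n_def by measurable
  define A where "A = (\<integral>\<^sup>+ s. n s \<partial>lborel)"
  define q where "q = (\<integral>\<^sup>+ s\<in>{0..T}. ennreal (ker s) \<partial>lborel)"
  have conv: "n t \<le> (\<integral>\<^sup>+ s. ennreal (ker (t - s)) * (n s * indicator {0..t} s) \<partial>lborel)" if t: "t \<in> {0..T}" for t
  proof -
    have "n t = ennreal (- x t)" using t by (simp add: n_def)
    also have "\<dots> \<le> ennreal (- (LBINT s:{0..t}. ker (t - s) * x s))"
      using x[OF t] a[OF t] by (intro ennreal_leI) simp
    also have "- (LBINT s:{0..t}. ker (t - s) * x s) = (LBINT s. - (indicator {0..t} s *\<^sub>R (ker (t - s) * x s)))"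
      unfolding set_lebesgue_integral_def by simp
    also have "ennreal \<dots> \<le> (\<integral>\<^sup>+ s. ennreal (- (indicator {0..t} s *\<^sub>R (ker (t - s) * x s))) \<partial>lborel)"
      by (rule ennreal_integral_le)
    also have "\<dots> = (\<integral>\<^sup>+ s. ennreal (ker (t - s)) * (n s * indicator {0..t} s) \<partial>lborel)"
    proof (rule nn_integral_cong)
      fix s
      show "ennreal (- (indicator {0..t} s *\<^sub>R (ker (t - s) * x s))) = ennreal (ker (t - s)) * (n s * indicator {0..t} s)"
      proof (cases "s \<in> {0..t}")
        case True
        have "ennreal (ker (t - s) * (- x s)) = ennreal (ker (t - s)) * ennreal (- x s)"
          by (rule ennreal_mult') simp
        then show ?thesis using True t by (simp add: n_def)
      qed simp
    qed
    finally show ?thesis .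
  qed
  have A_fin: "A < \<infinity>"
  proof -
    have "A \<le> (\<integral>\<^sup>+ s. ennreal (norm (indicator {0..T} s *\<^sub>R x s)) \<partial>lborel)"
      unfolding A_def n_def by (intro nn_integral_mono ennreal_leI) auto
    also have "\<dots> < \<infinity>" using x_int unfolding set_integrable_def integrable_iff_bounded by blast
    finally show ?thesis .
  qed
  have ker_int: "set_integrable lborel {0..T} ker"
    by (rule set_integrable_bounded[OF ker_measurable ker_abs_le])
  have "q = (\<integral>\<^sup>+ s. ennreal (indicator {0..T} s *\<^sub>R ker s) \<partial>lborel)"
    unfolding q_def by (intro nn_integral_cong) (auto simp: indicator_def)
  also have "\<dots> = ennreal (LBINT s:{0..T}. ker s)"
    unfolding set_lebesgue_integral_def
    using ker_int by (intro nn_integral_eq_integral) (auto simp: set_integrable_def)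
  also have "\<dots> < 1" using norm by (simp add: ennreal_less_one_iff)
  finally have q: "q < 1" .
  have n0: "n t = n t * indicator {0..T} t" for t by (auto simp: n_def indicator_def)
  have "A = (\<integral>\<^sup>+ t\<in>{0..T}. n t \<partial>lborel)" unfolding A_def by (rule nn_integral_cong) (rule n0)
  also have "\<dots> \<le> (\<integral>\<^sup>+ t. (\<integral>\<^sup>+ s. ennreal (ker (t - s)) * indicator {0..T} (t - s) * n s \<partial>lborel) \<partial>lborel)"
  proof (rule nn_integral_mono)
    fix t
    show "n t * indicator {0..T} t \<le> (\<integral>\<^sup>+ s. ennreal (ker (t - s)) * indicator {0..T} (t - s) * n s \<partial>lborel)"
    proof (cases "t \<in> {0..T}")
      case True
      have "(\<integral>\<^sup>+ s. ennreal (ker (t - s)) * (n s * indicator {0..t} s) \<partial>lborel)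
          \<le> (\<integral>\<^sup>+ s. ennreal (ker (t - s)) * indicator {0..T} (t - s) * n s \<partial>lborel)"
        using True by (intro nn_integral_mono) (auto simp: indicator_def)
      with conv[OF True] have "n t \<le> (\<integral>\<^sup>+ s. ennreal (ker (t - s)) * indicator {0..T} (t - s) * n s \<partial>lborel)"
        by (rule order_trans)
      then show ?thesis using True by simp
    qed simp
  qed
  also have "\<dots> = (\<integral>\<^sup>+ s. (\<integral>\<^sup>+ t. ennreal (ker (t - s)) * indicator {0..T} (t - s) * n s \<partial>lborel) \<partial>lborel)"
  proof (rule lborel_pair.Fubini')
    have "(\<lambda>z. ennreal (ker (snd z - fst z)) * indicator {0..T} (snd z - fst z) * n (fst z)) \<in> borel_measurable (lborel \<Otimes>\<^sub>M lborel)"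
      by measurable
    then show "(\<lambda>(s, t). ennreal (ker (t - s)) * indicator {0..T} (t - s) * n s) \<in> borel_measurable (lborel \<Otimes>\<^sub>M lborel)"
      by (simp add: case_prod_beta')
  qed
  also have "\<dots> = (\<integral>\<^sup>+ s. q * n s \<partial>lborel)"
  proof (rule nn_integral_cong)
    fix s
    have "(\<integral>\<^sup>+ t. ennreal (ker (t - s)) * indicator {0..T} (t - s) * n s \<partial>lborel)
        = (\<integral>\<^sup>+ t. ennreal (ker (t - s)) * indicator {0..T} (t - s) \<partial>lborel) * n s"
      by (rule nn_integral_multc) measurable
    also have "(\<integral>\<^sup>+ t. ennreal (ker (t - s)) * indicator {0..T} (t - s) \<partial>lborel) = q"
      unfolding q_def by (subst nn_integral_real_affine[where c=1 and t=s]) auto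
    finally show "(\<integral>\<^sup>+ t. ennreal (ker (t - s)) * indicator {0..T} (t - s) * n s \<partial>lborel) = q * n s" .
  qed
  also have "\<dots> = q * A" unfolding A_def by (rule nn_integral_cmult) measurable
  finally have AqA: "A \<le> q * A" .
  \<comment> \<open>Integrability of \<open>x\<close> makes \<open>A\<close> finite, so that A \<le>
    q A with q < 1 forces A = 0.\<close>
  have "A = 0"
  proof (rule ccontr)
    assume "A \<noteq> 0"
    then have "q * A < 1 * A" using q A_fin by (intro ennreal_mult_strict_right_mono) (auto simp: zero_less_iff_neq_zero)
    with AqA show False by simp
  qed
  then have n_AE: "AE s in lborel. n s = 0"
    unfolding A_def by (subst (asm) nn_integral_0_iff_AE) auto
  \<comment> \<open>The inequality \<open>conv\<close> holds at every \<open>t\<close> and its right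
    side sees only almost every \<open>s\<close>; this upgrades the conclusion to all of
    [0,T].\<close>
  have n_0: "n t = 0" if t: "t \<in> {0..T}" for t
  proof -
    have "(\<integral>\<^sup>+ s. ennreal (ker (t - s)) * (n s * indicator {0..t} s) \<partial>lborel) = (\<integral>\<^sup>+ s. 0 \<partial>(lborel :: real measure))"
      using n_AE by (intro nn_integral_cong_AE) (auto elim!: eventually_mono)
    then show ?thesis using conv[OF t] by simp
  qed
  have x0: "0 \<le> x s" if "s \<in> {0..T}" for s
    using n_0[OF that] that by (simp add: n_def ennreal_eq_0_iff)
  have int: "integrable lborel (\<lambda>s. indicator {0..t} s *\<^sub>R (ker (t - s) * x s))"
  proof (rule Bochner_Integration.integrable_bound[where f="\<lambda>s. \<Phi> 0 * (indicator {0..T} s *\<^sub>R x s)"])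
    show "integrable lborel (\<lambda>s. \<Phi> 0 * (indicator {0..T} s *\<^sub>R x s))"
      using x_int unfolding set_integrable_def by (rule integrable_mult_right)
    have "(\<lambda>s. indicator {0..t} s *\<^sub>R (ker (t - s) * (indicator {0..T} s *\<^sub>R x s))) \<in> borel_measurable lborel"
      by measurable
    moreover have "(\<lambda>s. indicator {0..t} s *\<^sub>R (ker (t - s) * (indicator {0..T} s *\<^sub>R x s)))
        = (\<lambda>s. indicator {0..t} s *\<^sub>R (ker (t - s) * x s))"
      using t by (auto simp: indicator_def fun_eq_iff)
    ultimately show "(\<lambda>s. indicator {0..t} s *\<^sub>R (ker (t - s) * x s)) \<in> borel_measurable lborel" by simp
    show "AE s in lborel. norm (indicator {0..t} s *\<^sub>R (ker (t - s) * x s)) \<le> norm (\<Phi> 0 * (indicator {0..T} s *\<^sub>R x s))"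
    proof (intro AE_I2)
      fix s
      show "norm (indicator {0..t} s *\<^sub>R (ker (t - s) * x s)) \<le> norm (\<Phi> 0 * (indicator {0..T} s *\<^sub>R x s))"
      proof (cases "s \<in> {0..t}")
        case True
        have "ker (t - s) * \<bar>x s\<bar> \<le> \<Phi> 0 * \<bar>x s\<bar>" by (rule mult_right_mono[OF ker_le_\<Phi>0]) simp
        then show ?thesis using True t \<Phi>0_ge_0 by (simp add: abs_mult)
      qed simp
    qed
  qed
  have nn: "0 \<le> indicator {0..t} s *\<^sub>R (ker (t - s) * x s)" for s
    using t x0[of s] by (auto simp: indicator_def)
  have I0: "0 \<le> (LBINT s:{0..t}. ker (t - s) * x s)"
    unfolding set_lebesgue_integral_def by (rule integral_nonneg_AE) (use nn in simp)
  then show "a t \<le> x t" using x[OF t] by simp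
  have "ennreal (LBINT s:{0..t}. ker (t - s) * x s) = (\<integral>\<^sup>+ s. ennreal (indicator {0..t} s *\<^sub>R (ker (t - s) * x s)) \<partial>lborel)"
    unfolding set_lebesgue_integral_def
    by (rule nn_integral_eq_integral[symmetric, OF int]) (use nn in simp)
  also have "\<dots> = (\<integral>\<^sup>+ s\<in>{0..t}. ennreal (ker (t - s)) * ennreal (x s) \<partial>lborel)"
    by (intro nn_integral_cong) (auto simp: indicator_def ennreal_mult')
  finally show "ennreal (x t) = ennreal (a t) + (\<integral>\<^sup>+ s\<in>{0..t}. ennreal (ker (t - s)) * ennreal (x s) \<partial>lborel)"
    using x[OF t] I0 a[OF t] by simp
qed

text \<open>Chebyshev's argument: one term of the second moment is at most the whole. Replacing the
  intensity by its bound \<open>c l\<close> and reversing time removes the dependence on the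
  positions in the history.\<close>

lemma square_mult_cprob_le:
  fixes p1 p2 :: "real \<Rightarrow> ennreal"
  assumes meas [measurable]: "p1 \<in> borel_measurable borel" "p2 \<in> borel_measurable borel"
    and p1: "\<And>t. t \<in> {0..T} \<Longrightarrow> p1 t = 1 + (\<integral>\<^sup>+ u\<in>{0..t}. ennreal (ker (t - u)) * p1 u \<partial>lborel)"
    and p2: "\<And>t. t \<in> {0..T} \<Longrightarrow> p2 t = (p1 t)\<^sup>2 + (\<integral>\<^sup>+ u\<in>{0..t}. ennreal (ker (t - u)) * p2 u \<partial>lborel)"
  defines "c l \<equiv> ennreal (\<mu> + real (length l) * \<Phi> 0)"
  shows "(of_nat m)\<^sup>2 * cprob m l 0
    \<le> (c l * (\<integral>\<^sup>+ u\<in>{0..T}. p1 u \<partial>lborel))\<^sup>2 + c l * (\<integral>\<^sup>+ u\<in>{0..T}. p2 u \<partial>lborel)"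
proof -
  have le: "(\<integral>\<^sup>+ u\<in>{0..T}. ennreal (lam l u) * p (T - u) \<partial>lborel) \<le> c l * (\<integral>\<^sup>+ u\<in>{0..T}. p u \<partial>lborel)"
    if [measurable]: "p \<in> borel_measurable borel" for p :: "real \<Rightarrow> ennreal"
  proof -
    have "(\<integral>\<^sup>+ u\<in>{0..T}. ennreal (lam l u) * p (T - u) \<partial>lborel) \<le> (\<integral>\<^sup>+ u. c l * (p (T - u) * indicator {0..T} u) \<partial>lborel)"
    proof (rule nn_integral_mono)
      fix u
      have "ennreal (lam l u) \<le> c l" unfolding c_def by (rule ennreal_leI[OF lam_le])
      then show "ennreal (lam l u) * p (T - u) * indicator {0..T} u \<le> c l * (p (T - u) * indicator {0..T} u)"
        unfolding mult.assoc by (rule mult_right_mono) simp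
    qed
    also have "\<dots> = c l * (\<integral>\<^sup>+ u\<in>{0..T}. p (T - u) \<partial>lborel)" by (rule nn_integral_cmult) measurable
    also have "(\<integral>\<^sup>+ u\<in>{0..T}. p (T - u) \<partial>lborel) = (\<integral>\<^sup>+ u\<in>{0..T}. p u \<partial>lborel)"
      by (rule nn_integral_Icc_reflect) measurable
    finally show ?thesis .
  qed
  have "(of_nat m)\<^sup>2 * cprob m l 0 \<le> (\<Sum>i\<le>m. (of_nat i)\<^sup>2 * cprob i l 0)"
    by (rule member_le_sum[where f="\<lambda>i. (of_nat i)\<^sup>2 * cprob i l 0"]) auto
  also have "\<dots> \<le> (\<integral>\<^sup>+ u\<in>{0..T}. ennreal (lam l u) * p1 (T - u) \<partial>lborel)\<^sup>2
      + (\<integral>\<^sup>+ u\<in>{0..T}. ennreal (lam l u) * p2 (T - u) \<partial>lborel)"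
    using T_pos by (intro sum_square_cprob_le meas p1 p2) auto
  also have "\<dots> \<le> (c l * (\<integral>\<^sup>+ u\<in>{0..T}. p1 u \<partial>lborel))\<^sup>2 + c l * (\<integral>\<^sup>+ u\<in>{0..T}. p2 u \<partial>lborel)"
    using le[OF meas(1)] le[OF meas(2)] by (intro add_mono power_mono) auto
  finally show ?thesis .
qed

text \<open>The first part dominates the law of the number of remaining jumps by the weights of
  \<beta>. The second part serves to show that these weights have total at least 1.\<close>

lemma cprob_le_c_coeff:
  assumes \<Phi>_meas: "set_borel_measurable borel {0..T} \<Phi>" and \<Phi>_norm: "(LBINT s:{0..T}. \<Phi> s) < 1"
    and \<Psi>1_int: "set_integrable lborel {0..T} \<Psi>1"
    and \<Psi>1: "\<And>t. t \<in> {0..T} \<Longrightarrow> \<Psi>1 t = 1 + (LBINT s:{0..t}. \<Phi> (t - s) * \<Psi>1 s)"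
    and \<Psi>2_int: "set_integrable lborel {0..T} \<Psi>2"
    and \<Psi>2: "\<And>t. t \<in> {0..T} \<Longrightarrow> \<Psi>2 t = (\<Psi>1 t)\<^sup>2 + (LBINT s:{0..t}. \<Phi> s * \<Psi>2 (t - s))"
  defines "C1 \<equiv> (LBINT t:{0..T}. \<Psi>2 t)" and "C2 \<equiv> (LBINT t:{0..T}. \<Psi>1 t)\<^sup>2"
  shows "cprob (Suc m) l 0 \<le> ennreal (min (c_coeff \<mu> \<Phi> C1 C2 (length l) / (real (Suc m))\<^sup>2) 1)"
    and "(\<mu> + real n * \<Phi> 0) * T \<le> c_coeff \<mu> \<Phi> C1 C2 n"
proof -
  have norm: "(LBINT s:{0..T}. ker s) < 1" using \<Phi>_norm LBINT_ker_eq_\<Phi>[OF \<Phi>_meas] by simp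
  have \<Psi>1_ker: "\<Psi>1 t = 1 + (LBINT s:{0..t}. ker (t - s) * \<Psi>1 s)" if "t \<in> {0..T}" for t
    using \<Psi>1[OF that] LBINT_\<Phi>_eq_ker[OF \<Phi>_meas \<Psi>1_int that] by simp
  have \<Psi>2_ker: "\<Psi>2 t = (\<Psi>1 t)\<^sup>2 + (LBINT s:{0..t}. ker (t - s) * \<Psi>2 s)" if "t \<in> {0..T}" for t
    using \<Psi>2[OF that] LBINT_\<Phi>_eq_ker[OF \<Phi>_meas \<Psi>2_int that]
      LBINT_Icc_reflect[where f="\<lambda>s. \<Phi> (t - s) * \<Psi>2 s" and t=t] by simp
  have r1: "1 \<le> \<Psi>1 t" "ennreal (\<Psi>1 t) = ennreal 1 + (\<integral>\<^sup>+ s\<in>{0..t}. ennreal (ker (t - s)) * ennreal (\<Psi>1 s) \<partial>lborel)"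
    if "t \<in> {0..T}" for t
    using renewal_nn_integral[OF norm \<Psi>1_int, where a="\<lambda>_. 1" and t=t] \<Psi>1_ker that by auto
  have r2: "(\<Psi>1 t)\<^sup>2 \<le> \<Psi>2 t" "ennreal (\<Psi>2 t) = ennreal ((\<Psi>1 t)\<^sup>2) + (\<integral>\<^sup>+ s\<in>{0..t}. ennreal (ker (t - s)) * ennreal (\<Psi>2 s) \<partial>lborel)"
    if "t \<in> {0..T}" for t
    using renewal_nn_integral[OF norm \<Psi>2_int, where a="\<lambda>t. (\<Psi>1 t)\<^sup>2" and t=t] \<Psi>2_ker that by auto
  have \<Psi>2_ge: "1 \<le> \<Psi>2 t" if "t \<in> {0..T}" for t
    using r1(1)[OF that] r2(1)[OF that] one_le_power[of "\<Psi>1 t" 2] by linarith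
  define p where "p \<Psi> t = ennreal (indicator {0..T} t *\<^sub>R \<Psi> t)" for \<Psi> :: "real \<Rightarrow> real" and t
  have p_meas: "p \<Psi> \<in> borel_measurable borel" if "set_integrable lborel {0..T} \<Psi>" for \<Psi>
    using borel_measurable_integrable[OF that[unfolded set_integrable_def]] unfolding p_def by simp
  have p_conv: "(\<integral>\<^sup>+ s\<in>{0..t}. ennreal (ker (t - s)) * ennreal (\<Psi> s) \<partial>lborel) = (\<integral>\<^sup>+ s\<in>{0..t}. ennreal (ker (t - s)) * p \<Psi> s \<partial>lborel)"
    if "t \<in> {0..T}" for \<Psi> t
    using that by (intro nn_integral_cong) (auto simp: p_def indicator_def)
  have p_int: "(\<integral>\<^sup>+ s\<in>{0..T}. p \<Psi> s \<partial>lborel) = ennreal (LBINT s:{0..T}. \<Psi> s)"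
    if "set_integrable lborel {0..T} \<Psi>" "\<And>t. t \<in> {0..T} \<Longrightarrow> 0 \<le> \<Psi> t" for \<Psi>
  proof -
    have "(\<integral>\<^sup>+ s\<in>{0..T}. p \<Psi> s \<partial>lborel) = (\<integral>\<^sup>+ s. ennreal (indicator {0..T} s *\<^sub>R \<Psi> s) \<partial>lborel)"
      by (intro nn_integral_cong) (auto simp: p_def indicator_def)
    also have "\<dots> = ennreal (LBINT s:{0..T}. \<Psi> s)"
      unfolding set_lebesgue_integral_def
      by (rule nn_integral_eq_integral[OF that(1)[unfolded set_integrable_def]]) (auto simp: indicator_def that(2))
    finally show ?thesis .
  qed
  have \<Psi>1_0: "0 \<le> \<Psi>1 t" and \<Psi>2_0: "0 \<le> \<Psi>2 t" if "t \<in> {0..T}" for t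
    using r1(1)[OF that] \<Psi>2_ge[OF that] by linarith+
  have p1: "p \<Psi>1 t = 1 + (\<integral>\<^sup>+ u\<in>{0..t}. ennreal (ker (t - u)) * p \<Psi>1 u \<partial>lborel)" if "t \<in> {0..T}" for t
  proof -
    have "p \<Psi>1 t = ennreal (\<Psi>1 t)" using that by (simp add: p_def)
    then show ?thesis using r1(2)[OF that] unfolding p_conv[OF that] by simp
  qed
  have p2: "p \<Psi>2 t = (p \<Psi>1 t)\<^sup>2 + (\<integral>\<^sup>+ u\<in>{0..t}. ennreal (ker (t - u)) * p \<Psi>2 u \<partial>lborel)" if "t \<in> {0..T}" for t
  proof -
    have "p \<Psi>2 t = ennreal (\<Psi>2 t)" "p \<Psi>1 t = ennreal (\<Psi>1 t)" using that by (simp_all add: p_def)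
    then show ?thesis using r2(2)[OF that] \<Psi>1_0[OF that] unfolding p_conv[OF that] by (simp add: ennreal_power)
  qed
  \<comment> \<open>\<open>\<Psi>2\<close> dominates the square of \<open>\<Psi>1\<close>, which is
    at least 1.\<close>
  have C1: "T \<le> C1"
  proof -
    have one: "set_integrable lborel {0..T} (\<lambda>_. 1 :: real)" by (rule set_integrable_bounded[where R=1]) auto
    have "T = (LBINT t:{0..T}. 1)" using T_pos by (simp add: set_integral_const emeasure_lborel_Icc_eq measure_lborel_Icc)
    also have "\<dots> \<le> C1" unfolding C1_def using \<Psi>2_ge by (intro set_integral_mono one \<Psi>2_int) auto
    finally show ?thesis .
  qed
  have I1: "0 \<le> (LBINT t:{0..T}. \<Psi>1 t)"
    unfolding set_lebesgue_integral_def by (intro integral_nonneg_AE AE_I2) (auto simp: indicator_def \<Psi>1_0)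
  let ?c = "\<lambda>n::nat. \<mu> + real n * \<Phi> 0"
  have c0: "0 \<le> ?c n" for n using \<mu>_nonneg \<Phi>0_ge_0 by simp
  show "?c n * T \<le> c_coeff \<mu> \<Phi> C1 C2 n"
  proof -
    have "?c n * T \<le> ?c n * C1" using C1 by (rule mult_left_mono) (rule c0)
    moreover have "0 \<le> (?c n)\<^sup>2 * C2" unfolding C2_def by simp
    ultimately show ?thesis unfolding c_coeff_def by linarith
  qed
  \<comment> \<open>Finiteness allows the division by (m + 1)^2 to take place in the reals; the
    bound by 1 also supplies the cap in the minimum.\<close>
  have "cprob (Suc m) l 0 \<le> 1" using T_pos by (intro cprob_le_1) auto
  then obtain q where q: "cprob (Suc m) l 0 = ennreal q" "0 \<le> q" "q \<le> 1"
    by (cases "cprob (Suc m) l 0") (auto simp: top_unique)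
  have "ennreal ((real (Suc m))\<^sup>2 * q) = (of_nat (Suc m))\<^sup>2 * cprob (Suc m) l 0"
    using q(2) by (simp add: q(1) ennreal_mult ennreal_power ennreal_of_nat_eq_real_of_nat del: of_nat_Suc)
  also have "\<dots> \<le> (ennreal (?c (length l)) * (\<integral>\<^sup>+ u\<in>{0..T}. p \<Psi>1 u \<partial>lborel))\<^sup>2
      + ennreal (?c (length l)) * (\<integral>\<^sup>+ u\<in>{0..T}. p \<Psi>2 u \<partial>lborel)"
    by (rule square_mult_cprob_le[OF p_meas[OF \<Psi>1_int] p_meas[OF \<Psi>2_int] p1 p2])
  also have "\<dots> = (ennreal (?c (length l)) * ennreal (LBINT t:{0..T}. \<Psi>1 t))\<^sup>2 + ennreal (?c (length l)) * ennreal C1"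
  proof -
    have "(\<integral>\<^sup>+ u\<in>{0..T}. p \<Psi>1 u \<partial>lborel) = ennreal (LBINT t:{0..T}. \<Psi>1 t)"
      by (rule p_int[OF \<Psi>1_int]) (rule \<Psi>1_0)
    moreover have "(\<integral>\<^sup>+ u\<in>{0..T}. p \<Psi>2 u \<partial>lborel) = ennreal C1"
      unfolding C1_def by (rule p_int[OF \<Psi>2_int]) (rule \<Psi>2_0)
    ultimately show ?thesis by (simp only:)
  qed
  also have "\<dots> = ennreal (c_coeff \<mu> \<Phi> C1 C2 (length l))"
  proof -
    have C1_0: "0 \<le> C1" using C1 T_pos by simp
    have "ennreal (?c (length l)) * ennreal (LBINT t:{0..T}. \<Psi>1 t) = ennreal (?c (length l) * (LBINT t:{0..T}. \<Psi>1 t))"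
      "ennreal (?c (length l)) * ennreal C1 = ennreal (?c (length l) * C1)"
      using c0 I1 C1_0 by (simp_all add: ennreal_mult)
    then show ?thesis
      unfolding c_coeff_def C2_def using c0[of "length l"] I1 C1_0
      by (simp add: ennreal_power ennreal_plus[symmetric] power_mult_distrib add.commute del: ennreal_plus)
  qed
  finally have "ennreal ((real (Suc m))\<^sup>2 * q) \<le> ennreal (c_coeff \<mu> \<Phi> C1 C2 (length l))" .
  moreover have "0 \<le> c_coeff \<mu> \<Phi> C1 C2 (length l)"
    unfolding c_coeff_def C2_def
    using \<mu>_nonneg \<Phi>0_ge_0 C1 T_pos by (intro add_nonneg_nonneg mult_nonneg_nonneg) auto
  ultimately have "(real (Suc m))\<^sup>2 * q \<le> c_coeff \<mu> \<Phi> C1 C2 (length l)"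
    by (simp only: ennreal_le_iff)
  then have "q \<le> c_coeff \<mu> \<Phi> C1 C2 (length l) / (real (Suc m))\<^sup>2"
    by (subst pos_le_divide_eq) (auto simp: mult.commute)
  then show "cprob (Suc m) l 0 \<le> ennreal (min (c_coeff \<mu> \<Phi> C1 C2 (length l) / (real (Suc m))\<^sup>2) 1)"
    unfolding q(1) using q(3) by (intro ennreal_leI) simp
qed

end

theorem proposition4p8:
  fixes M :: "'a measure"
    and T \<mu> \<kappa> C1 C2 :: real
    and \<Phi> \<Psi>1 \<Psi>2 :: "real \<Rightarrow> real"
    and N :: "'a \<Rightarrow> (real \<times> real) measure"
    and H :: "real \<Rightarrow> 'a \<Rightarrow> nat"
    and \<Lambda> L K :: "real \<Rightarrow> 'a \<Rightarrow> real"
    and \<eta> \<theta> \<eta>b \<theta>b :: "nat \<Rightarrow> 'a \<Rightarrow> real"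
    and f h :: "real \<Rightarrow> real" and g :: "real \<times> real \<Rightarrow> real"
    and \<beta> :: "nat \<Rightarrow> (nat \<Rightarrow> real) \<Rightarrow> ennreal"
  assumes "prob_space M"
    and "T > 0" and "\<mu> > 0" and "\<kappa> \<ge> 0"
    and \<Phi>_meas: "set_borel_measurable borel {0..T} \<Phi>"
    and \<Phi>_nonneg: "\<And>t. t \<in> {0..T} \<Longrightarrow> 0 \<le> \<Phi> t"
    and \<Phi>_bounded: "bounded (\<Phi> ` {0..T})"
    and \<Phi>_norm: "(LBINT s:{0..T}. \<Phi> s) < 1"
    and N: "prob_space.poisson_random_measure M (strip_measure T) N"
    and H: "hawkes_solution M T \<mu> \<Phi> N H \<Lambda>"
    and claims: "prob_space.claims_model M T N \<eta> \<theta> \<eta>b \<theta>b"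
    and f_meas: "set_borel_measurable borel {0..} f"
    and f_nonneg: "\<And>x. 0 \<le> x \<Longrightarrow> 0 \<le> f x"
    and f_bounded: "bounded (f ` {0..})"
    and g_meas: "set_borel_measurable borel ({0..} \<times> {0..}) g"
    and g_nonneg: "\<And>x y. 0 \<le> x \<Longrightarrow> 0 \<le> y \<Longrightarrow> 0 \<le> g (x, y)"
    and g_bounded: "bounded (g ` ({0..} \<times> {0..}))"
    and h_meas: "set_borel_measurable borel {0..} h"
    and h_nonneg: "\<And>x. 0 \<le> x \<Longrightarrow> 0 \<le> h x"
    and h_bounded: "bounded (h ` {0..})"
    and L_def: "L = discounted_claims T \<kappa> H (\<lambda>i \<omega>. f (\<eta> i \<omega>))"
    and K_def: "K = discounted_claims T \<kappa> H (\<lambda>i \<omega>. g (\<eta> i \<omega>, \<theta> i \<omega>))"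
    and h_mono: "mono_on {0..} h"
    and \<Phi>_antimono: "antimono_on {0..T} \<Phi>"
    and \<Psi>1_int: "set_integrable lborel {0..T} \<Psi>1"
    and \<Psi>1: "\<And>t. t \<in> {0..T} \<Longrightarrow> \<Psi>1 t = 1 + (LBINT s:{0..t}. \<Phi> (t - s) * \<Psi>1 s)"
    and \<Psi>2_int: "set_integrable lborel {0..T} \<Psi>2"
    and \<Psi>2: "\<And>t. t \<in> {0..T} \<Longrightarrow> \<Psi>2 t = (\<Psi>1 t)\<^sup>2 + (LBINT s:{0..t}. \<Phi> s * \<Psi>2 (t - s))"
    and C1_def: "C1 = (LBINT t:{0..T}. \<Psi>2 t)"
    and C2_def: "C2 = (LBINT t:{0..T}. \<Psi>1 t)\<^sup>2"
    and \<beta>_def: "\<beta> = beta M T \<mu> \<kappa> \<Phi> C1 C2 f g h \<eta> \<eta>b \<theta>b"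
  shows "(\<integral>\<^sup>+ \<omega>. ennreal (K T \<omega> * h (L T \<omega>)) \<partial>M)
    \<le> ennreal \<mu> * (\<integral>\<^sup>+ v1\<in>{0..T}. ennreal (exp (- \<kappa> * (T - v1))) * \<beta> 1 (\<lambda>_. v1) \<partial>lborel)
      + ennreal \<mu> * (\<Sum>m. simplex_integral (m + 2) T
          (\<lambda>v. ennreal ((\<Prod>i=2..m + 2. \<Phi> (v (i - 1) - v i)) * exp (- \<kappa> * (T - v 1)))
                * \<beta> (m + 2) v))"
proof -
  interpret prob_space M by fact
  interpret hawkes_model M T \<mu> \<Phi> N H \<Lambda>
    by unfold_locales (use \<open>T > 0\<close> \<open>\<mu> > 0\<close> \<Phi>_nonneg \<Phi>_antimono N H in auto)
  interpret cs: claim_space M T N \<eta> \<theta> \<eta>b \<theta>b f h g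
    by unfold_locales (use claims f_meas f_nonneg g_meas g_nonneg h_meas h_nonneg h_mono in auto)
  let ?c = "c_coeff \<mu> \<Phi> C1 C2"
  define wt where "wt n p = (case p of 0 \<Rightarrow> ennreal (exp (- T * (\<mu> + real n * \<Phi> 0)))
    | Suc p \<Rightarrow> ennreal (min (?c n / (real (Suc p))\<^sup>2) 1))" for n p
  note c_coeff = cprob_le_c_coeff[OF \<Phi>_meas \<Phi>_norm \<Psi>1_int \<Psi>1 \<Psi>2_int \<Psi>2, folded C1_def C2_def]
  interpret hc: hawkes_claims T \<mu> \<Phi> \<kappa> cs.Gc wt
  proof unfold_locales
    show "0 \<le> \<kappa>" by fact
    show "(\<lambda>(c, cs). cs.Gc c cs) \<in> borel_measurable (borel \<Otimes>\<^sub>M list_borel)" by (rule cs.Gc_measurable)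
    show "cs.Gc c ds = cs.Gc c es" if "mset ds = mset es" for c ds es using that by (rule cs.Gc_mset)
    show "cs.Gc c (ds @ es) \<le> cs.Gc c (ds @ replicate (length es) 1)" if "\<And>d. d \<in> set es \<Longrightarrow> d \<le> 1" for c ds es
      using that by (rule cs.Gc_mono)
    show "cs.Gc c ds \<le> cs.Gc c (ds @ replicate p 1)" for c ds p by (rule cs.Gc_append)
    show "cprob (Suc p) vs 0 \<le> wt (length vs) (Suc p)" for vs p
      using c_coeff(1) by (simp only: wt_def nat.case)
    \<comment> \<open>The terms p = 0 and p = 1 suffice: with x = T (\<mu> + n \<Phi>(0)) one has 1
      - exp(-x) \<le> min(x, 1), and x is at most c_n.\<close>
    show "1 \<le> (\<Sum>p. wt n p)" for n
    proof -
      let ?x = "T * (\<mu> + real n * \<Phi> 0)"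
      have x0: "0 \<le> ?x" using \<open>T > 0\<close> \<open>\<mu> > 0\<close> \<Phi>0_ge_0 by simp
      have cn: "0 \<le> ?c n" using x0 c_coeff(2)[of n] by (simp add: mult.commute)
      have "1 - exp (- ?x) \<le> ?x" using exp_ge_add_one_self[of "- ?x"] by simp
      also have "\<dots> \<le> ?c n" using c_coeff(2)[of n] by (simp add: mult.commute)
      finally have "1 - exp (- ?x) \<le> ?c n" .
      then have "1 \<le> exp (- ?x) + min (?c n / (real (Suc 0))\<^sup>2) 1" by (simp add: min_def)
      then have "1 \<le> ennreal (exp (- ?x) + min (?c n / (real (Suc 0))\<^sup>2) 1)" by simp
      also have "\<dots> \<le> ennreal (exp (- ?x)) + ennreal (min (?c n / (real (Suc 0))\<^sup>2) 1)"
        using cn by (subst ennreal_plus) auto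
      also have "\<dots> = (\<Sum>p<2. wt n p)" by (simp add: numeral_2_eq_2 wt_def)
      also have "\<dots> \<le> (\<Sum>p. wt n p)" by (rule sum_le_suminf) auto
      finally show ?thesis .
    qed
  qed
  \<comment> \<open>The chain lists the discount factors in the reverse order of
    \<open>claim_expectation\<close>, which \<open>Gc_mset\<close> absorbs; the distinguished one is
    last in the chain and first there.\<close>
  have weighted_claims: "hc.weighted_claims (rev (map v [1..<Suc n])) \<le> \<beta> n v" if n: "1 \<le> n" for n v
  proof -
    let ?vs = "rev (map v [1..<Suc n])"
    have vs: "?vs = rev (map v [2..<Suc n]) @ [v 1]"
      using n by (subst upt_conv_Cons) (auto simp: numeral_2_eq_2 simp del: upt_Suc)
    have capped_claims: "hc.capped_claims ?vs p = claim_expectation M T \<kappa> f g h \<eta> \<eta>b \<theta>b n p v" for p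
      unfolding hc.capped_claims_def cs.claim_expectation_eq[OF n] vs
      by (simp add: hc.disc_def rev_map comp_def del: upt_Suc) (rule cs.Gc_mset, simp del: upt_Suc)
    have "hc.weighted_claims ?vs = (\<Sum>p. wt n p * claim_expectation M T \<kappa> f g h \<eta> \<eta>b \<theta>b n p v)"
      unfolding hc.weighted_claims_def capped_claims by (simp del: upt_Suc)
    also have "\<dots> = (\<Sum>p. wt n (p + 1) * claim_expectation M T \<kappa> f g h \<eta> \<eta>b \<theta>b n (p + 1) v)
        + (\<Sum>p<1. wt n p * claim_expectation M T \<kappa> f g h \<eta> \<eta>b \<theta>b n p v)"
      by (rule suminf_offset) simp
    also have "\<dots> = \<beta> n v"
      unfolding \<beta>_def beta_def by (simp add: wt_def add.commute del: of_nat_Suc)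
    finally show ?thesis by simp
  qed
  have "(\<integral>\<^sup>+ \<omega>. ennreal (K T \<omega> * h (L T \<omega>)) \<partial>M) = (\<integral>\<^sup>+ \<omega>. cs.W hc.disc (jumps \<omega>) (cs.\<zeta> \<omega>) \<partial>M)"
  proof (rule nn_integral_cong_AE)
    \<comment> \<open>Claims and L_T are nonnegative, so the cutoffs \<open>f'\<close>,
      \<open>g'\<close>, \<open>h'\<close> agree with f, g, h; off a null set the measurable list
      \<open>jumps\<close> consists of the true jump times.\<close>
    show "AE \<omega> in M. ennreal (K T \<omega> * h (L T \<omega>)) = cs.W hc.disc (jumps \<omega>) (cs.\<zeta> \<omega>)"
      using AE_jumps AE_space
    proof eventually_elim
      case (elim \<omega>)
      interpret p: hawkes_path T \<mu> \<Phi> "N \<omega>" "\<lambda>t. H t \<omega>" "\<lambda>t. \<Lambda> t \<omega>" using elim by blast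
      have X: "jumps \<omega> = p.X" using elim by blast
      have \<omega>: "\<omega> \<in> space M" using elim by blast
      have len: "length (jumps \<omega>) = H T \<omega>" unfolding X by (simp add: p.m_def)
      have nth: "jumps \<omega> ! i = jump_time T H (Suc i) \<omega>" if "i < H T \<omega>" for i
        using that unfolding X p.X_def jump_time_def p.\<tau>_def
        by (subst nth_map) (auto simp: p.m_def simp del: upt_Suc)
      have nonneg: "0 \<le> \<eta> (Suc i) \<omega>" "0 \<le> \<theta> (Suc i) \<omega>" for i
        using cs.Z_nonneg[of "(False, Suc i)", OF _ \<omega>] by (auto simp: cs.Z_simps)
      have dc: "discounted_claims T \<kappa> H (\<lambda>i \<omega>. u (\<eta> i \<omega>, \<theta> i \<omega>)) T \<omega> = (\<Sum>i<length (jumps \<omega>). hc.disc (jumps \<omega> ! i) * u (cs.\<zeta> \<omega> i))"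
        for u :: "real \<times> real \<Rightarrow> real"
      proof -
        have "discounted_claims T \<kappa> H (\<lambda>i \<omega>. u (\<eta> i \<omega>, \<theta> i \<omega>)) T \<omega>
            = (\<Sum>i<H T \<omega>. exp (- \<kappa> * (T - jump_time T H (Suc i) \<omega>)) * u (\<eta> (Suc i) \<omega>, \<theta> (Suc i) \<omega>))"
          unfolding discounted_claims_def One_nat_def by (rule sum.atLeast1_atMost_eq)
        also have "\<dots> = (\<Sum>i<length (jumps \<omega>). hc.disc (jumps \<omega> ! i) * u (cs.\<zeta> \<omega> i))"
          unfolding len by (intro sum.cong) (auto simp: nth hc.disc_def cs.\<zeta>_def cs.Z_simps)
        finally show ?thesis .
      qed
      have \<zeta>: "cs.\<zeta> \<omega> i = (\<eta> (Suc i) \<omega>, \<theta> (Suc i) \<omega>)" for i by (simp add: cs.\<zeta>_def cs.Z_simps)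
      have Ke: "K T \<omega> = (\<Sum>i<length (jumps \<omega>). hc.disc (jumps \<omega> ! i) * cs.g' (cs.\<zeta> \<omega> i))"
        unfolding K_def dc[of g] \<zeta> cs.g'_def by (simp add: nonneg)
      have Le: "L T \<omega> = (\<Sum>i<length (jumps \<omega>). hc.disc (jumps \<omega> ! i) * cs.fz (cs.\<zeta> \<omega> i))"
        using dc[of "\<lambda>z. f (fst z)"] unfolding L_def \<zeta> cs.fz_def cs.f'_def by (simp add: nonneg)
      have "0 \<le> L T \<omega>" unfolding Le by (intro sum_nonneg mult_nonneg_nonneg) (auto simp: hc.disc_def)
      then have "h (L T \<omega>) = cs.h' (L T \<omega>)" by (simp add: cs.h'_def)
      then show ?case unfolding cs.W_def Ke[symmetric] Le[symmetric] by simp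
    qed
  qed
  also have "\<dots> = (\<integral>\<^sup>+ l. picks (\<lambda>x w. ennreal (hc.disc x) * cs.Gc (hc.disc x) (map hc.disc w)) l \<partial>distr M list_borel jumps)"
    by (rule cs.nn_integral_claims[OF jumps_measurable]) (auto simp: hc.disc_def)
  also have "\<dots> \<le> (\<Sum>m. \<integral>\<^sup>+ l. picks (\<lambda>x w. ennreal (hc.disc x) * cs.Gc (hc.disc x) (map hc.disc w)) l * ennreal (dens [] 0 l) \<partial>points T m)"
    by (rule law_jumps_le) measurable
  also have "\<dots> \<le> ennreal \<mu> * (\<Sum>i. \<integral>\<^sup>+ x\<in>{0..T}. ennreal (hc.disc x) * hc.chain_integral i [x] \<partial>lborel)"
    by (rule hc.suminf_picks_le)
  also have "\<dots> \<le> ennreal \<mu> * (\<integral>\<^sup>+ v1\<in>{0..T}. ennreal (exp (- \<kappa> * (T - v1))) * \<beta> 1 (\<lambda>_. v1) \<partial>lborel)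
      + ennreal \<mu> * (\<Sum>m. simplex_integral (m + 2) T
          (\<lambda>v. ennreal ((\<Prod>i=2..m + 2. \<Phi> (v (i - 1) - v i)) * exp (- \<kappa> * (T - v 1)))
                * \<beta> (m + 2) v))"
    by (rule hc.suminf_chain_integral_le[OF weighted_claims])
  finally show ?thesis .
qed

end
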